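(* Let $k\ge2$, let $(X_i,T_i)$ ($1\le i\le k$) be full shifts with one-block factor maps $\pi_i:X_i\to X_{i+1}$ ($1\le i\le k-1$), write $(X,T)=(X_1,T_1)$, let $\mathbf a=(a_1,\dots,a_k)\in\mathbb R^k$ with $a_1>0$ and $a_i\ge0$ for $i>1$, and endow $X$ with the metric $d_{\mathbf a}$. Let $\Phi=(\log\phi_n)_{n=1}^\infty\in\mathcal C_{asa}(X,T)$. Then there exists at least one $\mathbf a$-weighted weak Gibbs measure $\mu$ associated with $\Phi$ such that, furthermore, the following holds. Writing $\mu_i=\mu\circ\tau_{i-1}^{-1}$, for each $1\le i\le k$ the potential $\mathbf\Psi^{(i)}_\mu:=\big(\log\mu_i(\tau_{i-1}(x_{|n}))\big)_{n=1}^\infty$ belongs to $\mathcal C_{asa}(X,T)$, and for every $x=(x_i)_{i=1}^\infty\in X$ and $B=B(x,e^{-n/a_1})$, we have $$\log\mu(B)=\mathbf\Psi^{(1)}_{\mu,n}(x)+\sum_{i=2}^k\big(\mathbf\Psi^{(i)}_{\mu,\ell_i(n)}(x)-\mathbf\Psi^{(i)}_{\mu,\ell_{i-1}(n)}(x)\big)+c(x,n),$$ where $(c(x,n))_{n\ge1}$ is a sequence satisfying $\lim_{n\to\infty}c(x,n)/n=0$. If moreover $\Phi\in\mathcal C_{aa}(X,T)$ and $\Phi$ satisfies the bounded distortion property, then $c(x,n)$ can be taken bounded independently of $x$ and $n$, and the relation $\log\mu(B)=\mathbf\Psi^{(1)}_{\mu,n}(x)+\sum_{i=2}^k\big(\mathbf\Psi^{(i)}_{\mu,\ell_i(n)}(x)-\mathbf\Psi^{(i)}_{\mu,\ell_{i-1}(n)}(x)\big)+c(x,n)$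 takes the form $$\mu(B)\approx\prod_{i=1}^k\mu_i(\tau_{i-1}(I_i)),$$ where $I_i=x_{\ell_{i-1}(n)+1}\cdots x_{\ell_i(n)}$.
   Context: $X_i=\mathcal A_i^{\mathbb N}$ with $\mathcal A_i$ a finite alphabet and $T_i$ the left shift. A one-block factor map $\pi_i:X_i\to X_{i+1}$ is a continuous surjection with $\pi_iT_i=T_{i+1}\pi_i$ induced letter by letter by a map $\mathcal A_i\to\mathcal A_{i+1}$. $\pi_0$ is the identity of $X_1$ and $\tau_i=\pi_i\circ\cdots\circ\pi_0:X_1\to X_{i+1}$, $0\le i\le k-1$; these also act letterwise on words. $x_{|n}=x_1\cdots x_n$; $[I]$ is the cylinder of sequences beginning with the word $I$; the measure of a word is that of its cylinder (and $1$ for the empty word). $\mathcal M(X,T)$ is the set of $T$-invariant Borel probability measures. $A_i:=a_1+\cdots+a_i$. $\ell_0(n)=0$ and $\ell_i(n)=\min\{p\in\mathbb N:p\ge A_in/a_1\}$ for $1\le i\le k$ (so $\ell_1(n)=n$). Metric: $d_{\mathbf a}(x,y)=\max\big(e^{-|\tau_{i-1}(x)\wedge\tau_{i-1}(y)|/A_i}:1\le i\le k\big)$, $|u\wedge v|=\inf\{m\ge1:u_m\ne v_m\}-1$ ($\inf\emptyset=\infty$); $B(x,r)$ is the closed ball. Potentials: $(\log\phi_n)_{n\ge1}$ is sub-additive if each $\phi_n:X\to[0,\infty)$ is continuous and there is $c>0$ with $\phi_{n+m}(x)\le c\,\phi_n(x)\phi_m(T^nx)$ for all $x,n,m$. $\Phi=(\log\phi_n)$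 is asymptotically sub-additive if for every $\varepsilon>0$ there is a sub-additive $(\log\psi_n)$ with $\limsup_n\frac1n\sup_x|\log\phi_n(x)-\log\psi_n(x)|\le\varepsilon$ (convention $\log0-\log0=0$). $\Phi\in\mathcal C_{asa}(X,T)$ if both $\Phi$ and $-\Phi:=(\log(1/\phi_n))$ are asymptotically sub-additive. $\Phi\in\mathcal C_{aa}(X,T)$ (almost additive) if each $\phi_n$ is positive and continuous and there is $c>0$ with $c^{-1}\phi_n(x)\phi_m(T^nx)\le\phi_{n+m}(x)\le c\,\phi_n(x)\phi_m(T^nx)$ for all $x,n,m$. $\Phi$ has the bounded distortion property if there is $c>0$ with $c^{-1}\phi_n(y)\le\phi_n(x)\le c\,\phi_n(y)$ whenever $x,y$ lie in the same $n$-th cylinder. $\Phi_*(\mu)=\lim_n\frac1n\int\log\phi_n\,d\mu$; $h^{\mathbf a}_\mu(T)=\sum_{i=1}^ka_ih_{\mu\circ\tau_{i-1}^{-1}}(T_i)$; $P^{\mathbf a}(T,\Phi)=\sup\{\Phi_*(\mu)+h^{\mathbf a}_\mu(T):\mu\in\mathcal M(X,T)\}$. The potential $\Phi^{\mathbf a}$: put $\phi^{(0)}_n=\phi_n$ and, for $1\le i\le k-1$ and $y\in X_{i+1}$, $$\phi^{(i)}_n(y)=\Big(\sum_{I\in\mathcal A_i^n:\,[I]\cap\pi_i^{-1}(y)\ne\emptyset}\ \sup_{x\in[I]}\phi^{(i-1)}_n(x)^{1/A_i}\Big)^{A_i}.$$ For a word $J\in\mathcal A_{i+1}^n$, $\phi^{(i)}(J)=\sup\{\phi^{(i)}_n(y):y\in[J]\}$,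 $0\le i\le k-1$. Then $\Phi^{\mathbf a}=(\log\phi^{\mathbf a}_n)_n$ with $\phi^{\mathbf a}_n(x)=\phi^{(0)}(x_{|n})^{1/A_1}\prod_{i=1}^{k-1}\phi^{(i)}(\tau_i(x_{|n}))^{1/A_{i+1}-1/A_i}$; it is constant on $n$-th cylinders, and $\phi^{\mathbf a}_n(I)$ denotes its value on $[I]$. A fully supported Borel probability measure $\mu$ on $X$ (not necessarily invariant) is an $\mathbf a$-weighted weak Gibbs measure associated with $\Phi\in\mathcal C_{asa}(X,T)$ if there are positive numbers $(\kappa_n)_{n\ge1}$ with $\frac1n\log\kappa_n\to0$ such that for all $n\ge1$, $I\in\mathcal A_1^n$, the ratio of $\mu(I)$ to $\exp(-nP^{\mathbf a}(T,\Phi)/A_k)\,\phi^{\mathbf a}_n(I)$ lies in $(\kappa_n^{-1},\kappa_n)$. $\mathbf\Psi^{(i)}_{\mu,n}(x)=\log\mu_i(\tau_{i-1}(x_{|n}))$ denotes the $n$-th term of $\mathbf\Psi^{(i)}_\mu$. The symbol $\approx$ means that the ratio of the two sides lies between two positive constants independent of $x\in X$ and $n\ge1$. *)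

theory Defs
  imports "HOL-Probability.Probability"
begin

text \<open>
  All alphabets live in one letter type \<open>'a\<close>; the \<open>i\<close>-th alphabet is a finite set \<open>A i\<close>,
  \<open>1 \<le> i \<le> k\<close>. Sequences are functions \<open>nat \<Rightarrow> 'a\<close> and words are lists, so
  the letter written \<open>x\<^sub>m\<close>, \<open>m \<ge> 1\<close>, on paper is \<open>x (m - 1)\<close> here. Indices of alphabets, factor maps
  and weights start at \<open>1\<close>, and index \<open>0\<close> of a potential plays no role.
\<close>

section \<open>Full shifts, words and one-block factor maps\<close>

definition shift_space :: "'a set \<Rightarrow> (nat \<Rightarrow> 'a) topology" where
  "shift_space L = product_topology (\<lambda>_. discrete_topology L) UNIV"

abbreviation seqs :: "'a set \<Rightarrow> (nat \<Rightarrow> 'a) set" where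
  "seqs L \<equiv> topspace (shift_space L)"

definition shift_borel :: "'a set \<Rightarrow> (nat \<Rightarrow> 'a) measure" where
  "shift_borel L = sigma (seqs L) {U. openin (shift_space L) U}"

definition lshift :: "(nat \<Rightarrow> 'a) \<Rightarrow> nat \<Rightarrow> 'a" where
  "lshift x = (\<lambda>n. x (Suc n))"

definition words :: "'a set \<Rightarrow> nat \<Rightarrow> 'a list set" where
  "words L n = {I. length I = n \<and> set I \<subseteq> L}"

definition cyl :: "'a set \<Rightarrow> 'a list \<Rightarrow> (nat \<Rightarrow> 'a) set" where
  "cyl L I = {x \<in> seqs L. \<forall>j<length I. x j = I ! j}"

text \<open>The word \<open>x\<^bsub>m+1\<^esub> \<dots> x\<^sub>n\<close> (empty if \<open>n \<le> m\<close>).\<close>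

definition subword :: "(nat \<Rightarrow> 'a) \<Rightarrow> nat \<Rightarrow> nat \<Rightarrow> 'a list" where
  "subword x m n = map x [m..<n]"

abbreviation init_word :: "(nat \<Rightarrow> 'a) \<Rightarrow> nat \<Rightarrow> 'a list" where
  "init_word x n \<equiv> subword x 0 n"

definition letterwise :: "('a \<Rightarrow> 'b) \<Rightarrow> (nat \<Rightarrow> 'a) \<Rightarrow> nat \<Rightarrow> 'b" where
  "letterwise q x = (\<lambda>n. q (x n))"

definition one_block_factor :: "'a set \<Rightarrow> 'b set \<Rightarrow> ('a \<Rightarrow> 'b) \<Rightarrow> bool" where
  "one_block_factor L L' q \<longleftrightarrow>
     q ` L \<subseteq> L' \<and>
     continuous_map (shift_space L) (shift_space L') (letterwise q) \<and>
     letterwise q ` seqs L = seqs L' \<and>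
     (\<forall>x\<in>seqs L. letterwise q (lshift x) = lshift (letterwise q x))"

text \<open>\<open>p i\<close> is the letter map inducing \<open>\<pi>\<^sub>i\<close>, and \<open>tau p i\<close> the one inducing
  \<open>\<tau>\<^sub>i = \<pi>\<^sub>i \<circ> \<dots> \<circ> \<pi>\<^sub>0\<close>.\<close>

primrec tau :: "(nat \<Rightarrow> 'a \<Rightarrow> 'a) \<Rightarrow> nat \<Rightarrow> 'a \<Rightarrow> 'a" where
  "tau p 0 = id"
| "tau p (Suc i) = p (Suc i) \<circ> tau p i"


section \<open>Weights and the weighted metric\<close>

definition wsum :: "(nat \<Rightarrow> real) \<Rightarrow> nat \<Rightarrow> real" where
  "wsum a i = (\<Sum>j=1..i. a j)"

definition ell :: "(nat \<Rightarrow> real) \<Rightarrow> nat \<Rightarrow> nat \<Rightarrow> nat" where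
  "ell a i n = (if i = 0 then 0 else (LEAST q. wsum a i * real n / a 1 \<le> real q))"

text \<open>With letters indexed from \<open>0\<close>, the length of the longest common prefix is the
  infimum itself, without subtracting \<open>1\<close>; \<open>Inf {} = \<infinity>\<close> in \<open>enat\<close>.\<close>

definition common_prefix :: "(nat \<Rightarrow> 'a) \<Rightarrow> (nat \<Rightarrow> 'a) \<Rightarrow> enat" where
  "common_prefix u v = (INF m\<in>{m. u m \<noteq> v m}. enat m)"

definition exp_neg_div :: "enat \<Rightarrow> real \<Rightarrow> real" where
  "exp_neg_div t b = (case t of enat m \<Rightarrow> exp (- real m / b) | \<infinity> \<Rightarrow> 0)"

definition wdist ::
    "nat \<Rightarrow> (nat \<Rightarrow> 'a \<Rightarrow> 'a) \<Rightarrow> (nat \<Rightarrow> real) \<Rightarrow> (nat \<Rightarrow> 'a) \<Rightarrow> (nat \<Rightarrow> 'a) \<Rightarrow> real" where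
  "wdist k p a x y =
     Max ((\<lambda>i. exp_neg_div
                 (common_prefix (letterwise (tau p (i - 1)) x) (letterwise (tau p (i - 1)) y))
                 (wsum a i)) ` {1..k})"

definition wball ::
    "nat \<Rightarrow> 'a set \<Rightarrow> (nat \<Rightarrow> 'a \<Rightarrow> 'a) \<Rightarrow> (nat \<Rightarrow> real) \<Rightarrow> (nat \<Rightarrow> 'a) \<Rightarrow> real \<Rightarrow> (nat \<Rightarrow> 'a) set" where
  "wball k L p a x r = {y \<in> seqs L. wdist k p a x y \<le> r}"


section \<open>Potentials\<close>

text \<open>A potential \<open>(log \<phi>\<^sub>n)\<close> is represented by the sequence \<open>\<phi>\<close> itself.\<close>

definition subadditive_pot :: "'a set \<Rightarrow> (nat \<Rightarrow> (nat \<Rightarrow> 'a) \<Rightarrow> real) \<Rightarrow> bool" where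
  "subadditive_pot L \<phi> \<longleftrightarrow>
     (\<forall>n\<ge>1. continuous_map (shift_space L) euclideanreal (\<phi> n) \<and> (\<forall>x\<in>seqs L. 0 \<le> \<phi> n x)) \<and>
     (\<exists>c>0. \<forall>x\<in>seqs L. \<forall>n\<ge>1. \<forall>m\<ge>1. \<phi> (n + m) x \<le> c * \<phi> n x * \<phi> m ((lshift ^^ n) x))"

text \<open>\<open>|log u - log v|\<close> for \<open>u, v \<ge> 0\<close>, with \<open>log 0 - log 0 = 0\<close>.\<close>

definition log_gap :: "real \<Rightarrow> real \<Rightarrow> ereal" where
  "log_gap u v =
     (if u = 0 \<and> v = 0 then 0
      else if u = 0 \<or> v = 0 then \<infinity>
      else ereal \<bar>ln u - ln v\<bar>)"

text \<open>The approximating potentials are continuous, the approximated one need not be. It is only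
  asked to consist of non-negative bounded Borel functions, so that the integrals and the suprema
  over cylinders formed from it below make sense also for the finitely many \<open>n\<close> that the upper
  limit does not see.\<close>

definition asymp_subadditive_pot :: "'a set \<Rightarrow> (nat \<Rightarrow> (nat \<Rightarrow> 'a) \<Rightarrow> real) \<Rightarrow> bool" where
  "asymp_subadditive_pot L \<phi> \<longleftrightarrow>
     (\<forall>n\<ge>1. \<phi> n \<in> borel_measurable (shift_borel L) \<and> bounded (\<phi> n ` seqs L) \<and>
            (\<forall>x\<in>seqs L. 0 \<le> \<phi> n x)) \<and>
     (\<forall>\<epsilon>>0. \<exists>\<psi>. subadditive_pot L \<psi> \<and>
        limsup (\<lambda>n. ereal (1 / real n) * (SUP x\<in>seqs L. log_gap (\<phi> n x) (\<psi> n x))) \<le> ereal \<epsilon>)"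

text \<open>The class \<open>\<C>\<^bsub>asa\<^esub>\<close>. For \<open>-\<Phi> = (log (1/\<phi>\<^sub>n))\<close> to be defined, the \<open>\<phi>\<^sub>n\<close> have to be positive.\<close>

definition C_asa :: "'a set \<Rightarrow> (nat \<Rightarrow> (nat \<Rightarrow> 'a) \<Rightarrow> real) \<Rightarrow> bool" where
  "C_asa L \<phi> \<longleftrightarrow>
     (\<forall>n\<ge>1. \<forall>x\<in>seqs L. 0 < \<phi> n x) \<and>
     asymp_subadditive_pot L \<phi> \<and> asymp_subadditive_pot L (\<lambda>n x. 1 / \<phi> n x)"

definition C_aa :: "'a set \<Rightarrow> (nat \<Rightarrow> (nat \<Rightarrow> 'a) \<Rightarrow> real) \<Rightarrow> bool" where
  "C_aa L \<phi> \<longleftrightarrow>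
     (\<forall>n\<ge>1. continuous_map (shift_space L) euclideanreal (\<phi> n) \<and> (\<forall>x\<in>seqs L. 0 < \<phi> n x)) \<and>
     (\<exists>c>0. \<forall>x\<in>seqs L. \<forall>n\<ge>1. \<forall>m\<ge>1.
        inverse c * \<phi> n x * \<phi> m ((lshift ^^ n) x) \<le> \<phi> (n + m) x \<and>
        \<phi> (n + m) x \<le> c * \<phi> n x * \<phi> m ((lshift ^^ n) x))"

definition bounded_distortion :: "'a set \<Rightarrow> (nat \<Rightarrow> (nat \<Rightarrow> 'a) \<Rightarrow> real) \<Rightarrow> bool" where
  "bounded_distortion L \<phi> \<longleftrightarrow>
     (\<exists>c>0. \<forall>n\<ge>1. \<forall>I\<in>words L n. \<forall>x\<in>cyl L I. \<forall>y\<in>cyl L I.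
        inverse c * \<phi> n y \<le> \<phi> n x \<and> \<phi> n x \<le> c * \<phi> n y)"


section \<open>Invariant measures, entropy and weighted pressure\<close>

definition borel_prob :: "'a set \<Rightarrow> (nat \<Rightarrow> 'a) measure set" where
  "borel_prob L = {\<mu>. prob_space \<mu> \<and> sets \<mu> = sets (shift_borel L)}"

definition invariant_measures :: "'a set \<Rightarrow> (nat \<Rightarrow> 'a) measure set" where
  "invariant_measures L = {\<mu> \<in> borel_prob L. distr \<mu> \<mu> lshift = \<mu>}"

definition factor_measure ::
    "(nat \<Rightarrow> 'a set) \<Rightarrow> (nat \<Rightarrow> 'a \<Rightarrow> 'a) \<Rightarrow> (nat \<Rightarrow> 'a) measure \<Rightarrow> nat \<Rightarrow> (nat \<Rightarrow> 'a) measure" where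
  "factor_measure A p \<mu> i = distr \<mu> (shift_borel (A i)) (letterwise (tau p (i - 1)))"

text \<open>Kolmogorov--Sinai entropy, with \<open>0 log 0 = 0\<close> since \<open>ln 0 = 0\<close>. It is real-valued; on a
  full shift it is bounded by the logarithm of the size of the alphabet, so the supremum
  over partitions is a genuine one.\<close>

definition meas_partition :: "'b measure \<Rightarrow> 'b set set \<Rightarrow> bool" where
  "meas_partition M P \<longleftrightarrow> finite P \<and> P \<subseteq> sets M \<and> partition_on (space M) P"

definition iter_join :: "'b measure \<Rightarrow> ('b \<Rightarrow> 'b) \<Rightarrow> 'b set set \<Rightarrow> nat \<Rightarrow> 'b set set" where
  "iter_join M T P n =
     {space M \<inter> (\<Inter>j<n. (T ^^ j) -` f j) | f. \<forall>j<n. f j \<in> P} - {{}}"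

definition partition_entropy :: "'b measure \<Rightarrow> 'b set set \<Rightarrow> real" where
  "partition_entropy M P = - (\<Sum>B\<in>P. measure M B * ln (measure M B))"

definition ks_entropy :: "'b measure \<Rightarrow> ('b \<Rightarrow> 'b) \<Rightarrow> real" where
  "ks_entropy M T =
     Sup {lim (\<lambda>n. partition_entropy M (iter_join M T P n) / real n) | P. meas_partition M P}"

definition weighted_entropy ::
    "nat \<Rightarrow> (nat \<Rightarrow> 'a set) \<Rightarrow> (nat \<Rightarrow> 'a \<Rightarrow> 'a) \<Rightarrow> (nat \<Rightarrow> real) \<Rightarrow> (nat \<Rightarrow> 'a) measure \<Rightarrow> real" where
  "weighted_entropy k A p a \<mu> =
     (\<Sum>i=1..k. a i * ks_entropy (factor_measure A p \<mu> i) lshift)"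

definition pot_mean :: "(nat \<Rightarrow> (nat \<Rightarrow> 'a) \<Rightarrow> real) \<Rightarrow> (nat \<Rightarrow> 'a) measure \<Rightarrow> real" where
  "pot_mean \<phi> \<mu> = lim (\<lambda>n. (1 / real n) * (\<integral>x. ln (\<phi> n x) \<partial>\<mu>))"

text \<open>For \<open>\<Phi>\<close> in \<open>\<C>\<^bsub>asa\<^esub>\<close> the set below is non-empty and bounded.\<close>

definition weighted_pressure ::
    "nat \<Rightarrow> (nat \<Rightarrow> 'a set) \<Rightarrow> (nat \<Rightarrow> 'a \<Rightarrow> 'a) \<Rightarrow> (nat \<Rightarrow> real) \<Rightarrow>
     (nat \<Rightarrow> (nat \<Rightarrow> 'a) \<Rightarrow> real) \<Rightarrow> real" where
  "weighted_pressure k A p a \<phi> =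
     Sup {pot_mean \<phi> \<mu> + weighted_entropy k A p a \<mu> | \<mu>. \<mu> \<in> invariant_measures (A 1)}"


section \<open>The weighted potential and weak Gibbs measures\<close>

text \<open>\<open>level_pot A p a \<phi> i n y\<close> is \<open>\<phi>\<^sub>n\<^sup>(\<^sup>i\<^sup>)(y)\<close>, a function of \<open>y \<in> X\<^bsub>i+1\<^esub>\<close>; the step
  from \<open>i\<close> to \<open>Suc i\<close> sums over words of \<open>A\<^bsub>Suc i\<^esub>\<close>.\<close>

primrec level_pot ::
    "(nat \<Rightarrow> 'a set) \<Rightarrow> (nat \<Rightarrow> 'a \<Rightarrow> 'a) \<Rightarrow> (nat \<Rightarrow> real) \<Rightarrow> (nat \<Rightarrow> (nat \<Rightarrow> 'a) \<Rightarrow> real) \<Rightarrow>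
     nat \<Rightarrow> nat \<Rightarrow> (nat \<Rightarrow> 'a) \<Rightarrow> real" where
  "level_pot A p a \<phi> 0 = \<phi>"
| "level_pot A p a \<phi> (Suc i) = (\<lambda>n y.
     (\<Sum>I | I \<in> words (A (Suc i)) n \<and>
            cyl (A (Suc i)) I \<inter> {x \<in> seqs (A (Suc i)). letterwise (p (Suc i)) x = y} \<noteq> {}.
        (SUP x\<in>cyl (A (Suc i)) I. level_pot A p a \<phi> i n x powr (1 / wsum a (Suc i))))
     powr wsum a (Suc i))"

definition level_word ::
    "(nat \<Rightarrow> 'a set) \<Rightarrow> (nat \<Rightarrow> 'a \<Rightarrow> 'a) \<Rightarrow> (nat \<Rightarrow> real) \<Rightarrow> (nat \<Rightarrow> (nat \<Rightarrow> 'a) \<Rightarrow> real) \<Rightarrow>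
     nat \<Rightarrow> 'a list \<Rightarrow> real" where
  "level_word A p a \<phi> i J = (SUP y\<in>cyl (A (Suc i)) J. level_pot A p a \<phi> i (length J) y)"

text \<open>The common value of \<open>\<phi>\<^sub>n\<^sup>a\<close> on the cylinder of a word \<open>I\<close> of length \<open>n\<close>.\<close>

definition weighted_pot ::
    "nat \<Rightarrow> (nat \<Rightarrow> 'a set) \<Rightarrow> (nat \<Rightarrow> 'a \<Rightarrow> 'a) \<Rightarrow> (nat \<Rightarrow> real) \<Rightarrow>
     (nat \<Rightarrow> (nat \<Rightarrow> 'a) \<Rightarrow> real) \<Rightarrow> 'a list \<Rightarrow> real" where
  "weighted_pot k A p a \<phi> I =
     level_word A p a \<phi> 0 I powr (1 / wsum a 1) *
     (\<Prod>i=1..k-1. level_word A p a \<phi> i (map (tau p i) I)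
                     powr (1 / wsum a (Suc i) - 1 / wsum a i))"

definition fully_supported :: "'a set \<Rightarrow> (nat \<Rightarrow> 'a) measure \<Rightarrow> bool" where
  "fully_supported L \<mu> \<longleftrightarrow> (\<forall>U. openin (shift_space L) U \<and> U \<noteq> {} \<longrightarrow> 0 < measure \<mu> U)"

definition weighted_weak_Gibbs ::
    "nat \<Rightarrow> (nat \<Rightarrow> 'a set) \<Rightarrow> (nat \<Rightarrow> 'a \<Rightarrow> 'a) \<Rightarrow> (nat \<Rightarrow> real) \<Rightarrow>
     (nat \<Rightarrow> (nat \<Rightarrow> 'a) \<Rightarrow> real) \<Rightarrow> (nat \<Rightarrow> 'a) measure \<Rightarrow> bool" where
  "weighted_weak_Gibbs k A p a \<phi> \<mu> \<longleftrightarrow>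
     \<mu> \<in> borel_prob (A 1) \<and> fully_supported (A 1) \<mu> \<and>
     (\<exists>\<kappa>. (\<forall>n\<ge>1. 0 < \<kappa> n) \<and> (\<lambda>n. ln (\<kappa> n) / real n) \<longlonglongrightarrow> 0 \<and>
        (\<forall>n\<ge>1. \<forall>I\<in>words (A 1) n.
           measure \<mu> (cyl (A 1) I) /
             (exp (- real n * weighted_pressure k A p a \<phi> / wsum a k) * weighted_pot k A p a \<phi> I)
           \<in> {inverse (\<kappa> n)<..<\<kappa> n}))"

definition factor_word_measure ::
    "(nat \<Rightarrow> 'a set) \<Rightarrow> (nat \<Rightarrow> 'a \<Rightarrow> 'a) \<Rightarrow> (nat \<Rightarrow> 'a) measure \<Rightarrow> nat \<Rightarrow> 'a list \<Rightarrow> real" where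
  "factor_word_measure A p \<mu> i J = measure (factor_measure A p \<mu> i) (cyl (A i) J)"

text \<open>\<open>psi_pot A p \<mu> i\<close> is the sequence \<open>\<mu>\<^sub>i(\<tau>\<^bsub>i-1\<^esub>(x\<^bsub>|n\<^esub>))\<close> representing \<open>\<Psi>\<^sub>\<mu>\<^sup>(\<^sup>i\<^sup>)\<close>,
  and \<open>log_psi\<close> its logarithm.\<close>

definition psi_pot ::
    "(nat \<Rightarrow> 'a set) \<Rightarrow> (nat \<Rightarrow> 'a \<Rightarrow> 'a) \<Rightarrow> (nat \<Rightarrow> 'a) measure \<Rightarrow> nat \<Rightarrow>
     nat \<Rightarrow> (nat \<Rightarrow> 'a) \<Rightarrow> real" where
  "psi_pot A p \<mu> i n x = factor_word_measure A p \<mu> i (map (tau p (i - 1)) (init_word x n))"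

definition log_psi ::
    "(nat \<Rightarrow> 'a set) \<Rightarrow> (nat \<Rightarrow> 'a \<Rightarrow> 'a) \<Rightarrow> (nat \<Rightarrow> 'a) measure \<Rightarrow> nat \<Rightarrow>
     nat \<Rightarrow> (nat \<Rightarrow> 'a) \<Rightarrow> real" where
  "log_psi A p \<mu> i n x = ln (psi_pot A p \<mu> i n x)"

end

theory Submission
  imports Defs "HOL-Complex_Analysis.Great_Picard" "HOL-Real_Asymp.Real_Asymp"
begin

text \<open>
  Everything reduces to positive functions \<open>F\<close> on words. Asymptotic additivity of \<open>\<Phi>\<close> says that, for
  every \<open>\<epsilon>\<close>, the function \<open>I \<mapsto> sup\<^bsub>[I]\<^esub> \<phi>\<^sub>n\<close> agrees up to a factor \<open>e\<^sup>\<epsilon>\<^sup>n\<close> and constants with a \<open>G\<close> such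
  that \<open>G(IJ)/(G(I)G(J))\<close> is bounded above and below. This property is inherited by powers, products and
  sums over the fibres of a factor map, hence by \<open>F = \<phi>\<^sup>a\<close> and by the weights \<open>\<mu>\<^sub>i\<close> of any measure with
  \<open>\<mu>(I) = e\<^sup>o\<^sup>(\<^sup>n\<^sup>) F(I)/Z\<^sub>n\<close>, where \<open>Z\<^sub>n\<close> is the sum of \<open>F\<close> over the words of length \<open>n\<close>.
  Such a \<open>\<mu>\<close> is built from independent blocks of lengths \<open>1, 1, 2, 4, \<dots>\<close>; if \<open>F\<close> itself is almost
  multiplicative, an averaging argument gives an invariant \<open>\<mu>\<close> with \<open>e\<^sup>o\<^sup>(\<^sup>n\<^sup>)\<close> replaced by a constant.

  The variational principle \<open>log Z\<^sub>n = n P\<^sup>a/A\<^sub>k + o(n)\<close> rests on the identity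
  \<open>log sup\<^bsub>[I]\<^esub> \<phi>\<^sub>n = \<Sum>\<^sub>i a\<^sub>i log R\<^sub>i(\<tau>\<^bsub>i-1\<^esub> I)\<close>, where \<open>R\<^sub>i\<close> is the sum of \<open>F\<close> over the fibres of \<open>\<tau>\<^bsub>i-1\<^esub>\<close>: by Gibbs'
  inequality, applied on each level, energy plus weighted entropy is at most \<open>A\<^sub>k log Z\<^sub>n\<close>, with equality
  up to a constant for the invariant Gibbs measure of an approximant.

  A ball is the union of the cylinders of the words \<open>I\<^sub>1 K\<^sub>2 \<dots> K\<^sub>k\<close> with \<open>\<tau>\<^bsub>i-1\<^esub> K\<^sub>i = \<tau>\<^bsub>i-1\<^esub> I\<^sub>i\<close>, so that its
  measure nearly factorises.
\<close>

text \<open>Two obstacles shape the proof. The members of \<Phi> need not be continuous and are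
  sub-additive only through approximants, which bound log \<phi>_n from above by its pieces; the
  matching lower bound has to come from -\<Phi>. Comparing log \<phi>_n with the Birkhoff sums of
  (log \<phi>_N)/N for one large N, and then log \<phi>_N with a function of finitely many letters,
  yields a comparison function whose defect under concatenation is a constant: cutting a word
  disturbs only the windows across the cut. Secondly, an error \<epsilon> n cannot be averaged over
  positions, because the error of padding I to a long word grows with the long word and not with I.
  This is why the blocks of the general measure grow geometrically: a word of length n meets blocks
  of total length below 2n, and their logarithmic number makes the accumulated constants o(n). When
  the defect is constant, padding costs a constant whatever the length, and the average over
  positions keeps its bounds in the limit.\<close>

section \<open>Positive functions on words\<close>

text \<open>In logarithms, summation is monotone and commutes with adding a constant, so it is
  1-Lipschitz for the supremum norm. No factor for the number of summands appears, which keeps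
  errors stable when fibres are summed.\<close>

lemma ln_sum_close:
  fixes f g :: "'i \<Rightarrow> real"
  assumes "finite S" "S \<noteq> {}"
    and "\<And>i. i \<in> S \<Longrightarrow> 0 < f i" "\<And>i. i \<in> S \<Longrightarrow> 0 < g i"
    and "\<And>i. i \<in> S \<Longrightarrow> \<bar>ln (f i) - ln (g i)\<bar> \<le> e"
  shows "\<bar>ln (sum f S) - ln (sum g S)\<bar> \<le> e"
proof -
  have le: "ln (sum u S) \<le> e + ln (sum v S)"
    if uv: "\<And>i. i \<in> S \<Longrightarrow> 0 < u i" "\<And>i. i \<in> S \<Longrightarrow> 0 < v i"
      "\<And>i. i \<in> S \<Longrightarrow> ln (u i) \<le> e + ln (v i)" for u v :: "'i \<Rightarrow> real"
  proof -
    have pos: "0 < sum u S" "0 < sum v S"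
      using uv assms(1,2) by (auto intro: sum_pos)
    have "u i \<le> exp e * v i" if "i \<in> S" for i
    proof -
      have "u i = exp (ln (u i))" using uv(1)[OF that] by simp
      also have "\<dots> \<le> exp (e + ln (v i))" using uv(3)[OF that] by simp
      finally show ?thesis using uv(2)[OF that] by (simp add: exp_add)
    qed
    then have "sum u S \<le> exp e * sum v S"
      by (simp add: sum_distrib_left sum_mono)
    then have "ln (sum u S) \<le> ln (exp e * sum v S)"
      using pos by simp
    then show ?thesis using pos by (simp add: ln_mult)
  qed
  have "ln (f i) \<le> e + ln (g i)" "ln (g i) \<le> e + ln (f i)" if "i \<in> S" for i
    using assms(5)[OF that] by (auto simp: abs_le_iff)
  then show ?thesis
    using le[of f g] le[of g f] assms(3,4) by (fastforce simp: abs_le_iff)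
qed

section \<open>Words and sums over the words of a given length\<close>

lemma in_words_iff: "I \<in> words L n \<longleftrightarrow> length I = n \<and> set I \<subseteq> L"
  by (simp add: words_def)

lemma words_0 [simp]: "words L 0 = {[]}"
  by (auto simp: words_def)

lemma finite_words [simp]: "finite L \<Longrightarrow> finite (words L n)"
  using finite_lists_length_eq[of L n] by (simp add: words_def conj_commute)

lemma words_nonempty: "L \<noteq> {} \<Longrightarrow> words L n \<noteq> {}"
proof -
  assume "L \<noteq> {}"
  then obtain b where "b \<in> L" by auto
  then have "replicate n b \<in> words L n" by (auto simp: words_def)
  then show ?thesis by auto
qed

lemma bij_betw_append_words:
  "bij_betw (\<lambda>(I, J). I @ J) (words L n \<times> words L m) (words L (n + m))"
  unfolding bij_betw_def
proof
  show "inj_on (\<lambda>(I, J). I @ J) (words L n \<times> words L m)"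
    by (auto simp: inj_on_def words_def)
  show "(\<lambda>(I, J). I @ J) ` (words L n \<times> words L m) = words L (n + m)"
  proof (intro equalityI subsetI)
    fix K assume "K \<in> words L (n + m)"
    then have "take n K \<in> words L n" "drop n K \<in> words L m"
      by (auto simp: words_def dest: in_set_takeD in_set_dropD)
    then show "K \<in> (\<lambda>(I, J). I @ J) ` (words L n \<times> words L m)"
      by (intro image_eqI[of _ _ "(take n K, drop n K)"]) auto
  qed (auto simp: words_def)
qed

lemma sum_words_append:
  "(\<Sum>I\<in>words L (n + m). f I) = (\<Sum>I\<in>words L n. \<Sum>J\<in>words L m. f (I @ J))"
  unfolding sum.cartesian_product
  by (subst sum.reindex_bij_betw[OF bij_betw_append_words, symmetric]) (simp add: case_prod_unfold)

lemma words_1: "words L (Suc 0) = (\<lambda>b. [b]) ` L"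
  by (auto simp: words_def length_Suc_conv)

lemma sum_words_1: "(\<Sum>I\<in>words L (Suc 0). f I) = (\<Sum>b\<in>L. f [b])"
  unfolding words_1 by (subst sum.reindex) (auto simp: inj_on_def)

text \<open>The partition function Z_n of the overview.\<close>

definition word_sum :: "'a set \<Rightarrow> ('a list \<Rightarrow> real) \<Rightarrow> nat \<Rightarrow> real" where
  "word_sum L F n = (\<Sum>I\<in>words L n. F I)"

definition fiber :: "('a \<Rightarrow> 'b) \<Rightarrow> 'a set \<Rightarrow> 'b list \<Rightarrow> 'a list set" where
  "fiber q L J = {I \<in> words L (length J). map q I = J}"

definition push :: "('a \<Rightarrow> 'b) \<Rightarrow> 'a set \<Rightarrow> ('a list \<Rightarrow> real) \<Rightarrow> 'b list \<Rightarrow> real" where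
  "push q L F J = (\<Sum>I\<in>fiber q L J. F I)"

text \<open>The error depends on the total length only, so that one notion covers both regimes: a
  constant \<open>d\<close>, and \<open>d n = C + \<epsilon> * real n\<close>. Being two-sided, it
  survives negative powers.\<close>

definition almost_mult :: "'a set \<Rightarrow> (nat \<Rightarrow> real) \<Rightarrow> ('a list \<Rightarrow> real) \<Rightarrow> bool" where
  "almost_mult L d F \<longleftrightarrow> (\<forall>I. set I \<subseteq> L \<longrightarrow> 0 < F I) \<and>
     (\<forall>I J. set I \<subseteq> L \<longrightarrow> set J \<subseteq> L \<longrightarrow>
        \<bar>ln (F (I @ J)) - ln (F I) - ln (F J)\<bar> \<le> d (length I + length J))"

definition near :: "'a set \<Rightarrow> (nat \<Rightarrow> real) \<Rightarrow> ('a list \<Rightarrow> real) \<Rightarrow> ('a list \<Rightarrow> real) \<Rightarrow> bool" where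
  "near L d F G \<longleftrightarrow>
     (\<forall>I. set I \<subseteq> L \<longrightarrow> 0 < F I \<and> 0 < G I \<and> \<bar>ln (F I) - ln (G I)\<bar> \<le> d (length I))"

text \<open>The approximant must have a constant defect, not merely a small one: this is what gives
  it Fekete limits and invariant Gibbs measures. The constant may blow up as \<epsilon> tends to
  0.\<close>

definition tempered :: "'a set \<Rightarrow> ('a list \<Rightarrow> real) \<Rightarrow> bool" where
  "tempered L F \<longleftrightarrow>
     (\<forall>\<epsilon>>0. \<exists>C G. almost_mult L (\<lambda>_. C) G \<and> near L (\<lambda>n. C + \<epsilon> * real n) F G)"

lemma almost_mult_pos: "almost_mult L d F \<Longrightarrow> set I \<subseteq> L \<Longrightarrow> 0 < F I"
  by (simp add: almost_mult_def)

lemma almost_multD: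
  "almost_mult L d F \<Longrightarrow> set I \<subseteq> L \<Longrightarrow> set J \<subseteq> L \<Longrightarrow>
     \<bar>ln (F (I @ J)) - ln (F I) - ln (F J)\<bar> \<le> d (length I + length J)"
  by (simp add: almost_mult_def)

lemma almost_mult_nonneg: "almost_mult L d F \<Longrightarrow> L \<noteq> {} \<Longrightarrow> 0 \<le> d n"
proof -
  assume am: "almost_mult L d F" and "L \<noteq> {}"
  then obtain I where "I \<in> words L n" using words_nonempty[of L n] by auto
  then have "\<bar>ln (F (I @ [])) - ln (F I) - ln (F [])\<bar> \<le> d (length I + length ([] :: 'a list))"
    using almost_multD[OF am, of I "[]"] by (simp add: words_def)
  then show ?thesis using \<open>I \<in> words L n\<close> by (simp add: words_def)
qed

lemma nearD:
  assumes "near L d F G" "set I \<subseteq> L"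
  shows "0 < F I" "0 < G I" "\<bar>ln (F I) - ln (G I)\<bar> \<le> d (length I)"
  using assms by (auto simp: near_def)

lemma near_trans: "near L d F G \<Longrightarrow> near L e G H \<Longrightarrow> near L (\<lambda>n. d n + e n) F H"
  unfolding near_def by (smt (verit, best))

lemma near_mono: "near L d F G \<Longrightarrow> (\<And>n. d n \<le> e n) \<Longrightarrow> near L e F G"
  unfolding near_def by (meson order_trans)

lemma almost_mult_mono: "almost_mult L d F \<Longrightarrow> (\<And>n. d n \<le> e n) \<Longrightarrow> almost_mult L e F"
  unfolding almost_mult_def by (meson order_trans)

text \<open>Each of the three words in the inequality is compared with \<open>G\<close>. The parts
  are no longer than the whole, so monotonicity of \<open>e\<close> allows all three errors to be
  charged at the total length.\<close>

lemma almost_mult_near: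
  assumes am: "almost_mult L d G" and nr: "near L e F G"
    and "\<And>n m. n \<le> m \<Longrightarrow> e n \<le> e m"
  shows "almost_mult L (\<lambda>n. d n + 3 * e n) F"
  unfolding almost_mult_def
proof (intro conjI allI impI)
  fix I J :: "'a list" assume IJ: "set I \<subseteq> L" "set J \<subseteq> L"
  have "\<bar>ln (F (I @ J)) - ln (G (I @ J))\<bar> \<le> e (length I + length J)"
    using nearD(3)[OF nr, of "I @ J"] IJ by simp
  moreover have "\<bar>ln (F I) - ln (G I)\<bar> \<le> e (length I + length J)"
    using nearD(3)[OF nr, of I] IJ assms(3)[of "length I" "length I + length J"] by simp
  moreover have "\<bar>ln (F J) - ln (G J)\<bar> \<le> e (length I + length J)"
    using nearD(3)[OF nr, of J] IJ assms(3)[of "length J" "length I + length J"] by simp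
  ultimately show "\<bar>ln (F (I @ J)) - ln (F I) - ln (F J)\<bar>
      \<le> d (length I + length J) + 3 * e (length I + length J)"
    using almost_multD[OF am IJ] by linarith
qed (use nr in \<open>auto simp: near_def\<close>)

lemma tempered_almost_mult:
  assumes "tempered L F" "0 < \<epsilon>" "L \<noteq> {}"
  obtains C where "0 \<le> C" "almost_mult L (\<lambda>n. C + \<epsilon> * real n) F"
proof -
  obtain C G where CG: "almost_mult L (\<lambda>_. C) G" "near L (\<lambda>n. C + \<epsilon> / 3 * real n) F G"
    using assms by (metis tempered_def zero_less_divide_iff zero_less_numeral)
  have "almost_mult L (\<lambda>n. C + 3 * (C + \<epsilon> / 3 * real n)) F"
    using \<open>0 < \<epsilon>\<close> by (intro almost_mult_near[OF CG]) (simp add: mult_left_mono)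
  then have "almost_mult L (\<lambda>n. 4 * C + \<epsilon> * real n) F"
    by (rule almost_mult_mono) simp
  then show ?thesis
    using that[of "4 * C"] almost_mult_nonneg[OF CG(1) \<open>L \<noteq> {}\<close>] by simp
qed

lemma almost_mult_powr:
  assumes am: "almost_mult L d F"
  shows "almost_mult L (\<lambda>n. \<bar>s\<bar> * d n) (\<lambda>I. F I powr s)"
  unfolding almost_mult_def
proof (intro conjI allI impI)
  fix I J :: "'a list" assume IJ: "set I \<subseteq> L" "set J \<subseteq> L"
  have "0 < F I" "0 < F J" "0 < F (I @ J)"
    using IJ almost_mult_pos[OF am] by auto
  then have "ln (F (I @ J) powr s) - ln (F I powr s) - ln (F J powr s)
      = s * (ln (F (I @ J)) - ln (F I) - ln (F J))"
    by (simp add: ln_powr algebra_simps)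
  then show "\<bar>ln (F (I @ J) powr s) - ln (F I powr s) - ln (F J powr s)\<bar>
      \<le> \<bar>s\<bar> * d (length I + length J)"
    using almost_multD[OF am IJ] by (simp add: abs_mult mult_left_mono)
qed (use almost_mult_pos[OF am] in force)

lemma near_powr:
  assumes "near L d F G"
  shows "near L (\<lambda>n. \<bar>s\<bar> * d n) (\<lambda>I. F I powr s) (\<lambda>I. G I powr s)"
  unfolding near_def
proof (intro allI impI)
  fix I :: "'a list" assume I: "set I \<subseteq> L"
  note fg = nearD[OF assms I]
  have "ln (F I powr s) - ln (G I powr s) = s * (ln (F I) - ln (G I))"
    using fg by (simp add: ln_powr algebra_simps)
  then show "0 < F I powr s \<and> 0 < G I powr s \<and>
      \<bar>ln (F I powr s) - ln (G I powr s)\<bar> \<le> \<bar>s\<bar> * d (length I)"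
    using fg by (simp add: abs_mult mult_left_mono)
qed

lemma almost_mult_mult:
  assumes "almost_mult L d F" "almost_mult L e G"
  shows "almost_mult L (\<lambda>n. d n + e n) (\<lambda>I. F I * G I)"
  unfolding almost_mult_def
proof (intro conjI allI impI)
  fix I J :: "'a list" assume IJ: "set I \<subseteq> L" "set J \<subseteq> L"
  have "0 < F I" "0 < F J" "0 < F (I @ J)" "0 < G I" "0 < G J" "0 < G (I @ J)"
    using IJ almost_mult_pos[OF assms(1)] almost_mult_pos[OF assms(2)] by auto
  then show "\<bar>ln (F (I @ J) * G (I @ J)) - ln (F I * G I) - ln (F J * G J)\<bar>
      \<le> d (length I + length J) + e (length I + length J)"
    using almost_multD[OF assms(1) IJ] almost_multD[OF assms(2) IJ] by (simp add: ln_mult)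
qed (use almost_mult_pos[OF assms(1)] almost_mult_pos[OF assms(2)] in auto)

lemma near_mult:
  assumes "near L d F G" "near L e F' G'"
  shows "near L (\<lambda>n. d n + e n) (\<lambda>I. F I * F' I) (\<lambda>I. G I * G' I)"
  unfolding near_def
proof (intro allI impI)
  fix I :: "'a list" assume I: "set I \<subseteq> L"
  note fg = nearD[OF assms(1) I] nearD[OF assms(2) I]
  then show "0 < F I * F' I \<and> 0 < G I * G' I \<and>
      \<bar>ln (F I * F' I) - ln (G I * G' I)\<bar> \<le> d (length I) + e (length I)"
    by (simp add: ln_mult)
qed

lemma almost_mult_comp:
  assumes "almost_mult L' d F" "q ` L \<subseteq> L'"
  shows "almost_mult L d (\<lambda>I. F (map q I))"
proof -
  have "set (map q I) \<subseteq> L'" if "set I \<subseteq> L" for I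
    using that assms(2) by auto
  then show ?thesis
    using assms(1) unfolding almost_mult_def by (metis length_map map_append)
qed

lemma near_comp:
  assumes "near L' d F G" "q ` L \<subseteq> L'"
  shows "near L d (\<lambda>I. F (map q I)) (\<lambda>I. G (map q I))"
proof -
  have "set (map q I) \<subseteq> L'" if "set I \<subseteq> L" for I
    using that assms(2) by auto
  then show ?thesis
    using assms(1) unfolding near_def by (metis length_map)
qed

section \<open>Fibres of a letter map and sums over them\<close>

lemma fiber_Nil [simp]: "fiber q L [] = {[]}"
  by (auto simp: fiber_def)

lemma finite_fiber [simp]: "finite L \<Longrightarrow> finite (fiber q L J)"
  by (simp add: fiber_def)

lemma fiberD: "I \<in> fiber q L J \<Longrightarrow> set I \<subseteq> L" "I \<in> fiber q L J \<Longrightarrow> length I = length J"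
    "I \<in> fiber q L J \<Longrightarrow> map q I = J"
  by (auto simp: fiber_def words_def)

lemma fiber_nonempty:
  assumes "set J \<subseteq> q ` L"
  shows "fiber q L J \<noteq> {}"
proof -
  have "map (inv_into L q) J \<in> fiber q L J"
    using assms by (auto simp: fiber_def words_def inv_into_into f_inv_into_f subset_iff
        intro!: map_idI)
  then show ?thesis by auto
qed

lemma bij_betw_append_fiber:
  "bij_betw (\<lambda>(I, I'). I @ I') (fiber q L J \<times> fiber q L J') (fiber q L (J @ J'))"
  unfolding bij_betw_def
proof
  show "inj_on (\<lambda>(I, I'). I @ I') (fiber q L J \<times> fiber q L J')"
    by (auto simp: inj_on_def dest!: fiberD(2))
  show "(\<lambda>(I, I'). I @ I') ` (fiber q L J \<times> fiber q L J') = fiber q L (J @ J')"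
  proof (intro equalityI subsetI)
    fix K assume K: "K \<in> fiber q L (J @ J')"
    define n where "n = length J"
    have "take n K \<in> fiber q L J" "drop n K \<in> fiber q L J'"
      using K unfolding fiber_def words_def n_def
      by (auto simp: take_map [symmetric] drop_map [symmetric]
          dest!: in_set_takeD in_set_dropD)
    then show "K \<in> (\<lambda>(I, I'). I @ I') ` (fiber q L J \<times> fiber q L J')"
      by (intro image_eqI[of _ _ "(take n K, drop n K)"]) auto
  qed (auto simp: fiber_def words_def)
qed

lemma push_append:
  "push q L F (J @ J') = (\<Sum>(I, I')\<in>fiber q L J \<times> fiber q L J'. F (I @ I'))"
  unfolding push_def
  by (subst sum.reindex_bij_betw[OF bij_betw_append_fiber, symmetric]) (simp add: case_prod_unfold)

lemma push_pos:
  assumes "finite L" "\<And>I. set I \<subseteq> L \<Longrightarrow> 0 < F I" "set J \<subseteq> q ` L"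
  shows "0 < push q L F J"
  unfolding push_def
  using assms fiber_nonempty[of J q L] by (intro sum_pos) (auto dest: fiberD)

lemma near_push:
  assumes "near L d F G" "finite L" "q ` L = L'"
  shows "near L' d (push q L F) (push q L G)"
  unfolding near_def
proof (intro allI impI conjI)
  fix J :: "'b list" assume J: "set J \<subseteq> L'"
  note D = nearD[OF assms(1)]
  show "0 < push q L F J" "0 < push q L G J"
    using J assms D by (auto intro!: push_pos)
  show "\<bar>ln (push q L F J) - ln (push q L G J)\<bar> \<le> d (length J)"
    unfolding push_def
  proof (rule ln_sum_close)
    fix I assume "I \<in> fiber q L J"
    note f = fiberD[OF this]
    show "0 < F I" "0 < G I" "\<bar>ln (F I) - ln (G I)\<bar> \<le> d (length J)"
      using D[OF f(1)] f(2) by auto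
  qed (use J assms fiber_nonempty[of J q L] in auto)
qed

text \<open>The fibre over \<open>J @ J'\<close> is the product of the two fibres, so the product of
  the pushed weights is a sum over the same pairs; comparing summand by summand leaves the error
  unchanged.\<close>

lemma almost_mult_push:
  assumes am: "almost_mult L d F" and "finite L" "q ` L = L'"
  shows "almost_mult L' d (push q L F)"
  unfolding almost_mult_def
proof (intro allI impI conjI)
  fix J :: "'b list" assume J: "set J \<subseteq> L'"
  show pos: "0 < push q L F J"
    using J assms almost_mult_pos[OF am] by (auto intro!: push_pos)
  fix J' :: "'b list" assume J': "set J' \<subseteq> L'"
  have pos': "0 < push q L F J'"
    using J' assms almost_mult_pos[OF am] by (auto intro!: push_pos)
  let ?S = "fiber q L J \<times> fiber q L J'"
  have "\<bar>ln (sum (\<lambda>(I, I'). F (I @ I')) ?S) - ln (sum (\<lambda>(I, I'). F I * F I') ?S)\<bar>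
      \<le> d (length J + length J')"
  proof (rule ln_sum_close)
    fix x assume "x \<in> ?S"
    then obtain I I' where x: "x = (I, I')" "I \<in> fiber q L J" "I' \<in> fiber q L J'" by auto
    note f = fiberD[OF x(2)] fiberD[OF x(3)]
    have p: "0 < F I" "0 < F I'" "0 < F (I @ I')"
      using f almost_mult_pos[OF am] by auto
    show "0 < (case x of (I, I') \<Rightarrow> F (I @ I'))" "0 < (case x of (I, I') \<Rightarrow> F I * F I')"
      using x p by auto
    show "\<bar>ln (case x of (I, I') \<Rightarrow> F (I @ I')) - ln (case x of (I, I') \<Rightarrow> F I * F I')\<bar>
        \<le> d (length J + length J')"
      using x p almost_multD[OF am f(1) f(4)] f by (simp add: ln_mult)
  qed (use assms J J' fiber_nonempty[of J q L] fiber_nonempty[of J' q L] in auto)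
  moreover have "sum (\<lambda>(I, I'). F I * F I') ?S = push q L F J * push q L F J'"
    by (simp add: push_def sum_product sum.cartesian_product)
  ultimately show "\<bar>ln (push q L F (J @ J')) - ln (push q L F J) - ln (push q L F J')\<bar>
      \<le> d (length J + length J')"
    using pos pos' by (simp add: push_append ln_mult)
qed

text \<open>Total sums are pushes to a one-letter alphabet, so the estimates for partition functions
  below are special cases of those for fibres.\<close>

lemma word_sum_eq_push: "word_sum L F n = push (\<lambda>_. ()) L F (replicate n ())"
  unfolding word_sum_def push_def fiber_def
  by (rule sum.cong) (auto simp: words_def map_replicate_const)

lemma word_sum_pos:
  assumes "finite L" "L \<noteq> {}" "\<And>I. set I \<subseteq> L \<Longrightarrow> 0 < F I"
  shows "0 < word_sum L F n"
  unfolding word_sum_def using assms words_nonempty[of L n]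
  by (intro sum_pos) (auto simp: in_words_iff)

lemma near_word_sum:
  assumes "near L d F G" "finite L" "L \<noteq> {}"
  shows "\<bar>ln (word_sum L F n) - ln (word_sum L G n)\<bar> \<le> d n"
proof -
  have "near UNIV d (push (\<lambda>_. ()) L F) (push (\<lambda>_. ()) L G)"
    by (rule near_push[OF assms(1,2)]) (use assms(3) in auto)
  from nearD(3)[OF this, of "replicate n ()"] show ?thesis
    by (simp add: word_sum_eq_push)
qed

lemma almost_mult_word_sum:
  assumes "almost_mult L d F" "finite L" "L \<noteq> {}"
  shows "\<bar>ln (word_sum L F (n + m)) - ln (word_sum L F n) - ln (word_sum L F m)\<bar> \<le> d (n + m)"
proof -
  have "almost_mult UNIV d (push (\<lambda>_. ()) L F)"
    by (rule almost_mult_push[OF assms(1,2)]) (use assms(3) in auto)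
  from almost_multD[OF this, of "replicate n ()" "replicate m ()"] show ?thesis
    by (simp add: word_sum_eq_push replicate_add)
qed

lemma tempered_push:
  assumes "tempered L F" "finite L" "q ` L = L'"
  shows "tempered L' (push q L F)"
  using assms almost_mult_push near_push unfolding tempered_def by metis

lemma tempered_near:
  assumes F: "tempered L F" and "\<And>\<epsilon>. 0 < \<epsilon> \<Longrightarrow> \<exists>C\<ge>0. near L (\<lambda>n. C + \<epsilon> * real n) w F"
  shows "tempered L w"
  unfolding tempered_def
proof (intro allI impI)
  fix \<epsilon> :: real assume "0 < \<epsilon>"
  then obtain C G where 1: "almost_mult L (\<lambda>_. C) G" "near L (\<lambda>n. C + \<epsilon> / 2 * real n) F G"
    using F by (metis half_gt_zero tempered_def)
  obtain C' where 2: "0 \<le> C'" "near L (\<lambda>n. C' + \<epsilon> / 2 * real n) w F"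
    using assms(2)[of "\<epsilon> / 2"] \<open>0 < \<epsilon>\<close> by auto
  have "near L (\<lambda>n. (C + C') + \<epsilon> * real n) w G"
    by (rule near_mono[OF near_trans[OF 2(2) 1(2)]]) (simp add: field_simps)
  moreover have "almost_mult L (\<lambda>_. C + C') G"
    by (rule almost_mult_mono[OF 1(1)]) (use 2 in simp)
  ultimately show "\<exists>C G. almost_mult L (\<lambda>_. C) G \<and> near L (\<lambda>n. C + \<epsilon> * real n) w G"
    by blast
qed

lemma fiber_comp:
  "fiber (r \<circ> q) L J = (\<Union>K\<in>fiber r (q ` L) J. fiber q L K)"
proof (intro equalityI subsetI)
  fix I assume I: "I \<in> fiber (r \<circ> q) L J"
  have "map q I \<in> fiber r (q ` L) J" "I \<in> fiber q L (map q I)"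
    using fiberD[OF I] by (auto simp: fiber_def in_words_iff)
  then show "I \<in> (\<Union>K\<in>fiber r (q ` L) J. fiber q L K)"
    by blast
next
  fix I assume "I \<in> (\<Union>K\<in>fiber r (q ` L) J. fiber q L K)"
  then obtain K where K: "K \<in> fiber r (q ` L) J" "I \<in> fiber q L K"
    by blast
  then show "I \<in> fiber (r \<circ> q) L J"
    unfolding fiber_def in_words_iff
    using fiberD(1)[OF K(2)] fiberD(3)[OF K(1), symmetric] fiberD(3)[OF K(2), symmetric] by simp
qed

lemma push_push:
  assumes "finite L"
  shows "push r (q ` L) (push q L F) J = push (r \<circ> q) L F J"
  unfolding push_def fiber_comp
  by (subst sum.UNION_disjoint) (use assms fiberD(3)[of _ q L] in auto)

text \<open>Grouping words by their image: the change of variables formula for functions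
  \<open>g\<close> that see a word only through the factor.\<close>

lemma sum_push:
  assumes "finite L" "q ` L \<subseteq> L'" "finite L'"
  shows "(\<Sum>J\<in>words L' n. push q L F J * g J) = (\<Sum>I\<in>words L n. F I * g (map q I))"
proof -
  let ?h = "\<lambda>I. F I * g (map q I)"
  have "sum ?h (words L n) = (\<Sum>J\<in>words L' n. sum ?h {I \<in> words L n. map q I = J})"
  proof (rule sum.group [symmetric])
    show "map q ` words L n \<subseteq> words L' n"
      using assms(2) by (fastforce simp: in_words_iff)
  qed (use assms in auto)
  also have "\<dots> = (\<Sum>J\<in>words L' n. push q L F J * g J)"
  proof (rule sum.cong)
    fix J assume "J \<in> words L' n"
    then have "{I \<in> words L n. map q I = J} = fiber q L J"
      by (auto simp: fiber_def in_words_iff)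
    then show "sum ?h {I \<in> words L n. map q I = J} = push q L F J * g J"
      unfolding push_def sum_distrib_right by (intro sum.cong) (auto dest: fiberD(3))
  qed simp
  finally show ?thesis by simp
qed

section \<open>The weighted potential of a chain of factors\<close>

lemma almost_mult_prod:
  assumes "finite S" "\<And>i. i \<in> S \<Longrightarrow> almost_mult L (d i) (F i)"
  shows "almost_mult L (\<lambda>n. \<Sum>i\<in>S. d i n) (\<lambda>I. \<Prod>i\<in>S. F i I)"
  using assms
proof (induction S rule: finite_induct)
  case empty
  then show ?case by (simp add: almost_mult_def)
next
  case (insert i S)
  then have "almost_mult L (\<lambda>n. d i n + (\<Sum>i\<in>S. d i n)) (\<lambda>I. F i I * (\<Prod>i\<in>S. F i I))"
    by (intro almost_mult_mult) auto
  then show ?case using insert by simp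
qed

lemma near_prod:
  assumes "finite S" "\<And>i. i \<in> S \<Longrightarrow> near L (d i) (F i) (G i)"
  shows "near L (\<lambda>n. \<Sum>i\<in>S. d i n) (\<lambda>I. \<Prod>i\<in>S. F i I) (\<lambda>I. \<Prod>i\<in>S. G i I)"
  using assms
proof (induction S rule: finite_induct)
  case empty
  then show ?case by (simp add: near_def)
next
  case (insert i S)
  then have "near L (\<lambda>n. d i n + (\<Sum>i\<in>S. d i n))
      (\<lambda>I. F i I * (\<Prod>i\<in>S. F i I)) (\<lambda>I. G i I * (\<Prod>i\<in>S. G i I))"
    by (intro near_mult) auto
  then show ?case using insert by simp
qed

text \<open>Nonnegativity of the relative entropy of \<open>q\<close> with respect to the normalised
  \<open>R\<close>, from ln t \<le> t - 1. Zeros of \<open>q\<close> are allowed and contribute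
  nothing.\<close>

lemma gibbs_inequality:
  fixes q R :: "'i \<Rightarrow> real"
  assumes "finite S" "\<And>i. i \<in> S \<Longrightarrow> 0 \<le> q i" "sum q S = 1" "\<And>i. i \<in> S \<Longrightarrow> 0 < R i"
  shows "(\<Sum>i\<in>S. q i * ln (R i)) - (\<Sum>i\<in>S. q i * ln (q i)) \<le> ln (sum R S)"
proof -
  have "S \<noteq> {}" using assms(3) by auto
  then have Z: "0 < sum R S" using assms by (auto intro: sum_pos)
  have "q i * (ln (R i) - ln (q i) - ln (sum R S)) \<le> R i / sum R S - q i" if "i \<in> S" for i
  proof (cases "q i = 0")
    case True
    then show ?thesis using assms(4)[OF that] Z by simp
  next
    case False
    then have q: "0 < q i" using assms(2)[OF that] by simp
    have "ln (R i) - ln (q i) - ln (sum R S) = ln (R i / (q i * sum R S))"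
      using q Z assms(4)[OF that] by (simp add: ln_div ln_mult)
    also have "\<dots> \<le> R i / (q i * sum R S) - 1"
      using q Z assms(4)[OF that] by (intro ln_le_minus_one) simp
    finally have "q i * (ln (R i) - ln (q i) - ln (sum R S)) \<le> q i * (R i / (q i * sum R S) - 1)"
      using q by (intro mult_left_mono) auto
    also have "\<dots> = R i / sum R S - q i"
      using q by (simp add: field_simps)
    finally show ?thesis .
  qed
  then have "(\<Sum>i\<in>S. q i * (ln (R i) - ln (q i) - ln (sum R S))) \<le> (\<Sum>i\<in>S. R i / sum R S - q i)"
    by (rule sum_mono)
  also have "\<dots> = 0"
    using Z assms(3) by (simp add: sum_subtractf sum_divide_distrib [symmetric])
  finally show ?thesis
    using assms(3) by (simp add: right_diff_distrib sum_subtractf sum_distrib_right [symmetric])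
qed

definition word_entropy :: "'a set \<Rightarrow> ('a list \<Rightarrow> real) \<Rightarrow> nat \<Rightarrow> real" where
  "word_entropy L w n = - (\<Sum>I\<in>words L n. w I * ln (w I))"

text \<open>The counterpart of \<open>level_pot\<close> on words: once the bottom level is a
  function of words, no suprema over cylinders remain.\<close>

primrec level_weight :: "(nat \<Rightarrow> 'a set) \<Rightarrow> (nat \<Rightarrow> 'a \<Rightarrow> 'a) \<Rightarrow> (nat \<Rightarrow> real) \<Rightarrow> ('a list \<Rightarrow> real) \<Rightarrow>
    nat \<Rightarrow> 'a list \<Rightarrow> real" where
  "level_weight A p a F 0 = F"
| "level_weight A p a F (Suc i) = (\<lambda>J.
     push (p (Suc i)) (A (Suc i)) (\<lambda>I. level_weight A p a F i I powr (1 / wsum a (Suc i))) J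
       powr wsum a (Suc i))"

definition gibbs_weight :: "nat \<Rightarrow> (nat \<Rightarrow> 'a set) \<Rightarrow> (nat \<Rightarrow> 'a \<Rightarrow> 'a) \<Rightarrow> (nat \<Rightarrow> real) \<Rightarrow> ('a list \<Rightarrow> real) \<Rightarrow>
    'a list \<Rightarrow> real" where
  "gibbs_weight k A p a F I = F I powr (1 / wsum a 1) *
     (\<Prod>i=1..k-1. level_weight A p a F i (map (tau p i) I) powr (1 / wsum a (Suc i) - 1 / wsum a i))"

lemma map_tau_Suc: "map (tau p (Suc i)) I = map (p (Suc i)) (map (tau p i) I)"
  by simp

lemma map_tau_eq_mono:
  assumes "map (tau p i) I = map (tau p i) I'" "i \<le> j"
  shows "map (tau p j) I = map (tau p j) I'"
  using assms(2,1)
proof (induction rule: dec_induct)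
  case (step n)
  then show ?case by (metis map_tau_Suc)
qed

lemma tau_eq_mono:
  assumes "tau p i x = tau p i y" "i \<le> j"
  shows "tau p j x = tau p j y"
  using map_tau_eq_mono[of p i "[x]" "[y]" j] assms by simp

text \<open>Compare coefficients: \<open>l 0\<close> occurs only with a_1/A_1 = 1, and for j \<ge> 1
  the coefficient of \<open>l j\<close> is a_{j+1}/A_{j+1} + A_j (1/A_{j+1} - 1/A_j) = 0. The
  induction checks this cancellation for each new level.\<close>

lemma weighted_telescope:
  fixes a l :: "nat \<Rightarrow> real"
  assumes "\<And>i. i \<in> {1..K} \<Longrightarrow> wsum a i \<noteq> 0" "1 \<le> K"
  shows "(\<Sum>m<K. a (Suc m) * (l m / wsum a (Suc m) +
      (\<Sum>j=Suc m..<K. l j * (1 / wsum a (Suc j) - 1 / wsum a j)))) = l 0"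
  using assms(2,1)
proof (induction K rule: dec_induct)
  case base
  then show ?case by (simp add: wsum_def)
next
  case (step K)
  let ?e = "\<lambda>j. 1 / wsum a (Suc j) - 1 / wsum a j"
  have nz: "wsum a K \<noteq> 0" "wsum a (Suc K) \<noteq> 0" using step by auto
  have "(\<Sum>m<Suc K. a (Suc m) * (l m / wsum a (Suc m) + (\<Sum>j=Suc m..<Suc K. l j * ?e j)))
      = (\<Sum>m<K. a (Suc m) * (l m / wsum a (Suc m) + (\<Sum>j=Suc m..<K. l j * ?e j)))
        + (\<Sum>m<K. a (Suc m) * (l K * ?e K)) + a (Suc K) * l K / wsum a (Suc K)"
    by (simp add: sum.distrib [symmetric] algebra_simps)
  also have "(\<Sum>m<K. a (Suc m) * (l K * ?e K)) = wsum a K * (l K * ?e K)"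
    unfolding wsum_def sum_distrib_right [symmetric]
    by (simp add: sum.atLeast1_atMost_eq)
  also have "wsum a K * (l K * ?e K) = l K * (wsum a K - wsum a (Suc K)) / wsum a (Suc K)"
    using nz by (simp add: field_simps)
  also have "wsum a K - wsum a (Suc K) = - a (Suc K)"
    by (simp add: wsum_def)
  finally show ?case using step by simp
qed

locale factor_chain =
  fixes k :: nat and A :: "nat \<Rightarrow> 'a set" and p :: "nat \<Rightarrow> 'a \<Rightarrow> 'a" and a :: "nat \<Rightarrow> real"
  assumes k_pos: "1 \<le> k"
    and finite_A: "i \<in> {1..k} \<Longrightarrow> finite (A i)"
    and A_nonempty: "i \<in> {1..k} \<Longrightarrow> A i \<noteq> {}"
    and p_image: "i \<in> {1..k-1} \<Longrightarrow> p i ` A i = A (Suc i)"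
    and a1_pos: "0 < a 1"
    and a_nonneg: "i \<in> {2..k} \<Longrightarrow> 0 \<le> a i"
begin

lemma finite_A1 [simp]: "finite (A (Suc 0))"
  using finite_A[of 1] k_pos by simp

lemma A1_nonempty [simp]: "A (Suc 0) \<noteq> {}"
  using A_nonempty[of 1] k_pos by simp

lemma a_nonneg': "i \<in> {1..k} \<Longrightarrow> 0 \<le> a i"
  using a1_pos a_nonneg[of i] by (cases "i = 1") auto

lemma wsum_mono: "i \<le> j \<Longrightarrow> j \<le> k \<Longrightarrow> wsum a i \<le> wsum a j"
  unfolding wsum_def using a_nonneg' by (intro sum_mono2) auto

lemma wsum_pos: "i \<in> {1..k} \<Longrightarrow> 0 < wsum a i"
  using wsum_mono[of 1 i] a1_pos by (simp add: wsum_def)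

lemma tau_image: "i < k \<Longrightarrow> tau p i ` A 1 = A (Suc i)"
proof (induction i)
  case (Suc i)
  have "tau p (Suc i) ` A 1 = p (Suc i) ` (tau p i ` A 1)"
    by (simp add: image_comp)
  then show ?case using Suc p_image[of "Suc i"] by simp
qed simp

lemma tau_mem: "i \<le> k - 1 \<Longrightarrow> b \<in> A (Suc 0) \<Longrightarrow> tau p i b \<in> A (Suc i)"
  using tau_image[of i] k_pos by (cases "i < k") auto

lemma tau_image': "i \<in> {1..k} \<Longrightarrow> tau p (i - 1) ` A 1 = A i"
  using tau_image by (cases i) auto

text \<open>The powers 1/A and A around each sum cancel in the logarithm, so the error
  \<open>d\<close> does not grow from level to level.\<close>

lemma almost_mult_level_weight:
  assumes "almost_mult (A 1) d F" "i < k"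
  shows "almost_mult (A (Suc i)) d (level_weight A p a F i)"
  using assms(2)
proof (induction i)
  case (Suc i)
  have w: "0 < wsum a (Suc i)" using wsum_pos[of "Suc i"] Suc by simp
  from Suc have "almost_mult (A (Suc i)) d (level_weight A p a F i)" by simp
  from almost_mult_powr[OF almost_mult_push[OF almost_mult_powr[OF this, of "1 / wsum a (Suc i)"],
      of "p (Suc i)" "A (Suc (Suc i))"], of "wsum a (Suc i)"]
  show ?case using Suc w finite_A[of "Suc i"] p_image[of "Suc i"] by simp
qed (use assms in simp)

lemma near_level_weight:
  assumes "near (A 1) d F G" "i < k"
  shows "near (A (Suc i)) d (level_weight A p a F i) (level_weight A p a G i)"
  using assms(2)
proof (induction i)
  case (Suc i)
  have w: "0 < wsum a (Suc i)" using wsum_pos[of "Suc i"] Suc by simp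
  from Suc have "near (A (Suc i)) d (level_weight A p a F i) (level_weight A p a G i)" by simp
  from near_powr[OF near_push[OF near_powr[OF this, of "1 / wsum a (Suc i)"],
      of "p (Suc i)" "A (Suc (Suc i))"], of "wsum a (Suc i)"]
  show ?case using Suc w finite_A[of "Suc i"] p_image[of "Suc i"] by simp
qed (use assms in simp)

text \<open>The sum of the absolute exponents in \<open>gibbs_weight\<close>, hence the factor by
  which logarithmic errors of the potential are multiplied.\<close>

definition gibbs_const :: real where
  "gibbs_const = 1 / wsum a 1 + (\<Sum>i=1..k-1. \<bar>1 / wsum a (Suc i) - 1 / wsum a i\<bar>)"

lemma gibbs_const_pos: "0 < gibbs_const"
  unfolding gibbs_const_def using wsum_pos[of 1] k_pos by (intro add_pos_nonneg sum_nonneg) auto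

lemma almost_mult_gibbs_weight:
  assumes "almost_mult (A 1) d F"
  shows "almost_mult (A 1) (\<lambda>n. gibbs_const * d n) (gibbs_weight k A p a F)"
proof -
  have "almost_mult (A 1) (\<lambda>n. \<bar>1 / wsum a 1\<bar> * d n +
      (\<Sum>i=1..k-1. \<bar>1 / wsum a (Suc i) - 1 / wsum a i\<bar> * d n)) (gibbs_weight k A p a F)"
    unfolding gibbs_weight_def
    by (intro almost_mult_mult almost_mult_prod almost_mult_powr assms
        almost_mult_comp[OF almost_mult_level_weight[OF assms]]) (use tau_mem in auto)
  then show ?thesis
    using wsum_pos[of 1] k_pos by (simp add: gibbs_const_def distrib_right sum_distrib_right)
qed

lemma near_gibbs_weight:
  assumes "near (A 1) d F G"
  shows "near (A 1) (\<lambda>n. gibbs_const * d n) (gibbs_weight k A p a F) (gibbs_weight k A p a G)"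
proof -
  have "near (A 1) (\<lambda>n. \<bar>1 / wsum a 1\<bar> * d n +
      (\<Sum>i=1..k-1. \<bar>1 / wsum a (Suc i) - 1 / wsum a i\<bar> * d n)) (gibbs_weight k A p a F) (gibbs_weight k A p a G)"
    unfolding gibbs_weight_def
    by (intro near_mult near_prod near_powr assms near_comp[OF near_level_weight[OF assms]])
      (use tau_mem in auto)
  then show ?thesis
    using wsum_pos[of 1] k_pos by (simp add: gibbs_const_def distrib_right sum_distrib_right)
qed

lemma tempered_gibbs_weight:
  assumes "tempered (A 1) F"
  shows "tempered (A 1) (gibbs_weight k A p a F)"
  unfolding tempered_def
proof (intro allI impI)
  fix \<epsilon> :: real assume "0 < \<epsilon>"
  then obtain C G where G: "almost_mult (A 1) (\<lambda>_. C) G"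
      "near (A 1) (\<lambda>n. C + \<epsilon> / gibbs_const * real n) F G"
    using assms gibbs_const_pos by (metis tempered_def zero_less_divide_iff)
  have "near (A 1) (\<lambda>n. gibbs_const * C + \<epsilon> * real n) (gibbs_weight k A p a F) (gibbs_weight k A p a G)"
    by (rule near_mono[OF near_gibbs_weight[OF G(2)]]) (use gibbs_const_pos in \<open>simp add: distrib_left\<close>)
  then show "\<exists>C G. almost_mult (A 1) (\<lambda>_. C) G \<and> near (A 1) (\<lambda>n. C + \<epsilon> * real n) (gibbs_weight k A p a F) G"
    using almost_mult_gibbs_weight[OF G(1)] by blast
qed

lemma push_tau_Suc:
  assumes "Suc i < k"
  shows "push (tau p (Suc i)) (A 1) F = push (p (Suc i)) (A (Suc i)) (push (tau p i) (A 1) F)"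
  using push_push[of "A 1" "p (Suc i)" "tau p i" F] tau_image[of i] assms by auto

text \<open>The factors of level j > m see a word only through \<open>tau p j\<close>, hence are
  constant on the fibre and come out of the sum. What remains is the sum that defines the next level
  weight, and its exponent 1/A_{m+1} combines with 1/A_{m+2} - 1/A_{m+1} to 1/A_{m+2}.\<close>

lemma push_gibbs_weight:
  assumes "m < k" "set I \<subseteq> A 1"
  shows "push (tau p m) (A 1) (gibbs_weight k A p a F) (map (tau p m) I) =
     level_weight A p a F m (map (tau p m) I) powr (1 / wsum a (Suc m)) *
     (\<Prod>j=Suc m..<k. level_weight A p a F j (map (tau p j) I) powr (1 / wsum a (Suc j) - 1 / wsum a j))"
  using assms
proof (induction m arbitrary: I)
  case 0
  have "fiber (\<lambda>b. b) (A (Suc 0)) I = {I}"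
    using 0 by (auto simp: fiber_def in_words_iff)
  moreover have "{1..k-1} = {Suc 0..<k}" using k_pos by auto
  ultimately show ?case by (simp add: push_def gibbs_weight_def)
next
  case (Suc m)
  let ?f = "\<lambda>j I. level_weight A p a F j (map (tau p j) I) powr (1 / wsum a (Suc j) - 1 / wsum a j)"
  let ?g = "\<lambda>J. level_weight A p a F m J powr (1 / wsum a (Suc m))"
  let ?J = "map (tau p (Suc m)) I"
  have w: "0 < wsum a (Suc m)" using wsum_pos[of "Suc m"] Suc by simp
  have "push (tau p m) (A 1) (gibbs_weight k A p a F) K = ?g K * (\<Prod>j=Suc m..<k. ?f j I)"
    if K: "K \<in> fiber (p (Suc m)) (A (Suc m)) ?J" for K
  proof -
    have "set K \<subseteq> tau p m ` A 1" using fiberD(1)[OF K] tau_image[of m] Suc by simp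
    then obtain I' where I': "I' \<in> fiber (tau p m) (A 1) K"
      using fiber_nonempty by blast
    have "map (tau p (Suc m)) I' = ?J"
      using fiberD(3)[OF I'] fiberD(3)[OF K] by (metis map_tau_Suc)
    then have "?f j I' = ?f j I" if "Suc m \<le> j" for j
      using map_tau_eq_mono[OF _ that] by metis
    then have "(\<Prod>j=Suc m..<k. ?f j I') = (\<Prod>j=Suc m..<k. ?f j I)"
      by (intro prod.cong) auto
    then show ?thesis
      using Suc.IH[of I'] fiberD[OF I'] Suc.prems by simp
  qed
  then have "push (tau p (Suc m)) (A 1) (gibbs_weight k A p a F) ?J
      = push (p (Suc m)) (A (Suc m)) ?g ?J * (\<Prod>j=Suc m..<k. ?f j I)"
    unfolding push_tau_Suc[OF Suc.prems(1)] push_def[of "p (Suc m)"] sum_distrib_right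
    by (intro sum.cong) auto
  also have "push (p (Suc m)) (A (Suc m)) ?g ?J = level_weight A p a F (Suc m) ?J powr (1 / wsum a (Suc m))"
    using w by (simp add: powr_powr push_def sum_nonneg)
  also have "(\<Prod>j=Suc m..<k. ?f j I) = ?f (Suc m) I * (\<Prod>j=Suc (Suc m)..<k. ?f j I)"
    using Suc.prems by (simp add: prod.atLeast_Suc_lessThan)
  also have "level_weight A p a F (Suc m) ?J powr (1 / wsum a (Suc m)) *
      (?f (Suc m) I * (\<Prod>j=Suc (Suc m)..<k. ?f j I))
      = level_weight A p a F (Suc m) ?J powr (1 / wsum a (Suc (Suc m))) * (\<Prod>j=Suc (Suc m)..<k. ?f j I)"
    by (simp only: mult.assoc [symmetric] powr_add [symmetric]) simp
  finally show ?case .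
qed

lemma level_weight_pos:
  assumes "\<And>I. set I \<subseteq> A 1 \<Longrightarrow> 0 < F I" "i < k" "set J \<subseteq> A (Suc i)"
  shows "0 < level_weight A p a F i J"
proof -
  have "near (A 1) (\<lambda>_. 0) F F" using assms(1) by (simp add: near_def)
  from nearD(1)[OF near_level_weight[OF this assms(2)] assms(3)] show ?thesis .
qed

lemma gibbs_weight_pos:
  assumes "\<And>I. set I \<subseteq> A 1 \<Longrightarrow> 0 < F I" "set I \<subseteq> A 1"
  shows "0 < gibbs_weight k A p a F I"
proof -
  have "near (A 1) (\<lambda>_. 0) F F" using assms(1) by (simp add: near_def)
  from nearD(1)[OF near_gibbs_weight[OF this] assms(2)] show ?thesis .
qed

text \<open>By \<open>push_gibbs_weight\<close> the logarithm on each level is a combination of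
  logarithms of level weights; weighted with the a_i these telescope to level 0, which is
  \<open>F\<close>. The exponents in \<phi>^a are chosen exactly so that this happens.\<close>

lemma ln_potential_eq:
  assumes pos: "\<And>I. set I \<subseteq> A 1 \<Longrightarrow> 0 < F I" and I: "set I \<subseteq> A 1"
  shows "ln (F I) = (\<Sum>i=1..k. a i *
     ln (push (tau p (i - 1)) (A 1) (gibbs_weight k A p a F) (map (tau p (i - 1)) I)))"
proof -
  let ?l = "\<lambda>j. level_weight A p a F j (map (tau p j) I)"
  have l: "0 < ?l j" if "j < k" for j
    using level_weight_pos[of F j "map (tau p j) I", OF pos that] I tau_image[OF that] by auto
  have "ln (push (tau p m) (A 1) (gibbs_weight k A p a F) (map (tau p m) I)) =
      ln (?l m) / wsum a (Suc m) + (\<Sum>j=Suc m..<k. ln (?l j) * (1 / wsum a (Suc j) - 1 / wsum a j))"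
    if m: "m < k" for m
  proof -
    have S: "ln (\<Prod>j=Suc m..<k. ?l j powr (1 / wsum a (Suc j) - 1 / wsum a j))
        = (\<Sum>j=Suc m..<k. ln (?l j) * (1 / wsum a (Suc j) - 1 / wsum a j))"
      using l by (subst ln_prod) (force simp: ln_powr intro!: sum.cong)+
    have P: "0 < (\<Prod>j=Suc m..<k. ?l j powr (1 / wsum a (Suc j) - 1 / wsum a j))"
      using l by (intro prod_pos) force
    have "0 < ?l m powr (1 / wsum a (Suc m))"
      using l[OF m] by simp
    from ln_mult_pos[OF this P] show ?thesis
      using push_gibbs_weight[of m I F] m I l[OF m] S by (simp add: ln_powr)
  qed
  then have "(\<Sum>m<k. a (Suc m) * ln (push (tau p m) (A 1) (gibbs_weight k A p a F) (map (tau p m) I)))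
      = (\<Sum>m<k. a (Suc m) * (ln (?l m) / wsum a (Suc m) +
          (\<Sum>j=Suc m..<k. ln (?l j) * (1 / wsum a (Suc j) - 1 / wsum a j))))"
    by (intro sum.cong) auto
  also have "\<dots> = ln (?l 0)"
    using wsum_pos k_pos by (intro weighted_telescope) force+
  finally show ?thesis by (simp add: sum.atLeast1_atMost_eq)
qed

lemma word_sum_push:
  assumes "i < k"
  shows "(\<Sum>J\<in>words (A (Suc i)) n. push (tau p i) (A 1) F J) = (\<Sum>I\<in>words (A 1) n. F I)"
  using sum_push[of "A 1" "tau p i" "A (Suc i)" F "\<lambda>_. 1" n] tau_image[OF assms] finite_A[of "Suc i"] assms
  by simp

lemma energy_eq:
  assumes pos: "\<And>I. set I \<subseteq> A 1 \<Longrightarrow> 0 < F I"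
  shows "(\<Sum>I\<in>words (A 1) n. w I * ln (F I)) =
    (\<Sum>i=1..k. a i * (\<Sum>J\<in>words (A i) n. push (tau p (i - 1)) (A 1) w J *
        ln (push (tau p (i - 1)) (A 1) (gibbs_weight k A p a F) J)))"
proof -
  have "(\<Sum>I\<in>words (A 1) n. w I * ln (F I)) = (\<Sum>I\<in>words (A 1) n. \<Sum>i=1..k. a i *
      (w I * ln (push (tau p (i - 1)) (A 1) (gibbs_weight k A p a F) (map (tau p (i - 1)) I))))"
    by (intro sum.cong refl, subst ln_potential_eq[OF pos])
      (auto simp: in_words_iff sum_distrib_left intro!: sum.cong)
  also have "\<dots> = (\<Sum>i=1..k. a i * (\<Sum>I\<in>words (A 1) n.
      w I * ln (push (tau p (i - 1)) (A 1) (gibbs_weight k A p a F) (map (tau p (i - 1)) I))))"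
    by (subst sum.swap) (simp add: sum_distrib_left)
  also have "\<dots> = (\<Sum>i=1..k. a i * (\<Sum>J\<in>words (A i) n. push (tau p (i - 1)) (A 1) w J *
        ln (push (tau p (i - 1)) (A 1) (gibbs_weight k A p a F) J)))"
  proof (rule sum.cong)
    fix i assume i: "i \<in> {1..k}"
    have "(\<Sum>I\<in>words (A 1) n.
        w I * ln (push (tau p (i - 1)) (A 1) (gibbs_weight k A p a F) (map (tau p (i - 1)) I))) =
        (\<Sum>J\<in>words (A i) n. push (tau p (i - 1)) (A 1) w J *
        ln (push (tau p (i - 1)) (A 1) (gibbs_weight k A p a F) J))"
      by (subst sum_push) (use tau_image'[OF i] finite_A[OF i] in auto)
    then show "a i * (\<Sum>I\<in>words (A 1) n.
        w I * ln (push (tau p (i - 1)) (A 1) (gibbs_weight k A p a F) (map (tau p (i - 1)) I))) =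
        a i * (\<Sum>J\<in>words (A i) n. push (tau p (i - 1)) (A 1) w J *
        ln (push (tau p (i - 1)) (A 1) (gibbs_weight k A p a F) J))"
      by simp
  qed simp
  finally show ?thesis .
qed

text \<open>Passing to a factor preserves the total sum, so all levels share one partition function.
  Gibbs' inequality on level i costs its logarithm, and the nonnegative a_i add up to A_k.\<close>

lemma weighted_entropy_upper:
  assumes pos: "\<And>I. set I \<subseteq> A 1 \<Longrightarrow> 0 < F I"
    and w: "\<And>I. I \<in> words (A 1) n \<Longrightarrow> 0 \<le> w I" "(\<Sum>I\<in>words (A 1) n. w I) = 1"
  shows "(\<Sum>I\<in>words (A 1) n. w I * ln (F I)) +
      (\<Sum>i=1..k. a i * word_entropy (A i) (push (tau p (i - 1)) (A 1) w) n)
    \<le> wsum a k * ln (word_sum (A 1) (gibbs_weight k A p a F) n)"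
proof -
  let ?Z = "word_sum (A 1) (gibbs_weight k A p a F) n"
  let ?R = "\<lambda>i. push (tau p (i - 1)) (A 1) (gibbs_weight k A p a F)"
  let ?q = "\<lambda>i. push (tau p (i - 1)) (A 1) w"
  have "a i * ((\<Sum>J\<in>words (A i) n. ?q i J * ln (?R i J)) - (\<Sum>J\<in>words (A i) n. ?q i J * ln (?q i J)))
      \<le> a i * ln ?Z" if i: "i \<in> {1..k}" for i
  proof (rule mult_left_mono)
    have im: "tau p (i - 1) ` A 1 = A i" using tau_image'[OF i] .
    have s: "(\<Sum>J\<in>words (A i) n. push (tau p (i - 1)) (A 1) v J) = (\<Sum>I\<in>words (A 1) n. v I)" for v
      using word_sum_push[of "i - 1" v n] i by auto
    have "(\<Sum>J\<in>words (A i) n. ?q i J * ln (?R i J)) - (\<Sum>J\<in>words (A i) n. ?q i J * ln (?q i J))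
        \<le> ln (\<Sum>J\<in>words (A i) n. ?R i J)"
    proof (rule gibbs_inequality)
      fix J assume J: "J \<in> words (A i) n"
      then have "I \<in> words (A 1) n" if "I \<in> fiber (tau p (i - 1)) (A 1) J" for I
        using that by (auto simp: fiber_def in_words_iff)
      then show "0 \<le> ?q i J" using w by (auto simp: push_def intro!: sum_nonneg)
      show "0 < ?R i J"
        using J im by (intro push_pos gibbs_weight_pos[OF pos]) (auto simp: in_words_iff)
    qed (use finite_A[OF i] s w in auto)
    then show "(\<Sum>J\<in>words (A i) n. ?q i J * ln (?R i J)) - (\<Sum>J\<in>words (A i) n. ?q i J * ln (?q i J))
        \<le> ln ?Z"
      by (simp only: s word_sum_def)
  qed (use a_nonneg' i in auto)
  then have "(\<Sum>i=1..k. a i * ((\<Sum>J\<in>words (A i) n. ?q i J * ln (?R i J)) -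
      (\<Sum>J\<in>words (A i) n. ?q i J * ln (?q i J)))) \<le> (\<Sum>i=1..k. a i * ln ?Z)"
    by (rule sum_mono)
  moreover note energy_eq[of F w n]
  ultimately show ?thesis
    using pos unfolding word_entropy_def
    by (simp add: wsum_def sum_distrib_right right_diff_distrib sum_subtractf sum_negf)
qed

text \<open>If \<open>w\<close> is within \<open>C\<close>, in logarithms, of the normalised Gibbs
  weight, then so are its images on every level. Each integrand log R - log q is therefore at least
  log Z - C pointwise, not merely on average.\<close>

lemma weighted_entropy_lower:
  assumes pos: "\<And>I. set I \<subseteq> A 1 \<Longrightarrow> 0 < F I"
    and w: "\<And>I. I \<in> words (A 1) n \<Longrightarrow> 0 < w I" "(\<Sum>I\<in>words (A 1) n. w I) = 1"
    and C: "\<And>I. I \<in> words (A 1) n \<Longrightarrow>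
      \<bar>ln (w I) - (ln (gibbs_weight k A p a F I) - ln (word_sum (A 1) (gibbs_weight k A p a F) n))\<bar> \<le> C"
  shows "wsum a k * (ln (word_sum (A 1) (gibbs_weight k A p a F) n) - C) \<le>
    (\<Sum>I\<in>words (A 1) n. w I * ln (F I)) +
      (\<Sum>i=1..k. a i * word_entropy (A i) (push (tau p (i - 1)) (A 1) w) n)"
proof -
  let ?Z = "word_sum (A 1) (gibbs_weight k A p a F) n"
  let ?R = "\<lambda>i. push (tau p (i - 1)) (A 1) (gibbs_weight k A p a F)"
  let ?q = "\<lambda>i. push (tau p (i - 1)) (A 1) w"
  have Z: "0 < ?Z" using gibbs_weight_pos[OF pos] by (intro word_sum_pos) auto
  have "a i * (ln ?Z - C) \<le>
      a i * ((\<Sum>J\<in>words (A i) n. ?q i J * ln (?R i J)) - (\<Sum>J\<in>words (A i) n. ?q i J * ln (?q i J)))"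
    if i: "i \<in> {1..k}" for i
  proof (rule mult_left_mono)
    have im: "tau p (i - 1) ` A 1 = A i" using tau_image'[OF i] .
    have s: "(\<Sum>J\<in>words (A i) n. ?q i J) = 1"
      using word_sum_push[of "i - 1" w n] i w by auto
    have "?q i J * (ln ?Z - C) \<le> ?q i J * (ln (?R i J) - ln (?q i J))" if J: "J \<in> words (A i) n" for J
    proof (rule mult_left_mono)
      have f: "I \<in> words (A 1) n" "0 < gibbs_weight k A p a F I" if "I \<in> fiber (tau p (i - 1)) (A 1) J" for I
        using that J gibbs_weight_pos[OF pos] by (auto simp: fiber_def in_words_iff)
      then show q: "0 \<le> ?q i J" using w by (simp add: push_def sum_nonneg less_imp_le)
      have ne: "fiber (tau p (i - 1)) (A 1) J \<noteq> {}"
        using J im by (intro fiber_nonempty) (auto simp: in_words_iff)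
      have "\<bar>ln (?q i J) - ln (\<Sum>I\<in>fiber (tau p (i - 1)) (A 1) J. gibbs_weight k A p a F I / ?Z)\<bar> \<le> C"
        unfolding push_def
      proof (rule ln_sum_close[OF _ ne])
        fix I assume "I \<in> fiber (tau p (i - 1)) (A 1) J"
        note f = f[OF this]
        show "0 < w I" "0 < gibbs_weight k A p a F I / ?Z" "\<bar>ln (w I) - ln (gibbs_weight k A p a F I / ?Z)\<bar> \<le> C"
          using f(2) w(1)[OF f(1)] C[OF f(1)] Z by (auto simp: ln_div)
      qed simp
      moreover have "(\<Sum>I\<in>fiber (tau p (i - 1)) (A 1) J. gibbs_weight k A p a F I / ?Z) = ?R i J / ?Z"
        by (simp add: push_def sum_divide_distrib)
      moreover have "0 < ?R i J"
        using J im by (intro push_pos gibbs_weight_pos[OF pos]) (auto simp: in_words_iff)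
      ultimately show "ln ?Z - C \<le> ln (?R i J) - ln (?q i J)"
        using Z by (simp add: ln_div abs_le_iff)
    qed
    then have "(\<Sum>J\<in>words (A i) n. ?q i J * (ln ?Z - C)) \<le>
        (\<Sum>J\<in>words (A i) n. ?q i J * (ln (?R i J) - ln (?q i J)))"
      by (rule sum_mono)
    then show "ln ?Z - C \<le> (\<Sum>J\<in>words (A i) n. ?q i J * ln (?R i J)) -
        (\<Sum>J\<in>words (A i) n. ?q i J * ln (?q i J))"
      using s by (simp add: sum_distrib_right [symmetric] right_diff_distrib sum_subtractf)
  qed (use a_nonneg' i in auto)
  then have "(\<Sum>i=1..k. a i * (ln ?Z - C)) \<le>
      (\<Sum>i=1..k. a i * ((\<Sum>J\<in>words (A i) n. ?q i J * ln (?R i J)) -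
      (\<Sum>J\<in>words (A i) n. ?q i J * ln (?q i J))))"
    by (rule sum_mono)
  moreover note energy_eq[of F w n]
  ultimately show ?thesis
    using pos unfolding word_entropy_def
    by (simp add: wsum_def sum_distrib_right right_diff_distrib sum_subtractf sum_negf)
qed

end

section \<open>Almost additive sequences\<close>

lemma subadditive_mult:
  fixes b :: "nat \<Rightarrow> real"
  assumes "\<And>n m. b (n + m) \<le> b n + b m"
  shows "b (Suc q * N) \<le> real (Suc q) * b N"
proof (induction q)
  case (Suc q)
  have "b (Suc (Suc q) * N) \<le> b N + b (Suc q * N)"
    using assms[of N "Suc q * N"] by simp
  then show ?case using Suc by (simp add: algebra_simps)
qed simp

text \<open>Besides convergence, the conclusion keeps the fact that the limit bounds every b n / n
  from below; this becomes an explicit error in \<open>almost_additive_limit\<close>.\<close>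

lemma fekete:
  fixes b :: "nat \<Rightarrow> real"
  assumes sub: "\<And>n m. b (n + m) \<le> b n + b m" and lower: "\<And>n. - (B * real n) \<le> b n"
  obtains l where "(\<lambda>n. b n / real n) \<longlonglongrightarrow> l" "\<And>n. real n * l \<le> b n"
proof -
  define S where "S = (\<lambda>n. b n / real n) ` {1..}"
  define l where "l = Inf S"
  have bdd: "bdd_below S"
  proof (rule bdd_belowI)
    fix x assume "x \<in> S"
    then obtain n where "1 \<le> n" "x = b n / real n" by (auto simp: S_def)
    then show "- B \<le> x" using lower[of n] by (simp add: pos_le_divide_eq)
  qed
  have le: "l \<le> b n / real n" if "1 \<le> n" for n
    unfolding l_def using that bdd by (intro cInf_lower) (auto simp: S_def)
  have b0: "0 \<le> b 0" using sub[of 0 0] by simp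
  have conv: "(\<lambda>n. b n / real n) \<longlonglongrightarrow> l"
  proof (rule LIMSEQ_I)
    fix r :: real assume "0 < r"
    have "\<exists>x\<in>S. x < l + r / 2"
      unfolding l_def using \<open>0 < r\<close> bdd by (intro cInf_lessD) (auto simp: S_def)
    then obtain N where N: "1 \<le> N" "b N / real N < l + r / 2"
      by (auto simp: S_def)
    \<comment> \<open>\<open>K\<close> dominates the value at the remainder n mod N together with
      the difference between q * b N and (n/N) * b N; with it, \<open>up\<close> also covers n <
      N.\<close>
    define K where "K = Max ((\<lambda>s. \<bar>b s\<bar>) ` {..<N}) + \<bar>b N\<bar>"
    have K: "\<bar>b s\<bar> + \<bar>b N\<bar> \<le> K" if "s < N" for s
      unfolding K_def using that by (auto intro!: Max_ge)
    have up: "b n / real n \<le> b N / real N + K / real n" if n: "1 \<le> n" for n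
    proof (cases "n < N")
      case True
      have "b n \<le> \<bar>b n\<bar>" by simp
      moreover have "- \<bar>b N\<bar> \<le> b N / real N * real n"
      proof -
        have "real n / real N \<le> 1" using True by simp
        then have "\<bar>b N\<bar> * (real n / real N) \<le> \<bar>b N\<bar> * 1"
          by (intro mult_left_mono) auto
        moreover have "- (\<bar>b N\<bar> * (real n / real N)) \<le> b N * (real n / real N)"
          using abs_ge_minus_self[of "b N * (real n / real N)"] by (simp add: abs_mult)
        ultimately show ?thesis by simp
      qed
      ultimately have "b n \<le> b N / real N * real n + K"
        using K[OF True] by linarith
      then show ?thesis using n by (simp add: field_simps)
    next
      case False
      define q where "q = n div N"
      define s where "s = n mod N"
      have q: "n = q * N + s" "s < N" "1 \<le> q"
        using N False by (auto simp: q_def s_def div_greater_zero_iff Suc_le_eq)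
      have "b n \<le> b (q * N) + b s" using sub q by simp
      moreover have "b (q * N) \<le> real q * b N"
        using subadditive_mult[of b "q - 1" N] sub q by simp
      moreover have "real q * b N = b N / real N * real n - b N * (real s / real N)"
        using q N by (simp add: field_simps)
      moreover have "- (b N * (real s / real N)) \<le> \<bar>b N\<bar>"
      proof -
        have "\<bar>b N\<bar> * (real s / real N) \<le> \<bar>b N\<bar> * 1"
          using q by (intro mult_left_mono) auto
        then show ?thesis
          using abs_ge_minus_self[of "b N * (real s / real N)"] by (simp add: abs_mult)
      qed
      ultimately have "b n \<le> b N / real N * real n + K"
        using K[OF q(2)] by linarith
      then show ?thesis using n by (simp add: field_simps)
    qed
    obtain M where M: "K / (r / 2) < real M" using reals_Archimedean2 by blast
    have "norm (b n / real n - l) < r" if "max 1 M \<le> n" for n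
    proof -
      have "K / (r / 2) < real n" using M that by linarith
      then have "K / real n < r / 2" using \<open>0 < r\<close> that by (simp add: field_simps)
      then have "b n / real n - l < r" using up[of n] N(2) that by linarith
      then show ?thesis using le[of n] that by simp
    qed
    then show "\<exists>no. \<forall>n\<ge>no. norm (b n / real n - l) < r" by blast
  qed
  show ?thesis
  proof (rule that[OF conv])
    fix n show "real n * l \<le> b n"
      using le[of n] b0 by (cases "n = 0") (auto simp: field_simps)
  qed
qed

text \<open>Both b + C and -b + C are sub-additive. Their limits are opposite because the two
  sequences add up to the constant 2C, and the two lower bounds then enclose b n.\<close>

lemma almost_additive_limit:
  fixes b :: "nat \<Rightarrow> real"
  assumes "\<And>n m. \<bar>b (n + m) - b n - b m\<bar> \<le> C"
  obtains P where "\<And>n. \<bar>b n - real n * P\<bar> \<le> C"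
proof -
  have C: "0 \<le> C" using assms[of 0 0] by linarith
  have low: "- ((\<bar>f 1\<bar> + C) * real n) \<le> f n + C" if f: "\<And>n m. \<bar>f (n + m) - f n - f m\<bar> \<le> C"
    for f :: "nat \<Rightarrow> real" and n
  proof (induction n)
    case 0
    then show ?case using f[of 0 0] by (simp add: abs_le_iff)
  next
    case (Suc n)
    then show ?case
      using f[of n 1] C abs_ge_minus_self[of "f 1"] by (simp add: algebra_simps abs_le_iff)
  qed
  have sub: "f (n + m) + C \<le> (f n + C) + (f m + C)" if f: "\<And>n m. \<bar>f (n + m) - f n - f m\<bar> \<le> C"
    for f :: "nat \<Rightarrow> real" and n m
    using f[of n m] C by (simp add: abs_le_iff)
  have b': "\<bar>- b (n + m) - (- b n) - (- b m)\<bar> \<le> C" for n m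
    using assms[of n m] by linarith
  obtain l where l: "(\<lambda>n. (b n + C) / real n) \<longlonglongrightarrow> l" "\<And>n. real n * l \<le> b n + C"
    using fekete[of "\<lambda>n. b n + C", OF sub low] assms by blast
  obtain l' where l': "(\<lambda>n. (- b n + C) / real n) \<longlonglongrightarrow> l'" "\<And>n. real n * l' \<le> - b n + C"
    using fekete[of "\<lambda>n. - b n + C", OF sub[of "\<lambda>n. - b n"] low[of "\<lambda>n. - b n"]] b' by blast
  have "(\<lambda>n. (b n + C) / real n + (- b n + C) / real n) \<longlonglongrightarrow> l + l'"
    by (intro tendsto_add l l')
  moreover have "(\<lambda>n. (b n + C) / real n + (- b n + C) / real n) = (\<lambda>n. (2 * C) / real n)"
    by (auto simp: add_divide_distrib [symmetric])
  moreover have "(\<lambda>n. (2 * C) / real n) \<longlonglongrightarrow> 0"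
    by (rule lim_const_over_n)
  ultimately have "l + l' = 0"
    using LIMSEQ_unique by auto
  then have "l' = - l" by simp
  have "\<bar>b n - real n * l\<bar> \<le> C" for n
    using l(2)[of n] l'(2)[of n] \<open>l' = - l\<close> by (simp add: abs_le_iff)
  then show ?thesis using that by blast
qed

lemma sublinear_tendsto:
  fixes f :: "nat \<Rightarrow> real"
  assumes "\<And>\<epsilon>. 0 < \<epsilon> \<Longrightarrow> \<exists>C. \<forall>n\<ge>1. \<bar>f n\<bar> \<le> C + \<epsilon> * real n"
  shows "(\<lambda>n. f n / real n) \<longlonglongrightarrow> 0"
proof (rule LIMSEQ_I)
  fix r :: real assume r: "0 < r"
  then obtain C where C: "\<And>n. 1 \<le> n \<Longrightarrow> \<bar>f n\<bar> \<le> C + r / 2 * real n"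
    using assms[of "r / 2"] by auto
  obtain M where M: "C / (r / 2) < real M" using reals_Archimedean2 by blast
  have "norm (f n / real n - 0) < r" if n: "max 1 M \<le> n" for n
  proof -
    have "C / (r / 2) < real n" using M n by linarith
    then have "C < r / 2 * real n" using r by (simp add: field_simps)
    then have "\<bar>f n\<bar> < r * real n" using C[of n] n by simp
    then show ?thesis using n by (simp add: field_simps)
  qed
  then show "\<exists>no. \<forall>n\<ge>no. norm (f n / real n - 0) < r" by blast
qed

lemma linear_growth_tendsto:
  fixes f :: "nat \<Rightarrow> real"
  assumes "\<And>\<epsilon>. 0 < \<epsilon> \<Longrightarrow> \<exists>C. \<forall>n\<ge>1. \<bar>f n - real n * P\<bar> \<le> C + \<epsilon> * real n"
  shows "(\<lambda>n. f n / real n) \<longlonglongrightarrow> P"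
proof -
  have "(\<lambda>n. (f n - real n * P) / real n) \<longlonglongrightarrow> 0"
    by (rule sublinear_tendsto) (rule assms)
  then have "(\<lambda>n. (f n - real n * P) / real n + P) \<longlonglongrightarrow> 0 + P"
    by (intro tendsto_intros)
  moreover have "eventually (\<lambda>n. (f n - real n * P) / real n + P = f n / real n) sequentially"
    using eventually_ge_at_top[of 1] by eventually_elim (simp add: field_simps)
  ultimately show ?thesis by (simp add: tendsto_cong)
qed

text \<open>\<open>f\<close> is additive only up to errors that depend on the chosen rate, so its
  slope is a limit of slopes: those of the approximants force f n / n to be a Cauchy
  sequence.\<close>

lemma approx_additive_limit:
  fixes f :: "nat \<Rightarrow> real"
  assumes "\<And>\<epsilon>. 0 < \<epsilon> \<Longrightarrow> \<exists>C b. (\<forall>n m. \<bar>b (n + m) - b n - b m\<bar> \<le> C) \<and>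
             (\<forall>n\<ge>1. \<bar>f n - b n\<bar> \<le> C + \<epsilon> * real n)"
  obtains P where "\<And>\<epsilon>. 0 < \<epsilon> \<Longrightarrow> \<exists>C. \<forall>n\<ge>1. \<bar>f n - real n * P\<bar> \<le> C + \<epsilon> * real n"
proof -
  have ex: "\<exists>C P. \<forall>n\<ge>1. \<bar>f n - real n * P\<bar> \<le> C + \<epsilon> * real n" if "0 < \<epsilon>" for \<epsilon>
  proof -
    obtain C b where b: "\<And>n m. \<bar>b (n + m) - b n - b m\<bar> \<le> C"
        "\<And>n. 1 \<le> n \<Longrightarrow> \<bar>f n - b n\<bar> \<le> C + \<epsilon> * real n"
      using assms[OF \<open>0 < \<epsilon>\<close>] by blast
    obtain P where P: "\<And>n. \<bar>b n - real n * P\<bar> \<le> C"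
      using almost_additive_limit[of b C] b(1) by blast
    have "\<bar>f n - real n * P\<bar> \<le> (2 * C) + \<epsilon> * real n" if "1 \<le> n" for n
      using b(2)[OF that] P[of n] by linarith
    then show ?thesis by blast
  qed
  have lin: "\<forall>\<^sub>F n in sequentially. \<bar>f n / real n - P\<bar> \<le> 2 * \<epsilon>"
    if P: "\<And>n. 1 \<le> n \<Longrightarrow> \<bar>f n - real n * P\<bar> \<le> C + \<epsilon> * real n" and "0 < \<epsilon>" for C P \<epsilon>
  proof -
    obtain M where M: "C / \<epsilon> < real M" using reals_Archimedean2 by blast
    have "\<bar>f n / real n - P\<bar> \<le> 2 * \<epsilon>" if n: "max 1 M \<le> n" for n
    proof -
      have "C / \<epsilon> < real n" using M n by linarith
      then have "C < \<epsilon> * real n" using \<open>0 < \<epsilon>\<close> by (simp add: field_simps)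
      then have "\<bar>f n - real n * P\<bar> \<le> 2 * \<epsilon> * real n" using P[of n] n by simp
      moreover have "f n / real n - P = (f n - real n * P) / real n"
        using n by (simp add: field_simps)
      ultimately show ?thesis using n by (simp add: field_simps)
    qed
    then show ?thesis unfolding eventually_sequentially by blast
  qed
  have "Cauchy (\<lambda>n. f n / real n)"
  proof (rule metric_CauchyI)
    fix e :: real assume "0 < e"
    then obtain C P where "\<And>n. 1 \<le> n \<Longrightarrow> \<bar>f n - real n * P\<bar> \<le> C + e / 8 * real n"
      using ex[of "e / 8"] by auto
    then obtain M where M: "\<And>n. M \<le> n \<Longrightarrow> \<bar>f n / real n - P\<bar> \<le> 2 * (e / 8)"
      using lin[of P C "e / 8"] \<open>0 < e\<close> unfolding eventually_sequentially by auto
    have "dist (f m / real m) (f n / real n) < e" if "M \<le> m" "M \<le> n" for m n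
      using M[OF that(1)] M[OF that(2)] \<open>0 < e\<close> unfolding dist_real_def by linarith
    then show "\<exists>M. \<forall>m\<ge>M. \<forall>n\<ge>M. dist (f m / real m) (f n / real n) < e" by blast
  qed
  then obtain P where P: "(\<lambda>n. f n / real n) \<longlonglongrightarrow> P"
    using Cauchy_convergent convergent_def by blast
  have "\<exists>C. \<forall>n\<ge>1. \<bar>f n - real n * P\<bar> \<le> C + \<epsilon> * real n" if "0 < \<epsilon>" for \<epsilon>
  proof -
    \<comment> \<open>One third of \<epsilon> is for the error of this approximant, two thirds for
      the distance of its slope P' from P.\<close>
    obtain C P' where P': "\<And>n. 1 \<le> n \<Longrightarrow> \<bar>f n - real n * P'\<bar> \<le> C + \<epsilon> / 3 * real n"
      using ex[of "\<epsilon> / 3"] \<open>0 < \<epsilon>\<close> by auto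
    have "(\<lambda>n. \<bar>f n / real n - P'\<bar>) \<longlonglongrightarrow> \<bar>P - P'\<bar>"
      by (intro tendsto_intros P)
    then have PP: "\<bar>P - P'\<bar> \<le> 2 * (\<epsilon> / 3)"
      using lin[of P' C "\<epsilon> / 3", OF P'] \<open>0 < \<epsilon>\<close> by (intro tendsto_upperbound) auto
    have "\<bar>f n - real n * P\<bar> \<le> C + \<epsilon> * real n" if "1 \<le> n" for n
    proof -
      have "\<bar>real n * P' - real n * P\<bar> \<le> real n * (2 * (\<epsilon> / 3))"
        using mult_left_mono[OF PP, of "real n"]
        by (simp add: right_diff_distrib [symmetric] abs_mult abs_minus_commute)
      then have "\<bar>f n - real n * P\<bar> \<le> C + \<epsilon> / 3 * real n + real n * (2 * (\<epsilon> / 3))"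
        using P'[OF that] by linarith
      then show ?thesis by (simp add: field_simps)
    qed
    then show ?thesis by blast
  qed
  then show ?thesis using that by blast
qed

section \<open>Consistent families of word weights\<close>

text \<open>Kolmogorov consistency, with strict positivity so that the resulting measure is fully
  supported.\<close>

definition consistent :: "'a set \<Rightarrow> ('a list \<Rightarrow> real) \<Rightarrow> bool" where
  "consistent L w \<longleftrightarrow> w [] = 1 \<and> (\<forall>I. set I \<subseteq> L \<longrightarrow> 0 < w I \<and> (\<Sum>b\<in>L. w (I @ [b])) = w I)"

definition word_prob :: "'a set \<Rightarrow> ('a list \<Rightarrow> real) \<Rightarrow> 'a list \<Rightarrow> real" where
  "word_prob L F I = F I / word_sum L F (length I)"

lemma sum_words_Suc:
  "(\<Sum>I\<in>words L (Suc n). f I) = (\<Sum>I\<in>words L n. \<Sum>b\<in>L. f (I @ [b]))"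
  using sum_words_append[of f L n "Suc 0"] by (simp add: sum_words_1)

lemma sum_words_Suc_left:
  "(\<Sum>I\<in>words L (Suc n). f I) = (\<Sum>b\<in>L. \<Sum>I\<in>words L n. f (b # I))"
  using sum_words_append[of f L "Suc 0" n] by (simp add: sum_words_1)

text \<open>Divided by the partition function, this is the probability of finding \<open>I\<close>
  at position \<open>j\<close> of a random word of length \<open>M\<close>.\<close>

definition padded_sum :: "'a set \<Rightarrow> ('a list \<Rightarrow> real) \<Rightarrow> nat \<Rightarrow> nat \<Rightarrow> 'a list \<Rightarrow> real" where
  "padded_sum L F j M I = (\<Sum>J\<in>words L j. \<Sum>K\<in>words L (M - j - length I). F (J @ I @ K))"

lemma padded_sum_right:
  assumes "j + length I < M"
  shows "(\<Sum>b\<in>L. padded_sum L F j M (I @ [b])) = padded_sum L F j M I"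
proof -
  have M: "M - j - length I = Suc (M - j - Suc (length I))"
    using assms by simp
  have "padded_sum L F j M I = (\<Sum>J\<in>words L j. \<Sum>b\<in>L.
      \<Sum>K\<in>words L (M - j - Suc (length I)). F (J @ I @ b # K))"
    unfolding padded_sum_def by (subst M) (simp only: sum_words_Suc_left)
  also have "\<dots> = (\<Sum>b\<in>L. \<Sum>J\<in>words L j.
      \<Sum>K\<in>words L (M - j - Suc (length I)). F (J @ I @ b # K))"
    by (rule sum.swap)
  finally show ?thesis by (simp add: padded_sum_def)
qed

lemma padded_sum_left:
  "(\<Sum>b\<in>L. padded_sum L F j M (b # I)) = padded_sum L F (Suc j) M I"
  unfolding padded_sum_def sum_words_Suc by (subst sum.swap) simp

lemma padded_sum_Nil:
  assumes "j \<le> M"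
  shows "padded_sum L F j M [] = word_sum L F M"
  using sum_words_append[of F L j "M - j"] assms by (simp add: padded_sum_def word_sum_def)

text \<open>Cutting \<open>J @ I @ K\<close> at two places costs 2C, and cutting the partition
  function at the same places costs 2C again, whatever j and M are.\<close>

lemma ln_padded_sum:
  assumes am: "almost_mult L (\<lambda>_. C) F" and L: "finite L" "L \<noteq> {}"
    and I: "set I \<subseteq> L" and M: "j + length I \<le> M"
  shows "0 < padded_sum L F j M I"
    and "\<bar>ln (padded_sum L F j M I / word_sum L F M) - ln (word_prob L F I)\<bar> \<le> 4 * C"
proof -
  define r where "r = M - j - length I"
  have M': "M = j + (length I + r)" using M by (simp add: r_def)
  let ?Z = "word_sum L F"
  let ?S = "words L j \<times> words L r"
  note pos = almost_mult_pos[OF am]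
  have Z: "0 < ?Z n" for n by (rule word_sum_pos[OF L pos])
  have S: "finite ?S" "?S \<noteq> {}" using L words_nonempty[OF L(2)] by auto
  have D: "padded_sum L F j M I = (\<Sum>(J, K)\<in>?S. F (J @ I @ K))"
    by (simp add: padded_sum_def r_def sum.cartesian_product)
  show p: "0 < padded_sum L F j M I"
    unfolding D using S I pos by (intro sum_pos) (auto simp: in_words_iff)
  have c: "\<bar>ln (\<Sum>(J, K)\<in>?S. F (J @ I @ K)) - ln (\<Sum>(J, K)\<in>?S. F J * F I * F K)\<bar> \<le> 2 * C"
  proof (rule ln_sum_close[OF S])
    fix x assume "x \<in> ?S"
    then obtain J K where x: "x = (J, K)" "set J \<subseteq> L" "set K \<subseteq> L"
      by (auto simp: in_words_iff)
    have f: "0 < F J" "0 < F K" "0 < F I" "0 < F (J @ I @ K)"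
      using x I by (auto intro!: pos)
    show "0 < (case x of (J, K) \<Rightarrow> F (J @ I @ K))" "0 < (case x of (J, K) \<Rightarrow> F J * F I * F K)"
      using x f by auto
    have "\<bar>ln (F (J @ I @ K)) - ln (F J) - ln (F (I @ K))\<bar> \<le> C"
      using almost_multD[OF am, of J "I @ K"] x I by simp
    moreover have "\<bar>ln (F (I @ K)) - ln (F I) - ln (F K)\<bar> \<le> C"
      using almost_multD[OF am, of I K] x I by simp
    ultimately have "\<bar>ln (F (J @ I @ K)) - (ln (F J) + ln (F I) + ln (F K))\<bar> \<le> 2 * C"
      by linarith
    then show "\<bar>ln (case x of (J, K) \<Rightarrow> F (J @ I @ K)) - ln (case x of (J, K) \<Rightarrow> F J * F I * F K)\<bar>
        \<le> 2 * C"
      using x f by (simp add: ln_mult)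
  qed
  have e: "(\<Sum>(J, K)\<in>?S. F J * F I * F K) = ?Z j * F I * ?Z r"
    by (simp add: word_sum_def sum_distrib_right sum_distrib_left sum.cartesian_product [symmetric],
        rule sum.swap)
  have "\<bar>ln (?Z M) - ln (?Z j) - ln (?Z (length I + r))\<bar> \<le> C"
    unfolding M' by (rule almost_mult_word_sum[OF am L])
  moreover have "\<bar>ln (?Z (length I + r)) - ln (?Z (length I)) - ln (?Z r)\<bar> \<le> C"
    by (rule almost_mult_word_sum[OF am L])
  moreover have "ln (?Z j * F I * ?Z r) = ln (?Z j) + ln (F I) + ln (?Z r)"
    using Z[of j] Z[of r] pos[OF I] by (simp add: ln_mult)
  moreover have "ln (padded_sum L F j M I / ?Z M) = ln (padded_sum L F j M I) - ln (?Z M)"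
    using p Z[of M] by (simp add: ln_div)
  moreover have "ln (word_prob L F I) = ln (F I) - ln (?Z (length I))"
    using Z[of "length I"] pos[OF I] by (simp add: word_prob_def ln_div)
  ultimately show "\<bar>ln (padded_sum L F j M I / ?Z M) - ln (word_prob L F I)\<bar> \<le> 4 * C"
    using c[unfolded e] unfolding D by linarith
qed

lemma ln_close_bounds:
  fixes x y :: real
  assumes "0 < x" "0 < y" "\<bar>ln x - ln y\<bar> \<le> c"
  shows "exp (- c) * y \<le> x" "x \<le> exp c * y"
proof -
  have "x = exp (ln x)" "y = exp (ln y)" using assms by auto
  moreover have "exp (ln x) \<le> exp (c + ln y)" "exp (- c + ln y) \<le> exp (ln x)"
    using assms(3) by auto
  ultimately show "exp (- c) * y \<le> x" "x \<le> exp c * y"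
    by (metis exp_add)+
qed

lemma ln_close_boundsI:
  fixes x y :: real
  assumes "0 < y" "exp (- c) * y \<le> x" "x \<le> exp c * y"
  shows "\<bar>ln x - ln y\<bar> \<le> c"
proof -
  have x: "0 < x" using assms(1,2) by (metis exp_gt_zero mult_pos_pos order_less_le_trans)
  have "ln (exp (- c) * y) \<le> ln x" "ln x \<le> ln (exp c * y)"
    using assms x by (simp_all add: ln_le_cancel_iff)
  then show ?thesis using assms(1) by (simp add: ln_mult)
qed

text \<open>Averaging over the position of \<open>I\<close> in a long word makes the limit weights invariant.\<close>

lemma invariant_gibbs_weights:
  fixes L :: "'a set"
  assumes am: "almost_mult L (\<lambda>_. C) F" and L: "finite L" "L \<noteq> {}"
  obtains u where "consistent L u" "\<And>I. set I \<subseteq> L \<Longrightarrow> (\<Sum>b\<in>L. u (b # I)) = u I"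
    "near L (\<lambda>_. 4 * C) u (word_prob L F)"
proof -
  let ?Z = "word_sum L F"
  let ?g = "word_prob L F"
  note pos = almost_mult_pos[OF am]
  have Z: "0 < ?Z n" for n by (rule word_sum_pos[OF L pos])
  have g: "0 < ?g I" if "set I \<subseteq> L" for I
    using Z pos[OF that] by (simp add: word_prob_def)
  define D where "D j M I = padded_sum L F j M I / ?Z M" for j M I
  \<comment> \<open>The length 2(t+1) leaves room for every \<open>I\<close> with
    \<open>length I \<le> t\<close> at each of the t+1 starting positions.\<close>
  define v where "v t I = (\<Sum>j<Suc t. D j (2 * Suc t) I) / Suc t" for t I
  have D: "exp (- (4 * C)) * ?g I \<le> D j M I" "D j M I \<le> exp (4 * C) * ?g I"
    if "set I \<subseteq> L" "j + length I \<le> M" for I j M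
    using ln_close_bounds[OF _ g[OF that(1)] ln_padded_sum(2)[OF am L that]]
      ln_padded_sum(1)[OF am L that] Z[of M] by (auto simp: D_def)
  have v: "exp (- (4 * C)) * ?g I \<le> v t I" "v t I \<le> exp (4 * C) * ?g I"
    if I: "set I \<subseteq> L" "length I \<le> t" for I t
  proof -
    have "real (card {..<Suc t}) * (exp (- (4 * C)) * ?g I) \<le> (\<Sum>j<Suc t. D j (2 * Suc t) I)"
      by (rule sum_bounded_below) (use I in \<open>auto intro: D\<close>)
    moreover have "(\<Sum>j<Suc t. D j (2 * Suc t) I) \<le> real (card {..<Suc t}) * (exp (4 * C) * ?g I)"
      by (rule sum_bounded_above) (use I in \<open>auto intro: D\<close>)
    ultimately show "exp (- (4 * C)) * ?g I \<le> v t I" "v t I \<le> exp (4 * C) * ?g I"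
      unfolding v_def by (simp_all only: pos_le_divide_eq pos_divide_le_eq mult.commute
          card_lessThan of_nat_0_less_iff zero_less_Suc)
  qed
  \<comment> \<open>Division by \<open>?g I\<close> makes the bound exp(4C) uniform over the
    countably many words, as the diagonal argument requires; the value 0 covers the finitely many t
    below the length of \<open>I\<close>.\<close>
  define f where "f t I = (if length I \<le> t then v t I / ?g I else 0)" for t I
  have "countable {I. set I \<subseteq> L}"
    using countable_lists[OF countable_finite[OF L(1)]] by (simp add: lists_eq_set)
  moreover have "norm (f t I) \<le> exp (4 * C)" if "I \<in> {I. set I \<subseteq> L}" for t I
  proof -
    have "0 \<le> exp (- (4 * C)) * ?g I" using g that by (simp add: less_imp_le)
    then have "0 \<le> v t I" if "length I \<le> t"
      using v(1)[of I t] \<open>I \<in> {I. set I \<subseteq> L}\<close> that by (auto intro: order_trans)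
    then show ?thesis
      using v(2)[of I t] g[of I] that
      by (cases "length I \<le> t") (auto simp: f_def divide_le_eq abs_le_iff)
  qed
  ultimately obtain r where r: "strict_mono r"
      "\<And>I. I \<in> {I. set I \<subseteq> L} \<Longrightarrow> \<exists>l. (\<lambda>n. f (r n) I) \<longlonglongrightarrow> l"
    using function_convergent_subsequence[of "{I. set I \<subseteq> L}" f "exp (4 * C)"] by metis
  define u where "u I = lim (\<lambda>n. f (r n) I) * ?g I" for I
  have u: "(\<lambda>n. v (r n) I) \<longlonglongrightarrow> u I" if I: "set I \<subseteq> L" for I
  proof -
    have "(\<lambda>n. f (r n) I) \<longlonglongrightarrow> lim (\<lambda>n. f (r n) I)"
      using r(2)[of I] I by (simp add: convergent_LIMSEQ_iff [symmetric] convergent_def)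
    then have "(\<lambda>n. f (r n) I * ?g I) \<longlonglongrightarrow> u I"
      unfolding u_def by (intro tendsto_intros)
    moreover have "\<forall>\<^sub>F n in sequentially. f (r n) I * ?g I = v (r n) I"
      using eventually_ge_at_top[of "length I"]
    proof eventually_elim
      case (elim n)
      then have "length I \<le> r n" using seq_suble[OF r(1), of n] by simp
      then show ?case using g[OF I] by (simp add: f_def)
    qed
    ultimately show ?thesis by (simp add: tendsto_cong)
  qed
  have large: "\<forall>\<^sub>F n in sequentially. m < r n" for m
    using eventually_gt_at_top[of m]
    by eventually_elim (meson order_less_le_trans r(1) seq_suble)
  have bounds: "exp (- (4 * C)) * ?g I \<le> u I" "u I \<le> exp (4 * C) * ?g I" if I: "set I \<subseteq> L" for I
  proof -
    have "\<forall>\<^sub>F n in sequentially. exp (- (4 * C)) * ?g I \<le> v (r n) I"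
      using large[of "length I"] by eventually_elim (use I v in auto)
    then show "exp (- (4 * C)) * ?g I \<le> u I"
      by (intro tendsto_lowerbound[OF u[OF I]]) auto
    have "\<forall>\<^sub>F n in sequentially. v (r n) I \<le> exp (4 * C) * ?g I"
      using large[of "length I"] by eventually_elim (use I v in auto)
    then show "u I \<le> exp (4 * C) * ?g I"
      by (intro tendsto_upperbound[OF u[OF I]]) auto
  qed
  have near: "near L (\<lambda>_. 4 * C) u ?g"
    unfolding near_def
  proof (intro allI impI conjI)
    fix I :: "'a list" assume I: "set I \<subseteq> L"
    show "0 < ?g I" using g[OF I] .
    then show "0 < u I" using bounds(1)[OF I]
      by (metis exp_gt_zero mult_pos_pos order_less_le_trans)
    show "\<bar>ln (u I) - ln (?g I)\<bar> \<le> 4 * C"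
      using ln_close_boundsI[OF g[OF I] bounds[OF I]] .
  qed
  have "v t [] = 1" for t
    using Z[of "2 * Suc t"] by (simp add: v_def D_def padded_sum_Nil del: sum.lessThan_Suc)
  then have "u [] = 1"
    using u[of "[]"] by (simp add: LIMSEQ_const_iff)
  moreover have "(\<Sum>b\<in>L. u (I @ [b])) = u I" if I: "set I \<subseteq> L" for I
  proof -
    have "(\<lambda>n. \<Sum>b\<in>L. v (r n) (I @ [b])) \<longlonglongrightarrow> (\<Sum>b\<in>L. u (I @ [b]))"
      using I by (intro tendsto_sum u) auto
    moreover have "\<forall>\<^sub>F n in sequentially. (\<Sum>b\<in>L. v (r n) (I @ [b])) = v (r n) I"
      using large[of "length I"]
    proof eventually_elim
      case (elim n)
      have "(\<Sum>b\<in>L. v (r n) (I @ [b])) =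
          (\<Sum>j<Suc (r n). \<Sum>b\<in>L. D j (2 * Suc (r n)) (I @ [b])) / Suc (r n)"
        by (subst sum.swap) (simp add: v_def sum_divide_distrib [symmetric] del: sum.lessThan_Suc)
      also have "\<dots> = (\<Sum>j<Suc (r n). D j (2 * Suc (r n)) I) / Suc (r n)"
        using elim
        by (intro arg_cong2[where f = "(/)"] sum.cong refl)
          (auto simp: D_def sum_divide_distrib [symmetric] padded_sum_right)
      finally show ?case by (simp add: v_def)
    qed
    ultimately have "(\<lambda>n. v (r n) I) \<longlonglongrightarrow> (\<Sum>b\<in>L. u (I @ [b]))"
      by (simp add: tendsto_cong)
    then show ?thesis using u[OF I] LIMSEQ_unique by blast
  qed
  ultimately have "consistent L u"
    using near by (auto simp: consistent_def near_def)
  moreover have "(\<Sum>b\<in>L. u (b # I)) = u I" if I: "set I \<subseteq> L" for I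
  proof -
    \<comment> \<open>Summing over a letter in front of \<open>I\<close> moves the position from j
      to j+1, so the average changes only by its two end terms divided by t.\<close>
    have "(\<lambda>n. (\<Sum>b\<in>L. v (r n) (b # I)) - v (r n) I) \<longlonglongrightarrow> (\<Sum>b\<in>L. u (b # I)) - u I"
      using I by (intro tendsto_diff tendsto_sum u) auto
    moreover have "(\<lambda>n. (\<Sum>b\<in>L. v (r n) (b # I)) - v (r n) I) \<longlonglongrightarrow> 0"
    proof (rule Lim_null_comparison)
      have "(\<lambda>n. 2 * (exp (4 * C) * ?g I) * inverse (real (Suc (r n)))) \<longlonglongrightarrow> 2 * (exp (4 * C) * ?g I) * 0"
        using LIMSEQ_subseq_LIMSEQ[OF LIMSEQ_inverse_real_of_nat r(1)]
        by (intro tendsto_intros) (simp add: o_def)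
      then show "(\<lambda>n. 2 * (exp (4 * C) * ?g I) * inverse (real (Suc (r n)))) \<longlonglongrightarrow> 0" by simp
      show "\<forall>\<^sub>F n in sequentially. norm ((\<Sum>b\<in>L. v (r n) (b # I)) - v (r n) I)
          \<le> 2 * (exp (4 * C) * ?g I) * inverse (real (Suc (r n)))"
        using large[of "length I"]
      proof eventually_elim
        case (elim n)
        define t where "t = Suc (r n)"
        have "(\<Sum>b\<in>L. v (r n) (b # I)) = (\<Sum>j<t. \<Sum>b\<in>L. D j (2 * t) (b # I)) / t"
          by (subst sum.swap)
            (simp add: v_def t_def sum_divide_distrib [symmetric] del: sum.lessThan_Suc)
        also have "\<dots> = (\<Sum>j<t. D (Suc j) (2 * t) I) / t"
          by (simp add: D_def sum_divide_distrib [symmetric] padded_sum_left)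
        finally have "(\<Sum>b\<in>L. v (r n) (b # I)) - v (r n) I =
            ((\<Sum>j<t. D (Suc j) (2 * t) I) - (\<Sum>j<t. D j (2 * t) I)) / t"
          by (simp add: v_def t_def diff_divide_distrib del: sum.lessThan_Suc)
        also have "\<dots> = (D t (2 * t) I - D 0 (2 * t) I) / t"
          using sum_lessThan_telescope[of "\<lambda>j. D j (2 * t) I" t] by (simp add: sum_subtractf)
        finally have e: "(\<Sum>b\<in>L. v (r n) (b # I)) - v (r n) I = (D t (2 * t) I - D 0 (2 * t) I) / t" .
        have "0 \<le> exp (- (4 * C)) * ?g I" using g[OF I] by (simp add: less_imp_le)
        then have "\<bar>D t (2 * t) I - D 0 (2 * t) I\<bar> \<le> 2 * (exp (4 * C) * ?g I)"
          using D[OF I, of t "2 * t"] D[OF I, of 0 "2 * t"] elim by (simp add: t_def abs_le_iff)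
        then show ?case
          unfolding e t_def [symmetric] by (simp add: abs_mult divide_inverse mult_right_mono)
      qed
    qed
    ultimately show ?thesis using LIMSEQ_unique by fastforce
  qed
  ultimately show ?thesis using that near by blast
qed

text \<open>Independent blocks of lengths \<open>1, 1, 2, 4, 8, \<dots>\<close>: a word of length \<open>n\<close> meets only
  \<open>O(log n)\<close> of them and the last one is no longer than \<open>2 n\<close>.\<close>

primrec block_weight :: "'a set \<Rightarrow> ('a list \<Rightarrow> real) \<Rightarrow> nat \<Rightarrow> 'a list \<Rightarrow> real" where
  "block_weight L F 0 I = word_prob L F I"
| "block_weight L F (Suc j) I = block_weight L F j (take (2 ^ j) I) * word_prob L F (drop (2 ^ j) I)"

text \<open>The blocks up to index j have total length 2^j, and \<open>block_weight\<close> is meant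
  for words of exactly that length; shorter words get the marginal.\<close>

definition block_marginal :: "'a set \<Rightarrow> ('a list \<Rightarrow> real) \<Rightarrow> nat \<Rightarrow> 'a list \<Rightarrow> real" where
  "block_marginal L F j I = (\<Sum>K\<in>words L (2 ^ j - length I). block_weight L F j (I @ K))"

lemma sum_word_prob:
  assumes "0 < word_sum L F n"
  shows "(\<Sum>I\<in>words L n. word_prob L F I) = 1"
proof -
  have "(\<Sum>I\<in>words L n. word_prob L F I) = (\<Sum>I\<in>words L n. F I / word_sum L F n)"
    by (intro sum.cong) (auto simp: word_prob_def in_words_iff)
  then show ?thesis
    using assms by (simp add: sum_divide_distrib [symmetric] word_sum_def)
qed

text \<open>The additional block is summed out and has total mass one.\<close>

lemma block_marginal_Suc:
  assumes "\<And>n. 0 < word_sum L F n" "length I \<le> 2 ^ j"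
  shows "block_marginal L F (Suc j) I = block_marginal L F j I"
proof -
  have "2 ^ Suc j - length I = (2 ^ j - length I) + 2 ^ j" using assms(2) by simp
  then have "block_marginal L F (Suc j) I = (\<Sum>K\<in>words L (2 ^ j - length I).
      \<Sum>K'\<in>words L (2 ^ j). block_weight L F (Suc j) (I @ K @ K'))"
    unfolding block_marginal_def by (simp only: sum_words_append)
  also have "\<dots> = (\<Sum>K\<in>words L (2 ^ j - length I).
      \<Sum>K'\<in>words L (2 ^ j). block_weight L F j (I @ K) * word_prob L F K')"
    using assms(2) by (intro sum.cong refl) (auto simp: in_words_iff)
  finally show ?thesis
    using sum_word_prob[OF assms(1)]
    by (simp add: sum_distrib_left [symmetric] block_marginal_def)
qed

lemma block_marginal_mono:
  assumes "\<And>n. 0 < word_sum L F n" "length I \<le> 2 ^ j" "j \<le> i"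
  shows "block_marginal L F i I = block_marginal L F j I"
  using assms(3)
proof (induction rule: dec_induct)
  case (step n)
  have "(2::nat) ^ j \<le> 2 ^ n" using step by (intro power_increasing) auto
  then have "length I \<le> 2 ^ n" using assms(2) by linarith
  then show ?case using block_marginal_Suc[OF assms(1)] step by simp
qed simp

text \<open>The doubling from 2^j to 2^(j+1) cuts \<open>F\<close> and the partition function once
  each, at cost C + \<epsilon> 2^(j+1) per cut. The constants add up linearly in the number of
  blocks, the other terms geometrically.\<close>

lemma ln_block_weight:
  assumes am: "almost_mult L (\<lambda>n. C + \<epsilon> * real n) F" and L: "finite L" "L \<noteq> {}"
    and "set I \<subseteq> L" "length I = 2 ^ j"
  shows "0 < block_weight L F j I \<and>
    \<bar>ln (block_weight L F j I) - ln (word_prob L F I)\<bar> \<le> 2 * real j * C + 4 * \<epsilon> * 2 ^ j"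
  using assms(4,5)
proof (induction j arbitrary: I)
  case 0
  note pos = almost_mult_pos[OF am]
  have "0 < word_sum L F 1" by (rule word_sum_pos[OF L pos])
  moreover have "0 \<le> \<epsilon>"
  proof (rule ccontr)
    assume "\<not> 0 \<le> \<epsilon>"
    then obtain n where "C / (- \<epsilon>) < real n" using reals_Archimedean2 by blast
    then have "C + \<epsilon> * real n < 0" using \<open>\<not> 0 \<le> \<epsilon>\<close> by (simp add: field_simps)
    then show False using almost_mult_nonneg[OF am L(2), of n] by simp
  qed
  ultimately show ?case
    using 0 pos[of I] by (simp add: word_prob_def)
next
  case (Suc j)
  let ?I = "take (2 ^ j) I" and ?J = "drop (2 ^ j) I"
  let ?Z = "word_sum L F"
  note pos = almost_mult_pos[OF am]
  have Z: "0 < ?Z n" for n by (rule word_sum_pos[OF L pos])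
  have IJ: "set ?I \<subseteq> L" "set ?J \<subseteq> L" "length ?I = 2 ^ j" "length ?J = 2 ^ j"
    using Suc.prems by (auto dest: in_set_takeD in_set_dropD)
  note IH = Suc.IH[OF IJ(1,3)]
  have F: "0 < F ?I" "0 < F ?J" "0 < F I" using pos IJ Suc.prems by auto
  define X where "X = C + \<epsilon> * 2 ^ Suc j"
  have 1: "\<bar>ln (F I) - ln (F ?I) - ln (F ?J)\<bar> \<le> X"
    unfolding X_def using almost_multD[OF am IJ(1,2)] IJ(3,4) by simp
  have 2: "\<bar>ln (?Z (2 ^ Suc j)) - ln (?Z (2 ^ j)) - ln (?Z (2 ^ j))\<bar> \<le> X"
    unfolding X_def using almost_mult_word_sum[OF am L, of "2 ^ j" "2 ^ j"] by (simp add: mult_2 [symmetric])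
  have p: "ln (word_prob L F I) = ln (F I) - ln (?Z (2 ^ Suc j))"
    "ln (word_prob L F ?I) = ln (F ?I) - ln (?Z (2 ^ j))"
    "ln (word_prob L F ?J) = ln (F ?J) - ln (?Z (2 ^ j))"
    using Z[of "2 ^ j"] Z[of "2 ^ Suc j"] F IJ Suc.prems by (simp_all add: word_prob_def ln_div)
  have J: "0 < word_prob L F ?J" using Z F by (simp add: word_prob_def)
  have W: "ln (block_weight L F (Suc j) I) = ln (block_weight L F j ?I) + ln (word_prob L F ?J)"
    using IH J by (simp add: ln_mult)
  have "\<bar>ln (word_prob L F I) - ln (word_prob L F ?I) - ln (word_prob L F ?J)\<bar>
      \<le> 2 * X"
    unfolding p using 1 2 by linarith
  then have "\<bar>ln (block_weight L F j ?I) + ln (word_prob L F ?J) - ln (word_prob L F I)\<bar>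
      \<le> (2 * real j * C + 4 * \<epsilon> * 2 ^ j) + 2 * X"
    using IH[THEN conjunct2] by linarith
  then show ?case using IH J W by (simp add: X_def algebra_simps)
qed

lemma exists_dyadic:
  fixes n :: nat
  assumes "1 \<le> n"
  obtains j where "n \<le> 2 ^ j" "2 ^ j < 2 * n"
proof -
  define j where "j = (LEAST j. n \<le> 2 ^ j)"
  have "n \<le> 2 ^ n" by (rule less_imp_le) (rule less_exp)
  then have j: "n \<le> 2 ^ j" unfolding j_def by (rule LeastI)
  have "2 ^ j < 2 * n"
  proof (cases j)
    case (Suc i)
    then have "\<not> n \<le> 2 ^ i" using not_less_Least[of i "\<lambda>j. n \<le> 2 ^ j"] by (simp add: j_def)
    then show ?thesis using Suc by simp
  qed (use assms in simp)
  then show ?thesis using j that by blast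
qed

text \<open>A constant paid once per block is absorbed into an arbitrarily small multiple of the
  length 2^j.\<close>

lemma linear_le_exponential:
  fixes B \<delta> :: real
  assumes "0 < \<delta>"
  obtains K where "0 \<le> K" "\<And>j. B * (real j + 1) \<le> K + \<delta> * 2 ^ j"
proof -
  have "\<forall>\<^sub>F j in sequentially. B * (real j + 1) \<le> \<delta> * 2 ^ j"
    using assms by real_asymp
  then obtain N where N: "\<And>j. N \<le> j \<Longrightarrow> B * (real j + 1) \<le> \<delta> * 2 ^ j"
    unfolding eventually_sequentially by blast
  have "B * (real j + 1) \<le> \<bar>B\<bar> * (real N + 1) + \<delta> * 2 ^ j" for j
  proof (cases "N \<le> j")
    case True
    have "0 \<le> \<bar>B\<bar> * (real N + 1)" by simp
    then show ?thesis using N[OF True] by linarith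
  next
    case False
    have "B * (real j + 1) \<le> \<bar>B\<bar> * (real j + 1)" by (intro mult_right_mono) auto
    also have "\<dots> \<le> \<bar>B\<bar> * (real N + 1)" using False by (intro mult_left_mono) auto
    also have "\<dots> \<le> \<bar>B\<bar> * (real N + 1) + \<delta> * 2 ^ j" using assms by simp
    finally show ?thesis .
  qed
  then show ?thesis by (intro that[of "\<bar>B\<bar> * (real N + 1)"]) auto
qed

lemma gibbs_weights:
  fixes L :: "'a set"
  assumes tm: "tempered L F" and L: "finite L" "L \<noteq> {}"
  obtains w where "consistent L w"
    "\<And>\<epsilon>. 0 < \<epsilon> \<Longrightarrow> \<exists>C\<ge>0. near L (\<lambda>n. C + \<epsilon> * real n) w (word_prob L F)"
proof -
  \<comment> \<open>Since \<open>length I \<le> 2 ^ length I\<close>, this level is large enough,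
    and every other sufficient level gives the same value, which is the fact \<open>w\<close>
    below.\<close>
  define w where "w I = block_marginal L F (length I) I" for I
  let ?Z = "word_sum L F"
  obtain C0 where "almost_mult L (\<lambda>n. C0 + 1 * real n) F"
    using tempered_almost_mult[OF tm _ L(2), of 1] by auto
  note pos = almost_mult_pos[OF this]
  have Z: "0 < ?Z n" for n by (rule word_sum_pos[OF L pos])
  have w: "w I = block_marginal L F j I" if "length I \<le> 2 ^ j" for I j
  proof -
    have "length I \<le> 2 ^ length I" by (rule less_imp_le) (rule less_exp)
    then have "block_marginal L F (max (length I) j) I = w I"
      unfolding w_def by (intro block_marginal_mono[OF Z]) auto
    moreover have "block_marginal L F (max (length I) j) I = block_marginal L F j I"
      using that by (intro block_marginal_mono[OF Z]) auto
    ultimately show ?thesis by simp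
  qed
  have near: "\<exists>C\<ge>0. near L (\<lambda>n. C + \<epsilon> * real n) w (word_prob L F)" if \<epsilon>: "0 < \<epsilon>" for \<epsilon>
  proof -
    \<comment> \<open>The divisor is 14 = 2 * 7: multiples of 2^j arise four times from the block
      weights, once from cutting \<open>F (I @ K')\<close>, once from cutting the partition function
      and once from absorbing the constants, and 2^j may be almost twice the length of
      \<open>I\<close>.\<close>
    obtain C where C: "0 \<le> C" and am: "almost_mult L (\<lambda>n. C + \<epsilon> / 14 * real n) F"
      using tempered_almost_mult[OF tm _ L(2), of "\<epsilon> / 14"] \<epsilon> by auto
    obtain K where K: "0 \<le> K" "\<And>j. (2 * C) * (real j + 1) \<le> K + \<epsilon> / 14 * 2 ^ j"
      using linear_le_exponential[of "\<epsilon> / 14" "2 * C"] \<epsilon> by auto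
    have ZI: "0 < word_prob L F I" if "set I \<subseteq> L" for I
      using pos[OF that] Z by (simp add: word_prob_def)
    have key: "0 < w I \<and> \<bar>ln (w I) - ln (word_prob L F I)\<bar> \<le> K + \<epsilon> * real (length I)"
      if I: "set I \<subseteq> L" for I
    proof (cases "I = []")
      case True
      have "w [] = 1"
        using sum_word_prob[OF Z, of "Suc 0"] by (simp add: w_def block_marginal_def)
      moreover have "word_prob L F [] = 1"
        using pos[of "[]"] by (simp add: word_prob_def word_sum_def)
      ultimately show ?thesis using True K by simp
    next
      case False
      then have n: "1 \<le> length I" by (cases I) auto
      then obtain j where j: "length I \<le> 2 ^ j" "2 ^ j < 2 * length I"
        using exists_dyadic by blast
      define r where "r = 2 ^ j - length I"
      have jr: "2 ^ j = length I + r" using j by (simp add: r_def)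
      have sets: "set (I @ K') \<subseteq> L" "length (I @ K') = 2 ^ j" if "K' \<in> words L r" for K'
        using that I jr by (auto simp: in_words_iff)
      have wI: "w I = (\<Sum>K'\<in>words L r. block_weight L F j (I @ K'))"
        using w[OF j(1)] by (simp add: block_marginal_def r_def)
      have ne: "finite (words L r)" "words L r \<noteq> {}" using L words_nonempty[OF L(2)] by auto
      have e: "0 < block_weight L F j (I @ K')"
        "\<bar>ln (block_weight L F j (I @ K')) - ln (F I * F K' / ?Z (2 ^ j))\<bar>
          \<le> 2 * real j * C + C + 5 * (\<epsilon> / 14) * 2 ^ j" if K': "K' \<in> words L r" for K'
      proof -
        note b = ln_block_weight[OF am L sets[OF K']]
        then show "0 < block_weight L F j (I @ K')" by simp
        have K'': "set K' \<subseteq> L" "length K' = r" using K' by (auto simp: in_words_iff)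
        have "\<bar>ln (F (I @ K')) - ln (F I) - ln (F K')\<bar> \<le> C + \<epsilon> / 14 * real (length I + r)"
          using almost_multD[OF am I K''(1)] K''(2) by simp
        moreover have "real (length I + r) = 2 ^ j" using jr by (metis of_nat_numeral of_nat_power)
        moreover have "ln (word_prob L F (I @ K')) = ln (F (I @ K')) - ln (?Z (2 ^ j))"
          using sets[OF K'] Z[of "2 ^ j"] pos[of "I @ K'"] by (simp add: word_prob_def ln_div)
        moreover have "ln (F I * F K' / ?Z (2 ^ j)) = ln (F I) + ln (F K') - ln (?Z (2 ^ j))"
          using Z[of "2 ^ j"] pos[OF I] pos[OF K''(1)] by (simp add: ln_mult ln_div)
        ultimately show "\<bar>ln (block_weight L F j (I @ K')) - ln (F I * F K' / ?Z (2 ^ j))\<bar>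
            \<le> 2 * real j * C + C + 5 * (\<epsilon> / 14) * 2 ^ j"
          using b[THEN conjunct2] by simp
      qed
      have "\<bar>ln (w I) - ln (\<Sum>K'\<in>words L r. F I * F K' / ?Z (2 ^ j))\<bar>
          \<le> 2 * real j * C + C + 5 * (\<epsilon> / 14) * 2 ^ j"
        unfolding wI
      proof (rule ln_sum_close[OF ne e(1)])
        fix K' assume "K' \<in> words L r"
        then show "0 < F I * F K' / ?Z (2 ^ j)"
          using Z[of "2 ^ j"] pos[OF I] pos[of K'] by (simp add: in_words_iff)
      qed (use e in auto)
      moreover have "(\<Sum>K'\<in>words L r. F I * F K' / ?Z (2 ^ j)) = F I * ?Z r / ?Z (2 ^ j)"
        by (simp add: word_sum_def sum_distrib_left sum_divide_distrib)
      moreover have "ln (F I * ?Z r / ?Z (2 ^ j)) = ln (F I) + ln (?Z r) - ln (?Z (2 ^ j))"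
        using Z[of r] Z[of "2 ^ j"] pos[OF I] by (simp add: ln_mult ln_div)
      moreover have "ln (word_prob L F I) = ln (F I) - ln (?Z (length I))"
        using Z[of "length I"] pos[OF I] by (simp add: word_prob_def ln_div)
      moreover have "\<bar>ln (?Z (2 ^ j)) - ln (?Z (length I)) - ln (?Z r)\<bar> \<le> C + \<epsilon> / 14 * 2 ^ j"
        using almost_mult_word_sum[OF am L, of "length I" r] jr
        by (metis of_nat_numeral of_nat_power)
      ultimately have "\<bar>ln (w I) - ln (word_prob L F I)\<bar>
          \<le> (2 * C) * (real j + 1) + 6 * (\<epsilon> / 14) * 2 ^ j"
        by (simp add: algebra_simps)
      also have "\<dots> \<le> K + 7 * (\<epsilon> / 14) * 2 ^ j" using K(2)[of j] by simp
      also have "\<dots> \<le> K + 7 * (\<epsilon> / 14) * (2 * real (length I))"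
      proof -
        have "(2::real) ^ j \<le> 2 * real (length I)"
          using j(2) by (metis of_nat_less_iff of_nat_mult of_nat_numeral of_nat_power less_imp_le)
        then show ?thesis using \<epsilon> by (intro add_left_mono mult_left_mono) auto
      qed
      finally have "\<bar>ln (w I) - ln (word_prob L F I)\<bar> \<le> K + \<epsilon> * real (length I)" by simp
      moreover have "0 < w I" unfolding wI using ne e by (intro sum_pos) auto
      ultimately show ?thesis by blast
    qed
    then have "near L (\<lambda>n. K + \<epsilon> * real n) w (word_prob L F)"
      using ZI unfolding near_def by blast
    then show ?thesis using K(1) by blast
  qed
  have "consistent L w"
    unfolding consistent_def
  proof (intro conjI allI impI)
    show "w [] = 1"
      using sum_word_prob[OF Z, of "Suc 0"] by (simp add: w_def block_marginal_def)
    fix I :: "'a list" assume I: "set I \<subseteq> L"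
    show "0 < w I" using near[of 1] I by (auto simp: near_def)
    \<comment> \<open>This level suffices for \<open>I\<close> and for all its one-letter
      extensions, so both sides are the same sum over longer words.\<close>
    define n where "n = Suc (length I)"
    have n: "n < 2 ^ n" by (rule less_exp)
    have "(\<Sum>b\<in>L. w (I @ [b])) = (\<Sum>b\<in>L. block_marginal L F n (I @ [b]))"
      using n by (intro sum.cong refl w) (simp add: n_def)
    also have "\<dots> = (\<Sum>K\<in>words L (Suc (2 ^ n - n)). block_weight L F n (I @ K))"
      unfolding sum_words_Suc_left block_marginal_def by (simp add: n_def)
    also have "Suc (2 ^ n - n) = 2 ^ n - length I" using n by (simp add: n_def)
    also have "(\<Sum>K\<in>words L (2 ^ n - length I). block_weight L F n (I @ K)) = w I"
      using n by (subst w[of I n]) (simp_all add: n_def block_marginal_def)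
    finally show "(\<Sum>b\<in>L. w (I @ [b])) = w I" .
  qed
  then show ?thesis using that near by blast
qed

section \<open>Borel probability measures on the full shift\<close>

lemma seqs_iff: "x \<in> seqs L \<longleftrightarrow> (\<forall>n. x n \<in> L)"
  by (auto simp: shift_space_def PiE_iff)

lemma length_init_word [simp]: "length (init_word x n) = n"
  by (simp add: subword_def)

lemma init_word_nth [simp]: "j < n \<Longrightarrow> init_word x n ! j = x j"
  by (simp add: subword_def)

lemma init_word_0 [simp]: "init_word x 0 = []"
  by (simp add: subword_def)

lemma init_word_eq_iff: "init_word x n = init_word y n \<longleftrightarrow> (\<forall>j<n. x j = y j)"
  by (auto simp: list_eq_iff_nth_eq)

lemma init_word_in_words: "x \<in> seqs L \<Longrightarrow> init_word x n \<in> words L n"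
  by (auto simp: in_words_iff subword_def seqs_iff)

lemma take_init_word: "m \<le> n \<Longrightarrow> take m (init_word x n) = init_word x m"
  by (simp add: subword_def take_map)

lemma cyl_iff: "x \<in> cyl L I \<longleftrightarrow> x \<in> seqs L \<and> init_word x (length I) = I"
  by (auto simp: cyl_def list_eq_iff_nth_eq)

lemma cyl_subset: "cyl L I \<subseteq> seqs L"
  by (auto simp: cyl_def)

lemma cyl_Nil [simp]: "cyl L [] = seqs L"
  by (auto simp: cyl_def)

lemma cyl_disjoint: "length I = length J \<Longrightarrow> I \<noteq> J \<Longrightarrow> cyl L I \<inter> cyl L J = {}"
  by (auto simp: cyl_iff)

text \<open>A concrete point of the cylinder of \<open>I\<close>; it also turns functions of
  sequences into functions of words.\<close>

definition ext_word :: "'a \<Rightarrow> 'a list \<Rightarrow> nat \<Rightarrow> 'a" where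
  "ext_word b I = (\<lambda>j. if j < length I then I ! j else b)"

lemma ext_word_cyl: "b \<in> L \<Longrightarrow> set I \<subseteq> L \<Longrightarrow> ext_word b I \<in> cyl L I"
  by (auto simp: ext_word_def cyl_def seqs_iff)

lemma cyl_nonempty: "L \<noteq> {} \<Longrightarrow> set I \<subseteq> L \<Longrightarrow> cyl L I \<noteq> {}"
  using ext_word_cyl[of "SOME b. b \<in> L" L I] some_in_eq[of L] by auto

lemma openin_cyl:
  assumes I: "set I \<subseteq> L"
  shows "openin (shift_space L) (cyl L I)"
proof -
  define S where "S j = (if j < length I then {I ! j} else L)" for j
  have SL: "S j \<subseteq> L" for j
    using I nth_mem[of j I] by (auto simp: S_def)
  have "x \<in> cyl L I \<longleftrightarrow> (\<forall>j. x j \<in> S j)" for x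
  proof
    assume x: "\<forall>j. x j \<in> S j"
    have "x j = I ! j" if "j < length I" for j
      using x[rule_format, of j] that by (simp add: S_def)
    then show "x \<in> cyl L I" using x SL by (auto simp: cyl_def seqs_iff)
  qed (simp add: S_def cyl_def seqs_iff)
  then have eq: "cyl L I = PiE UNIV S" by (auto simp: PiE_iff)
  have "finite {j \<in> UNIV. S j \<noteq> topspace (discrete_topology L)}"
    by (rule finite_subset[of _ "{..<length I}"]) (auto simp: S_def)
  then show ?thesis
    unfolding shift_space_def eq openin_PiE_gen using SL by simp
qed

lemma openin_cyl_subset:
  assumes "openin (shift_space L) U" "x \<in> U"
  obtains n where "cyl L (init_word x n) \<subseteq> U"
proof -
  obtain V where V: "finite {j. V j \<noteq> L}" "x \<in> PiE UNIV V" "PiE UNIV V \<subseteq> U"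
    using assms unfolding shift_space_def openin_product_topology_alt by auto
  obtain n where n: "\<And>j. V j \<noteq> L \<Longrightarrow> j < n"
    using V(1) unfolding finite_nat_set_iff_bounded by auto
  have "cyl L (init_word x n) \<subseteq> U"
  proof
    fix y assume y: "y \<in> cyl L (init_word x n)"
    have "y j \<in> V j" for j
    proof (cases "V j = L")
      case True
      then show ?thesis using y by (auto simp: cyl_def seqs_iff)
    next
      case False
      then have "y j = x j" using n y by (auto simp: cyl_def)
      then show ?thesis using V(2) by (auto simp: PiE_iff)
    qed
    then have "y \<in> PiE UNIV V" by (simp add: PiE_iff)
    then show "y \<in> U" using V(3) by (rule set_rev_mp)
  qed
  then show ?thesis by (rule that)
qed

lemma seqs_eq_UN_cyl: "seqs L = (\<Union>I\<in>words L n. cyl L I)"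
proof (intro equalityI subsetI)
  fix x assume x: "x \<in> seqs L"
  then have "x \<in> cyl L (init_word x n)" by (simp add: cyl_iff)
  then show "x \<in> (\<Union>I\<in>words L n. cyl L I)" using init_word_in_words[OF x] by blast
qed (use cyl_subset in auto)

definition cyls :: "'a set \<Rightarrow> (nat \<Rightarrow> 'a) set set" where
  "cyls L = cyl L ` {I. set I \<subseteq> L}"

lemma space_shift_borel [simp]: "space (shift_borel L) = seqs L"
  by (simp add: shift_borel_def space_measure_of_conv)

text \<open>A finite alphabet has only countably many words, so every open set is a countable union
  of cylinders.\<close>

lemma sets_shift_borel:
  assumes "finite L"
  shows "sets (shift_borel L) = sigma_sets (seqs L) (cyls L)"
proof -
  have "sets (shift_borel L) = sigma_sets (seqs L) {U. openin (shift_space L) U}"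
    unfolding shift_borel_def by (rule sets_measure_of) (auto dest: openin_subset)
  also have "\<dots> = sigma_sets (seqs L) (cyls L)"
  proof (rule sigma_sets_eqI)
    fix U assume "U \<in> {U. openin (shift_space L) U}"
    then have U: "openin (shift_space L) U" by simp
    define S where "S = {I. set I \<subseteq> L \<and> cyl L I \<subseteq> U}"
    have "U = (\<Union>I\<in>S. cyl L I)"
    proof (intro equalityI subsetI)
      fix x assume x: "x \<in> U"
      then have xs: "x \<in> seqs L" using openin_subset[OF U] by auto
      obtain n where n: "cyl L (init_word x n) \<subseteq> U" using openin_cyl_subset[OF U x] .
      then have "init_word x n \<in> S" using init_word_in_words[OF xs, of n]
        by (auto simp: S_def in_words_iff)
      moreover have "x \<in> cyl L (init_word x n)" using xs by (simp add: cyl_iff)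
      ultimately show "x \<in> (\<Union>I\<in>S. cyl L I)" by blast
    qed (auto simp: S_def)
    moreover have "countable S"
    proof (rule countable_subset)
      show "countable (lists L)" using assms by (intro countable_lists countable_finite)
    qed (auto simp: S_def)
    moreover have "cyl L I \<in> sigma_sets (seqs L) (cyls L)" if "I \<in> S" for I
      using that by (auto simp: S_def cyls_def)
    ultimately show "U \<in> sigma_sets (seqs L) (cyls L)"
      by (metis sigma_sets_UNION countable_image imageE)
  next
    fix U assume "U \<in> cyls L"
    then show "U \<in> sigma_sets (seqs L) {U. openin (shift_space L) U}"
      by (auto simp: cyls_def openin_cyl)
  qed
  finally show ?thesis .
qed

lemma cyl_sets: "set I \<subseteq> L \<Longrightarrow> cyl L I \<in> sets (shift_borel L)"
  unfolding shift_borel_def using openin_cyl[of I L]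
  by (subst sets_measure_of) (auto dest: openin_subset)

lemma measurable_shift_borel:
  assumes "finite L'" "f \<in> space M \<rightarrow> seqs L'"
    and "\<And>I. set I \<subseteq> L' \<Longrightarrow> f -` cyl L' I \<inter> space M \<in> sets M"
  shows "f \<in> measurable M (shift_borel L')"
  by (rule measurable_sigma_sets[OF sets_shift_borel[OF assms(1)]])
    (use assms cyl_subset[of L'] in \<open>auto simp: cyls_def\<close>)

lemma lshift_pow: "(lshift ^^ n) x j = x (n + j)"
  by (induction n arbitrary: j) (auto simp: lshift_def)

lemma lshift_pow_seqs: "x \<in> seqs L \<Longrightarrow> (lshift ^^ n) x \<in> seqs L"
  by (simp add: seqs_iff lshift_pow)

lemma lshift_vimage_cyl:
  "lshift -` cyl L I \<inter> seqs L = (\<Union>b\<in>L. cyl L (b # I))"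
  by (auto simp: cyl_def seqs_iff lshift_def nth_Cons less_Suc_eq_0_disj split: nat.splits)

lemma measurable_lshift:
  assumes "finite L"
  shows "lshift \<in> measurable (shift_borel L) (shift_borel L)"
proof (rule measurable_shift_borel[OF assms])
  fix I assume "set I \<subseteq> L"
  then show "lshift -` cyl L I \<inter> space (shift_borel L) \<in> sets (shift_borel L)"
    unfolding space_shift_borel lshift_vimage_cyl
    using assms by (intro sets.finite_UN cyl_sets) auto
qed (auto simp: seqs_iff lshift_def)

text \<open>A cylinder of the factor pulls back to a union of cylinders over a fibre; this is how
  image measures turn into \<open>push\<close>.\<close>

lemma letterwise_vimage_cyl:
  assumes "q ` L \<subseteq> L'"
  shows "letterwise q -` cyl L' J \<inter> seqs L = (\<Union>I\<in>fiber q L J. cyl L I)"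
proof (intro equalityI subsetI)
  fix x assume x: "x \<in> letterwise q -` cyl L' J \<inter> seqs L"
  then have "init_word x (length J) \<in> fiber q L J"
    using init_word_in_words[of x L "length J"]
    by (auto simp: fiber_def cyl_def letterwise_def list_eq_iff_nth_eq)
  moreover have "x \<in> cyl L (init_word x (length J))" using x by (simp add: cyl_iff)
  ultimately show "x \<in> (\<Union>I\<in>fiber q L J. cyl L I)" by blast
next
  fix x assume "x \<in> (\<Union>I\<in>fiber q L J. cyl L I)"
  then obtain I where I: "I \<in> fiber q L J" "x \<in> cyl L I" by auto
  have "q (x n) \<in> L'" for n using assms I(2) by (auto simp: cyl_def seqs_iff)
  then show "x \<in> letterwise q -` cyl L' J \<inter> seqs L"
    using I(2) fiberD(2,3)[OF I(1)]
    by (simp add: cyl_def seqs_iff letterwise_def) (metis nth_map)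
qed

lemma measurable_letterwise:
  assumes "finite L" "finite L'" "q ` L \<subseteq> L'"
  shows "letterwise q \<in> measurable (shift_borel L) (shift_borel L')"
proof (rule measurable_shift_borel[OF assms(2)])
  fix I assume "set I \<subseteq> L'"
  show "letterwise q -` cyl L' I \<inter> space (shift_borel L) \<in> sets (shift_borel L)"
    unfolding space_shift_borel letterwise_vimage_cyl[OF assms(3)]
    using assms(1) by (intro sets.finite_UN cyl_sets) (auto dest: fiberD(1))
qed (use assms(3) in \<open>force simp: seqs_iff letterwise_def\<close>)

lemma borel_probD:
  assumes "\<mu> \<in> borel_prob L"
  shows "prob_space \<mu>" "sets \<mu> = sets (shift_borel L)" "space \<mu> = seqs L"
  using assms sets_eq_imp_space_eq[of \<mu> "shift_borel L"] by (auto simp: borel_prob_def)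

lemma measure_UN_cyl:
  assumes "\<mu> \<in> borel_prob L" "finite W" "W \<subseteq> words L n"
  shows "measure \<mu> (\<Union>I\<in>W. cyl L I) = (\<Sum>I\<in>W. measure \<mu> (cyl L I))"
proof -
  interpret prob_space \<mu> using borel_probD[OF assms(1)] by simp
  have W: "set I \<subseteq> L" "length I = n" if "I \<in> W" for I
    using subsetD[OF assms(3) that] by (simp_all add: in_words_iff)
  show ?thesis
  proof (rule finite_measure_finite_Union[OF assms(2)])
    show "cyl L ` W \<subseteq> sets \<mu>"
      unfolding borel_probD(2)[OF assms(1)] using W(1) by (auto intro!: cyl_sets)
    show "disjoint_family_on (cyl L) W"
      unfolding disjoint_family_on_def
    proof (intro ballI impI)
      fix I J assume "I \<in> W" "J \<in> W" "I \<noteq> J"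
      then show "cyl L I \<inter> cyl L J = {}" using W(2) by (intro cyl_disjoint) auto
    qed
  qed
qed

lemma sum_measure_cyl:
  assumes "\<mu> \<in> borel_prob L" "finite L"
  shows "(\<Sum>I\<in>words L n. measure \<mu> (cyl L I)) = 1"
proof -
  interpret prob_space \<mu> using borel_probD[OF assms(1)] by simp
  show ?thesis
    using measure_UN_cyl[OF assms(1), of "words L n" n] assms(2) seqs_eq_UN_cyl[of L n] prob_space
      borel_probD(3)[OF assms(1)] by simp
qed

text \<open>Two cylinders are nested or disjoint, so together with the empty set they are stable
  under intersection and determine a probability measure.\<close>

lemma measure_eq_cyl:
  assumes "\<mu> \<in> borel_prob L" "\<nu> \<in> borel_prob L" "finite L"
    and eq: "\<And>I. set I \<subseteq> L \<Longrightarrow> measure \<mu> (cyl L I) = measure \<nu> (cyl L I)"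
  shows "\<mu> = \<nu>"
proof -
  interpret \<mu>: prob_space \<mu> using borel_probD[OF assms(1)] by simp
  interpret \<nu>: prob_space \<nu> using borel_probD[OF assms(2)] by simp
  let ?E = "insert {} (cyls L)"
  have inter: "cyl L I \<inter> cyl L J \<in> ?E" if IJ: "set I \<subseteq> L" "set J \<subseteq> L" "length I \<le> length J" for I J
  proof (cases "take (length I) J = I")
    case True
    have "cyl L J \<subseteq> cyl L I"
      using True IJ(3) by (metis (no_types, lifting) cyl_iff subsetI take_init_word)
    then show ?thesis using IJ by (auto simp: cyls_def Int_absorb1)
  next
    case False
    have "cyl L I \<inter> cyl L J = {}"
      using False IJ(3) by (metis (no_types, lifting) cyl_iff disjoint_iff take_init_word)
    then show ?thesis by simp
  qed
  have "Int_stable ?E"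
    unfolding Int_stable_def
  proof (intro ballI)
    fix B C assume BC: "B \<in> ?E" "C \<in> ?E"
    show "B \<inter> C \<in> ?E"
    proof (cases "B = {} \<or> C = {}")
      case False
      then obtain I J where IJ: "B = cyl L I" "C = cyl L J" "set I \<subseteq> L" "set J \<subseteq> L"
        using BC by (auto simp: cyls_def)
      then show ?thesis
        using inter[of I J] inter[of J I] by (cases "length I \<le> length J") (auto simp: Int_commute)
    qed auto
  qed
  moreover have "sigma_sets (seqs L) ?E = sigma_sets (seqs L) (cyls L)"
    by (intro sigma_sets_eqI) (auto intro: sigma_sets.Empty)
  ultimately show ?thesis
    using eq borel_probD[OF assms(1)] borel_probD[OF assms(2)] sets_shift_borel[OF assms(3)]
      cyl_subset[of L]
    by (intro measure_eqI_generator_eq[of ?E "seqs L" \<mu> \<nu> "\<lambda>_. seqs L"])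
      (auto simp: cyls_def \<mu>.emeasure_eq_measure \<nu>.emeasure_eq_measure
        intro: image_eqI[of _ _ "[]"] dest: cyl_subset[THEN subsetD])
qed

section \<open>Existence of a measure with prescribed cylinder weights\<close>

text \<open>The measure is the law of the random sequence whose \<open>n\<close>-th initial word is the label of the
  interval containing a uniform random number, the intervals of order \<open>n\<close> having lengths \<open>w I\<close>.\<close>

definition refine_step :: "('a list \<Rightarrow> real) \<Rightarrow> (nat \<Rightarrow> 'a) \<Rightarrow> real \<Rightarrow> 'a list \<times> real \<Rightarrow> 'a list \<times> real" where
  "refine_step w e t s = (let r = (LEAST r. t < snd s + (\<Sum>j<Suc r. w (fst s @ [e j])))
     in (fst s @ [e r], snd s + (\<Sum>j<r. w (fst s @ [e j]))))"

definition refine :: "('a list \<Rightarrow> real) \<Rightarrow> (nat \<Rightarrow> 'a) \<Rightarrow> real \<Rightarrow> nat \<Rightarrow> 'a list \<times> real" where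
  "refine w e t n = (refine_step w e t ^^ n) ([], 0)"

lemma refine_Suc: "refine w e t (Suc n) = refine_step w e t (refine w e t n)"
  by (simp add: refine_def)

lemma length_refine: "length (fst (refine w e t n)) = n"
proof (induction n)
  case (Suc n)
  then show ?case by (simp add: refine_Suc refine_step_def Let_def)
qed (simp add: refine_def)

text \<open>The state is a label with the left end of its interval. Consistency says that the
  intervals of the children exactly fill that of the parent, so label \<open>I\<close> is produced
  on a half-open interval of length \<open>w I\<close>. The left end belongs to the induction
  because the next refinement starts from it.\<close>

lemma refine_interval:
  assumes cons: "consistent L w" and e: "bij_betw e {..<d} L" and I: "I \<in> words L n"
  shows "\<exists>c\<ge>0. c + w I \<le> 1 \<and> (\<forall>t. 0 \<le> t \<longrightarrow> t < 1 \<longrightarrow>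
     (fst (refine w e t n) = I \<longleftrightarrow> c \<le> t \<and> t < c + w I) \<and>
     (fst (refine w e t n) = I \<longrightarrow> snd (refine w e t n) = c))"
  using I
proof (induction n arbitrary: I)
  case 0
  then show ?case using cons by (intro exI[of _ 0]) (simp add: refine_def consistent_def)
next
  case (Suc n)
  then obtain I' b where I': "I = I' @ [b]" "I' \<in> words L n" "b \<in> L"
    by (cases I rule: rev_cases) (auto simp: in_words_iff)
  define g where "g j = w (I' @ [e j])" for j
  have g: "0 < g j" if "j < d" for j
  proof -
    have "e j \<in> L" using e that by (auto simp: bij_betw_def)
    then show ?thesis using cons I'(2) by (auto simp: g_def consistent_def in_words_iff)
  qed
  have gsum: "(\<Sum>j<d. g j) = w I'"
  proof -
    have "(\<Sum>j<d. g j) = (\<Sum>b\<in>L. w (I' @ [b]))"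
      unfolding g_def by (rule sum.reindex_bij_betw[OF e])
    then show ?thesis using cons I'(2) by (auto simp: consistent_def in_words_iff)
  qed
  obtain r where r: "r < d" "b = e r"
    using e I'(3) by (auto simp: bij_betw_def)
  obtain c where c: "0 \<le> c" "c + w I' \<le> 1"
    and ct: "\<And>t. 0 \<le> t \<Longrightarrow> t < 1 \<Longrightarrow> fst (refine w e t n) = I' \<longleftrightarrow> c \<le> t \<and> t < c + w I'"
      "\<And>t. 0 \<le> t \<Longrightarrow> t < 1 \<Longrightarrow> fst (refine w e t n) = I' \<Longrightarrow> snd (refine w e t n) = c"
    using Suc.IH[OF I'(2)] by blast
  have gmono: "(\<Sum>j<i. g j) \<le> (\<Sum>j<i'. g j)" if "i \<le> i'" "i' \<le> d" for i i'
    using that g by (intro sum_mono2) (auto intro: less_imp_le)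
  have wI: "w I = g r" by (simp add: I' r g_def)
  let ?c = "c + (\<Sum>j<r. g j)"
  have top: "?c + w I \<le> c + w I'"
    using gmono[of "Suc r" d] r gsum wI by simp
  have bot: "0 \<le> (\<Sum>j<r. g j)" using gmono[of 0 r] r by simp
  show ?case
  proof (intro exI[of _ ?c] conjI allI impI)
    show "0 \<le> ?c" using c bot by simp
    show "?c + w I \<le> 1" using top c by simp
    fix t :: real assume t: "0 \<le> t" "t < 1"
    \<comment> \<open>The index selected at the next step. On the interval of I' the last partial
      sum is w I', so an index below d qualifies and the least one is attained there.\<close>
    define s where "s = (LEAST r. t < snd (refine w e t n) + (\<Sum>j<Suc r. w (fst (refine w e t n) @ [e j])))"
    have R: "refine w e t (Suc n) = (fst (refine w e t n) @ [e s],
        snd (refine w e t n) + (\<Sum>j<s. w (fst (refine w e t n) @ [e j])))"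
      by (simp add: refine_Suc refine_step_def Let_def s_def)
    have seq: "s = r \<longleftrightarrow> ?c \<le> t \<and> t < ?c + w I"
      and sd: "s < d" if eq: "fst (refine w e t n) = I'"
    proof -
      have cc: "snd (refine w e t n) = c" using ct(2)[OF t eq] .
      have ti: "c \<le> t" "t < c + w I'" using ct(1)[OF t] eq by auto
      have s': "s = (LEAST i. t < c + (\<Sum>j<Suc i. g j))"
        unfolding s_def eq cc g_def ..
      have d: "0 < d" using r by simp
      have ex: "t < c + (\<Sum>j<Suc (d - 1). g j)" using ti gsum d by simp
      then have hit: "t < c + (\<Sum>j<Suc s. g j)" unfolding s' by (rule LeastI)
      have le: "s \<le> i" if "t < c + (\<Sum>j<Suc i. g j)" for i
        unfolding s' using that by (rule Least_le)
      show "s < d" using le[OF ex] d by simp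
      show "s = r \<longleftrightarrow> ?c \<le> t \<and> t < ?c + w I"
      proof
        assume sr: "s = r"
        have "?c \<le> t"
        proof (cases r)
          case 0
          then show ?thesis using ti by simp
        next
          case (Suc i)
          then have "\<not> t < c + (\<Sum>j<Suc i. g j)" using le[of i] sr by auto
          then show ?thesis using Suc by simp
        qed
        then show "?c \<le> t \<and> t < ?c + w I" using hit sr wI by simp
      next
        assume tr: "?c \<le> t \<and> t < ?c + w I"
        then have "s \<le> r" using le[of r] wI by simp
        moreover have "\<not> s < r"
        proof
          assume "s < r"
          then have "(\<Sum>j<Suc s. g j) \<le> (\<Sum>j<r. g j)" using gmono[of "Suc s" r] r by simp
          then show False using hit tr by simp
        qed
        ultimately show "s = r" by simp
      qed
    qed
    have es: "e s = e r \<longleftrightarrow> s = r" if "s < d"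
      using e that r by (auto simp: bij_betw_def inj_on_def)
    show "fst (refine w e t (Suc n)) = I \<longleftrightarrow> ?c \<le> t \<and> t < ?c + w I"
    proof
      assume "fst (refine w e t (Suc n)) = I"
      then have "fst (refine w e t n) = I'" "e s = e r" using I' r by (auto simp: R)
      then show "?c \<le> t \<and> t < ?c + w I" using seq sd es by blast
    next
      assume tr: "?c \<le> t \<and> t < ?c + w I"
      then have "fst (refine w e t n) = I'" using ct(1)[OF t] top bot by simp
      then show "fst (refine w e t (Suc n)) = I" using seq tr I' r by (simp add: R)
    qed
    assume "fst (refine w e t (Suc n)) = I"
    then have eq: "fst (refine w e t n) = I'" "e s = e r" using I' r by (auto simp: R)
    then have "s = r" using sd es by blast
    then show "snd (refine w e t (Suc n)) = ?c"
      using eq(1) ct(2)[OF t eq(1)] by (simp add: R g_def)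
  qed
qed

lemma exists_cyl_measure:
  assumes cons: "consistent L w" and L: "finite L"
  obtains \<mu> where "\<mu> \<in> borel_prob L" "\<And>I. set I \<subseteq> L \<Longrightarrow> measure \<mu> (cyl L I) = w I"
proof -
  obtain e where "bij_betw e {0..<card L} L"
    using ex_bij_betw_nat_finite[OF L] by blast
  then have e: "bij_betw e {..<card L} L" by (simp add: atLeast0LessThan)
  define X where "X t n = fst (refine w e t (Suc n)) ! n" for t n
  have pre: "init_word (X t) n = fst (refine w e t n)" for t n
  proof (induction n)
    case 0
    then show ?case by (simp add: refine_def)
  next
    case (Suc n)
    have "fst (refine w e t (Suc n)) = fst (refine w e t n) @ [X t n]"
      unfolding X_def by (simp add: refine_Suc refine_step_def Let_def length_refine nth_append)
    then show ?case using Suc by (simp add: subword_def)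
  qed
  \<comment> \<open>These two facts together exclude an empty alphabet.\<close>
  have "w [] = 1" "w [] = (\<Sum>b\<in>L. w [b])"
    using cons unfolding consistent_def by (force dest: spec[of _ "[]"])+
  define M where "M = restrict_space lborel {0..<1::real}"
  have M: "space M = {0..<1}" "sets M = (\<inter>) {0..<1} ` sets borel"
    by (simp_all add: M_def space_restrict_space sets_restrict_space)
  have words: "fst (refine w e t n) \<in> words L n" if t: "0 \<le> t" "t < 1" for t n
  proof (induction n)
    case 0
    then show ?case by (simp add: refine_def)
  next
    case (Suc n)
    let ?I = "fst (refine w e t n)"
    obtain c where c: "fst (refine w e t n) = ?I \<longleftrightarrow> c \<le> t \<and> t < c + w ?I"
        "snd (refine w e t n) = c"
      using refine_interval[OF cons e Suc] t by blast
    define s where "s = (LEAST r. t < c + (\<Sum>j<Suc r. w (?I @ [e j])))"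
    have "(\<Sum>j<card L. w (?I @ [e j])) = w ?I"
      using sum.reindex_bij_betw[OF e, of "\<lambda>b. w (?I @ [b])"] cons Suc
      by (auto simp: consistent_def in_words_iff)
    moreover have "0 < card L"
    proof (rule ccontr)
      assume "\<not> 0 < card L"
      then have "L = {}" using L by simp
      then show False using \<open>w [] = 1\<close> \<open>w [] = (\<Sum>b\<in>L. w [b])\<close> by simp
    qed
    ultimately have "t < c + (\<Sum>j<Suc (card L - 1). w (?I @ [e j]))" using c by simp
    then have "s \<le> card L - 1" unfolding s_def by (rule Least_le)
    then have "e s \<in> L" using \<open>0 < card L\<close> e by (auto simp: bij_betw_def)
    moreover have "fst (refine w e t (Suc n)) = ?I @ [e s]"
      using c(2) by (simp add: refine_Suc refine_step_def Let_def s_def)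
    ultimately show ?case using Suc by (simp add: in_words_iff)
  qed
  have Xs: "X t \<in> seqs L" if "0 \<le> t" "t < 1" for t
    using words[OF that] unfolding seqs_iff X_def
    by (metis in_words_iff lessI nth_mem subset_code(1))
  \<comment> \<open>The preimage of a cylinder is a single interval, which gives the measurability
    of \<open>X\<close> and the weights of its law at once.\<close>
  have vim: "\<exists>c\<ge>0. c + w I \<le> 1 \<and> X -` cyl L I \<inter> space M = {c..<c + w I}" if I: "set I \<subseteq> L" for I
  proof -
    obtain c where c: "0 \<le> c" "c + w I \<le> 1" "\<And>t. 0 \<le> t \<Longrightarrow> t < 1 \<Longrightarrow>
        fst (refine w e t (length I)) = I \<longleftrightarrow> c \<le> t \<and> t < c + w I"
      using refine_interval[OF cons e, of I "length I"] I by (auto simp: in_words_iff)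
    have "X -` cyl L I \<inter> space M = {c..<c + w I}"
      using c Xs by (auto simp: M cyl_iff pre)
    then show ?thesis using c by blast
  qed
  have meas: "X \<in> measurable M (shift_borel L)"
  proof (rule measurable_shift_borel[OF L])
    fix I assume "set I \<subseteq> L"
    then obtain c where "0 \<le> c" "c + w I \<le> 1" "X -` cyl L I \<inter> space M = {c..<c + w I}"
      using vim by blast
    then show "X -` cyl L I \<inter> space M \<in> sets M"
      by (auto simp: M intro!: image_eqI[of _ _ "{c..<c + w I}"])
  qed (use Xs in \<open>auto simp: M\<close>)
  have emM: "emeasure M B = emeasure lborel B" if "B \<in> sets borel" "B \<subseteq> {0..<1}" for B
    unfolding M_def using that by (subst emeasure_restrict_space) auto
  interpret M: prob_space M
    by (rule prob_spaceI) (simp add: M emM)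
  define \<mu> where "\<mu> = distr M (shift_borel L) X"
  have "prob_space \<mu>" unfolding \<mu>_def by (rule M.prob_space_distr[OF meas])
  then have "\<mu> \<in> borel_prob L" by (simp add: borel_prob_def \<mu>_def)
  moreover have "measure \<mu> (cyl L I) = w I" if I: "set I \<subseteq> L" for I
  proof -
    obtain c where c: "0 \<le> c" "c + w I \<le> 1" "X -` cyl L I \<inter> space M = {c..<c + w I}"
      using vim[OF I] by blast
    have "0 < w I" using cons I by (simp add: consistent_def)
    have "measure \<mu> (cyl L I) = measure M {c..<c + w I}"
      unfolding \<mu>_def using c(3) meas cyl_sets[OF I] by (simp add: measure_distr)
    also have "\<dots> = w I"
      unfolding measure_def using c \<open>0 < w I\<close> by (subst emM) auto
    finally show ?thesis .
  qed
  ultimately show ?thesis using that by blast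
qed

section \<open>Entropy of finite-valued maps\<close>

text \<open>Shannon entropy, in natural units, of the partition into the level sets of
  \<open>X\<close>. With maps in place of partitions, a join becomes a pair and refinement becomes
  functional dependence.\<close>

definition sf_entropy :: "'b measure \<Rightarrow> ('b \<Rightarrow> 'c) \<Rightarrow> real" where
  "sf_entropy M X = - (\<Sum>v\<in>X ` space M.
     measure M (X -` {v} \<inter> space M) * ln (measure M (X -` {v} \<inter> space M)))"

lemma sf_entropy_cong:
  assumes "\<And>x. x \<in> space M \<Longrightarrow> X x = Y x"
  shows "sf_entropy M X = sf_entropy M Y"
proof -
  have "X ` space M = Y ` space M" "X -` {v} \<inter> space M = Y -` {v} \<inter> space M" for v
    using assms by auto
  then show ?thesis by (simp add: sf_entropy_def)
qed

lemma simple_function_compose_measurable: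
  assumes "simple_function N X" "T \<in> measurable M N"
  shows "simple_function M (\<lambda>x. X (T x))"
  unfolding simple_function_def
proof (intro conjI ballI)
  have "(\<lambda>x. X (T x)) ` space M \<subseteq> X ` space N"
    using measurable_space[OF assms(2)] by auto
  then show "finite ((\<lambda>x. X (T x)) ` space M)"
    using simple_functionD(1)[OF assms(1)] finite_subset by blast
  fix v
  have "(\<lambda>x. X (T x)) -` {v} \<inter> space M = T -` (X -` {v} \<inter> space N) \<inter> space M"
    using measurable_space[OF assms(2)] by auto
  then show "(\<lambda>x. X (T x)) -` {v} \<inter> space M \<in> sets M"
    using measurable_sets[OF assms(2) simple_functionD(2)[OF assms(1)]] by simp
qed

context prob_space
begin

text \<open>The link to information theory in base e, from which the chain rule and the data
  processing inequality are taken.\<close>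

lemma sf_entropy_eq:
  assumes "simple_function M X"
  shows "sf_entropy M X = entropy (exp 1) (count_space (X ` space M)) X"
proof -
  interpret information_space M "exp 1" by standard simp
  show ?thesis
    unfolding entropy_simple_distributed[OF simple_distributedI[OF assms measure_nonneg refl]]
    by (simp add: sf_entropy_def log_def)
qed

lemma sf_entropy_nonneg: "0 \<le> sf_entropy M X"
proof -
  have "prob B * ln (prob B) \<le> 0" for B
  proof (cases "prob B = 0")
    case False
    then have "0 < prob B" using measure_nonneg[of M B] by linarith
    moreover from this have "ln (prob B) \<le> 0" by simp
    ultimately show ?thesis by (intro mult_nonneg_nonpos) auto
  qed simp
  then show ?thesis by (simp add: sf_entropy_def sum_nonpos)
qed

lemma sf_entropy_const: "sf_entropy M (\<lambda>_. c) = 0"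
proof -
  have "(\<lambda>_. c) ` space M = {c}" using not_empty by auto
  moreover have "(\<lambda>_. c) -` {c} \<inter> space M = space M" by auto
  ultimately show ?thesis using prob_space by (simp add: sf_entropy_def)
qed

lemma sf_entropy_Pair_le:
  assumes "simple_function M X" "simple_function M Y"
  shows "sf_entropy M (\<lambda>x. (X x, Y x)) \<le> sf_entropy M X + sf_entropy M Y"
proof -
  interpret information_space M "exp 1" by standard simp
  show ?thesis
    using entropy_chain_rule[OF assms] conditional_entropy_less_eq_entropy[OF assms(2,1)] assms
    by (simp add: sf_entropy_eq)
qed

text \<open>\<open>Y\<close> is a function of \<open>X\<close> on the space, and processing cannot
  increase entropy.\<close>

lemma sf_entropy_le:
  assumes X: "simple_function M X"
    and det: "\<And>x y. x \<in> space M \<Longrightarrow> y \<in> space M \<Longrightarrow> X x = X y \<Longrightarrow> Y x = Y y"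
  shows "sf_entropy M Y \<le> sf_entropy M X"
proof -
  interpret information_space M "exp 1" by standard simp
  define f where "f v = Y (SOME x. x \<in> space M \<and> X x = v)" for v
  have f: "(f \<circ> X) x = Y x" if "x \<in> space M" for x
  proof -
    have "\<exists>y. y \<in> space M \<and> X y = X x" using that by blast
    then have "(SOME y. y \<in> space M \<and> X y = X x) \<in> space M \<and>
        X (SOME y. y \<in> space M \<and> X y = X x) = X x"
      by (rule someI_ex)
    from det[OF conjunct1[OF this] that conjunct2[OF this]] show ?thesis by (simp add: f_def)
  qed
  have "sf_entropy M Y = sf_entropy M (f \<circ> X)"
    by (rule sf_entropy_cong) (rule f[symmetric])
  also have "\<dots> \<le> sf_entropy M X"
    using entropy_data_processing[OF X, of f] X simple_function_compose[OF X, of f]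
    by (simp add: sf_entropy_eq)
  finally show ?thesis .
qed

lemma sf_entropy_le_Pair:
  assumes X: "simple_function M X" and Y: "simple_function M Y"
    and det: "\<And>x y. x \<in> space M \<Longrightarrow> y \<in> space M \<Longrightarrow> X x = X y \<Longrightarrow> Y x = Y y \<Longrightarrow> Z x = Z y"
  shows "sf_entropy M Z \<le> sf_entropy M X + sf_entropy M Y"
proof -
  have "sf_entropy M Z \<le> sf_entropy M (\<lambda>x. (X x, Y x))"
  proof (rule sf_entropy_le[OF simple_function_Pair[OF X Y]])
    fix x y assume "x \<in> space M" "y \<in> space M" "(X x, Y x) = (X y, Y y)"
    then show "Z x = Z y" using det[of x y] by simp
  qed
  then show ?thesis using sf_entropy_Pair_le[OF X Y] by simp
qed

lemma sf_entropy_invariant: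
  assumes X: "simple_function M X" and T: "T \<in> measurable M M" "distr M M T = M"
  shows "sf_entropy M (\<lambda>x. X (T x)) = sf_entropy M X"
proof -
  have eq: "measure M ((\<lambda>x. X (T x)) -` {v} \<inter> space M) = measure M (X -` {v} \<inter> space M)" for v
  proof -
    have "(\<lambda>x. X (T x)) -` {v} \<inter> space M = T -` (X -` {v} \<inter> space M) \<inter> space M"
      using measurable_space[OF T(1)] by auto
    then have "measure M ((\<lambda>x. X (T x)) -` {v} \<inter> space M) = measure (distr M M T) (X -` {v} \<inter> space M)"
      using measure_distr[OF T(1) simple_functionD(2)[OF X]] by simp
    then show ?thesis using T(2) by simp
  qed
  have "(\<lambda>x. X (T x)) ` space M \<subseteq> X ` space M"
    using measurable_space[OF T(1)] by auto
  \<comment> \<open>Composition with \<open>T\<close> may miss values of \<open>X\<close>; these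
    have measure zero and contribute 0 * ln 0 = 0.\<close>
  moreover have "measure M (X -` {v} \<inter> space M) = 0"
    if "v \<notin> (\<lambda>x. X (T x)) ` space M" for v
  proof -
    have "(\<lambda>x. X (T x)) -` {v} \<inter> space M = {}" using that by auto
    then show ?thesis using eq[of v] by simp
  qed
  ultimately have "(\<Sum>v\<in>(\<lambda>x. X (T x)) ` space M.
      measure M (X -` {v} \<inter> space M) * ln (measure M (X -` {v} \<inter> space M))) =
      (\<Sum>v\<in>X ` space M. measure M (X -` {v} \<inter> space M) * ln (measure M (X -` {v} \<inter> space M)))"
    using simple_functionD(1)[OF X] by (intro sum.mono_neutral_left) auto
  then show ?thesis by (simp add: sf_entropy_def eq)
qed

text \<open>With t the measure of the event, ln s \<le> s - 1 at s = 1/sqrt t gives -t ln t \<le> 2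
  sqrt t, and at s = 1/(1-t) it gives -(1-t) ln (1-t) \<le> t \<le> sqrt t. The resulting bound is
  monotone in \<delta>, unlike the binary entropy itself.\<close>

lemma sf_entropy_event:
  assumes D: "D \<in> sets M" and le: "prob D \<le> \<delta>"
  shows "sf_entropy M (\<lambda>x. x \<in> D) \<le> 3 * sqrt \<delta>"
proof -
  define t where "t = prob D"
  have t: "0 \<le> t" "t \<le> 1" "t \<le> \<delta>" using le by (auto simp: t_def)
  define h where "h s = - (s * ln s)" for s :: real
  have h0: "0 \<le> h s" if "0 \<le> s" "s \<le> 1" for s
    using that by (cases "s = 0") (auto simp: h_def mult_nonneg_nonpos)
  have v: "(\<lambda>x. x \<in> D) -` {True} \<inter> space M = D" "(\<lambda>x. x \<in> D) -` {False} \<inter> space M = space M - D"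
    using sets.sets_into_space[OF D] by auto
  have "sf_entropy M (\<lambda>x. x \<in> D) = (\<Sum>v\<in>(\<lambda>x. x \<in> D) ` space M. h (prob ((\<lambda>x. x \<in> D) -` {v} \<inter> space M)))"
    by (simp add: sf_entropy_def h_def sum_negf)
  also have "\<dots> \<le> (\<Sum>v\<in>{True, False}. h (prob ((\<lambda>x. x \<in> D) -` {v} \<inter> space M)))"
    by (intro sum_mono2 h0) auto
  also have "\<dots> = h t + h (1 - t)"
    using v prob_compl[OF D] by (simp add: t_def)
  finally have sum: "sf_entropy M (\<lambda>x. x \<in> D) \<le> h t + h (1 - t)" .
  have ht: "h t \<le> 2 * sqrt t"
  proof (cases "t = 0")
    case False
    then have tp: "0 < t" using t by simp
    have "ln (1 / sqrt t) \<le> 1 / sqrt t - 1" using tp by (intro ln_le_minus_one) simp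
    moreover have "ln (1 / sqrt t) = - (ln t / 2)" using tp by (simp add: ln_div ln_sqrt)
    ultimately have "- ln t \<le> 2 / sqrt t" by simp
    then have "t * (- ln t) \<le> t * (2 / sqrt t)" using tp by (intro mult_left_mono) auto
    also have "t * (2 / sqrt t) = 2 * sqrt t" using tp by (simp add: real_div_sqrt field_simps)
    finally show ?thesis by (simp add: h_def)
  qed (simp add: h_def)
  have h1t: "h (1 - t) \<le> t"
  proof (cases "t = 1")
    case False
    then have s: "0 < 1 - t" using t by simp
    have "ln (1 / (1 - t)) \<le> 1 / (1 - t) - 1" using s by (intro ln_le_minus_one) simp
    then have "- ln (1 - t) \<le> 1 / (1 - t) - 1" using s by (simp add: ln_div)
    then have "(1 - t) * (- ln (1 - t)) \<le> (1 - t) * (1 / (1 - t) - 1)"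
      using s by (intro mult_left_mono) auto
    also have "\<dots> = t" using s by (simp add: right_diff_distrib)
    finally show ?thesis by (simp add: h_def)
  qed (simp add: h_def)
  have "t \<le> sqrt t"
    using t by (metis real_sqrt_le_iff real_sqrt_pow2 power2_eq_square mult_left_le_one_le
        real_sqrt_le_1_iff real_sqrt_ge_0_iff)
  moreover have "sqrt t \<le> sqrt \<delta>" using t by simp
  ultimately show ?thesis using sum ht h1t by linarith
qed

end

section \<open>Entropy of the shift\<close>

definition orbit_name :: "('b \<Rightarrow> 'c) \<Rightarrow> ('b \<Rightarrow> 'b) \<Rightarrow> nat \<Rightarrow> 'b \<Rightarrow> 'c list" where
  "orbit_name g T n x = map (\<lambda>j. g ((T ^^ j) x)) [0..<n]"

text \<open>A partition viewed as a finite-valued map, so that its iterated joins become orbit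
  names.\<close>

definition atom :: "'b set set \<Rightarrow> 'b \<Rightarrow> 'b set" where
  "atom P x = (THE B. B \<in> P \<and> x \<in> B)"

lemma orbit_name_eq_iff:
  "orbit_name g T n x = orbit_name g T n y \<longleftrightarrow> (\<forall>j<n. g ((T ^^ j) x) = g ((T ^^ j) y))"
  by (auto simp: orbit_name_def list_eq_iff_nth_eq)

lemma orbit_name_Suc: "orbit_name g T (Suc n) x = orbit_name g T n x @ [g ((T ^^ n) x)]"
  by (simp add: orbit_name_def)

locale measure_preserving_system = prob_space M for M :: "'b measure" +
  fixes T :: "'b \<Rightarrow> 'b"
  assumes T_meas: "T \<in> measurable M M" and T_inv: "distr M M T = M"
begin

lemma funpow_meas: "(T ^^ n) \<in> measurable M M"
proof (induction n)
  case (Suc n)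
  then show ?case using measurable_comp[OF Suc T_meas] by (simp add: o_def)
qed (simp add: id_def)

lemma funpow_space: "x \<in> space M \<Longrightarrow> (T ^^ n) x \<in> space M"
  using measurable_space[OF funpow_meas] .

lemma simple_function_orbit_name:
  assumes "simple_function M g"
  shows "simple_function M (orbit_name g T n)"
proof (induction n)
  case (Suc n)
  have "simple_function M (\<lambda>x. g ((T ^^ n) x))"
    by (rule simple_function_compose_measurable[OF assms funpow_meas])
  from simple_function_compose[OF simple_function_Pair[OF Suc this], of "\<lambda>(l, v). l @ [v]"]
  show ?case by (simp add: o_def orbit_name_Suc [abs_def])
qed (simp add: orbit_name_def [abs_def])

lemma sf_entropy_funpow:
  assumes "simple_function M X"
  shows "sf_entropy M (\<lambda>x. X ((T ^^ n) x)) = sf_entropy M X"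
proof (induction n)
  case (Suc n)
  have "sf_entropy M (\<lambda>x. X ((T ^^ Suc n) x)) = sf_entropy M (\<lambda>x. X ((T ^^ n) (T x)))"
    by (simp add: funpow_swap1)
  also have "\<dots> = sf_entropy M (\<lambda>x. X ((T ^^ n) x))"
    by (rule sf_entropy_invariant[OF simple_function_compose_measurable[OF assms funpow_meas] T_meas T_inv])
  finally show ?case using Suc by simp
qed simp

text \<open>A name of length n+m is determined by the name of length n and the name of length m of
  the n-th iterate, and the latter has unchanged entropy by invariance.\<close>

lemma sf_entropy_orbit_name_subadditive:
  assumes "simple_function M g"
  shows "sf_entropy M (orbit_name g T (n + m)) \<le> sf_entropy M (orbit_name g T n) + sf_entropy M (orbit_name g T m)"
proof -
  note sf = simple_function_orbit_name[OF assms]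
  have "sf_entropy M (orbit_name g T (n + m)) \<le>
      sf_entropy M (orbit_name g T n) + sf_entropy M (\<lambda>x. orbit_name g T m ((T ^^ n) x))"
  proof (rule sf_entropy_le_Pair[OF sf simple_function_compose_measurable[OF sf funpow_meas]])
    fix x y assume xy: "orbit_name g T n x = orbit_name g T n y"
      "orbit_name g T m ((T ^^ n) x) = orbit_name g T m ((T ^^ n) y)"
    have "g ((T ^^ j) x) = g ((T ^^ j) y)" if "j < n + m" for j
    proof (cases "j < n")
      case False
      have "g ((T ^^ (j - n)) ((T ^^ n) x)) = g ((T ^^ (j - n)) ((T ^^ n) y))"
        using xy(2) that False by (auto simp: orbit_name_eq_iff)
      then show ?thesis using False by (metis add_diff_inverse_nat add.commute comp_apply funpow_add)
    qed (use xy(1) in \<open>auto simp: orbit_name_eq_iff\<close>)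
    then show "orbit_name g T (n + m) x = orbit_name g T (n + m) y"
      by (simp add: orbit_name_eq_iff)
  qed
  then show ?thesis using sf_entropy_funpow[OF sf] by simp
qed

lemma entropy_rate:
  assumes "simple_function M g"
  obtains l where "(\<lambda>n. sf_entropy M (orbit_name g T n) / real n) \<longlonglongrightarrow> l"
proof (rule fekete[of "\<lambda>n. sf_entropy M (orbit_name g T n)" 0])
  show "- (0 * real n) \<le> sf_entropy M (orbit_name g T n)" for n
    using sf_entropy_nonneg by simp
qed (rule sf_entropy_orbit_name_subadditive[OF assms], rule that)

lemma sf_entropy_orbit_name_le:
  assumes "simple_function M g"
  shows "sf_entropy M (orbit_name g T n) \<le> real n * sf_entropy M g"
proof (induction n)
  case 0
  have "orbit_name g T 0 = (\<lambda>_. [])" by (rule ext) (simp add: orbit_name_def)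
  then show ?case by (simp add: sf_entropy_const)
next
  case (Suc n)
  have "orbit_name g T 1 x = [g x]" for x by (simp add: orbit_name_def)
  then have "sf_entropy M (orbit_name g T 1) \<le> sf_entropy M g"
    by (intro sf_entropy_le assms) auto
  then show ?case
    using sf_entropy_orbit_name_subadditive[OF assms, of n 1] Suc by (simp add: algebra_simps)
qed

lemma atom_eq_iff:
  assumes "meas_partition M P" "x \<in> space M" "B \<in> P"
  shows "atom P x = B \<longleftrightarrow> x \<in> B"
proof -
  have P: "partition_on (space M) P" using assms(1) by (simp add: meas_partition_def)
  have ex: "\<exists>!B. B \<in> P \<and> x \<in> B"
    using partition_onD1[OF P] partition_onD2[OF P] assms(2)
    by (auto simp: disjoint_def)
  then show ?thesis
    unfolding atom_def using assms(3) theI'[OF ex] by auto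
qed

lemma atom_mem:
  assumes "meas_partition M P" "x \<in> space M"
  shows "atom P x \<in> P" "x \<in> atom P x"
proof -
  have P: "partition_on (space M) P" using assms(1) by (simp add: meas_partition_def)
  obtain B where B: "B \<in> P" "x \<in> B" using partition_onD1[OF P] assms(2) by auto
  then have "atom P x = B" using atom_eq_iff[OF assms] by simp
  then show "atom P x \<in> P" "x \<in> atom P x" using B by auto
qed

lemma simple_function_atom:
  assumes "meas_partition M P"
  shows "simple_function M (atom P)"
  unfolding simple_function_def
proof (intro conjI ballI)
  have P: "finite P" "P \<subseteq> sets M" using assms by (auto simp: meas_partition_def)
  have "atom P ` space M \<subseteq> P" using atom_mem[OF assms] by auto
  then show "finite (atom P ` space M)" using P(1) finite_subset by blast
  fix B assume "B \<in> atom P ` space M"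
  then have B: "B \<in> P" using atom_mem[OF assms] by auto
  then have "atom P -` {B} \<inter> space M = B"
    using atom_eq_iff[OF assms _ B] sets.sets_into_space[of B M] P(2) by auto
  then show "atom P -` {B} \<inter> space M \<in> sets M" using B P(2) by auto
qed

text \<open>A non-empty intersection of preimages of atoms is a level set of the orbit name;
  removing the empty set in \<open>iter_join\<close> matches the restriction to values actually
  taken.\<close>

lemma iter_join_eq:
  assumes P: "meas_partition M P"
  shows "iter_join M T P n =
    (\<lambda>v. orbit_name (atom P) T n -` {v} \<inter> space M) ` (orbit_name (atom P) T n ` space M)"
proof (intro equalityI subsetI)
  let ?N = "orbit_name (atom P) T n"
  fix B assume "B \<in> iter_join M T P n"
  then obtain f where f: "B = space M \<inter> (\<Inter>j<n. (T ^^ j) -` f j)" "\<And>j. j < n \<Longrightarrow> f j \<in> P" "B \<noteq> {}"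
    by (auto simp: iter_join_def)
  have iff: "y \<in> B \<longleftrightarrow> (\<forall>j<n. atom P ((T ^^ j) y) = f j)" if "y \<in> space M" for y
    using that f(1,2) atom_eq_iff[OF P funpow_space[OF that]] by auto
  obtain x where x: "x \<in> B" using f(3) by auto
  then have xs: "x \<in> space M" using f(1) by auto
  have "y \<in> B \<longleftrightarrow> y \<in> ?N -` {?N x} \<inter> space M" for y
  proof (cases "y \<in> space M")
    case True
    then show ?thesis using iff[OF True] iff[OF xs] x by (simp add: orbit_name_eq_iff)
  qed (simp add: f(1))
  then have "B = ?N -` {?N x} \<inter> space M" by (rule set_eqI)
  then show "B \<in> (\<lambda>v. ?N -` {v} \<inter> space M) ` (?N ` space M)" using xs by blast
next
  let ?N = "orbit_name (atom P) T n"
  fix B assume "B \<in> (\<lambda>v. ?N -` {v} \<inter> space M) ` (?N ` space M)"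
  then obtain x where x: "x \<in> space M" "B = ?N -` {?N x} \<inter> space M" by auto
  define f where "f j = atom P ((T ^^ j) x)" for j
  have fP: "f j \<in> P" for j using atom_mem[OF P funpow_space[OF x(1)]] by (simp add: f_def)
  have "y \<in> B \<longleftrightarrow> (\<forall>j<n. (T ^^ j) y \<in> f j)" if "y \<in> space M" for y
    using that x atom_eq_iff[OF P funpow_space[OF that] fP]
    by (auto simp: orbit_name_eq_iff f_def)
  then have "B = space M \<inter> (\<Inter>j<n. (T ^^ j) -` f j)" using x(2) by auto
  moreover have "B \<noteq> {}" using x by auto
  ultimately show "B \<in> iter_join M T P n" using fP unfolding iter_join_def by blast
qed

lemma partition_entropy_iter_join:
  assumes P: "meas_partition M P"
  shows "partition_entropy M (iter_join M T P n) = sf_entropy M (orbit_name (atom P) T n)"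
  unfolding partition_entropy_def iter_join_eq[OF P] sf_entropy_def
  by (subst sum.reindex) (auto simp: inj_on_def)

end

section \<open>Approximation by cylinder sets\<close>

text \<open>The sets visible in the first n letters, described through points rather than as unions
  of cylinders, which makes complements and unions immediate.\<close>

definition determined :: "'a set \<Rightarrow> nat \<Rightarrow> (nat \<Rightarrow> 'a) set \<Rightarrow> bool" where
  "determined L n C \<longleftrightarrow> C \<subseteq> seqs L \<and>
     (\<forall>x\<in>seqs L. \<forall>y\<in>seqs L. init_word x n = init_word y n \<longrightarrow> x \<in> C \<longrightarrow> y \<in> C)"

lemma determined_mono:
  assumes "determined L n C" "n \<le> m"
  shows "determined L m C"
proof -
  have "init_word x n = init_word y n" if "init_word x m = init_word y m" for x y :: "nat \<Rightarrow> 'a"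
    using that take_init_word[OF assms(2)] by metis
  then show ?thesis using assms(1) unfolding determined_def by blast
qed

lemma determined_sets:
  assumes "determined L n C" "finite L"
  shows "C \<in> sets (shift_borel L)"
proof -
  have "C = (\<Union>I\<in>(\<lambda>x. init_word x n) ` C. cyl L I)"
  proof (intro equalityI subsetI)
    fix x assume "x \<in> C"
    moreover from this have "x \<in> cyl L (init_word x n)"
      using assms(1) by (auto simp: determined_def cyl_iff)
    ultimately show "x \<in> (\<Union>I\<in>(\<lambda>x. init_word x n) ` C. cyl L I)" by blast
  next
    fix y assume "y \<in> (\<Union>I\<in>(\<lambda>x. init_word x n) ` C. cyl L I)"
    then obtain x where "x \<in> C" "y \<in> seqs L" "init_word y n = init_word x n"
      by (auto simp: cyl_iff)
    then show "y \<in> C" using assms(1) unfolding determined_def by (metis subsetD)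
  qed
  moreover have sub: "(\<lambda>x. init_word x n) ` C \<subseteq> words L n"
    using assms(1) init_word_in_words by (auto simp: determined_def)
  moreover have "finite ((\<lambda>x. init_word x n) ` C)"
    using finite_subset[OF sub] assms(2) by simp
  moreover have "cyl L I \<in> sets (shift_borel L)" if "I \<in> (\<lambda>x. init_word x n) ` C" for I
    using subsetD[OF sub that] by (intro cyl_sets) (simp add: in_words_iff)
  ultimately show ?thesis by (metis sets.finite_UN)
qed

lemma determined_UN:
  assumes "\<And>i. i \<in> S \<Longrightarrow> determined L n (C i)"
  shows "determined L n (\<Union>i\<in>S. C i)"
  using assms unfolding determined_def by blast

text \<open>Induction over the generated sigma-algebra: complements have the same symmetric
  difference, and a countable union is cut off at a finite stage and then approximated term by
  term.\<close>

lemma approx_determined: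
  assumes \<mu>: "\<mu> \<in> borel_prob L" and L: "finite L" and B: "B \<in> sets (shift_borel L)" and "0 < \<epsilon>"
  shows "\<exists>n C. determined L n C \<and> measure \<mu> ((B - C) \<union> (C - B)) < \<epsilon>"
  using B[unfolded sets_shift_borel[OF L]] \<open>0 < \<epsilon>\<close>
proof (induction arbitrary: \<epsilon>)
  case (Basic B)
  then obtain I where I: "B = cyl L I" by (auto simp: cyls_def)
  have "determined L (length I) B" by (auto simp: determined_def I cyl_iff)
  then show ?case using Basic by (intro exI[of _ "length I"] exI[of _ B]) auto
next
  case Empty
  then show ?case by (intro exI[of _ 0] exI[of _ "{}"]) (auto simp: determined_def)
next
  case (Compl B)
  then obtain n C where C: "determined L n C" "measure \<mu> ((B - C) \<union> (C - B)) < \<epsilon>" by blast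
  have "B \<subseteq> seqs L"
    using Compl.hyps sets.sets_into_space[of B "shift_borel L"] by (simp add: sets_shift_borel[OF L])
  then have "(seqs L - B - (seqs L - C)) \<union> (seqs L - C - (seqs L - B)) = (B - C) \<union> (C - B)"
    using C(1) by (auto simp: determined_def)
  moreover have "determined L n (seqs L - C)"
    using C(1) unfolding determined_def by (metis DiffD1 DiffD2 DiffI subsetI)
  ultimately show ?case using C(2) by metis
next
  case (Union B)
  interpret prob_space \<mu> using borel_probD[OF \<mu>] by simp
  have Bs: "B i \<in> sets \<mu>" for i
    using Union.hyps by (simp add: borel_probD(2)[OF \<mu>] sets_shift_borel[OF L])
  define U where "U N = (\<Union>i<N. B i)" for N
  have Us: "U N \<in> sets \<mu>" for N using Bs by (simp add: U_def)
  have "incseq U" by (auto simp: U_def incseq_def le_fun_def intro: order_less_le_trans)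
  then have "(\<lambda>N. prob (U N)) \<longlonglongrightarrow> prob (\<Union>N. U N)"
    using Us by (intro finite_Lim_measure_incseq) auto
  moreover have "(\<Union>N. U N) = (\<Union>i. B i)" by (auto simp: U_def)
  ultimately have "(\<lambda>N. prob (U N)) \<longlonglongrightarrow> prob (\<Union>i. B i)" by simp
  then have "\<forall>\<^sub>F N in sequentially. prob (\<Union>i. B i) - \<epsilon> / 2 < prob (U N)"
    using \<open>0 < \<epsilon>\<close> by (intro order_tendstoD) auto
  then obtain N where N: "prob (\<Union>i. B i) - \<epsilon> / 2 < prob (U N)"
    by (auto simp: eventually_sequentially)
  \<comment> \<open>Half of \<epsilon> pays for the tail of the union, the other half is shared by
    the N members kept; \<open>Suc N\<close> keeps the divisor positive.\<close>
  let ?\<delta> = "\<epsilon> / (2 * real (Suc N))"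
  have "\<forall>i. \<exists>n C. determined L n C \<and> prob ((B i - C) \<union> (C - B i)) < ?\<delta>"
    using Union.IH \<open>0 < \<epsilon>\<close> by (auto simp del: of_nat_Suc)
  then obtain n C where C: "\<And>i. determined L (n i) (C i)" "\<And>i. prob ((B i - C i) \<union> (C i - B i)) < ?\<delta>"
    by metis
  define m where "m = Max (n ` {..N})"
  define V where "V = (\<Union>i<N. C i)"
  have "determined L m V"
    unfolding V_def
  proof (rule determined_UN)
    fix i assume "i \<in> {..<N}"
    then show "determined L m (C i)" unfolding m_def by (intro determined_mono[OF C(1)] Max_ge) auto
  qed
  have Cs: "C i \<in> sets \<mu>" for i
    using determined_sets[OF C(1) L] by (simp add: borel_probD(2)[OF \<mu>])
  let ?D = "\<lambda>i. (B i - C i) \<union> (C i - B i)"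
  have "((\<Union>i. B i) - V) \<union> (V - (\<Union>i. B i)) \<subseteq> ((\<Union>i. B i) - U N) \<union> (\<Union>i<N. ?D i)"
    by (auto simp: U_def V_def)
  then have "prob (((\<Union>i. B i) - V) \<union> (V - (\<Union>i. B i))) \<le> prob (((\<Union>i. B i) - U N) \<union> (\<Union>i<N. ?D i))"
    using Bs Cs Us by (intro finite_measure_mono) auto
  also have "\<dots> \<le> prob ((\<Union>i. B i) - U N) + prob (\<Union>i<N. ?D i)"
    using Bs Cs Us by (intro measure_Un_le) auto
  also have "prob ((\<Union>i. B i) - U N) = prob (\<Union>i. B i) - prob (U N)"
    using Bs Us by (intro finite_measure_Diff) (auto simp: U_def)
  also have "prob (\<Union>i<N. ?D i) \<le> (\<Sum>i<N. prob (?D i))"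
    using Bs Cs by (intro finite_measure_subadditive_finite) auto
  also have "(\<Sum>i<N. prob (?D i)) \<le> (\<Sum>i<N. ?\<delta>)"
    using C(2) by (intro sum_mono less_imp_le)
  also have "(\<Sum>i<N. ?\<delta>) \<le> \<epsilon> / 2"
    using \<open>0 < \<epsilon>\<close> by (simp add: field_simps)
  finally have "prob (((\<Union>i. B i) - V) \<union> (V - (\<Union>i. B i))) < \<epsilon>" using N by simp
  then show ?case using \<open>determined L m V\<close> by blast
qed

section \<open>The Kolmogorov--Sinai theorem for the cylinder partition\<close>

lemma invariant_measuresD:
  assumes "\<mu> \<in> invariant_measures L" "finite L"
  shows "\<mu> \<in> borel_prob L" "measure_preserving_system \<mu> lshift"
proof -
  show \<mu>: "\<mu> \<in> borel_prob L" using assms(1) by (simp add: invariant_measures_def)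
  have "lshift \<in> measurable \<mu> \<mu>"
    using measurable_lshift[OF assms(2)]
    by (simp cong: measurable_cong_sets add: borel_probD(2)[OF \<mu>])
  then show "measure_preserving_system \<mu> lshift"
    using assms(1) borel_probD(1)[OF \<mu>]
    by (simp add: measure_preserving_system_def measure_preserving_system_axioms_def invariant_measures_def)
qed

lemma vimage_init_word: "I \<in> words L n \<Longrightarrow> (\<lambda>x. init_word x n) -` {I} \<inter> seqs L = cyl L I"
  by (auto simp: cyl_iff in_words_iff)

lemma simple_function_init_word:
  assumes \<mu>: "\<mu> \<in> borel_prob L" and "finite L"
  shows "simple_function \<mu> (\<lambda>x. init_word x n)"
  unfolding simple_function_def borel_probD(2,3)[OF \<mu>]
proof (intro conjI ballI)
  have sub: "(\<lambda>x. init_word x n) ` seqs L \<subseteq> words L n" using init_word_in_words by auto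
  then show "finite ((\<lambda>x. init_word x n) ` seqs L)"
    by (rule finite_subset) (simp add: assms(2))
  fix I assume "I \<in> (\<lambda>x. init_word x n) ` seqs L"
  then have "I \<in> words L n" using sub by auto
  then show "(\<lambda>x. init_word x n) -` {I} \<inter> seqs L \<in> sets (shift_borel L)"
    by (simp add: vimage_init_word cyl_sets in_words_iff)
qed

lemma sf_entropy_init_word:
  assumes \<mu>: "\<mu> \<in> borel_prob L" and "finite L"
  shows "sf_entropy \<mu> (\<lambda>x. init_word x n) = word_entropy L (\<lambda>I. measure \<mu> (cyl L I)) n"
proof -
  have sub: "(\<lambda>x. init_word x n) ` seqs L \<subseteq> words L n" using init_word_in_words by auto
  have "measure \<mu> (cyl L I) = 0" if "I \<in> words L n - (\<lambda>x. init_word x n) ` seqs L" for I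
  proof -
    have "x \<notin> cyl L I" for x
    proof
      assume "x \<in> cyl L I"
      then have "x \<in> seqs L" "I = init_word x n" using that by (auto simp: cyl_iff in_words_iff)
      then show False using that by blast
    qed
    then have "cyl L I = {}" by blast
    then show ?thesis by simp
  qed
  then have "(\<Sum>I\<in>(\<lambda>x. init_word x n) ` seqs L. measure \<mu> (cyl L I) * ln (measure \<mu> (cyl L I))) =
      (\<Sum>I\<in>words L n. measure \<mu> (cyl L I) * ln (measure \<mu> (cyl L I)))"
    using sub assms(2) by (intro sum.mono_neutral_left) auto
  moreover have "(\<Sum>I\<in>(\<lambda>x. init_word x n) ` seqs L. measure \<mu> (cyl L I) * ln (measure \<mu> (cyl L I))) =
      (\<Sum>I\<in>(\<lambda>x. init_word x n) ` seqs L. measure \<mu> ((\<lambda>x. init_word x n) -` {I} \<inter> seqs L) *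
         ln (measure \<mu> ((\<lambda>x. init_word x n) -` {I} \<inter> seqs L)))"
    using sub by (intro sum.cong refl) (auto simp: vimage_init_word)
  ultimately show ?thesis
    by (simp add: sf_entropy_def word_entropy_def borel_probD(3)[OF \<mu>])
qed

text \<open>The partition by the first letter attains the supremum. For another partition P, each
  atom agrees with a set determined by m letters outside a small error set. The P-name of length j
  is then a function of the first j + m letters and of the record of errors along the orbit, and
  this record adds entropy at most \<epsilon> per step.\<close>

theorem ks_entropy_shift:
  assumes \<mu>: "\<mu> \<in> invariant_measures L" and L: "finite L"
  shows "(\<lambda>n. word_entropy L (\<lambda>I. measure \<mu> (cyl L I)) n / real n) \<longlonglongrightarrow> ks_entropy \<mu> lshift"
proof -
  note \<mu>' = invariant_measuresD[OF \<mu> L]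
  note sp = borel_probD[OF \<mu>'(1)]
  interpret measure_preserving_system \<mu> lshift by (rule \<mu>'(2))
  define H where "H n = sf_entropy \<mu> (\<lambda>x. init_word x n)" for n
  note sfi = simple_function_init_word[OF \<mu>'(1) L]
  have Hname: "H n = sf_entropy \<mu> (orbit_name (\<lambda>x. x 0) lshift n)" for n
  proof -
    have "orbit_name (\<lambda>x. x 0) lshift n = (\<lambda>x :: nat \<Rightarrow> 'a. init_word x n)"
      by (rule ext) (simp add: orbit_name_def lshift_pow subword_def)
    then show ?thesis by (simp add: H_def)
  qed
  have Hsub: "H (n + m) \<le> H n + H m" for n m
  proof -
    have "simple_function \<mu> (\<lambda>x. hd (init_word x 1))"
      using simple_function_compose[OF sfi, of hd] by (simp add: o_def)
    then have "simple_function \<mu> (\<lambda>x. x 0)" by (simp add: subword_def)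
    from sf_entropy_orbit_name_subadditive[OF this] show ?thesis by (simp add: Hname)
  qed
  have "- (0 * real n) \<le> H n" for n using sf_entropy_nonneg by (simp add: H_def)
  with Hsub obtain h where h: "(\<lambda>n. H n / real n) \<longlonglongrightarrow> h"
    using fekete[of H 0] by blast
  have part: "\<exists>l\<le>h. (\<lambda>n. partition_entropy \<mu> (iter_join \<mu> lshift P n) / real n) \<longlonglongrightarrow> l"
    if P: "meas_partition \<mu> P" for P
  proof -
    note sfa = simple_function_atom[OF P]
    define b where "b n = sf_entropy \<mu> (orbit_name (atom P) lshift n)" for n
    obtain l where l: "(\<lambda>n. b n / real n) \<longlonglongrightarrow> l"
      using entropy_rate[OF sfa] unfolding b_def by blast
    have fin: "finite P" and Ps: "\<And>B. B \<in> P \<Longrightarrow> B \<in> sets (shift_borel L)"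
      using P sp by (auto simp: meas_partition_def)
    have "l \<le> h + \<epsilon>" if "0 < \<epsilon>" for \<epsilon>
    proof -
      \<comment> \<open>Chosen so that the error events, one per atom and each of entropy at most 3
        sqrt \<delta> = \<rho>, contribute at most \<epsilon> together.\<close>
      define \<rho> where "\<rho> = \<epsilon> / (real (card P) + 1)"
      define \<delta> where "\<delta> = (\<rho> / 3)\<^sup>2"
      have \<rho>: "0 < \<rho>" "real (card P) * \<rho> \<le> \<epsilon>"
        using \<open>0 < \<epsilon>\<close> by (auto simp: \<rho>_def field_simps)
      then have "sqrt \<delta> = \<rho> / 3" by (simp add: \<delta>_def del: power_divide)
      with \<rho> have \<delta>: "0 < \<delta>" "real (card P) * (3 * sqrt \<delta>) \<le> \<epsilon>"
        by (auto simp: \<delta>_def)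
      have "\<forall>B\<in>P. \<exists>n C. determined L n C \<and> prob ((B - C) \<union> (C - B)) < \<delta>"
        using approx_determined[OF \<mu>'(1) L Ps \<delta>(1)] by blast
      then obtain n C where C: "\<And>B. B \<in> P \<Longrightarrow> determined L (n B) (C B)"
          "\<And>B. B \<in> P \<Longrightarrow> prob ((B - C B) \<union> (C B - B)) < \<delta>"
        by metis
      define m where "m = Max (insert 0 (n ` P))"
      have Cm: "determined L m (C B)" if "B \<in> P" for B
        unfolding m_def using fin that by (intro determined_mono[OF C(1)] Max_ge) auto
      define D where "D B = (B - C B) \<union> (C B - B)" for B
      have Ds: "D B \<in> sets \<mu>" if "B \<in> P" for B
        using determined_sets[OF C(1)[OF that] L] Ps[OF that] sp by (auto simp: D_def)
      \<comment> \<open>\<open>E P x\<close> lists the atoms whose approximation errs at x; general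
        subsets \<open>S\<close> serve the induction that bounds its entropy.\<close>
      define E where "E S x = {B \<in> S. x \<in> D B}" for S x
      have sfD: "simple_function \<mu> (\<lambda>x. x \<in> D B)" if "B \<in> P" for B
      proof -
        have v: "(\<lambda>x. x \<in> D B) -` {True} \<inter> space \<mu> = D B"
            "(\<lambda>x. x \<in> D B) -` {False} \<inter> space \<mu> = space \<mu> - D B"
          using sets.sets_into_space[OF Ds[OF that]] by auto
        have "(\<lambda>x. x \<in> D B) -` {v} \<inter> space \<mu> \<in> sets \<mu>" for v
          using v Ds[OF that] by (cases v) auto
        then show ?thesis by (auto simp: simple_function_def)
      qed
      have E: "simple_function \<mu> (E S) \<and> sf_entropy \<mu> (E S) \<le> real (card S) * (3 * sqrt \<delta>)"
        if "S \<subseteq> P" for S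
        using finite_subset[OF that fin] that
      proof (induction S rule: finite_induct)
        case empty
        have "E {} = (\<lambda>_. {})" by (rule ext) (simp add: E_def)
        then show ?case by (simp add: sf_entropy_const)
      next
        case (insert B S)
        then have IH: "simple_function \<mu> (E S)" "sf_entropy \<mu> (E S) \<le> real (card S) * (3 * sqrt \<delta>)"
          and B: "B \<in> P" by auto
        have eq: "E (insert B S) x = (if x \<in> D B then insert B (E S x) else E S x)" for x
          by (auto simp: E_def)
        have "simple_function \<mu> (E (insert B S))"
          using simple_function_compose[OF simple_function_Pair[OF sfD[OF B] IH(1)],
              of "\<lambda>(v, s). if v then insert B s else s"]
          by (simp add: o_def eq [abs_def] cong: if_cong)
        moreover have "sf_entropy \<mu> (E (insert B S)) \<le> sf_entropy \<mu> (\<lambda>x. x \<in> D B) + sf_entropy \<mu> (E S)"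
          by (rule sf_entropy_le_Pair[OF sfD[OF B] IH(1)]) (simp add: eq)
        moreover have "sf_entropy \<mu> (\<lambda>x. x \<in> D B) \<le> 3 * sqrt \<delta>"
          using C(2)[OF B] by (intro sf_entropy_event Ds B) (simp add: D_def)
        ultimately show ?case using IH insert by (simp add: algebra_simps)
      qed
      have bound: "b j \<le> H j + H m + real j * \<epsilon>" for j
      proof -
        have "b j \<le> H (j + m) + sf_entropy \<mu> (orbit_name (E P) lshift j)"
          unfolding b_def H_def
        proof (rule sf_entropy_le_Pair[OF sfi simple_function_orbit_name])
          show "simple_function \<mu> (E P)" using E by simp
          fix x y assume xy: "x \<in> space \<mu>" "y \<in> space \<mu>" "init_word x (j + m) = init_word y (j + m)"
            "orbit_name (E P) lshift j x = orbit_name (E P) lshift j y"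
          have "atom P ((lshift ^^ i) x) = atom P ((lshift ^^ i) y)" if i: "i < j" for i
          proof -
            let ?x = "(lshift ^^ i) x" and ?y = "(lshift ^^ i) y"
            let ?B = "atom P ?x"
            have s: "?x \<in> seqs L" "?y \<in> seqs L" using xy(1,2) sp(3) by (auto intro: lshift_pow_seqs)
            have B: "?B \<in> P" "?x \<in> ?B" using atom_mem[OF P, of ?x] s sp(3) by auto
            have "init_word ?x m = init_word ?y m"
              using xy(3) i by (simp add: init_word_eq_iff lshift_pow)
            then have "?x \<in> C ?B \<longleftrightarrow> ?y \<in> C ?B"
              using Cm[OF B(1)] s unfolding determined_def by metis
            moreover have "E P ?x = E P ?y"
              using xy(4) i by (simp add: orbit_name_eq_iff)
            then have "?x \<in> D ?B \<longleftrightarrow> ?y \<in> D ?B" using B(1) unfolding E_def by blast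
            \<comment> \<open>Membership in an atom is membership in its approximation corrected by
              membership in the error set, and both agree for the two points.\<close>
            ultimately have "?y \<in> ?B" using B(2) by (auto simp: D_def)
            then show ?thesis using atom_eq_iff[OF P, of ?y ?B] B s sp(3) by auto
          qed
          then show "orbit_name (atom P) lshift j x = orbit_name (atom P) lshift j y"
            by (simp add: orbit_name_eq_iff)
        qed
        also have "H (j + m) \<le> H j + H m" by (rule Hsub)
        also have "sf_entropy \<mu> (orbit_name (E P) lshift j) \<le> real j * sf_entropy \<mu> (E P)"
          using E by (intro sf_entropy_orbit_name_le) simp
        also have "real j * sf_entropy \<mu> (E P) \<le> real j * \<epsilon>"
          using E[of P] \<delta>(2) by (intro mult_left_mono) auto
        finally show ?thesis by simp
      qed
      have "(\<lambda>j. H j / real j + H m / real j + \<epsilon>) \<longlonglongrightarrow> h + 0 + \<epsilon>"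
        by (intro tendsto_add h tendsto_const lim_const_over_n)
      moreover have "\<forall>\<^sub>F j in sequentially. b j / real j \<le> H j / real j + H m / real j + \<epsilon>"
        using eventually_ge_at_top[of 1]
      proof eventually_elim
        case (elim j)
        have "b j / real j \<le> (H j + H m + real j * \<epsilon>) / real j"
          using bound[of j] by (intro divide_right_mono) auto
        then show ?case using elim by (simp add: add_divide_distrib)
      qed
      ultimately show "l \<le> h + \<epsilon>"
        using tendsto_le[OF _ _ l] by fastforce
    qed
    then have "l \<le> h" by (rule field_le_epsilon)
    then show ?thesis using l by (auto simp: partition_entropy_iter_join[OF P] b_def)
  qed
  define P0 where "P0 = (\<lambda>b. cyl L [b]) ` L"
  have P0: "meas_partition \<mu> P0"
    unfolding meas_partition_def
  proof (intro conjI)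
    show "finite P0" using L by (simp add: P0_def)
    show "P0 \<subseteq> sets \<mu>" unfolding sp(2) by (auto simp: P0_def intro!: cyl_sets)
    show "partition_on (space \<mu>) P0"
      unfolding sp(3)
    proof (rule partition_onI)
      show "\<Union> P0 = seqs L" by (auto simp: P0_def cyl_def seqs_iff)
      show "disjnt p q" if "p \<in> P0" "q \<in> P0" "p \<noteq> q" for p q
        using that by (auto simp: P0_def disjnt_def cyl_def)
      have "cyl L [b] \<noteq> {}" if "b \<in> L" for b
        using that by (intro cyl_nonempty) auto
      then have "\<forall>p\<in>P0. p \<noteq> {}" by (simp add: P0_def)
      then show "{} \<notin> P0" by blast
    qed
  qed
  have "atom P0 x = cyl L [x 0]" if "x \<in> seqs L" for x
    using that atom_eq_iff[OF P0, of x "cyl L [x 0]"] sp(3) by (auto simp: P0_def cyl_def seqs_iff)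
  then have at: "atom P0 x = atom P0 y \<longleftrightarrow> x 0 = y 0" if "x \<in> seqs L" "y \<in> seqs L" for x y
    using that by (auto simp: cyl_def)
  have "sf_entropy \<mu> (orbit_name (atom P0) lshift n) = H n" for n
  proof -
    have "orbit_name (atom P0) lshift n x = orbit_name (atom P0) lshift n y \<longleftrightarrow> init_word x n = init_word y n"
      if "x \<in> seqs L" "y \<in> seqs L" for x y
      using that at[OF lshift_pow_seqs lshift_pow_seqs, of x y]
      by (simp add: orbit_name_eq_iff init_word_eq_iff lshift_pow)
    then show ?thesis
      unfolding H_def using sfi simple_function_orbit_name[OF simple_function_atom[OF P0]] sp(3)
      by (intro antisym sf_entropy_le) auto
  qed
  then have P0h: "(\<lambda>n. partition_entropy \<mu> (iter_join \<mu> lshift P0 n) / real n) \<longlonglongrightarrow> h"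
    using h by (simp add: partition_entropy_iter_join[OF P0])
  have "ks_entropy \<mu> lshift = h"
    unfolding ks_entropy_def
  proof (rule cSup_eq_maximum)
    show "h \<in> {lim (\<lambda>n. partition_entropy \<mu> (iter_join \<mu> lshift P n) / real n) |P. meas_partition \<mu> P}"
      using P0 limI[OF P0h] by blast
    fix y assume "y \<in> {lim (\<lambda>n. partition_entropy \<mu> (iter_join \<mu> lshift P n) / real n) |P. meas_partition \<mu> P}"
    then show "y \<le> h" using part limI by blast
  qed
  then show ?thesis
    using h by (simp add: H_def sf_entropy_init_word[OF \<mu>'(1) L])
qed

section \<open>Asymptotically additive potentials\<close>

lemma compact_space_shift_space: "finite L \<Longrightarrow> compact_space (shift_space L)"
  by (simp add: shift_space_def compact_space_product_topology compact_space_discrete_topology)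

lemma continuous_map_init_word:
  "continuous_map (shift_space L) euclideanreal (\<lambda>x. g (init_word x n))"
  unfolding continuous_map_def
proof (intro conjI allI impI)
  fix U :: "real set"
  have "{x \<in> seqs L. g (init_word x n) \<in> U} = (\<Union>I\<in>{I \<in> words L n. g I \<in> U}. cyl L I)"
  proof (intro equalityI subsetI)
    fix x assume x: "x \<in> {x \<in> seqs L. g (init_word x n) \<in> U}"
    then have "init_word x n \<in> {I \<in> words L n. g I \<in> U}" "x \<in> cyl L (init_word x n)"
      using init_word_in_words by (auto simp: cyl_iff)
    then show "x \<in> (\<Union>I\<in>{I \<in> words L n. g I \<in> U}. cyl L I)" by blast
  next
    fix x assume "x \<in> (\<Union>I\<in>{I \<in> words L n. g I \<in> U}. cyl L I)"
    then obtain I where "length I = n" "g I \<in> U" "x \<in> cyl L I" by (auto simp: in_words_iff)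
    then show "x \<in> {x \<in> seqs L. g (init_word x n) \<in> U}" by (auto simp: cyl_iff)
  qed
  then show "openin (shift_space L) {x \<in> seqs L. g (init_word x n) \<in> U}"
    by (auto intro!: openin_Union openin_cyl simp: in_words_iff)
qed simp

lemma borel_measurable_continuous_map:
  assumes "continuous_map (shift_space L) euclideanreal f"
  shows "f \<in> borel_measurable (shift_borel L)"
proof (rule borel_measurableI)
  fix U :: "real set" assume "open U"
  then have "openin (shift_space L) {x \<in> seqs L. f x \<in> U}"
    using openin_continuous_map_preimage[OF assms, of U] by simp
  moreover have "f -` U \<inter> space (shift_borel L) = {x \<in> seqs L. f x \<in> U}" by auto
  ultimately show "f -` U \<inter> space (shift_borel L) \<in> sets (shift_borel L)"
    unfolding shift_borel_def by (auto dest: openin_subset)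
qed

lemma continuous_map_bounded:
  assumes "continuous_map (shift_space L) euclideanreal f" "finite L"
  obtains B where "1 \<le> B" "\<And>x. x \<in> seqs L \<Longrightarrow> \<bar>f x\<bar> \<le> B"
proof -
  have "compactin euclideanreal (f ` seqs L)"
    using image_compactin[OF _ assms(1)] compact_space_shift_space[OF assms(2)]
    by (simp add: compact_space_def)
  then have "bounded (f ` seqs L)" by (simp add: compact_imp_bounded)
  then obtain B where "\<And>x. x \<in> seqs L \<Longrightarrow> \<bar>f x\<bar> \<le> B" by (auto simp: bounded_iff)
  then show ?thesis by (intro that[of "max 1 B"]) (auto intro: max.coboundedI2)
qed

text \<open>By compactness finitely many cylinders on which \<open>f\<close> varies little cover the
  space; the longest of their words gives \<open>m\<close>.\<close>

lemma continuous_map_uniform: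
  assumes f: "continuous_map (shift_space L) euclideanreal f" and L: "finite L" and "0 < \<delta>"
  obtains m where "\<And>x y. x \<in> seqs L \<Longrightarrow> y \<in> seqs L \<Longrightarrow> init_word x m = init_word y m \<Longrightarrow>
     \<bar>f x - f y\<bar> \<le> \<delta>"
proof -
  have "\<exists>n. \<forall>y\<in>cyl L (init_word x n). \<bar>f y - f x\<bar> < \<delta> / 2" if x: "x \<in> seqs L" for x
  proof -
    have "openin (shift_space L) {y \<in> seqs L. f y \<in> ball (f x) (\<delta> / 2)}"
      using openin_continuous_map_preimage[OF f, of "ball (f x) (\<delta> / 2)"] by simp
    moreover have "x \<in> {y \<in> seqs L. f y \<in> ball (f x) (\<delta> / 2)}" using x \<open>0 < \<delta>\<close> by simp
    ultimately obtain n where "cyl L (init_word x n) \<subseteq> {y \<in> seqs L. f y \<in> ball (f x) (\<delta> / 2)}"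
      by (rule openin_cyl_subset)
    then show ?thesis by (force simp: dist_real_def abs_minus_commute)
  qed
  then obtain n where n: "\<And>x y. x \<in> seqs L \<Longrightarrow> y \<in> cyl L (init_word x (n x)) \<Longrightarrow> \<bar>f y - f x\<bar> < \<delta> / 2"
    by metis
  let ?U = "(\<lambda>x. cyl L (init_word x (n x))) ` seqs L"
  have "openin (shift_space L) U" if "U \<in> ?U" for U
    using that init_word_in_words by (fastforce intro!: openin_cyl simp: in_words_iff)
  moreover have "seqs L \<subseteq> \<Union> ?U" by (auto simp: cyl_iff)
  ultimately have "\<exists>F. finite F \<and> F \<subseteq> ?U \<and> seqs L \<subseteq> \<Union> F"
    using compact_space_shift_space[OF L] unfolding compact_space_alt by meson
  then obtain F where F: "finite F" "F \<subseteq> ?U" "seqs L \<subseteq> \<Union> F" by blast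
  from finite_subset_image[OF F(1,2)] obtain K where
    K: "finite K" "K \<subseteq> seqs L" "F = (\<lambda>x. cyl L (init_word x (n x))) ` K" by blast
  define m where "m = Max (insert 0 (n ` K))"
  have "\<bar>f x - f y\<bar> \<le> \<delta>" if xy: "x \<in> seqs L" "y \<in> seqs L" "init_word x m = init_word y m" for x y
  proof -
    obtain z where z: "z \<in> K" "x \<in> cyl L (init_word z (n z))"
      using K(3) F(3) xy(1) by auto
    have "n z \<le> m" unfolding m_def using K(1) z(1) by (intro Max_ge) auto
    then have "init_word x (n z) = init_word y (n z)"
      using xy(3) take_init_word by metis
    then have "y \<in> cyl L (init_word z (n z))" using z(2) xy(2) by (simp add: cyl_iff)
    moreover have "z \<in> seqs L" using K(2) z(1) by auto
    ultimately have "\<bar>f x - f z\<bar> < \<delta> / 2" "\<bar>f y - f z\<bar> < \<delta> / 2"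
      using n z(2) by simp_all
    then show ?thesis by linarith
  qed
  then show ?thesis using that by blast
qed

lemma continuous_map_ln:
  assumes "continuous_map X euclideanreal f" "\<And>x. x \<in> topspace X \<Longrightarrow> 0 < f x"
  shows "continuous_map X euclideanreal (\<lambda>x. ln (f x))"
proof -
  have "continuous_map X (top_of_set {0<..}) f"
    using assms by (auto simp: continuous_map_in_subtopology)
  moreover have "continuous_map (top_of_set {0<..}) euclideanreal (ln :: real \<Rightarrow> real)"
    unfolding continuous_map_iff_continuous by (intro continuous_intros) auto
  ultimately show ?thesis
    using continuous_map_compose[of X _ f euclideanreal ln] by (simp add: o_def)
qed

text \<open>The upper limit in the definition controls only large n, whence \<open>N\<close>; before
  that the approximant may even vanish. The constant is raised to at least 1 so that its logarithm
  is nonnegative.\<close>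

lemma asymp_subadditive_approx:
  assumes as: "asymp_subadditive_pot L \<phi>" and pos: "\<And>n x. 1 \<le> n \<Longrightarrow> x \<in> seqs L \<Longrightarrow> 0 < \<phi> n x"
    and "0 < \<epsilon>"
  shows "\<exists>\<psi> c N. subadditive_pot L \<psi> \<and> 1 \<le> c \<and> 1 \<le> N \<and>
    (\<forall>x\<in>seqs L. \<forall>n\<ge>1. \<forall>m\<ge>1. \<psi> (n + m) x \<le> c * \<psi> n x * \<psi> m ((lshift ^^ n) x)) \<and>
    (\<forall>n\<ge>N. \<forall>x\<in>seqs L. 0 < \<psi> n x \<and> \<bar>ln (\<phi> n x) - ln (\<psi> n x)\<bar> \<le> \<epsilon> * real n)"
proof -
  obtain \<psi> where \<psi>: "subadditive_pot L \<psi>"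
    "limsup (\<lambda>n. ereal (1 / real n) * (SUP x\<in>seqs L. log_gap (\<phi> n x) (\<psi> n x))) \<le> ereal (\<epsilon> / 2)"
    using as \<open>0 < \<epsilon>\<close> unfolding asymp_subadditive_pot_def by (meson half_gt_zero)
  obtain c where c: "0 < c" "\<And>x n m. x \<in> seqs L \<Longrightarrow> 1 \<le> n \<Longrightarrow> 1 \<le> m \<Longrightarrow>
      \<psi> (n + m) x \<le> c * \<psi> n x * \<psi> m ((lshift ^^ n) x)"
    using \<psi>(1) unfolding subadditive_pot_def by blast
  have nn: "0 \<le> \<psi> n x" if "1 \<le> n" "x \<in> seqs L" for n x
    using \<psi>(1) that unfolding subadditive_pot_def by blast
  have c': "\<psi> (n + m) x \<le> max 1 c * \<psi> n x * \<psi> m ((lshift ^^ n) x)"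
    if "x \<in> seqs L" "1 \<le> n" "1 \<le> m" for x n m
  proof -
    have "c * (\<psi> n x * \<psi> m ((lshift ^^ n) x)) \<le> max 1 c * (\<psi> n x * \<psi> m ((lshift ^^ n) x))"
      using nn that lshift_pow_seqs[OF that(1), of n] by (intro mult_right_mono mult_nonneg_nonneg) auto
    then show ?thesis using c(2)[OF that] by (simp add: mult.assoc)
  qed
  have "ereal (\<epsilon> / 2) < ereal \<epsilon>" using \<open>0 < \<epsilon>\<close> by simp
  with \<psi>(2) have "limsup (\<lambda>n. ereal (1 / real n) * (SUP x\<in>seqs L. log_gap (\<phi> n x) (\<psi> n x))) < ereal \<epsilon>"
    by (rule order_le_less_trans)
  then have "\<forall>\<^sub>F n in sequentially.
      ereal (1 / real n) * (SUP x\<in>seqs L. log_gap (\<phi> n x) (\<psi> n x)) < ereal \<epsilon>"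
    by (rule Limsup_lessD)
  then obtain N where N: "\<And>n. N \<le> n \<Longrightarrow>
      ereal (1 / real n) * (SUP x\<in>seqs L. log_gap (\<phi> n x) (\<psi> n x)) < ereal \<epsilon>"
    unfolding eventually_sequentially by blast
  have "0 < \<psi> n x \<and> \<bar>ln (\<phi> n x) - ln (\<psi> n x)\<bar> \<le> \<epsilon> * real n"
    if n: "max 1 N \<le> n" and x: "x \<in> seqs L" for n x
  proof -
    have "ereal (1 / real n) * log_gap (\<phi> n x) (\<psi> n x) \<le>
        ereal (1 / real n) * (SUP x\<in>seqs L. log_gap (\<phi> n x) (\<psi> n x))"
      using x by (intro ereal_mult_left_mono SUP_upper) auto
    then have lt: "ereal (1 / real n) * log_gap (\<phi> n x) (\<psi> n x) < ereal \<epsilon>"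
      using N[of n] n by (meson max.bounded_iff order_le_less_trans)
    have \<phi>: "0 < \<phi> n x" using pos[OF _ x] n by simp
    have "\<psi> n x \<noteq> 0"
    proof
      assume "\<psi> n x = 0"
      then have "log_gap (\<phi> n x) (\<psi> n x) = \<infinity>" using \<phi> by (simp add: log_gap_def)
      then show False using lt n by simp
    qed
    then have "ereal (1 / real n * \<bar>ln (\<phi> n x) - ln (\<psi> n x)\<bar>) < ereal \<epsilon>"
      using lt \<phi> by (simp add: log_gap_def)
    then have "\<bar>ln (\<phi> n x) - ln (\<psi> n x)\<bar> \<le> \<epsilon> * real n"
      using n by (simp add: field_simps)
    then show ?thesis using \<open>\<psi> n x \<noteq> 0\<close> nn[OF _ x, of n] n by simp
  qed
  then show ?thesis
    using \<psi>(1) c' by (intro exI[of _ \<psi>] exI[of _ "max 1 c"] exI[of _ "max 1 N"]) auto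
qed

lemma asymp_subadditive_potI:
  assumes meas: "\<And>n. 1 \<le> n \<Longrightarrow> \<phi> n \<in> borel_measurable (shift_borel L)"
    and bdd: "\<And>n. 1 \<le> n \<Longrightarrow> bounded (\<phi> n ` seqs L)"
    and pos: "\<And>n x. 1 \<le> n \<Longrightarrow> x \<in> seqs L \<Longrightarrow> 0 < \<phi> n x"
    and ap: "\<And>\<epsilon>. 0 < \<epsilon> \<Longrightarrow> \<exists>C \<psi>. subadditive_pot L \<psi> \<and>
      (\<forall>n\<ge>1. \<forall>x\<in>seqs L. 0 < \<psi> n x \<and> \<bar>ln (\<phi> n x) - ln (\<psi> n x)\<bar> \<le> C + \<epsilon> * real n)"
  shows "asymp_subadditive_pot L \<phi>"
  unfolding asymp_subadditive_pot_def
proof (intro conjI allI impI)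
  fix \<epsilon> :: real assume \<epsilon>: "0 < \<epsilon>"
  then obtain C \<psi> where \<psi>: "subadditive_pot L \<psi>"
    "\<And>n x. 1 \<le> n \<Longrightarrow> x \<in> seqs L \<Longrightarrow> 0 < \<psi> n x \<and> \<bar>ln (\<phi> n x) - ln (\<psi> n x)\<bar> \<le> C + \<epsilon> / 2 * real n"
    using ap[of "\<epsilon> / 2"] by auto
  obtain M where M: "C / (\<epsilon> / 2) < real M" using reals_Archimedean2 by blast
  have "\<forall>\<^sub>F n in sequentially.
      ereal (1 / real n) * (SUP x\<in>seqs L. log_gap (\<phi> n x) (\<psi> n x)) \<le> ereal \<epsilon>"
    using eventually_ge_at_top[of "max 1 M"]
  proof eventually_elim
    case (elim n)
    have "C / (\<epsilon> / 2) < real n" using M elim by linarith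
    then have C: "C + \<epsilon> / 2 * real n \<le> \<epsilon> * real n" using \<epsilon> by (simp add: field_simps)
    have "(SUP x\<in>seqs L. log_gap (\<phi> n x) (\<psi> n x)) \<le> ereal (\<epsilon> * real n)"
    proof (rule SUP_least)
      fix x assume x: "x \<in> seqs L"
      show "log_gap (\<phi> n x) (\<psi> n x) \<le> ereal (\<epsilon> * real n)"
        using \<psi>(2)[of n x] pos[of n x] x elim C by (auto simp: log_gap_def)
    qed
    then have "ereal (1 / real n) * (SUP x\<in>seqs L. log_gap (\<phi> n x) (\<psi> n x))
        \<le> ereal (1 / real n) * ereal (\<epsilon> * real n)"
      by (intro ereal_mult_left_mono) auto
    then show ?case using elim by simp
  qed
  then have "limsup (\<lambda>n. ereal (1 / real n) * (SUP x\<in>seqs L. log_gap (\<phi> n x) (\<psi> n x))) \<le> ereal \<epsilon>"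
    by (rule Limsup_bounded)
  then show "\<exists>\<psi>. subadditive_pot L \<psi> \<and>
      limsup (\<lambda>n. ereal (1 / real n) * (SUP x\<in>seqs L. log_gap (\<phi> n x) (\<psi> n x))) \<le> ereal \<epsilon>"
    using \<psi>(1) by blast
qed (use meas bdd pos in \<open>auto intro: less_imp_le\<close>)

lemma C_asaD:
  assumes "C_asa L \<phi>" "1 \<le> n"
  shows "\<phi> n \<in> borel_measurable (shift_borel L)" "bounded (\<phi> n ` seqs L)"
    "x \<in> seqs L \<Longrightarrow> 0 < \<phi> n x"
  using assms by (auto simp: C_asa_def asymp_subadditive_pot_def)

lemma C_asa_inverse: "C_asa L \<phi> \<Longrightarrow> C_asa L (\<lambda>n x. 1 / \<phi> n x)"
  by (simp add: C_asa_def)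

text \<open>The logarithm is bounded above through \<phi>_n and below through 1/\<phi>_n, both of
  which the class requires to be bounded for every single n.\<close>

lemma C_asa_ln_bounded:
  assumes "C_asa L \<phi>"
  obtains b where "\<And>n x. 1 \<le> n \<Longrightarrow> x \<in> seqs L \<Longrightarrow> \<bar>ln (\<phi> n x)\<bar> \<le> b n"
proof -
  have "\<exists>b. \<forall>x\<in>seqs L. \<bar>ln (\<phi> n x)\<bar> \<le> b" if n: "1 \<le> n" for n
  proof -
    have "bounded ((\<lambda>x. 1 / \<phi> n x) ` seqs L)"
      using C_asaD(2)[OF C_asa_inverse[OF assms] n] .
    then obtain B' where B': "\<And>x. x \<in> seqs L \<Longrightarrow> \<bar>1 / \<phi> n x\<bar> \<le> B'"
      by (auto simp: bounded_iff)
    obtain B where B: "\<And>x. x \<in> seqs L \<Longrightarrow> \<bar>\<phi> n x\<bar> \<le> B"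
      using C_asaD(2)[OF assms n] by (auto simp: bounded_iff)
    have "\<bar>ln (\<phi> n x)\<bar> \<le> max B B'" if x: "x \<in> seqs L" for x
    proof -
      have p: "0 < \<phi> n x" using C_asaD(3)[OF assms n x] .
      have "ln (\<phi> n x) \<le> \<phi> n x" "ln (1 / \<phi> n x) \<le> 1 / \<phi> n x"
        using p by (auto intro!: less_imp_le ln_less_self)
      then have "ln (\<phi> n x) \<le> B" "- ln (\<phi> n x) \<le> B'"
        using B[OF x] B'[OF x] p by (simp_all add: ln_div)
      then show ?thesis by (auto simp: abs_le_iff le_max_iff_disj)
    qed
    then show ?thesis by blast
  qed
  then show ?thesis using that by metis
qed

text \<open>The sums \<open>ln \<psi>\<^bsub>n+1\<^esub>(x) + \<dots> + ln \<psi>\<^bsub>n+N\<^esub>(x)\<close> telescope in \<open>n\<close>, so that sub-additivity is only used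
  with blocks of the fixed length \<open>N\<close>.\<close>

lemma C_asa_le_birkhoff:
  assumes as: "C_asa L \<phi>" and L: "finite L" and "0 < \<epsilon>"
  obtains N0 where "1 \<le> N0" "\<And>N. N0 \<le> N \<Longrightarrow> \<exists>C. \<forall>n\<ge>1. \<forall>x\<in>seqs L.
     ln (\<phi> n x) \<le> (\<Sum>j<n. ln (\<phi> N ((lshift ^^ j) x))) / real N + \<epsilon> * real n + C"
proof -
  \<comment> \<open>Five parts: two in \<open>short\<close>, one for passing from u to ln \<psi> at
    length n + r, and two per block of length N, for ln c and for passing from ln \<psi>_N back to
    u_N.\<close>
  define \<eta> where "\<eta> = \<epsilon> / 5"
  have \<eta>: "0 < \<eta>" using \<open>0 < \<epsilon>\<close> by (simp add: \<eta>_def)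
  note pos = C_asaD(3)[OF as]
  define u where "u n x = ln (\<phi> n x)" for n x
  obtain b where b: "\<And>n x. 1 \<le> n \<Longrightarrow> x \<in> seqs L \<Longrightarrow> \<bar>u n x\<bar> \<le> b n"
    using C_asa_ln_bounded[OF as] unfolding u_def by blast
  have as0: "asymp_subadditive_pot L \<phi>" using as by (simp add: C_asa_def)
  obtain \<psi> c N1 where sub: "subadditive_pot L \<psi>" and c: "1 \<le> c" and N1: "1 \<le> N1"
    and \<psi>: "\<And>x n m. x \<in> seqs L \<Longrightarrow> 1 \<le> n \<Longrightarrow> 1 \<le> m \<Longrightarrow> \<psi> (n + m) x \<le> c * \<psi> n x * \<psi> m ((lshift ^^ n) x)"
    and \<psi>u: "\<And>n x. N1 \<le> n \<Longrightarrow> x \<in> seqs L \<Longrightarrow> 0 < \<psi> n x \<and> \<bar>u n x - ln (\<psi> n x)\<bar> \<le> \<eta> * real n"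
    using asymp_subadditive_approx[OF as0 pos \<eta>] unfolding u_def by auto
  have pos': "0 < 1 / \<phi> n x" if "1 \<le> n" "x \<in> seqs L" for n x using pos[OF that] by simp
  have as': "asymp_subadditive_pot L (\<lambda>n x. 1 / \<phi> n x)" using as by (simp add: C_asa_def)
  obtain \<psi>' c' N2 where sub': "subadditive_pot L \<psi>'" and c': "1 \<le> c'" and N2: "1 \<le> N2"
    and \<psi>': "\<And>x n m. x \<in> seqs L \<Longrightarrow> 1 \<le> n \<Longrightarrow> 1 \<le> m \<Longrightarrow> \<psi>' (n + m) x \<le> c' * \<psi>' n x * \<psi>' m ((lshift ^^ n) x)"
    and \<psi>u': "\<And>n x. N2 \<le> n \<Longrightarrow> x \<in> seqs L \<Longrightarrow> 0 < \<psi>' n x \<and> \<bar>ln (1 / \<phi> n x) - ln (\<psi>' n x)\<bar> \<le> \<eta> * real n"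
    using asymp_subadditive_approx[OF as' pos' \<eta>] by auto
  have \<psi>u'': "\<bar>u n x + ln (\<psi>' n x)\<bar> \<le> \<eta> * real n" if "N2 \<le> n" "x \<in> seqs L" for n x
    using \<psi>u'[OF that] pos[of n x] that N2 by (simp add: ln_div u_def abs_minus_commute add.commute)
  \<comment> \<open>From here on the sub-additivity constant is negligible over one block.\<close>
  obtain M where M: "ln c / \<eta> < real M" using reals_Archimedean2 by blast
  define N0 where "N0 = max M (max N1 N2)"
  have N0: "N1 \<le> N0" "N2 \<le> N0" "1 \<le> N0" "M \<le> N0" using N1 by (auto simp: N0_def)
  have "\<exists>C. \<forall>n\<ge>1. \<forall>x\<in>seqs L. u n x \<le> (\<Sum>j<n. u N ((lshift ^^ j) x)) / real N + \<epsilon> * real n + C"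
    if N: "N0 \<le> N" for N
  proof -
    have Npos: "0 < real N" using N N0 by simp
    have lnc: "ln c \<le> \<eta> * real N"
    proof -
      have "ln c / \<eta> \<le> real N" using M N0 N by simp
      then show ?thesis using \<eta> by (simp add: field_simps)
    qed
    have "\<exists>B. \<forall>r\<in>{1..N}. \<forall>x\<in>seqs L. \<psi>' r x \<le> B \<and> 1 \<le> B"
    proof -
      have "\<forall>r\<in>{1..N}. \<exists>B. 1 \<le> B \<and> (\<forall>x\<in>seqs L. \<bar>\<psi>' r x\<bar> \<le> B)"
        using sub' continuous_map_bounded[OF _ L] unfolding subadditive_pot_def
        by (metis atLeastAtMost_iff)
      then obtain B where B: "\<And>r. r \<in> {1..N} \<Longrightarrow> 1 \<le> B r \<and> (\<forall>x\<in>seqs L. \<bar>\<psi>' r x\<bar> \<le> B r)"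
        by metis
      have "\<psi>' r x \<le> 1 + (\<Sum>r\<in>{1..N}. B r) \<and> 1 \<le> 1 + (\<Sum>r\<in>{1..N}. B r)"
        if r: "r \<in> {1..N}" and x: "x \<in> seqs L" for r x
      proof -
        have nn: "0 \<le> B r" if "r \<in> {1..N}" for r using B[OF that] by simp
        have "\<psi>' r x \<le> B r" using B[OF r] x by (auto simp: abs_le_iff)
        also have "B r \<le> (\<Sum>r\<in>{1..N}. B r)" using r nn by (intro member_le_sum) auto
        finally show ?thesis using sum_nonneg[of "{1..N}" B] nn by simp
      qed
      then show ?thesis by blast
    qed
    then obtain B where B: "\<And>r x. r \<in> {1..N} \<Longrightarrow> x \<in> seqs L \<Longrightarrow> \<psi>' r x \<le> B \<and> 1 \<le> B" by blast
    \<comment> \<open>Here -\<Phi> enters: sub-additivity for 1/\<phi> says that appending r letters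
      cannot lower u by more than the stated error, so u at length n may be replaced by its average
      over the lengths n + r with r in {1..N}.\<close>
    have short: "u n x \<le> u (n + r) x + (ln c' + ln B) + \<eta> * (2 * real n + real N)"
      if n: "N0 \<le> n" and r: "r \<in> {1..N}" and x: "x \<in> seqs L" for n r x
    proof -
      have Tx: "(lshift ^^ n) x \<in> seqs L" using lshift_pow_seqs[OF x] .
      have n1: "1 \<le> n" using n N0 by simp
      have p: "0 < \<psi>' n x" "0 < \<psi>' (n + r) x" using \<psi>u'[OF _ x, of n] \<psi>u'[OF _ x, of "n + r"] n N0 by auto
      have le: "\<psi>' (n + r) x \<le> c' * \<psi>' n x * \<psi>' r ((lshift ^^ n) x)" using \<psi>'[OF x n1] r by simp
      have c'p: "0 < c' * \<psi>' n x" using c' p by simp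
      have pr: "0 < \<psi>' r ((lshift ^^ n) x)"
        using le p(2) c'p by (metis order_less_le_trans zero_less_mult_pos)
      have "ln (\<psi>' (n + r) x) \<le> ln (c' * \<psi>' n x * \<psi>' r ((lshift ^^ n) x))"
        using le p(2) by simp
      also have "\<dots> = ln c' + ln (\<psi>' n x) + ln (\<psi>' r ((lshift ^^ n) x))"
        using c' p pr by (simp add: ln_mult)
      also have "ln (\<psi>' r ((lshift ^^ n) x)) \<le> ln B" using B[OF r Tx] pr by simp
      finally have "ln (\<psi>' (n + r) x) \<le> ln c' + ln (\<psi>' n x) + ln B" by simp
      moreover have "\<bar>u (n + r) x + ln (\<psi>' (n + r) x)\<bar> \<le> \<eta> * (real n + real N)"
      proof -
        have "\<bar>u (n + r) x + ln (\<psi>' (n + r) x)\<bar> \<le> \<eta> * real (n + r)"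
          using \<psi>u''[OF _ x, of "n + r"] n N0 by linarith
        also have "\<dots> \<le> \<eta> * (real n + real N)" using \<eta> r by (intro mult_left_mono) auto
        finally show ?thesis .
      qed
      moreover have "\<bar>u n x + ln (\<psi>' n x)\<bar> \<le> \<eta> * real n" using \<psi>u''[OF _ x] n N0 by simp
      ultimately show ?thesis by (simp add: algebra_simps abs_le_iff)
    qed
    define S where "S n x = (\<Sum>r\<in>{1..N}. ln (\<psi> (n + r) x))" for n x
    have tel: "S n x \<le> S N0 x + (\<Sum>j\<in>{N0..<n}. ln c + ln (\<psi> N ((lshift ^^ Suc j) x)))"
      if n: "N0 \<le> n" and x: "x \<in> seqs L" for n x
      using n
    proof (induction rule: dec_induct)
      case (step n)
      have Tx: "(lshift ^^ Suc n) x \<in> seqs L" using lshift_pow_seqs[OF x] .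
      have p: "0 < \<psi> (Suc n) x" "0 < \<psi> (Suc n + N) x" "0 < \<psi> N ((lshift ^^ Suc n) x)"
        using \<psi>u[OF _ x, of "Suc n"] \<psi>u[OF _ x, of "Suc n + N"] \<psi>u[OF _ Tx, of N] N N0 step by auto
      have "\<psi> (Suc n + N) x \<le> c * \<psi> (Suc n) x * \<psi> N ((lshift ^^ Suc n) x)"
        using \<psi>[OF x, of "Suc n" N] N N0 by simp
      then have "ln (\<psi> (Suc n + N) x) \<le> ln (c * \<psi> (Suc n) x * \<psi> N ((lshift ^^ Suc n) x))"
        using p by (simp del: funpow.simps)
      also have "\<dots> = ln c + ln (\<psi> (Suc n) x) + ln (\<psi> N ((lshift ^^ Suc n) x))"
        using p c by (simp add: ln_mult del: funpow.simps)
      finally have 1: "ln (\<psi> (Suc n + N) x) - ln (\<psi> (Suc n) x) \<le> ln c + ln (\<psi> N ((lshift ^^ Suc n) x))"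
        by simp
      have shift: "S m x = (\<Sum>r<N. ln (\<psi> (m + Suc r) x))" for m
        unfolding S_def by (rule sum.reindex_bij_witness[of _ Suc "\<lambda>r. r - 1"]) auto
      have "S (Suc n) x - S n x = (\<Sum>r<N. ln (\<psi> (Suc n + Suc r) x) - ln (\<psi> (Suc n + r) x))"
        by (simp add: shift sum_subtractf)
      also have "\<dots> = ln (\<psi> (Suc n + N) x) - ln (\<psi> (Suc n) x)"
        using sum_lessThan_telescope[of "\<lambda>r. ln (\<psi> (Suc n + r) x)" N] by simp
      finally show ?case using 1 step by (simp del: funpow.simps)
    qed simp
    define B1 where "B1 = (\<Sum>n\<le>N0 + N. \<bar>b n\<bar>)"
    have B1: "\<bar>u n x\<bar> \<le> B1" if "1 \<le> n" "n \<le> N0 + N" "x \<in> seqs L" for n x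
    proof -
      have "\<bar>u n x\<bar> \<le> \<bar>b n\<bar>" using b[OF that(1,3)] by simp
      also have "\<dots> \<le> B1" unfolding B1_def using that(2) by (intro member_le_sum) auto
      finally show ?thesis .
    qed
    have B1nn: "0 \<le> B1" unfolding B1_def by (intro sum_nonneg) auto
    have uN: "\<bar>u N ((lshift ^^ j) x)\<bar> \<le> B1" if "x \<in> seqs L" for j x
      using B1[of N] N N0 lshift_pow_seqs[OF that] by simp
    \<comment> \<open>Large enough to settle n < N0 by crude bounds and to collect all terms that do
      not grow with n otherwise.\<close>
    define K where "K = \<bar>ln c' + ln B\<bar> + 4 * \<eta> * (real N0 + real N) + (real N0 + 3) * B1"
    have final: "u n x \<le> (\<Sum>j<n. u N ((lshift ^^ j) x)) / real N + \<epsilon> * real n + K"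
      if n: "1 \<le> n" and x: "x \<in> seqs L" for n x
    proof (cases "N0 \<le> n")
      case False
      have "\<bar>\<Sum>j<n. u N ((lshift ^^ j) x)\<bar> \<le> (\<Sum>j<n. B1)"
        using uN[OF x] by (intro order_trans[OF sum_abs] sum_mono)
      also have "\<dots> \<le> real N0 * B1" using False B1nn by (simp add: mult_right_mono)
      finally have s: "- (real N0 * B1) \<le> (\<Sum>j<n. u N ((lshift ^^ j) x))" by linarith
      have "real N0 * B1 / real N \<le> real N0 * B1 / 1"
        using B1nn N N0 by (intro divide_left_mono) auto
      then have "- (real N0 * B1) \<le> (- (real N0 * B1)) / real N" by simp
      also have "\<dots> \<le> (\<Sum>j<n. u N ((lshift ^^ j) x)) / real N"
        using s by (intro divide_right_mono) auto
      finally have "- (real N0 * B1) \<le> (\<Sum>j<n. u N ((lshift ^^ j) x)) / real N" .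
      moreover have "u n x \<le> B1" using B1[OF n _ x] False by (auto simp: abs_le_iff)
      moreover have "0 \<le> \<epsilon> * real n" "0 \<le> 4 * \<eta> * (real N0 + real N)" using \<open>0 < \<epsilon>\<close> \<eta> by auto
      ultimately show ?thesis using B1nn unfolding K_def by (simp add: distrib_right)
    next
      case True
      have "real N * u n x = (\<Sum>r\<in>{1..N}. u n x)" by simp
      also have "\<dots> \<le> (\<Sum>r\<in>{1..N}. ln (\<psi> (n + r) x) + (\<bar>ln c' + ln B\<bar> + \<eta> * (3 * real n + 2 * real N)))"
      proof (rule sum_mono)
        fix r assume r: "r \<in> {1..N}"
        have "u (n + r) x - ln (\<psi> (n + r) x) \<le> \<eta> * real (n + r)"
          using \<psi>u[OF _ x, of "n + r"] True N0 by (auto simp: abs_le_iff)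
        also have "\<dots> \<le> \<eta> * (real n + real N)" using \<eta> r by (intro mult_left_mono) auto
        finally show "u n x \<le> ln (\<psi> (n + r) x) + (\<bar>ln c' + ln B\<bar> + \<eta> * (3 * real n + 2 * real N))"
          using short[OF True r x] abs_ge_self[of "ln c' + ln B"] by (simp add: algebra_simps)
      qed
      also have "\<dots> = S n x + real N * (\<bar>ln c' + ln B\<bar> + \<eta> * (3 * real n + 2 * real N))"
        by (simp add: S_def sum.distrib)
      also have "S n x \<le> S N0 x + (\<Sum>j\<in>{N0..<n}. ln c + ln (\<psi> N ((lshift ^^ Suc j) x)))"
        by (rule tel[OF True x])
      also have "S N0 x \<le> (\<Sum>r\<in>{1..N}. B1 + \<eta> * (real N0 + real N))"
        unfolding S_def
      proof (rule sum_mono)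
        fix r assume r: "r \<in> {1..N}"
        have "ln (\<psi> (N0 + r) x) - u (N0 + r) x \<le> \<eta> * real (N0 + r)"
          using \<psi>u[OF _ x, of "N0 + r"] N0 by (auto simp: abs_le_iff)
        also have "\<dots> \<le> \<eta> * (real N0 + real N)" using \<eta> r by (intro mult_left_mono) auto
        finally show "ln (\<psi> (N0 + r) x) \<le> B1 + \<eta> * (real N0 + real N)"
          using B1[of "N0 + r" x] r x by (auto simp: abs_le_iff)
      qed
      also have "(\<Sum>j\<in>{N0..<n}. ln c + ln (\<psi> N ((lshift ^^ Suc j) x)))
          \<le> (\<Sum>j\<in>{N0..<n}. 2 * \<eta> * real N + u N ((lshift ^^ Suc j) x))"
      proof (rule sum_mono)
        fix j
        have "(lshift ^^ Suc j) x \<in> seqs L" using lshift_pow_seqs[OF x] .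
        then have "ln (\<psi> N ((lshift ^^ Suc j) x)) - u N ((lshift ^^ Suc j) x) \<le> \<eta> * real N"
          using \<psi>u[of N "(lshift ^^ Suc j) x"] N N0 by (auto simp: abs_le_iff simp del: funpow.simps)
        then show "ln c + ln (\<psi> N ((lshift ^^ Suc j) x)) \<le> 2 * \<eta> * real N + u N ((lshift ^^ Suc j) x)"
          using lnc by (simp del: funpow.simps)
      qed
      \<comment> \<open>The Birkhoff sum over the indices from N0 + 1 to n is completed to the one
        over j < n; the N0 + 2 terms exchanged are each at most \<open>B1\<close> in absolute
        value.\<close>
      also have "\<dots> \<le> real n * (2 * \<eta> * real N) + (\<Sum>j<n. u N ((lshift ^^ j) x)) + (real N0 + 2) * B1"
      proof -
        have "(\<Sum>j\<in>{N0..<n}. u N ((lshift ^^ Suc j) x)) = (\<Sum>j\<in>{Suc N0..<Suc n}. u N ((lshift ^^ j) x))"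
          by (simp only: sum.shift_bounds_Suc_ivl)
        also have "\<dots> = (\<Sum>j\<in>{..<Suc n}. u N ((lshift ^^ j) x)) - (\<Sum>j\<in>{..<Suc N0}. u N ((lshift ^^ j) x))"
          using sum.atLeastLessThan_concat[of 0 "Suc N0" "Suc n" "\<lambda>j. u N ((lshift ^^ j) x)"] True
          unfolding lessThan_atLeast0 by linarith
        also have "\<dots> \<le> (\<Sum>j<n. u N ((lshift ^^ j) x)) + B1 + (real N0 + 1) * B1"
        proof -
          have "\<bar>\<Sum>j<Suc N0. u N ((lshift ^^ j) x)\<bar> \<le> (\<Sum>j<Suc N0. B1)"
            using uN[OF x] by (intro order_trans[OF sum_abs] sum_mono)
          then have "- (\<Sum>j<Suc N0. u N ((lshift ^^ j) x)) \<le> (real N0 + 1) * B1"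
            by (simp add: abs_le_iff algebra_simps)
          moreover have "u N ((lshift ^^ n) x) \<le> B1" using uN[OF x, of n] by (simp add: abs_le_iff)
          ultimately show ?thesis by simp
        qed
        finally have 1: "(\<Sum>j\<in>{N0..<n}. u N ((lshift ^^ Suc j) x))
            \<le> (\<Sum>j<n. u N ((lshift ^^ j) x)) + (real N0 + 2) * B1"
          by (simp add: algebra_simps)
        have "real (n - N0) * (2 * \<eta> * real N) \<le> real n * (2 * \<eta> * real N)"
          using \<eta> by (intro mult_right_mono) auto
        then show ?thesis using 1 True by (simp add: sum.distrib of_nat_diff del: funpow.simps)
      qed
      finally have "real N * u n x \<le> real N * (B1 + \<eta> * (real N0 + real N)) +
          (real n * (2 * \<eta> * real N) + (\<Sum>j<n. u N ((lshift ^^ j) x)) + (real N0 + 2) * B1) +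
          real N * (\<bar>ln c' + ln B\<bar> + \<eta> * (3 * real n + 2 * real N))"
        by simp
      also have "(real N0 + 2) * B1 \<le> real N * ((real N0 + 2) * B1)"
        using mult_right_mono[of 1 "real N" "(real N0 + 2) * B1"] B1nn N N0 by simp
      finally have "real N * u n x \<le> real N * (B1 + \<eta> * (real N0 + real N)) +
          (real n * (2 * \<eta> * real N) + (\<Sum>j<n. u N ((lshift ^^ j) x)) + real N * ((real N0 + 2) * B1)) +
          real N * (\<bar>ln c' + ln B\<bar> + \<eta> * (3 * real n + 2 * real N))"
        by simp
      also have "\<dots> = real N * ((\<Sum>j<n. u N ((lshift ^^ j) x)) / real N + 5 * \<eta> * real n +
          (\<bar>ln c' + ln B\<bar> + \<eta> * (real N0 + 3 * real N) + (real N0 + 3) * B1))"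
        using Npos by (simp add: field_simps)
      finally have "u n x \<le> (\<Sum>j<n. u N ((lshift ^^ j) x)) / real N + 5 * \<eta> * real n +
          (\<bar>ln c' + ln B\<bar> + \<eta> * (real N0 + 3 * real N) + (real N0 + 3) * B1)"
        using Npos by simp
      moreover have "\<eta> * (real N0 + 3 * real N) \<le> 4 * \<eta> * (real N0 + real N)"
        using \<eta> by (simp add: distrib_left)
      ultimately show ?thesis by (simp add: K_def \<eta>_def)
    qed
    then show ?thesis by blast
  qed
  then show ?thesis using that[of N0] N0(3) unfolding u_def by blast
qed

text \<open>The lower bound is the upper bound for 1/\<phi>, which belongs to the same
  class.\<close>

lemma C_asa_birkhoff:
  assumes as: "C_asa L \<phi>" and L: "finite L" and "0 < \<epsilon>"
  obtains N0 where "1 \<le> N0" "\<And>N. N0 \<le> N \<Longrightarrow> \<exists>C. \<forall>n\<ge>1. \<forall>x\<in>seqs L.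
     \<bar>ln (\<phi> n x) - (\<Sum>j<n. ln (\<phi> N ((lshift ^^ j) x))) / real N\<bar> \<le> \<epsilon> * real n + C"
proof -
  obtain N1 where N1: "1 \<le> N1" "\<And>N. N1 \<le> N \<Longrightarrow> \<exists>C. \<forall>n\<ge>1. \<forall>x\<in>seqs L.
     ln (\<phi> n x) \<le> (\<Sum>j<n. ln (\<phi> N ((lshift ^^ j) x))) / real N + \<epsilon> * real n + C"
    by (rule C_asa_le_birkhoff[OF as L \<open>0 < \<epsilon>\<close>]) blast
  obtain N2 where N2: "1 \<le> N2" "\<And>N. N2 \<le> N \<Longrightarrow> \<exists>C. \<forall>n\<ge>1. \<forall>x\<in>seqs L.
     ln (1 / \<phi> n x) \<le> (\<Sum>j<n. ln (1 / \<phi> N ((lshift ^^ j) x))) / real N + \<epsilon> * real n + C"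
    by (rule C_asa_le_birkhoff[OF C_asa_inverse[OF as] L \<open>0 < \<epsilon>\<close>]) blast
  have "\<exists>C. \<forall>n\<ge>1. \<forall>x\<in>seqs L.
     \<bar>ln (\<phi> n x) - (\<Sum>j<n. ln (\<phi> N ((lshift ^^ j) x))) / real N\<bar> \<le> \<epsilon> * real n + C"
    if N: "max N1 N2 \<le> N" for N
  proof -
    obtain C1 where C1: "\<And>n x. 1 \<le> n \<Longrightarrow> x \<in> seqs L \<Longrightarrow>
        ln (\<phi> n x) \<le> (\<Sum>j<n. ln (\<phi> N ((lshift ^^ j) x))) / real N + \<epsilon> * real n + C1"
      using N1(2)[of N] N by auto
    obtain C2 where C2: "\<And>n x. 1 \<le> n \<Longrightarrow> x \<in> seqs L \<Longrightarrow>
        ln (1 / \<phi> n x) \<le> (\<Sum>j<n. ln (1 / \<phi> N ((lshift ^^ j) x))) / real N + \<epsilon> * real n + C2"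
      using N2(2)[of N] N by auto
    have ln1: "ln (1 / \<phi> n x) = - ln (\<phi> n x)" if "1 \<le> n" "x \<in> seqs L" for n x
      using C_asaD(3)[OF as that] by (simp add: ln_div)
    have "\<bar>ln (\<phi> n x) - (\<Sum>j<n. ln (\<phi> N ((lshift ^^ j) x))) / real N\<bar> \<le> \<epsilon> * real n + max C1 C2"
      if n: "1 \<le> n" and x: "x \<in> seqs L" for n x
    proof -
      have "(\<Sum>j<n. ln (1 / \<phi> N ((lshift ^^ j) x))) = - (\<Sum>j<n. ln (\<phi> N ((lshift ^^ j) x)))"
        unfolding sum_negf [symmetric] using N N1(1) by (intro sum.cong refl ln1 lshift_pow_seqs[OF x]) simp
      then have "- ln (\<phi> n x) \<le> - ((\<Sum>j<n. ln (\<phi> N ((lshift ^^ j) x))) / real N) + \<epsilon> * real n + C2"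
        using C2[OF n x] ln1[OF n x] by simp
      then show ?thesis using C1[OF n x] by linarith
    qed
    then show ?thesis by blast
  qed
  then show ?thesis using that[of "max N1 N2"] N1(1) by auto
qed

text \<open>\<phi>_N itself need not be continuous, but for large N its logarithm is within
  \<epsilon> N / 3 of that of a continuous approximant, to which compactness applies.\<close>

lemma C_asa_uniform:
  assumes as: "C_asa L \<phi>" and L: "finite L" and "0 < \<epsilon>"
  obtains N0 where "1 \<le> N0" "\<And>N. N0 \<le> N \<Longrightarrow> \<exists>m. \<forall>x\<in>seqs L. \<forall>y\<in>seqs L.
     init_word x m = init_word y m \<longrightarrow> \<bar>ln (\<phi> N x) - ln (\<phi> N y)\<bar> \<le> \<epsilon> * real N"
proof -
  have as0: "asymp_subadditive_pot L \<phi>" using as by (simp add: C_asa_def)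
  have "0 < \<epsilon> / 3" using \<open>0 < \<epsilon>\<close> by simp
  from asymp_subadditive_approx[OF as0 C_asaD(3)[OF as] this] obtain \<psi> c N1 where
    \<psi>: "subadditive_pot L \<psi>" "1 \<le> N1"
    "\<And>n x. N1 \<le> n \<Longrightarrow> x \<in> seqs L \<Longrightarrow> 0 < \<psi> n x \<and> \<bar>ln (\<phi> n x) - ln (\<psi> n x)\<bar> \<le> \<epsilon> / 3 * real n"
    by auto
  have "\<exists>m. \<forall>x\<in>seqs L. \<forall>y\<in>seqs L.
     init_word x m = init_word y m \<longrightarrow> \<bar>ln (\<phi> N x) - ln (\<phi> N y)\<bar> \<le> \<epsilon> * real N" if N: "N1 \<le> N" for N
  proof -
    have "continuous_map (shift_space L) euclideanreal (\<lambda>x. ln (\<psi> N x))"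
      using \<psi> N by (intro continuous_map_ln) (auto simp: subadditive_pot_def)
    moreover have "0 < \<epsilon> / 3 * real N" using \<open>0 < \<epsilon>\<close> N \<psi>(2) by simp
    ultimately obtain m where m: "\<And>x y. x \<in> seqs L \<Longrightarrow> y \<in> seqs L \<Longrightarrow> init_word x m = init_word y m \<Longrightarrow>
        \<bar>ln (\<psi> N x) - ln (\<psi> N y)\<bar> \<le> \<epsilon> / 3 * real N"
      using continuous_map_uniform[OF _ L] by blast
    have "\<bar>ln (\<phi> N x) - ln (\<phi> N y)\<bar> \<le> \<epsilon> * real N"
      if "x \<in> seqs L" "y \<in> seqs L" "init_word x m = init_word y m" for x y
      using m[OF that] \<psi>(3)[OF N that(1), THEN conjunct2] \<psi>(3)[OF N that(2), THEN conjunct2] by linarith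
    then show ?thesis by blast
  qed
  then show ?thesis using that \<psi>(2) by blast
qed

section \<open>Birkhoff sums of functions of finitely many letters\<close>

lemma sum_lessThan_add:
  fixes f :: "nat \<Rightarrow> real"
  shows "(\<Sum>j<n + m. f j) = (\<Sum>j<n. f j) + (\<Sum>j<m. f (n + j))"
  by (induction m) simp_all

text \<open>At most \<open>m\<close> indices are too close to the end for the good bound, and only
  these pay \<open>B\<close>.\<close>

lemma sum_tail_le:
  fixes f :: "nat \<Rightarrow> real"
  assumes "\<And>j. j < n \<Longrightarrow> j + m \<le> n \<Longrightarrow> f j \<le> e" "\<And>j. j < n \<Longrightarrow> f j \<le> B" "0 \<le> B" "0 \<le> e"
  shows "(\<Sum>j<n. f j) \<le> real n * e + real m * B"
proof -
  have "(\<Sum>j<n. f j) \<le> (\<Sum>j<n. e + (if n < j + m then B else 0))"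
    using assms by (intro sum_mono) (auto simp: not_less intro: add_increasing)
  also have "\<dots> = real n * e + (\<Sum>j\<in>{j \<in> {..<n}. n < j + m}. B)"
    by (subst sum.inter_filter) (simp_all add: sum.distrib)
  also have "(\<Sum>j\<in>{j \<in> {..<n}. n < j + m}. B) \<le> real m * B"
  proof -
    have "{j \<in> {..<n}. n < j + m} \<subseteq> {n - m..<n}" by auto
    from card_mono[OF _ this] have "card {j \<in> {..<n}. n < j + m} \<le> m" by simp
    then show ?thesis using \<open>0 \<le> B\<close> by (simp add: mult_right_mono)
  qed
  finally show ?thesis by simp
qed

text \<open>Windows that run over the end of the word are truncated, so \<open>h\<close> is also
  evaluated at words shorter than \<open>m\<close>.\<close>

definition window_weight :: "nat \<Rightarrow> ('a list \<Rightarrow> real) \<Rightarrow> 'a list \<Rightarrow> real" where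
  "window_weight m h I = exp (\<Sum>j<length I. h (take m (drop j I)))"

text \<open>Concatenation changes only the at most \<open>m\<close> windows that start in
  \<open>I\<close> and reach across the cut, each by at most 2B.\<close>

lemma almost_mult_window_weight:
  assumes h: "\<And>J. set J \<subseteq> L \<Longrightarrow> \<bar>h J\<bar> \<le> B"
  shows "almost_mult L (\<lambda>_. real m * (2 * B)) (window_weight m h)"
  unfolding almost_mult_def
proof (intro conjI allI impI)
  fix I J :: "'a list" assume IJ: "set I \<subseteq> L" "set J \<subseteq> L"
  have B: "0 \<le> B" using h[of "[]"] by simp
  have s: "set (take m (drop j K)) \<subseteq> L" if "set K \<subseteq> L" for j and K :: "'a list"
    using that by (meson order_trans set_drop_subset set_take_subset)
  have "(\<Sum>j<length (I @ J). h (take m (drop j (I @ J)))) =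
      (\<Sum>j<length I. h (take m (drop j (I @ J)))) + (\<Sum>j<length J. h (take m (drop j J)))"
    by (simp add: sum_lessThan_add)
  then have "\<bar>ln (window_weight m h (I @ J)) - ln (window_weight m h I) - ln (window_weight m h J)\<bar>
      = \<bar>\<Sum>j<length I. h (take m (drop j (I @ J))) - h (take m (drop j I))\<bar>"
    by (simp add: window_weight_def sum_subtractf)
  also have "\<dots> \<le> (\<Sum>j<length I. \<bar>h (take m (drop j (I @ J))) - h (take m (drop j I))\<bar>)"
    by (rule sum_abs)
  also have "\<dots> \<le> real (length I) * 0 + real m * (2 * B)"
  proof (rule sum_tail_le)
    fix j assume j: "j < length I"
    show "\<bar>h (take m (drop j (I @ J))) - h (take m (drop j I))\<bar> \<le> 2 * B"
    proof -
      have "\<bar>h (take m (drop j (I @ J)))\<bar> \<le> B" by (rule h[OF s]) (simp add: IJ)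
      moreover have "\<bar>h (take m (drop j I))\<bar> \<le> B" by (rule h[OF s]) (simp add: IJ)
      ultimately show ?thesis by linarith
    qed
    show "\<bar>h (take m (drop j (I @ J))) - h (take m (drop j I))\<bar> \<le> 0" if "j + m \<le> length I"
      using that by simp
  qed (use B in auto)
  finally show "\<bar>ln (window_weight m h (I @ J)) - ln (window_weight m h I) - ln (window_weight m h J)\<bar>
      \<le> real m * (2 * B)" by simp
qed (simp add: window_weight_def)

text \<open>Half of the rate pays for replacing log \<phi>_n by Birkhoff sums of (log \<phi>_N)/N,
  half for replacing log \<phi>_N by its value at the window extended by a fixed letter. N is fixed
  first and determines the window length m.\<close>

lemma C_asa_word_approx:
  assumes as: "C_asa L \<phi>" and L: "finite L" "L \<noteq> {}" and "0 < \<epsilon>"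
  obtains C G where "almost_mult L (\<lambda>_. C) G"
    "\<And>n x. 1 \<le> n \<Longrightarrow> x \<in> seqs L \<Longrightarrow> \<bar>ln (\<phi> n x) - ln (G (init_word x n))\<bar> \<le> C + \<epsilon> * real n"
proof -
  have \<epsilon>: "0 < \<epsilon> / 2" using \<open>0 < \<epsilon>\<close> by simp
  obtain N1 where N1: "1 \<le> N1" "\<And>N. N1 \<le> N \<Longrightarrow> \<exists>C. \<forall>n\<ge>1. \<forall>x\<in>seqs L.
     \<bar>ln (\<phi> n x) - (\<Sum>j<n. ln (\<phi> N ((lshift ^^ j) x))) / real N\<bar> \<le> \<epsilon> / 2 * real n + C"
    by (rule C_asa_birkhoff[OF as L(1) \<epsilon>]) blast
  obtain N2 where N2: "1 \<le> N2" "\<And>N. N2 \<le> N \<Longrightarrow> \<exists>m. \<forall>x\<in>seqs L. \<forall>y\<in>seqs L.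
     init_word x m = init_word y m \<longrightarrow> \<bar>ln (\<phi> N x) - ln (\<phi> N y)\<bar> \<le> \<epsilon> / 2 * real N"
    by (rule C_asa_uniform[OF as L(1) \<epsilon>]) blast
  define N where "N = max N1 N2"
  have N: "0 < real N" "1 \<le> N" using N1(1) by (auto simp: N_def)
  obtain C where C: "\<And>n x. 1 \<le> n \<Longrightarrow> x \<in> seqs L \<Longrightarrow>
     \<bar>ln (\<phi> n x) - (\<Sum>j<n. ln (\<phi> N ((lshift ^^ j) x))) / real N\<bar> \<le> \<epsilon> / 2 * real n + C"
    using N1(2)[of N] by (auto simp: N_def)
  obtain m where m: "\<And>x y. x \<in> seqs L \<Longrightarrow> y \<in> seqs L \<Longrightarrow> init_word x m = init_word y m \<Longrightarrow>
      \<bar>ln (\<phi> N x) - ln (\<phi> N y)\<bar> \<le> \<epsilon> / 2 * real N"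
    using N2(2)[of N] by (auto simp: N_def)
  obtain bb where bb: "\<And>n x. 1 \<le> n \<Longrightarrow> x \<in> seqs L \<Longrightarrow> \<bar>ln (\<phi> n x)\<bar> \<le> bb n"
    by (rule C_asa_ln_bounded[OF as]) blast
  obtain a0 where a0: "a0 \<in> L" using L(2) by auto
  define B where "B = bb N / real N"
  define h where "h J = ln (\<phi> N (ext_word a0 J)) / real N" for J
  define G where "G = window_weight m h"
  have uB: "\<bar>ln (\<phi> N x) / real N\<bar> \<le> B" if "x \<in> seqs L" for x
    using bb[OF N(2) that] N by (simp add: B_def divide_right_mono)
  have ext: "ext_word a0 J \<in> seqs L" if "set J \<subseteq> L" for J
    using ext_word_cyl[OF a0 that] cyl_subset by blast
  have h: "\<bar>h J\<bar> \<le> B" if "set J \<subseteq> L" for J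
    unfolding h_def by (rule uB[OF ext[OF that]])
  have B: "0 \<le> B" using h[of "[]"] by simp
  have am: "almost_mult L (\<lambda>_. real m * (2 * B)) G"
    unfolding G_def by (rule almost_mult_window_weight[OF h])
  have near: "\<bar>ln (\<phi> n x) - ln (G (init_word x n))\<bar> \<le> (\<bar>C\<bar> + real m * (2 * B)) + \<epsilon> * real n"
    if n: "1 \<le> n" and x: "x \<in> seqs L" for n x
  proof -
    let ?u = "\<lambda>j. ln (\<phi> N ((lshift ^^ j) x)) / real N"
    let ?h = "\<lambda>j. h (take m (drop j (init_word x n)))"
    have "\<bar>(\<Sum>j<n. ?u j) - (\<Sum>j<n. ?h j)\<bar> \<le> (\<Sum>j<n. \<bar>?u j - ?h j\<bar>)"
      unfolding sum_subtractf [symmetric] by (rule sum_abs)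
    also have "\<dots> \<le> real n * (\<epsilon> / 2) + real m * (2 * B)"
    proof (rule sum_tail_le)
      fix j assume j: "j < n"
      let ?J = "take m (drop j (init_word x n))"
      have J: "set ?J \<subseteq> L"
        using init_word_in_words[OF x, of n] unfolding in_words_iff
        by (meson order_trans set_drop_subset set_take_subset)
      have Tx: "(lshift ^^ j) x \<in> seqs L" by (rule lshift_pow_seqs[OF x])
      show "\<bar>?u j - ?h j\<bar> \<le> 2 * B" using uB[OF Tx] h[OF J] by linarith
      assume jm: "j + m \<le> n"
      have "?J = init_word ((lshift ^^ j) x) m"
        using jm by (simp add: list_eq_iff_nth_eq lshift_pow)
      then have "init_word (ext_word a0 ?J) m = init_word ((lshift ^^ j) x) m"
        using jm by (simp add: init_word_eq_iff ext_word_def)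
      from m[OF ext[OF J] Tx this]
      have "\<bar>ln (\<phi> N ((lshift ^^ j) x)) - ln (\<phi> N (ext_word a0 ?J))\<bar> \<le> \<epsilon> / 2 * real N"
        by (simp add: abs_minus_commute)
      then have "\<bar>ln (\<phi> N ((lshift ^^ j) x)) - ln (\<phi> N (ext_word a0 ?J))\<bar> / real N \<le> \<epsilon> / 2"
        using N by (simp add: pos_divide_le_eq)
      then show "\<bar>?u j - ?h j\<bar> \<le> \<epsilon> / 2"
        using N by (simp add: h_def diff_divide_distrib [symmetric])
    qed (use B \<epsilon> in auto)
    finally have "\<bar>(\<Sum>j<n. ?u j) - ln (G (init_word x n))\<bar> \<le> real n * (\<epsilon> / 2) + real m * (2 * B)"
      by (simp add: G_def window_weight_def)
    then show ?thesis
      using C[OF n x] by (simp add: sum_divide_distrib algebra_simps)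
  qed
  have "almost_mult L (\<lambda>_. \<bar>C\<bar> + real m * (2 * B)) G"
    by (rule almost_mult_mono[OF am]) simp
  then show ?thesis using that near by blast
qed

text \<open>The value 1 at the empty word takes the place of the meaningless index 0 and makes the
  empty word neutral for concatenation.\<close>

definition sup_weight :: "'a set \<Rightarrow> (nat \<Rightarrow> (nat \<Rightarrow> 'a) \<Rightarrow> real) \<Rightarrow> 'a list \<Rightarrow> real" where
  "sup_weight L \<phi> I = (if I = [] then 1 else (SUP x\<in>cyl L I. \<phi> (length I) x))"

lemma sup_weight_close:
  assumes L: "L \<noteq> {}" and I: "set I \<subseteq> L" "I \<noteq> []" and g: "0 < g"
    and b: "\<And>x. x \<in> cyl L I \<Longrightarrow> 0 < \<phi> (length I) x \<and> \<bar>ln (\<phi> (length I) x) - ln g\<bar> \<le> e"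
  shows "0 < sup_weight L \<phi> I" "\<bar>ln (sup_weight L \<phi> I) - ln g\<bar> \<le> e"
proof -
  have bb: "exp (- e) * g \<le> \<phi> (length I) x" "\<phi> (length I) x \<le> exp e * g" if "x \<in> cyl L I" for x
    using ln_close_bounds[OF _ g, of "\<phi> (length I) x" e] b[OF that] by auto
  obtain x0 where x0: "x0 \<in> cyl L I" using cyl_nonempty[OF L I(1)] by auto
  have bdd: "bdd_above (\<phi> (length I) ` cyl L I)" using bb by (auto intro!: bdd_aboveI2)
  have up: "sup_weight L \<phi> I \<le> exp e * g"
    using I(2) x0 bb by (auto simp: sup_weight_def intro!: cSUP_least)
  have "exp (- e) * g \<le> \<phi> (length I) x0" by (rule bb[OF x0])
  also have "\<dots> \<le> sup_weight L \<phi> I"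
    using I(2) x0 bdd by (auto simp: sup_weight_def intro!: cSUP_upper)
  finally have low: "exp (- e) * g \<le> sup_weight L \<phi> I" .
  show "0 < sup_weight L \<phi> I" using low g by (metis exp_gt_zero mult_pos_pos order_less_le_trans)
  show "\<bar>ln (sup_weight L \<phi> I) - ln g\<bar> \<le> e" by (rule ln_close_boundsI[OF g low up])
qed

lemma near_sup_weight:
  assumes L: "L \<noteq> {}" and G: "almost_mult L (\<lambda>_. C) G" and \<epsilon>: "0 \<le> \<epsilon>"
    and pos: "\<And>n x. 1 \<le> n \<Longrightarrow> x \<in> seqs L \<Longrightarrow> 0 < \<phi> n x"
    and b: "\<And>n x. 1 \<le> n \<Longrightarrow> x \<in> seqs L \<Longrightarrow> \<bar>ln (\<phi> n x) - ln (G (init_word x n))\<bar> \<le> C + \<epsilon> * real n"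
  shows "near L (\<lambda>n. C + \<epsilon> * real n) (sup_weight L \<phi>) G"
  unfolding near_def
proof (intro allI impI)
  fix I :: "'a list" assume I: "set I \<subseteq> L"
  have g: "0 < G I" using almost_mult_pos[OF G I] .
  show "0 < sup_weight L \<phi> I \<and> 0 < G I \<and> \<bar>ln (sup_weight L \<phi> I) - ln (G I)\<bar> \<le> C + \<epsilon> * real (length I)"
  proof (cases "I = []")
    case True
    \<comment> \<open>Splitting the empty word into two empty words shows that ln (G []) is at most
      C in absolute value.\<close>
    then show ?thesis using almost_multD[OF G, of "[]" "[]"] g by (simp add: sup_weight_def)
  next
    case False
    then have n: "1 \<le> length I" by (cases I) auto
    have "0 < \<phi> (length I) x \<and> \<bar>ln (\<phi> (length I) x) - ln (G I)\<bar> \<le> C + \<epsilon> * real (length I)"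
      if "x \<in> cyl L I" for x
      using that b[OF n, of x] pos[OF n, of x] by (simp add: cyl_iff)
    from sup_weight_close[of L I "G I" \<phi> "C + \<epsilon> * real (length I)", OF L I False g this]
    show ?thesis using g by blast
  qed
qed

lemma tempered_sup_weight:
  assumes as: "C_asa L \<phi>" and L: "finite L" "L \<noteq> {}"
  shows "tempered L (sup_weight L \<phi>)"
  unfolding tempered_def
proof (intro allI impI)
  fix \<epsilon> :: real assume \<epsilon>: "0 < \<epsilon>"
  obtain C G where CG: "almost_mult L (\<lambda>_. C) G"
    "\<And>n x. 1 \<le> n \<Longrightarrow> x \<in> seqs L \<Longrightarrow> \<bar>ln (\<phi> n x) - ln (G (init_word x n))\<bar> \<le> C + \<epsilon> * real n"
    by (rule C_asa_word_approx[OF as L \<epsilon>]) blast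
  have "near L (\<lambda>n. C + \<epsilon> * real n) (sup_weight L \<phi>) G"
    using \<epsilon> by (intro near_sup_weight[OF L(2) CG(1) _ C_asaD(3)[OF as] CG(2)]) auto
  then show "\<exists>C G. almost_mult L (\<lambda>_. C) G \<and> near L (\<lambda>n. C + \<epsilon> * real n) (sup_weight L \<phi>) G"
    using CG(1) by blast
qed

text \<open>Bounded distortion replaces each supremum by the value at one point, at cost ln d for
  each of \<open>I\<close>, \<open>J\<close> and \<open>I @ J\<close>; almost additivity along the
  orbit of that point costs ln c.\<close>

lemma almost_mult_sup_weight:
  assumes aa: "C_aa L \<phi>" and bd: "bounded_distortion L \<phi>" and L: "L \<noteq> {}"
  obtains C where "almost_mult L (\<lambda>_. C) (sup_weight L \<phi>)"
proof -
  have pos: "0 < \<phi> n x" if "1 \<le> n" "x \<in> seqs L" for n x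
    using aa that by (auto simp: C_aa_def)
  obtain c where c: "0 < c" "\<And>x n m. x \<in> seqs L \<Longrightarrow> 1 \<le> n \<Longrightarrow> 1 \<le> m \<Longrightarrow>
      inverse c * \<phi> n x * \<phi> m ((lshift ^^ n) x) \<le> \<phi> (n + m) x \<and>
      \<phi> (n + m) x \<le> c * \<phi> n x * \<phi> m ((lshift ^^ n) x)"
    using aa unfolding C_aa_def by blast
  obtain d where d: "0 < d" "\<And>n I x y. 1 \<le> n \<Longrightarrow> I \<in> words L n \<Longrightarrow> x \<in> cyl L I \<Longrightarrow> y \<in> cyl L I \<Longrightarrow>
      inverse d * \<phi> n y \<le> \<phi> n x \<and> \<phi> n x \<le> d * \<phi> n y"
    using bd unfolding bounded_distortion_def by blast
  have cl: "0 < sup_weight L \<phi> I \<and> \<bar>ln (sup_weight L \<phi> I) - ln (\<phi> (length I) y)\<bar> \<le> ln d"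
    if I: "set I \<subseteq> L" "I \<noteq> []" and y: "y \<in> cyl L I" for I y
  proof -
    have n: "1 \<le> length I" using I(2) by (cases I) auto
    have p: "0 < \<phi> (length I) x" if "x \<in> cyl L I" for x using that cyl_subset pos[OF n] by blast
    have "\<bar>ln (\<phi> (length I) x) - ln (\<phi> (length I) y)\<bar> \<le> ln d" if x: "x \<in> cyl L I" for x
      using d(2)[OF n _ x y] I(1) p[OF y] d(1)
      by (intro ln_close_boundsI) (auto simp: in_words_iff exp_minus)
    then show ?thesis using sup_weight_close[of L I "\<phi> (length I) y" \<phi> "ln d", OF L I p[OF y]] p by blast
  qed
  \<comment> \<open>Needed when one of the words is empty; it follows by comparing the two sides of
    almost additivity at one point.\<close>
  have c0: "0 \<le> ln c"
  proof -
    obtain x where x: "x \<in> seqs L" using L ext_word_cyl[of _ L "[]"] by fastforce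
    have "0 < \<phi> 1 x * \<phi> 1 ((lshift ^^ 1) x)"
      by (intro mult_pos_pos pos x lshift_pow_seqs order_refl)
    moreover have "inverse c * (\<phi> 1 x * \<phi> 1 ((lshift ^^ 1) x)) \<le> c * (\<phi> 1 x * \<phi> 1 ((lshift ^^ 1) x))"
      using c(2)[OF x, of 1 1] by (simp add: mult.assoc)
    ultimately have "inverse c \<le> c" by (simp only: mult_le_cancel_right)
    then have "ln (inverse c) \<le> ln c" using c(1) by simp
    then show ?thesis using c(1) by (simp add: ln_inverse)
  qed
  have d0: "0 \<le> ln d"
  proof -
    obtain b0 where "b0 \<in> L" using L by auto
    moreover obtain x where "x \<in> cyl L [b0]" using cyl_nonempty[OF L, of "[b0]"] \<open>b0 \<in> L\<close> by auto
    ultimately have "\<bar>ln (sup_weight L \<phi> [b0]) - ln (\<phi> (Suc 0) x)\<bar> \<le> ln d"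
      using cl[of "[b0]" x] by simp
    then show ?thesis by linarith
  qed
  have "\<bar>ln (sup_weight L \<phi> (I @ J)) - ln (sup_weight L \<phi> I) - ln (sup_weight L \<phi> J)\<bar> \<le> ln c + 3 * ln d"
    if IJ: "set I \<subseteq> L" "set J \<subseteq> L" for I J
  proof (cases "I = [] \<or> J = []")
    case True
    then show ?thesis using c0 d0 by (auto simp: sup_weight_def)
  next
    case False
    then have n: "1 \<le> length I" "1 \<le> length J" by (auto simp: Suc_le_eq)
    obtain x where x: "x \<in> cyl L (I @ J)" using cyl_nonempty[OF L, of "I @ J"] IJ by auto
    have xs: "x \<in> seqs L" using x cyl_subset by blast
    have xI: "x \<in> cyl L I" using x by (auto simp: cyl_def nth_append split: if_splits)
    let ?y = "(lshift ^^ length I) x"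
    have ys: "?y \<in> seqs L" by (rule lshift_pow_seqs[OF xs])
    have "x (length I + j) = J ! j" if "j < length J" for j
    proof -
      have "x (length I + j) = (I @ J) ! (length I + j)" using x that by (simp add: cyl_def)
      then show ?thesis by simp
    qed
    then have yJ: "?y \<in> cyl L J" using ys by (simp add: cyl_def lshift_pow)
    have p: "0 < \<phi> (length I) x" "0 < \<phi> (length J) ?y" "0 < \<phi> (length I + length J) x"
      using pos n xs ys by auto
    have "\<bar>ln (\<phi> (length I + length J) x) - ln (\<phi> (length I) x * \<phi> (length J) ?y)\<bar> \<le> ln c"
      using c(2)[OF xs n] p c(1) by (intro ln_close_boundsI) (auto simp: exp_minus mult.assoc)
    moreover have "ln (\<phi> (length I) x * \<phi> (length J) ?y) = ln (\<phi> (length I) x) + ln (\<phi> (length J) ?y)"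
      using p by (simp add: ln_mult)
    moreover have "\<bar>ln (sup_weight L \<phi> (I @ J)) - ln (\<phi> (length I + length J) x)\<bar> \<le> ln d"
      using cl[of "I @ J" x] IJ False x by simp
    ultimately show ?thesis
      using cl[OF IJ(1) _ xI] cl[OF IJ(2) _ yJ] False by (simp add: abs_le_iff)
  qed
  moreover have "0 < sup_weight L \<phi> I" if I: "set I \<subseteq> L" for I
  proof (cases "I = []")
    case False
    obtain x where "x \<in> cyl L I" using cyl_nonempty[OF L I] by auto
    then show ?thesis using cl[OF I False] by blast
  qed (simp add: sup_weight_def)
  ultimately have "almost_mult L (\<lambda>_. ln c + 3 * ln d) (sup_weight L \<phi>)"
    by (simp add: almost_mult_def)
  then show ?thesis by (rule that)
qed

section \<open>The potentials \<open>\<phi>\<^sup>(\<^sup>i\<^sup>)\<close> and \<open>\<phi>\<^sup>a\<close> as functions of words\<close>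

text \<open>\<open>level_pot\<close> takes the supremum of powers, the word functions take the power
  of the supremum. Raising to s and to 1/s are both monotone, which gives the two
  inequalities.\<close>

lemma SUP_powr:
  fixes f :: "'b \<Rightarrow> real"
  assumes "S \<noteq> {}" "bdd_above (f ` S)" "\<And>x. x \<in> S \<Longrightarrow> 0 < f x" "0 < s"
  shows "(SUP x\<in>S. f x powr s) = (SUP x\<in>S. f x) powr s"
proof -
  obtain x0 where x0: "x0 \<in> S" using assms(1) by auto
  have le: "f x \<le> (SUP x\<in>S. f x)" if "x \<in> S" for x using assms(2) that by (rule cSUP_upper2) simp
  have p: "0 < (SUP x\<in>S. f x)" using le[OF x0] assms(3)[OF x0] by simp
  have ub: "f x powr s \<le> (SUP x\<in>S. f x) powr s" if "x \<in> S" for x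
    using le[OF that] assms(3)[OF that] assms(4) by (intro powr_mono2) auto
  have bdd: "bdd_above ((\<lambda>x. f x powr s) ` S)" using ub by (auto intro!: bdd_aboveI2)
  have le': "f x powr s \<le> (SUP x\<in>S. f x powr s)" if "x \<in> S" for x
    using bdd that by (rule cSUP_upper2) simp
  have p': "0 < (SUP x\<in>S. f x powr s)"
    using le'[OF x0] assms(3)[OF x0] by (metis order_less_le_trans powr_gt_zero less_irrefl)
  have "(SUP x\<in>S. f x) \<le> (SUP x\<in>S. f x powr s) powr (1 / s)"
  proof (rule cSUP_least[OF assms(1)])
    fix x assume x: "x \<in> S"
    have "f x = (f x powr s) powr (1 / s)" using assms(3)[OF x] assms(4) by (simp add: powr_powr)
    also have "\<dots> \<le> (SUP x\<in>S. f x powr s) powr (1 / s)"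
      using le'[OF x] assms(4) by (intro powr_mono2) auto
    finally show "f x \<le> (SUP x\<in>S. f x powr s) powr (1 / s)" .
  qed
  then have "(SUP x\<in>S. f x) powr s \<le> ((SUP x\<in>S. f x powr s) powr (1 / s)) powr s"
    using p assms(4) by (intro powr_mono2) auto
  also have "\<dots> = (SUP x\<in>S. f x powr s)" using assms(4) p' by (simp add: powr_powr)
  finally have low: "(SUP x\<in>S. f x) powr s \<le> (SUP x\<in>S. f x powr s)" .
  have "(SUP x\<in>S. f x powr s) \<le> (SUP x\<in>S. f x) powr s"
    by (rule cSUP_least[OF assms(1) ub])
  then show ?thesis using low by simp
qed

context factor_chain
begin

text \<open>Past position n a preimage of \<open>y\<close> can be continued letter by letter because
  \<open>p i\<close> is onto, so only the first n letters of \<open>y\<close> matter.\<close>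

lemma fiber_eq_cyl:
  assumes i: "i \<in> {1..k-1}" and y: "y \<in> seqs (A (Suc i))"
  shows "{I. I \<in> words (A i) n \<and> cyl (A i) I \<inter> {x \<in> seqs (A i). letterwise (p i) x = y} \<noteq> {}}
     = fiber (p i) (A i) (init_word y n)"
proof (intro equalityI subsetI)
  fix I assume "I \<in> {I. I \<in> words (A i) n \<and> cyl (A i) I \<inter> {x \<in> seqs (A i). letterwise (p i) x = y} \<noteq> {}}"
  then obtain x where x: "I \<in> words (A i) n" "x \<in> cyl (A i) I" "letterwise (p i) x = y" by auto
  have "map (p i) I = init_word y n"
    using x by (auto simp: list_eq_iff_nth_eq cyl_def in_words_iff letterwise_def)
  then show "I \<in> fiber (p i) (A i) (init_word y n)" using x(1) by (simp add: fiber_def)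
next
  fix I assume I: "I \<in> fiber (p i) (A i) (init_word y n)"
  note f = fiberD[OF I]
  have im: "y j \<in> p i ` A i" for j using y p_image[OF i] by (simp add: seqs_iff)
  define x where "x j = (if j < n then I ! j else inv_into (A i) (p i) (y j))" for j
  have "x j \<in> A i" for j
    using f(1,2) nth_mem[of j I] inv_into_into[OF im] by (auto simp: x_def)
  then have "x \<in> cyl (A i) I" using f(2) by (simp add: cyl_def seqs_iff x_def)
  moreover have "p i (x j) = y j" for j
  proof (cases "j < n")
    case True
    then have "p i (x j) = map (p i) I ! j" using f(2) by (simp add: x_def)
    then show ?thesis using f(3) True by simp
  qed (simp add: x_def f_inv_into_f[OF im])
  then have "letterwise (p i) x = y" by (simp add: letterwise_def)
  ultimately have "x \<in> cyl (A i) I \<inter> {x \<in> seqs (A i). letterwise (p i) x = y}"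
    using cyl_subset by blast
  moreover have "I \<in> words (A i) n" using f(1,2) by (simp add: in_words_iff)
  ultimately show "I \<in> {I. I \<in> words (A i) n \<and>
      cyl (A i) I \<inter> {x \<in> seqs (A i). letterwise (p i) x = y} \<noteq> {}}"
    by blast
qed

text \<open>The claims are proved together because the supremum on one level enters the sum of the
  next. The first leaves out i = 0, where \<phi>_n need not be constant on cylinders; from level 1
  on the suprema are over constants.\<close>

lemma level_pot_eq:
  assumes pos: "\<And>n x. 1 \<le> n \<Longrightarrow> x \<in> seqs (A 1) \<Longrightarrow> 0 < \<phi> n x"
    and bdd: "\<And>n. 1 \<le> n \<Longrightarrow> bounded (\<phi> n ` seqs (A 1))"
    and n: "1 \<le> n" and i: "i < k"
  shows "(i \<noteq> 0 \<longrightarrow> (\<forall>y\<in>seqs (A (Suc i)).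
       level_pot A p a \<phi> i n y = level_weight A p a (sup_weight (A 1) \<phi>) i (init_word y n))) \<and>
     (\<forall>I\<in>words (A (Suc i)) n. \<forall>s>0. (SUP x\<in>cyl (A (Suc i)) I. level_pot A p a \<phi> i n x powr s)
       = level_weight A p a (sup_weight (A 1) \<phi>) i I powr s) \<and>
     (\<forall>I\<in>words (A (Suc i)) n. level_word A p a \<phi> i I = level_weight A p a (sup_weight (A 1) \<phi>) i I)"
  using i
proof (induction i)
  case 0
  have b: "bdd_above (\<phi> n ` cyl (A 1) I)" for I
    using bdd[OF n] cyl_subset by (meson bounded_imp_bdd_above bounded_subset image_mono)
  have "(SUP x\<in>cyl (A 1) I. \<phi> n x) = sup_weight (A 1) \<phi> I" if "I \<in> words (A 1) n" for I
    using that n by (auto simp: sup_weight_def in_words_iff)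
  moreover have "(SUP x\<in>cyl (A 1) I. \<phi> n x powr s) = (SUP x\<in>cyl (A 1) I. \<phi> n x) powr s"
    if "I \<in> words (A 1) n" "0 < s" for I s
  proof (rule SUP_powr[OF _ b _ that(2)])
    show "cyl (A 1) I \<noteq> {}" using that by (intro cyl_nonempty) (auto simp: in_words_iff)
    show "0 < \<phi> n x" if "x \<in> cyl (A 1) I" for x using that cyl_subset by (intro pos[OF n]) blast
  qed
  ultimately show ?case by (simp add: level_word_def in_words_iff)
next
  case (Suc i)
  let ?F = "sup_weight (A 1) \<phi>"
  have i: "Suc i \<in> {1..k-1}" "i < k" using Suc.prems by auto
  have IH: "(SUP x\<in>cyl (A (Suc i)) I. level_pot A p a \<phi> i n x powr (1 / wsum a (Suc i)))
      = level_weight A p a ?F i I powr (1 / wsum a (Suc i))" if "I \<in> words (A (Suc i)) n" for I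
    using Suc.IH[OF i(2)] that wsum_pos[of "Suc i"] i by auto
  have pot: "level_pot A p a \<phi> (Suc i) n y = level_weight A p a ?F (Suc i) (init_word y n)"
    if y: "y \<in> seqs (A (Suc (Suc i)))" for y
    unfolding level_pot.simps level_weight.simps fiber_eq_cyl[OF i(1) y] push_def
    by (intro arg_cong2[where f = "(powr)"] sum.cong refl IH) (auto simp: fiber_def)
  have const: "(SUP x\<in>cyl (A (Suc (Suc i))) I. f (level_pot A p a \<phi> (Suc i) n x))
      = f (level_weight A p a ?F (Suc i) I)" if I: "I \<in> words (A (Suc (Suc i))) n" for I and f :: "real \<Rightarrow> real"
  proof -
    have "level_pot A p a \<phi> (Suc i) n x = level_weight A p a ?F (Suc i) I" if "x \<in> cyl (A (Suc (Suc i))) I" for x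
      using that I pot[of x] by (auto simp: cyl_iff in_words_iff)
    then have "(\<lambda>x. f (level_pot A p a \<phi> (Suc i) n x)) ` cyl (A (Suc (Suc i))) I
        = (\<lambda>x. f (level_weight A p a ?F (Suc i) I)) ` cyl (A (Suc (Suc i))) I"
      by (intro image_cong) auto
    moreover have "cyl (A (Suc (Suc i))) I \<noteq> {}"
      using I A_nonempty[of "Suc (Suc i)"] Suc.prems by (intro cyl_nonempty) (auto simp: in_words_iff)
    ultimately show ?thesis by simp
  qed
  have "level_word A p a \<phi> (Suc i) I = level_weight A p a ?F (Suc i) I" if "I \<in> words (A (Suc (Suc i))) n" for I
    using const[OF that, of "\<lambda>t. t"] that by (simp add: level_word_def in_words_iff)
  moreover have "(SUP x\<in>cyl (A (Suc (Suc i))) I. level_pot A p a \<phi> (Suc i) n x powr s)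
      = level_weight A p a ?F (Suc i) I powr s" if "I \<in> words (A (Suc (Suc i))) n" for I s
    using const[OF that, of "\<lambda>t. t powr s"] .
  ultimately show ?case using pot by blast
qed

lemma weighted_pot_eq:
  assumes pos: "\<And>n x. 1 \<le> n \<Longrightarrow> x \<in> seqs (A 1) \<Longrightarrow> 0 < \<phi> n x"
    and bdd: "\<And>n. 1 \<le> n \<Longrightarrow> bounded (\<phi> n ` seqs (A 1))"
    and n: "1 \<le> n" and I: "I \<in> words (A 1) n"
  shows "weighted_pot k A p a \<phi> I = gibbs_weight k A p a (sup_weight (A 1) \<phi>) I"
proof -
  have "level_word A p a \<phi> i (map (tau p i) I) = level_weight A p a (sup_weight (A 1) \<phi>) i (map (tau p i) I)"
    if i: "i < k" for i
  proof -
    have "map (tau p i) I \<in> words (A (Suc i)) n"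
      using I tau_mem[of i] i by (auto simp: in_words_iff)
    then show ?thesis using level_pot_eq[of \<phi>, OF pos bdd n i] by blast
  qed
  from this[of 0] this show ?thesis
    using k_pos by (auto simp: weighted_pot_def gibbs_weight_def intro!: prod.cong)
qed

end

section \<open>The variational principle\<close>

text \<open>Invariance need only be checked on cylinders, where the preimage under the shift is the
  union over all letters put in front.\<close>

lemma invariant_measureI:
  assumes \<mu>: "\<mu> \<in> borel_prob L" and L: "finite L"
    and w: "\<And>I. set I \<subseteq> L \<Longrightarrow> measure \<mu> (cyl L I) = w I"
    and inv: "\<And>I. set I \<subseteq> L \<Longrightarrow> (\<Sum>b\<in>L. w (b # I)) = w I"
  shows "\<mu> \<in> invariant_measures L"
proof -
  note sp = borel_probD[OF \<mu>]
  interpret prob_space \<mu> by (rule sp(1))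
  have T: "lshift \<in> measurable \<mu> \<mu>"
    using measurable_lshift[OF L] by (simp cong: measurable_cong_sets add: sp(2))
  have d: "distr \<mu> \<mu> lshift \<in> borel_prob L"
    using prob_space_distr[OF T] by (simp add: borel_prob_def sp(2))
  have "distr \<mu> \<mu> lshift = \<mu>"
  proof (rule measure_eq_cyl[OF d \<mu> L])
    fix I assume I: "set I \<subseteq> L"
    have "measure (distr \<mu> \<mu> lshift) (cyl L I) = measure \<mu> (lshift -` cyl L I \<inter> seqs L)"
      using cyl_sets[OF I] by (subst measure_distr[OF T]) (simp_all add: sp)
    also have "lshift -` cyl L I \<inter> seqs L = (\<Union>J\<in>(\<lambda>b. b # I) ` L. cyl L J)"
      by (simp add: lshift_vimage_cyl)
    also have "measure \<mu> \<dots> = (\<Sum>J\<in>(\<lambda>b. b # I) ` L. measure \<mu> (cyl L J))"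
      using L I by (intro measure_UN_cyl[OF \<mu>, of _ "Suc (length I)"]) (auto simp: in_words_iff)
    also have "\<dots> = (\<Sum>b\<in>L. w (b # I))"
      using I w by (subst sum.reindex) (auto simp: inj_on_def)
    finally show "measure (distr \<mu> \<mu> lshift) (cyl L I) = measure \<mu> (cyl L I)"
      using inv[OF I] w[OF I] by simp
  qed
  then show ?thesis using \<mu> by (simp add: invariant_measures_def)
qed

section \<open>Integrals of bounded functions and of functions of words\<close>

lemma integrable_bounded_measurable:
  fixes f :: "(nat \<Rightarrow> 'a) \<Rightarrow> real"
  assumes "\<mu> \<in> borel_prob L" "f \<in> borel_measurable (shift_borel L)" "\<And>x. x \<in> seqs L \<Longrightarrow> \<bar>f x\<bar> \<le> B"
  shows "integrable \<mu> f"
proof -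
  note sp = borel_probD[OF assms(1)]
  interpret prob_space \<mu> by (rule sp(1))
  have "f \<in> borel_measurable \<mu>" using assms(2) by (simp cong: measurable_cong_sets add: sp(2))
  then show ?thesis
    using assms(3) by (intro integrable_const_bound[of _ B]) (auto simp: sp(3))
qed

lemma integrable_word:
  fixes g :: "'a list \<Rightarrow> real"
  assumes "\<mu> \<in> borel_prob L" "finite L"
  shows "integrable \<mu> (\<lambda>x. g (init_word x n))"
proof -
  have c: "continuous_map (shift_space L) euclideanreal (\<lambda>x. g (init_word x n))"
    by (rule continuous_map_init_word)
  obtain B where "\<And>x. x \<in> seqs L \<Longrightarrow> \<bar>g (init_word x n)\<bar> \<le> B"
    by (rule continuous_map_bounded[OF c assms(2)]) blast
  then show ?thesis
    by (rule integrable_bounded_measurable[OF assms(1) borel_measurable_continuous_map[OF c]])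
qed

lemma integral_word:
  fixes g :: "'a list \<Rightarrow> real"
  assumes \<mu>: "\<mu> \<in> borel_prob L" and L: "finite L"
  shows "(\<integral>x. g (init_word x n) \<partial>\<mu>) = (\<Sum>I\<in>words L n. measure \<mu> (cyl L I) * g I)"
proof -
  note sp = borel_probD[OF \<mu>]
  interpret prob_space \<mu> by (rule sp(1))
  have "(\<integral>x. g (init_word x n) \<partial>\<mu>) = (\<integral>x. (\<Sum>I\<in>words L n. g I * indicator (cyl L I) x) \<partial>\<mu>)"
  proof (rule Bochner_Integration.integral_cong)
    fix x assume "x \<in> space \<mu>"
    then have x: "x \<in> seqs L" by (simp add: sp(3))
    have "(\<Sum>I\<in>words L n. g I * indicator (cyl L I) x) =
        (\<Sum>I\<in>words L n. if I = init_word x n then g I else 0)"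
      using x by (intro sum.cong) (auto simp: indicator_def cyl_iff in_words_iff)
    then show "g (init_word x n) = (\<Sum>I\<in>words L n. g I * indicator (cyl L I) x)"
      using L init_word_in_words[OF x] by simp
  qed simp
  also have "\<dots> = (\<Sum>I\<in>words L n. \<integral>x. g I * indicator (cyl L I) x \<partial>\<mu>)"
    using sp(2) cyl_sets
    by (intro Bochner_Integration.integral_sum integrable_mult_right integrable_real_indicator)
      (auto simp: in_words_iff less_top[symmetric])
  also have "\<dots> = (\<Sum>I\<in>words L n. measure \<mu> (cyl L I) * g I)"
    using sp(3) by (intro sum.cong) (simp_all add: Int_absorb2[OF cyl_subset])
  finally show ?thesis .
qed

lemma integral_close:
  fixes f g :: "'b \<Rightarrow> real"
  assumes "prob_space \<mu>" "integrable \<mu> f" "integrable \<mu> g" "\<And>x. x \<in> space \<mu> \<Longrightarrow> \<bar>f x - g x\<bar> \<le> e"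
  shows "\<bar>(\<integral>x. f x \<partial>\<mu>) - (\<integral>x. g x \<partial>\<mu>)\<bar> \<le> e"
proof -
  interpret prob_space \<mu> by (rule assms(1))
  have le: "(\<integral>x. u x \<partial>\<mu>) \<le> (\<integral>x. v x \<partial>\<mu>) + e"
    if uv: "integrable \<mu> u" "integrable \<mu> v" "\<And>x. x \<in> space \<mu> \<Longrightarrow> u x \<le> v x + e" for u v :: "'b \<Rightarrow> real"
  proof -
    have "(\<integral>x. u x \<partial>\<mu>) \<le> (\<integral>x. v x + e \<partial>\<mu>)"
      by (rule integral_mono) (use uv in simp_all)
    then show ?thesis using uv(2) prob_space by simp
  qed
  have "f x \<le> g x + e" "g x \<le> f x + e" if "x \<in> space \<mu>" for x
    using assms(4)[OF that] by linarith+
  then show ?thesis using le[OF assms(2,3)] le[OF assms(3,2)] by (simp add: abs_le_iff)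
qed

lemma integrable_ln_potential:
  assumes "C_asa L \<phi>" "\<mu> \<in> borel_prob L" "1 \<le> n"
  shows "integrable \<mu> (\<lambda>x. ln (\<phi> n x))"
proof -
  obtain b where b: "\<And>n x. 1 \<le> n \<Longrightarrow> x \<in> seqs L \<Longrightarrow> \<bar>ln (\<phi> n x)\<bar> \<le> b n"
    by (rule C_asa_ln_bounded[OF assms(1)]) blast
  have "(\<lambda>x. ln (\<phi> n x)) \<in> borel_measurable (shift_borel L)"
    using C_asaD(1)[OF assms(1,3)] by measurable
  then show ?thesis by (rule integrable_bounded_measurable[OF assms(2) _ b[OF assms(3)]])
qed

lemma init_word_add: "init_word x (n + m) = init_word x n @ init_word ((lshift ^^ n) x) m"
  by (rule nth_equalityI) (auto simp: nth_append lshift_pow)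

text \<open>\<open>pot_mean\<close> is defined through \<open>lim\<close> and is informative only
  with convergence. For an approximant \<open>G\<close> the integrals are almost additive by
  invariance of \<mu>, and the limit follows from \<open>approx_additive_limit\<close>.\<close>

lemma pot_mean_tendsto:
  assumes as: "C_asa L \<phi>" and L: "finite L" "L \<noteq> {}" and \<mu>: "\<mu> \<in> invariant_measures L"
  shows "(\<lambda>n. (\<integral>x. ln (\<phi> n x) \<partial>\<mu>) / real n) \<longlonglongrightarrow> pot_mean \<phi> \<mu>"
proof -
  note \<mu>' = invariant_measuresD[OF \<mu> L(1)]
  interpret measure_preserving_system \<mu> lshift by (rule \<mu>'(2))
  have "\<exists>C b. (\<forall>n m. \<bar>b (n + m) - b n - b m\<bar> \<le> C) \<and>
      (\<forall>n\<ge>1. \<bar>(\<integral>x. ln (\<phi> n x) \<partial>\<mu>) - b n\<bar> \<le> C + \<epsilon> * real n)" if \<epsilon>: "0 < \<epsilon>" for \<epsilon>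
  proof -
    obtain C G where G: "almost_mult L (\<lambda>_. C) G"
      "\<And>n x. 1 \<le> n \<Longrightarrow> x \<in> seqs L \<Longrightarrow> \<bar>ln (\<phi> n x) - ln (G (init_word x n))\<bar> \<le> C + \<epsilon> * real n"
      by (rule C_asa_word_approx[OF as L \<epsilon>]) blast
    define b where "b n = (\<integral>x. ln (G (init_word x n)) \<partial>\<mu>)" for n
    have int: "integrable \<mu> (\<lambda>x. ln (G (init_word x n)))" for n
      by (rule integrable_word[OF \<mu>'(1) L(1)])
    have inv: "integrable \<mu> (\<lambda>x. ln (G (init_word ((lshift ^^ n) x) m)))
        \<and> (\<integral>x. ln (G (init_word ((lshift ^^ n) x) m)) \<partial>\<mu>) = b m" for n m
    proof (induction n)
      case 0
      then show ?case using int by (simp add: b_def)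
    next
      case (Suc n)
      let ?f = "\<lambda>x. ln (G (init_word ((lshift ^^ n) x) m))"
      have f: "?f \<in> borel_measurable \<mu>" using Suc by (auto intro: borel_measurable_integrable)
      have eq: "(\<lambda>x. ln (G (init_word ((lshift ^^ Suc n) x) m))) = (\<lambda>x. ?f (lshift x))"
        by (simp add: funpow_swap1)
      have "integrable (distr \<mu> \<mu> lshift) ?f" using Suc T_inv by simp
      then have "integrable \<mu> (\<lambda>x. ?f (lshift x))" by (rule integrable_distr[OF T_meas])
      moreover have "(\<integral>x. ?f (lshift x) \<partial>\<mu>) = (\<integral>x. ?f x \<partial>distr \<mu> \<mu> lshift)"
        by (rule integral_distr[OF T_meas f, symmetric])
      ultimately show ?case unfolding eq using Suc T_inv by simp
    qed
    have "\<bar>b (n + m) - b n - b m\<bar> \<le> C" for n m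
    proof -
      let ?g = "\<lambda>x. ln (G (init_word x n)) + ln (G (init_word ((lshift ^^ n) x) m))"
      have "\<bar>(\<integral>x. ln (G (init_word x (n + m))) \<partial>\<mu>) - (\<integral>x. ?g x \<partial>\<mu>)\<bar> \<le> C"
      proof (rule integral_close)
        show "prob_space \<mu>" by unfold_locales
        show "integrable \<mu> ?g" using int inv[of n m] by simp
        fix x assume "x \<in> space \<mu>"
        then have x: "x \<in> seqs L" using borel_probD(3)[OF \<mu>'(1)] by simp
        show "\<bar>ln (G (init_word x (n + m))) - ?g x\<bar> \<le> C"
          using almost_multD[OF G(1), of "init_word x n" "init_word ((lshift ^^ n) x) m"]
            init_word_in_words[OF x, of n] init_word_in_words[OF lshift_pow_seqs[OF x], of n m]
          by (simp add: init_word_add in_words_iff diff_diff_eq)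
      qed (rule int)
      moreover have "(\<integral>x. ?g x \<partial>\<mu>) = b n + b m"
        using int inv[of n m] by (simp add: b_def)
      ultimately show ?thesis by (simp add: b_def algebra_simps)
    qed
    moreover have "\<bar>(\<integral>x. ln (\<phi> n x) \<partial>\<mu>) - b n\<bar> \<le> C + \<epsilon> * real n" if n: "1 \<le> n" for n
      unfolding b_def
    proof (rule integral_close)
      show "prob_space \<mu>" by unfold_locales
      show "integrable \<mu> (\<lambda>x. ln (\<phi> n x))" by (rule integrable_ln_potential[OF as \<mu>'(1) n])
      show "\<bar>ln (\<phi> n x) - ln (G (init_word x n))\<bar> \<le> C + \<epsilon> * real n" if "x \<in> space \<mu>" for x
        using that G(2)[OF n] borel_probD(3)[OF \<mu>'(1)] by simp
    qed (rule int)
    ultimately show ?thesis by blast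
  qed
  then obtain P where "\<And>\<epsilon>. 0 < \<epsilon> \<Longrightarrow>
      \<exists>C. \<forall>n\<ge>1. \<bar>(\<integral>x. ln (\<phi> n x) \<partial>\<mu>) - real n * P\<bar> \<le> C + \<epsilon> * real n"
    using approx_additive_limit[of "\<lambda>n. \<integral>x. ln (\<phi> n x) \<partial>\<mu>"] by blast
  then have lim: "(\<lambda>n. (\<integral>x. ln (\<phi> n x) \<partial>\<mu>) / real n) \<longlonglongrightarrow> P"
    by (rule linear_growth_tendsto)
  then have "pot_mean \<phi> \<mu> = P" unfolding pot_mean_def by (intro limI) simp
  then show ?thesis using lim by simp
qed

context factor_chain
begin

lemma measurable_tau:
  assumes "i \<in> {1..k}"
  shows "letterwise (tau p (i - 1)) \<in> measurable (shift_borel (A 1)) (shift_borel (A i))"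
  by (rule measurable_letterwise) (use tau_image'[OF assms] finite_A[OF assms] in auto)

lemma measurable_tau':
  assumes "i \<in> {1..k}" "\<mu> \<in> borel_prob (A 1)"
  shows "letterwise (tau p (i - 1)) \<in> measurable \<mu> (shift_borel (A i))"
  using measurable_tau[OF assms(1)] by (simp cong: measurable_cong_sets add: borel_probD(2)[OF assms(2)])

lemma factor_measure_borel_prob:
  assumes "i \<in> {1..k}" "\<mu> \<in> borel_prob (A 1)"
  shows "factor_measure A p \<mu> i \<in> borel_prob (A i)"
  using prob_space.prob_space_distr[OF borel_probD(1)[OF assms(2)] measurable_tau'[OF assms]]
  by (simp add: borel_prob_def factor_measure_def)

lemma factor_word_measure_eq:
  assumes i: "i \<in> {1..k}" and \<mu>: "\<mu> \<in> borel_prob (A 1)" and J: "set J \<subseteq> A i"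
  shows "factor_word_measure A p \<mu> i J = push (tau p (i - 1)) (A 1) (\<lambda>I. measure \<mu> (cyl (A 1) I)) J"
proof -
  have "factor_word_measure A p \<mu> i J = measure \<mu> (letterwise (tau p (i - 1)) -` cyl (A i) J \<inter> seqs (A 1))"
    unfolding factor_word_measure_def factor_measure_def
    using cyl_sets[OF J] borel_probD(3)[OF \<mu>] by (subst measure_distr[OF measurable_tau'[OF i \<mu>]]) simp_all
  also have "letterwise (tau p (i - 1)) -` cyl (A i) J \<inter> seqs (A 1)
      = (\<Union>I\<in>fiber (tau p (i - 1)) (A 1) J. cyl (A 1) I)"
    by (rule letterwise_vimage_cyl) (use tau_image'[OF i] in auto)
  also have "measure \<mu> \<dots> = push (tau p (i - 1)) (A 1) (\<lambda>I. measure \<mu> (cyl (A 1) I)) J"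
    unfolding push_def by (rule measure_UN_cyl[OF \<mu>, of _ "length J"]) (auto simp: fiber_def)
  finally show ?thesis .
qed

lemma factor_measure_invariant:
  assumes i: "i \<in> {1..k}" and \<mu>: "\<mu> \<in> invariant_measures (A 1)"
  shows "factor_measure A p \<mu> i \<in> invariant_measures (A i)"
proof -
  let ?f = "letterwise (tau p (i - 1))" and ?N = "shift_borel (A i)"
  have fin: "finite (A 1)" by simp
  note \<mu>' = invariant_measuresD[OF \<mu> fin]
  interpret measure_preserving_system \<mu> lshift by (rule \<mu>'(2))
  have f: "?f \<in> measurable \<mu> ?N" by (rule measurable_tau'[OF i \<mu>'(1)])
  have T: "lshift \<in> measurable ?N ?N" by (rule measurable_lshift[OF finite_A[OF i]])
  have "distr (distr \<mu> ?N ?f) (distr \<mu> ?N ?f) lshift = distr (distr \<mu> ?N ?f) ?N lshift"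
    by (rule distr_cong) simp_all
  also have "\<dots> = distr \<mu> ?N (lshift \<circ> ?f)" by (rule distr_distr[OF T f])
  also have "lshift \<circ> ?f = ?f \<circ> lshift" by (rule ext) (simp add: letterwise_def lshift_def)
  also have "distr \<mu> ?N (?f \<circ> lshift) = distr (distr \<mu> \<mu> lshift) ?N ?f"
    by (rule distr_distr[OF f T_meas, symmetric])
  also have "\<dots> = distr \<mu> ?N ?f" by (simp add: T_inv)
  finally show ?thesis
    using factor_measure_borel_prob[OF i \<mu>'(1)] by (simp add: invariant_measures_def factor_measure_def)
qed

lemma weighted_entropy_tendsto:
  assumes \<mu>: "\<mu> \<in> invariant_measures (A 1)"
  shows "(\<lambda>n. (\<Sum>i=1..k. a i * word_entropy (A i)
      (push (tau p (i - 1)) (A 1) (\<lambda>I. measure \<mu> (cyl (A 1) I))) n) / real n)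
    \<longlonglongrightarrow> weighted_entropy k A p a \<mu>"
proof -
  have fin: "finite (A 1)" by simp
  note \<mu>' = invariant_measuresD[OF \<mu> fin]
  have "(\<lambda>n. word_entropy (A i) (push (tau p (i - 1)) (A 1) (\<lambda>I. measure \<mu> (cyl (A 1) I))) n / real n)
      \<longlonglongrightarrow> ks_entropy (factor_measure A p \<mu> i) lshift" if i: "i \<in> {1..k}" for i
  proof -
    have "word_entropy (A i) (\<lambda>J. measure (factor_measure A p \<mu> i) (cyl (A i) J)) n =
        word_entropy (A i) (push (tau p (i - 1)) (A 1) (\<lambda>I. measure \<mu> (cyl (A 1) I))) n" for n
      unfolding word_entropy_def
      using factor_word_measure_eq[OF i \<mu>'(1)]
      by (auto simp: factor_word_measure_def in_words_iff intro!: sum.cong)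
    then show ?thesis
      using ks_entropy_shift[OF factor_measure_invariant[OF i \<mu>] finite_A[OF i]] by simp
  qed
  then show ?thesis
    unfolding weighted_entropy_def sum_divide_distrib times_divide_eq_right [symmetric]
    by (intro tendsto_sum tendsto_mult tendsto_const)
qed

lemma variational_principle:
  assumes as: "C_asa (A 1) \<phi>" and "0 < \<epsilon>"
  obtains C where "\<And>n. 1 \<le> n \<Longrightarrow> \<bar>ln (word_sum (A 1) (gibbs_weight k A p a (sup_weight (A 1) \<phi>)) n) -
      real n * (weighted_pressure k A p a \<phi> / wsum a k)\<bar> \<le> C + \<epsilon> * real n"
proof -
  have fin: "finite (A 1)" "A 1 \<noteq> {}" by simp_all
  let ?W = "sup_weight (A 1) \<phi>"
  let ?F = "gibbs_weight k A p a ?W"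
  let ?Z = "word_sum (A 1) ?F"
  have Ak: "0 < wsum a k" using wsum_pos[of k] k_pos by simp
  have tb: "tempered (A 1) ?W" by (rule tempered_sup_weight[OF as fin])
  have tF: "tempered (A 1) ?F" by (rule tempered_gibbs_weight[OF tb])
  obtain C0 where am0: "almost_mult (A 1) (\<lambda>n. C0 + 1 * real n) ?W"
    using tempered_almost_mult[OF tb _ fin(2), of 1] by auto
  note F0pos = almost_mult_pos[OF am0]
  \<comment> \<open>An approximant of the Gibbs weight supplies the almost additive sequence; the
    slope \<open>P\<close> obtained from it is identified with the pressure by two
    inequalities.\<close>
  have "\<exists>C b. (\<forall>n m. \<bar>b (n + m) - b n - b m\<bar> \<le> C) \<and> (\<forall>n\<ge>1. \<bar>ln (?Z n) - b n\<bar> \<le> C + \<epsilon> * real n)"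
    if \<epsilon>: "0 < \<epsilon>" for \<epsilon>
  proof -
    obtain C G where G: "almost_mult (A 1) (\<lambda>_. C) G" "near (A 1) (\<lambda>n. C + \<epsilon> * real n) ?F G"
      using tF \<epsilon> unfolding tempered_def by blast
    then show ?thesis
      using almost_mult_word_sum[OF G(1) fin] near_word_sum[OF G(2) fin]
      by (intro exI[of _ C] exI[of _ "\<lambda>n. ln (word_sum (A 1) G n)"]) auto
  qed
  then obtain P where P: "\<And>\<epsilon>. 0 < \<epsilon> \<Longrightarrow> \<exists>C. \<forall>n\<ge>1. \<bar>ln (?Z n) - real n * P\<bar> \<le> C + \<epsilon> * real n"
    using approx_additive_limit[of "\<lambda>n. ln (?Z n)"] by blast
  have limZ: "(\<lambda>n. ln (?Z n) / real n) \<longlonglongrightarrow> P" by (rule linear_growth_tendsto[OF P])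
  define S where "S \<mu> = pot_mean \<phi> \<mu> + weighted_entropy k A p a \<mu>" for \<mu>
  define E where "E \<mu> n = (\<integral>x. ln (\<phi> n x) \<partial>\<mu>) + (\<Sum>i=1..k. a i * word_entropy (A i)
      (push (tau p (i - 1)) (A 1) (\<lambda>I. measure \<mu> (cyl (A 1) I))) n)" for \<mu> n
  have limE: "(\<lambda>n. E \<mu> n / real n) \<longlonglongrightarrow> S \<mu>" if "\<mu> \<in> invariant_measures (A 1)" for \<mu>
    unfolding E_def S_def add_divide_distrib
    by (intro tendsto_add pot_mean_tendsto[OF as fin that] weighted_entropy_tendsto[OF that])
  have upper: "S \<mu> \<le> wsum a k * P" if \<mu>: "\<mu> \<in> invariant_measures (A 1)" for \<mu>
  proof -
    note \<mu>' = invariant_measuresD[OF \<mu> fin(1)]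
    note sp = borel_probD[OF \<mu>'(1)]
    have "E \<mu> n \<le> wsum a k * ln (?Z n)" if n: "1 \<le> n" for n
    proof -
      have "(\<integral>x. ln (\<phi> n x) \<partial>\<mu>) \<le> (\<integral>x. ln (?W (init_word x n)) \<partial>\<mu>)"
      proof (rule integral_mono[OF integrable_ln_potential[OF as \<mu>'(1) n] integrable_word[OF \<mu>'(1) fin(1)]])
        fix x assume "x \<in> space \<mu>"
        then have x: "x \<in> seqs (A 1)" by (simp add: sp(3))
        have "bdd_above (\<phi> n ` cyl (A 1) (init_word x n))"
          using C_asaD(2)[OF as n] cyl_subset by (meson bounded_imp_bdd_above bounded_subset image_mono)
        then have "\<phi> n x \<le> (SUP y\<in>cyl (A 1) (init_word x n). \<phi> n y)"
          using x by (intro cSUP_upper) (simp_all add: cyl_iff)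
        moreover have "init_word x n \<noteq> []" using n by (metis length_init_word list.size(3) not_one_le_zero)
        ultimately show "ln (\<phi> n x) \<le> ln (?W (init_word x n))"
          using C_asaD(3)[OF as n x] by (simp add: sup_weight_def)
      qed
      also have "\<dots> = (\<Sum>I\<in>words (A 1) n. measure \<mu> (cyl (A 1) I) * ln (?W I))"
        by (rule integral_word[OF \<mu>'(1) fin(1)])
      finally have "E \<mu> n \<le> (\<Sum>I\<in>words (A 1) n. measure \<mu> (cyl (A 1) I) * ln (?W I)) +
          (\<Sum>i=1..k. a i * word_entropy (A i)
            (push (tau p (i - 1)) (A 1) (\<lambda>I. measure \<mu> (cyl (A 1) I))) n)"
        by (simp add: E_def)
      also have "\<dots> \<le> wsum a k * ln (?Z n)"
        by (rule weighted_entropy_upper[OF F0pos measure_nonneg sum_measure_cyl[OF \<mu>'(1) fin(1)]])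
      finally show ?thesis .
    qed
    then have "E \<mu> n / real n \<le> wsum a k * (ln (?Z n) / real n)" if "1 \<le> n" for n
      using divide_right_mono[of "E \<mu> n" "wsum a k * ln (?Z n)" "real n"] that by simp
    then have "\<forall>\<^sub>F n in sequentially. E \<mu> n / real n \<le> wsum a k * (ln (?Z n) / real n)"
      unfolding eventually_sequentially by blast
    moreover have "(\<lambda>n. wsum a k * (ln (?Z n) / real n)) \<longlonglongrightarrow> wsum a k * P"
      by (intro tendsto_intros limZ)
    ultimately show ?thesis
      using tendsto_le[OF _ _ limE[OF \<mu>]] by fastforce
  qed
  \<comment> \<open>The loss at rate \<epsilon>: once for replacing log \<phi>_n by log G in the
    energy, and \<open>wsum a k * gibbs_const\<close> times through the partition functions.\<close>
  define K where "K = 1 + wsum a k * gibbs_const"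
  have Kpos: "0 < K" unfolding K_def using Ak gibbs_const_pos by (intro add_pos_pos mult_pos_pos) auto
  \<comment> \<open>No maximising measure is constructed: the invariant Gibbs measure belongs to the
    approximant and changes with \<epsilon>.\<close>
  have lower: "\<exists>\<mu>\<in>invariant_measures (A 1). wsum a k * P \<le> S \<mu> + K * \<epsilon>" if \<epsilon>: "0 < \<epsilon>" for \<epsilon>
  proof -
    obtain C G where G: "almost_mult (A 1) (\<lambda>_. C) G"
      "\<And>n x. 1 \<le> n \<Longrightarrow> x \<in> seqs (A 1) \<Longrightarrow> \<bar>ln (\<phi> n x) - ln (G (init_word x n))\<bar> \<le> C + \<epsilon> * real n"
      by (rule C_asa_word_approx[OF as fin \<epsilon>]) blast
    have nb: "near (A 1) (\<lambda>n. C + \<epsilon> * real n) ?W G"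
      using \<epsilon> by (intro near_sup_weight[OF fin(2) G(1) _ C_asaD(3)[OF as] G(2)]) auto
    let ?FG = "gibbs_weight k A p a G"
    let ?ZG = "word_sum (A 1) ?FG"
    define C1 where "C1 = gibbs_const * C"
    have amG: "almost_mult (A 1) (\<lambda>_. C1) ?FG" unfolding C1_def by (rule almost_mult_gibbs_weight[OF G(1)])
    have nZ: "\<bar>ln (?Z n) - ln (?ZG n)\<bar> \<le> gibbs_const * (C + \<epsilon> * real n)" for n
      by (rule near_word_sum[OF near_gibbs_weight[OF nb] fin])
    obtain u where u: "consistent (A 1) u" "\<And>I. set I \<subseteq> A 1 \<Longrightarrow> (\<Sum>b\<in>A 1. u (b # I)) = u I"
      "near (A 1) (\<lambda>_. 4 * C1) u (word_prob (A 1) ?FG)"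
      by (rule invariant_gibbs_weights[OF amG fin]) blast
    obtain \<mu> where \<mu>: "\<mu> \<in> borel_prob (A 1)" "\<And>I. set I \<subseteq> A 1 \<Longrightarrow> measure \<mu> (cyl (A 1) I) = u I"
      by (rule exists_cyl_measure[OF u(1) fin(1)]) blast
    have inv: "\<mu> \<in> invariant_measures (A 1)"
      by (rule invariant_measureI[OF \<mu>(1) fin(1) \<mu>(2) u(2)])
    have bound: "wsum a k * (ln (?Z n) - gibbs_const * (C + \<epsilon> * real n) - 4 * C1) \<le> E \<mu> n + C + \<epsilon> * real n"
      if n: "1 \<le> n" for n
    proof -
      have mI: "measure \<mu> (cyl (A 1) I) = u I" if "I \<in> words (A 1) n" for I
        using that \<mu>(2) by (simp add: in_words_iff)
      have "wsum a k * (ln (?ZG n) - 4 * C1) \<le>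
          (\<Sum>I\<in>words (A 1) n. measure \<mu> (cyl (A 1) I) * ln (G I)) +
          (\<Sum>i=1..k. a i * word_entropy (A i)
            (push (tau p (i - 1)) (A 1) (\<lambda>I. measure \<mu> (cyl (A 1) I))) n)"
      proof (rule weighted_entropy_lower[OF almost_mult_pos[OF G(1)]])
        fix I assume I: "I \<in> words (A 1) n"
        then have sI: "set I \<subseteq> A 1" "length I = n" by (auto simp: in_words_iff)
        have "0 < ?ZG n" by (rule word_sum_pos[OF fin almost_mult_pos[OF amG]])
        then have "ln (word_prob (A 1) ?FG I) = ln (?FG I) - ln (?ZG n)"
          using almost_mult_pos[OF amG sI(1)] sI(2) by (simp add: word_prob_def ln_div)
        then show "\<bar>ln (measure \<mu> (cyl (A 1) I)) - (ln (?FG I) - ln (?ZG n))\<bar> \<le> 4 * C1"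
          using nearD(3)[OF u(3) sI(1)] mI[OF I] by simp
        show "0 < measure \<mu> (cyl (A 1) I)" using nearD(1)[OF u(3) sI(1)] mI[OF I] by simp
      qed (use sum_measure_cyl[OF \<mu>(1) fin(1)] in simp_all)
      also have "(\<Sum>I\<in>words (A 1) n. measure \<mu> (cyl (A 1) I) * ln (G I)) = (\<integral>x. ln (G (init_word x n)) \<partial>\<mu>)"
        by (rule integral_word[OF \<mu>(1) fin(1), symmetric])
      also have "\<dots> \<le> (\<integral>x. ln (\<phi> n x) \<partial>\<mu>) + (C + \<epsilon> * real n)"
      proof -
        have "\<bar>(\<integral>x. ln (\<phi> n x) \<partial>\<mu>) - (\<integral>x. ln (G (init_word x n)) \<partial>\<mu>)\<bar> \<le> C + \<epsilon> * real n"
          using G(2)[OF n] borel_probD[OF \<mu>(1)]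
          by (intro integral_close integrable_ln_potential[OF as \<mu>(1) n] integrable_word[OF \<mu>(1) fin(1)]) auto
        then show ?thesis by linarith
      qed
      finally have "wsum a k * (ln (?ZG n) - 4 * C1) \<le> E \<mu> n + C + \<epsilon> * real n"
        by (simp add: E_def)
      moreover have "wsum a k * (ln (?Z n) - gibbs_const * (C + \<epsilon> * real n) - 4 * C1)
          \<le> wsum a k * (ln (?ZG n) - 4 * C1)"
        using nZ[of n] Ak by (intro mult_left_mono) (auto simp: abs_le_iff)
      ultimately show ?thesis by linarith
    qed
    define D where "D = wsum a k * (gibbs_const * C + 4 * C1) + C"
    have "\<forall>\<^sub>F n in sequentially. wsum a k * (ln (?Z n) / real n) \<le> E \<mu> n / real n + D / real n + K * \<epsilon>"
      using eventually_ge_at_top[of 1]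
    proof eventually_elim
      case (elim n)
      have "wsum a k * ln (?Z n) \<le> E \<mu> n + D + K * \<epsilon> * real n"
        using bound[OF elim] by (simp add: D_def K_def algebra_simps)
      then have "wsum a k * ln (?Z n) / real n \<le> (E \<mu> n + D + K * \<epsilon> * real n) / real n"
        by (intro divide_right_mono) auto
      then show ?case using elim by (simp add: add_divide_distrib)
    qed
    moreover have "(\<lambda>n. wsum a k * (ln (?Z n) / real n)) \<longlonglongrightarrow> wsum a k * P"
      by (intro tendsto_intros limZ)
    moreover have "(\<lambda>n. E \<mu> n / real n + D / real n + K * \<epsilon>) \<longlonglongrightarrow> S \<mu> + 0 + K * \<epsilon>"
      by (intro tendsto_add limE[OF inv] lim_const_over_n tendsto_const)
    ultimately have "wsum a k * P \<le> S \<mu> + 0 + K * \<epsilon>"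
      by (intro tendsto_le[OF sequentially_bot]) auto
    then show ?thesis using inv by auto
  qed
  have "weighted_pressure k A p a \<phi> = wsum a k * P"
  proof -
    let ?T = "{pot_mean \<phi> \<mu> + weighted_entropy k A p a \<mu> | \<mu>. \<mu> \<in> invariant_measures (A 1)}"
    have T: "?T = S ` invariant_measures (A 1)" by (auto simp: S_def)
    have ne: "invariant_measures (A 1) \<noteq> {}" using lower[of 1] by auto
    have bdd: "bdd_above (S ` invariant_measures (A 1))" using upper by (auto intro!: bdd_aboveI2)
    have "Sup (S ` invariant_measures (A 1)) \<le> wsum a k * P"
      using ne upper by (intro cSUP_least)
    moreover have "wsum a k * P \<le> Sup (S ` invariant_measures (A 1))"
    proof (rule field_le_epsilon)
      fix e :: real assume "0 < e"
      then obtain \<mu> where \<mu>: "\<mu> \<in> invariant_measures (A 1)" "wsum a k * P \<le> S \<mu> + K * (e / K)"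
        using lower[of "e / K"] Kpos by auto
      have "S \<mu> \<le> Sup (S ` invariant_measures (A 1))" using bdd \<mu>(1) by (rule cSUP_upper2) simp
      then show "wsum a k * P \<le> Sup (S ` invariant_measures (A 1)) + e" using \<mu>(2) Kpos by simp
    qed
    ultimately show ?thesis unfolding weighted_pressure_def T by simp
  qed
  then have "weighted_pressure k A p a \<phi> / wsum a k = P" using Ak by simp
  then show ?thesis using P[OF \<open>0 < \<epsilon>\<close>] that by auto
qed

end

section \<open>Weak Gibbs weights\<close>

lemma ln_word_prob:
  assumes L: "finite L" "L \<noteq> {}" and pos: "\<forall>I. set I \<subseteq> L \<longrightarrow> 0 < F I" and I: "set I \<subseteq> L"
  shows "0 < word_prob L F I" "ln (word_prob L F I) = ln (F I) - ln (word_sum L F (length I))"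
proof -
  have "0 < word_sum L F (length I)" by (rule word_sum_pos[OF L]) (use pos in blast)
  moreover have "0 < F I" using pos I by blast
  ultimately show "0 < word_prob L F I" "ln (word_prob L F I) = ln (F I) - ln (word_sum L F (length I))"
    by (simp_all add: word_prob_def ln_div)
qed

lemma almost_mult_word_prob:
  assumes am: "almost_mult L d F" and L: "finite L" "L \<noteq> {}"
  shows "almost_mult L (\<lambda>n. 2 * d n) (word_prob L F)"
  unfolding almost_mult_def
proof (intro conjI allI impI)
  have pos: "\<forall>I. set I \<subseteq> L \<longrightarrow> 0 < F I" using almost_mult_pos[OF am] by blast
  note l = ln_word_prob[OF L pos]
  show "0 < word_prob L F I" if "set I \<subseteq> L" for I by (rule l(1)[OF that])
  fix I J :: "'a list" assume IJ: "set I \<subseteq> L" "set J \<subseteq> L"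
  then have "set (I @ J) \<subseteq> L" by simp
  note ls = l(2)[OF IJ(1)] l(2)[OF IJ(2)] l(2)[OF this]
  show "\<bar>ln (word_prob L F (I @ J)) - ln (word_prob L F I) - ln (word_prob L F J)\<bar>
      \<le> 2 * d (length I + length J)"
    using almost_multD[OF am IJ] almost_mult_word_sum[OF am L, of "length I" "length J"]
    unfolding ls length_append by linarith
qed

lemma near_word_prob:
  assumes nr: "near L d F G" and L: "finite L" "L \<noteq> {}"
  shows "near L (\<lambda>n. 2 * d n) (word_prob L F) (word_prob L G)"
  unfolding near_def
proof (intro allI impI)
  fix I :: "'a list" assume I: "set I \<subseteq> L"
  have pos: "\<forall>I. set I \<subseteq> L \<longrightarrow> 0 < F I" "\<forall>I. set I \<subseteq> L \<longrightarrow> 0 < G I"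
    using nr by (auto simp: near_def)
  note l = ln_word_prob[OF L pos(1) I] ln_word_prob[OF L pos(2) I]
  have "\<bar>ln (word_prob L F I) - ln (word_prob L G I)\<bar> \<le> 2 * d (length I)"
    using nearD(3)[OF nr I] near_word_sum[OF nr L, of "length I"] unfolding l(2,4) by linarith
  then show "0 < word_prob L F I \<and> 0 < word_prob L G I \<and>
      \<bar>ln (word_prob L F I) - ln (word_prob L G I)\<bar> \<le> 2 * d (length I)"
    using l(1,3) by blast
qed

lemma tempered_word_prob:
  assumes tm: "tempered L F" and L: "finite L" "L \<noteq> {}"
  shows "tempered L (word_prob L F)"
  unfolding tempered_def
proof (intro allI impI)
  fix \<epsilon> :: real assume "0 < \<epsilon>"
  then obtain C G where G: "almost_mult L (\<lambda>_. C) G" "near L (\<lambda>n. C + \<epsilon> / 2 * real n) F G"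
    using tm unfolding tempered_def by (meson half_gt_zero)
  have "near L (\<lambda>n. 2 * C + \<epsilon> * real n) (word_prob L F) (word_prob L G)"
    by (rule near_mono[OF near_word_prob[OF G(2) L]]) simp
  then show "\<exists>C G. almost_mult L (\<lambda>_. C) G \<and> near L (\<lambda>n. C + \<epsilon> * real n) (word_prob L F) G"
    using almost_mult_word_prob[OF G(1) L] by blast
qed

section \<open>Potentials obtained from functions of words\<close>

lemma tempered_comp:
  assumes "tempered L' F" "q ` L \<subseteq> L'"
  shows "tempered L (\<lambda>I. F (map q I))"
  using assms almost_mult_comp near_comp unfolding tempered_def by metis

lemma tempered_inverse:
  assumes "tempered L F"
  shows "tempered L (\<lambda>I. 1 / F I)"
proof -
  have am: "almost_mult L d (\<lambda>I. 1 / G I)" if "almost_mult L d G" for d and G :: "'a list \<Rightarrow> real"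
    unfolding almost_mult_def
  proof (intro conjI allI impI)
    fix I J :: "'a list" assume IJ: "set I \<subseteq> L" "set J \<subseteq> L"
    have "0 < G I" "0 < G J" "0 < G (I @ J)" using IJ almost_mult_pos[OF that] by auto
    then show "\<bar>ln (1 / G (I @ J)) - ln (1 / G I) - ln (1 / G J)\<bar> \<le> d (length I + length J)"
      using almost_multD[OF that IJ] by (simp add: ln_div abs_le_iff)
  qed (use almost_mult_pos[OF that] in auto)
  have nr: "near L d (\<lambda>I. 1 / F I) (\<lambda>I. 1 / G I)" if "near L d F G" for d and G :: "'a list \<Rightarrow> real"
    unfolding near_def
  proof (intro allI impI)
    fix I :: "'a list" assume I: "set I \<subseteq> L"
    show "0 < 1 / F I \<and> 0 < 1 / G I \<and> \<bar>ln (1 / F I) - ln (1 / G I)\<bar> \<le> d (length I)"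
      using nearD[OF that I] by (simp add: ln_div abs_le_iff)
  qed
  show ?thesis using assms am nr unfolding tempered_def by metis
qed

text \<open>The word approximant itself serves as the approximating potential: it depends on n
  letters, hence is continuous, and its constant defect C is sub-additivity with constant
  exp(C).\<close>

lemma asymp_subadditive_word:
  assumes tm: "tempered L v" and L: "finite L" "L \<noteq> {}"
  shows "asymp_subadditive_pot L (\<lambda>n x. v (init_word x n))"
proof (rule asymp_subadditive_potI)
  have c: "continuous_map (shift_space L) euclideanreal (\<lambda>x. v (init_word x n))" for n
    by (rule continuous_map_init_word)
  show "(\<lambda>x. v (init_word x n)) \<in> borel_measurable (shift_borel L)" for n
    by (rule borel_measurable_continuous_map[OF c])
  show "bounded ((\<lambda>x. v (init_word x n)) ` seqs L)" for n
  proof -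
    obtain B where "\<And>x. x \<in> seqs L \<Longrightarrow> \<bar>v (init_word x n)\<bar> \<le> B"
      by (rule continuous_map_bounded[OF c L(1)]) blast
    then show ?thesis by (auto simp: bounded_iff)
  qed
  obtain C0 where "almost_mult L (\<lambda>n. C0 + 1 * real n) v"
    using tempered_almost_mult[OF tm _ L(2), of 1] by auto
  then show "0 < v (init_word x n)" if "x \<in> seqs L" for n x
    using init_word_in_words[OF that, of n] by (auto simp: almost_mult_def in_words_iff)
  fix \<epsilon> :: real assume "0 < \<epsilon>"
  then obtain C G where G: "almost_mult L (\<lambda>_. C) G" "near L (\<lambda>n. C + \<epsilon> * real n) v G"
    using tm unfolding tempered_def by blast
  have s: "set (init_word x n) \<subseteq> L" if "x \<in> seqs L" for x n
    using init_word_in_words[OF that, of n] by (simp add: in_words_iff)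
  have Gp: "0 < G (init_word x n)" if "x \<in> seqs L" for x n
    using almost_mult_pos[OF G(1) s[OF that]] .
  have sub: "G (init_word x (n + m)) \<le> exp C * G (init_word x n) * G (init_word ((lshift ^^ n) x) m)"
    if x: "x \<in> seqs L" for x n m
  proof -
    have Tx: "(lshift ^^ n) x \<in> seqs L" by (rule lshift_pow_seqs[OF x])
    have p: "0 < G (init_word x n)" "0 < G (init_word ((lshift ^^ n) x) m)"
      using Gp x Tx by auto
    have "\<bar>ln (G (init_word x (n + m))) - ln (G (init_word x n) * G (init_word ((lshift ^^ n) x) m))\<bar> \<le> C"
      using almost_multD[OF G(1) s[OF x, of n] s[OF Tx, of m]] p
      by (simp add: init_word_add ln_mult diff_diff_eq)
    then show ?thesis
      using ln_close_bounds(2)[of "G (init_word x (n + m))"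
          "G (init_word x n) * G (init_word ((lshift ^^ n) x) m)" C] Gp[OF x] p by simp
  qed
  have "subadditive_pot L (\<lambda>n x. G (init_word x n))"
    unfolding subadditive_pot_def
    using continuous_map_init_word less_imp_le[OF Gp] sub by (auto intro!: exI[of _ "exp C"])
  moreover have "0 < G (init_word x n) \<and>
      \<bar>ln (v (init_word x n)) - ln (G (init_word x n))\<bar> \<le> C + \<epsilon> * real n" if "x \<in> seqs L" for x n
    using nearD[OF G(2) s[OF that, of n]] by simp
  ultimately show "\<exists>C \<psi>. subadditive_pot L \<psi> \<and> (\<forall>n\<ge>1. \<forall>x\<in>seqs L. 0 < \<psi> n x \<and>
      \<bar>ln (v (init_word x n)) - ln (\<psi> n x)\<bar> \<le> C + \<epsilon> * real n)"
    by blast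
qed

lemma C_asa_word:
  assumes "tempered L v" "finite L" "L \<noteq> {}"
  shows "C_asa L (\<lambda>n x. v (init_word x n))"
proof -
  obtain C0 where am: "almost_mult L (\<lambda>n. C0 + 1 * real n) v"
    using tempered_almost_mult[OF assms(1) _ assms(3), of 1] by auto
  have "0 < v (init_word x n)" if "x \<in> seqs L" for x n
    using init_word_in_words[OF that, of n] by (intro almost_mult_pos[OF am]) (simp add: in_words_iff)
  then show ?thesis
    using asymp_subadditive_word[OF assms] asymp_subadditive_word[OF tempered_inverse[OF assms(1)] assms(2,3)]
    by (simp add: C_asa_def)
qed

text \<open>The class looks only at n \<ge> 1 and at points of the shift space, where cylinder
  measures can be replaced by pushed weights.\<close>

lemma C_asa_cong:
  assumes "C_asa L \<phi>" "\<And>n x. 1 \<le> n \<Longrightarrow> x \<in> seqs L \<Longrightarrow> \<phi>' n x = \<phi> n x"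
  shows "C_asa L \<phi>'"
proof -
  have as: "asymp_subadditive_pot L f'" if f: "asymp_subadditive_pot L f"
    and eq: "\<And>n x. 1 \<le> n \<Longrightarrow> x \<in> seqs L \<Longrightarrow> f' n x = f n x" for f f' :: "nat \<Rightarrow> (nat \<Rightarrow> 'a) \<Rightarrow> real"
    unfolding asymp_subadditive_pot_def
  proof (intro conjI allI impI)
    fix n :: nat assume n: "1 \<le> n"
    have "f n \<in> borel_measurable (shift_borel L)" using f n by (simp add: asymp_subadditive_pot_def)
    then show "f' n \<in> borel_measurable (shift_borel L)"
      using eq[OF n] by (subst measurable_cong[where g = "f n"]) auto
    have "f' n ` seqs L = f n ` seqs L" using eq[OF n] by (intro image_cong) auto
    then show "bounded (f' n ` seqs L)" using f n by (simp add: asymp_subadditive_pot_def)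
    show "\<forall>x\<in>seqs L. 0 \<le> f' n x" using f n eq[OF n] by (simp add: asymp_subadditive_pot_def)
  next
    fix \<epsilon> :: real assume "0 < \<epsilon>"
    then obtain \<psi> where \<psi>: "subadditive_pot L \<psi>"
      "limsup (\<lambda>n. ereal (1 / real n) * (SUP x\<in>seqs L. log_gap (f n x) (\<psi> n x))) \<le> ereal \<epsilon>"
      using f unfolding asymp_subadditive_pot_def by blast
    have "\<forall>\<^sub>F n in sequentially. ereal (1 / real n) * (SUP x\<in>seqs L. log_gap (f' n x) (\<psi> n x)) =
        ereal (1 / real n) * (SUP x\<in>seqs L. log_gap (f n x) (\<psi> n x))"
      using eventually_ge_at_top[of 1] by eventually_elim (simp add: eq)
    from Limsup_eq[OF this] show "\<exists>\<psi>. subadditive_pot L \<psi> \<and>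
        limsup (\<lambda>n. ereal (1 / real n) * (SUP x\<in>seqs L. log_gap (f' n x) (\<psi> n x))) \<le> ereal \<epsilon>"
      using \<psi> by (intro exI[of _ \<psi>]) simp
  qed
  show ?thesis
    using assms(1) assms(2) as[of \<phi> \<phi>'] as[of "\<lambda>n x. 1 / \<phi> n x" "\<lambda>n x. 1 / \<phi>' n x"]
    by (simp add: C_asa_def)
qed

section \<open>Balls of the weighted metric\<close>

lemma enat_le_common_prefix: "enat l \<le> common_prefix u v \<longleftrightarrow> (\<forall>t<l. u t = v t)"
proof -
  have "enat l \<le> common_prefix u v \<longleftrightarrow> (\<forall>m. u m \<noteq> v m \<longrightarrow> l \<le> m)"
    unfolding common_prefix_def le_INF_iff by simp
  then show ?thesis by (metis not_less)
qed

text \<open>For a common prefix of length m the inequality says m \<ge> b n / a1, which for integers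
  means m \<ge> l; an infinite prefix has distance 0.\<close>

lemma exp_neg_div_le_iff:
  assumes b: "0 < b" and a: "0 < a1" and l: "l = (LEAST q. b * real n / a1 \<le> real q)"
  shows "exp_neg_div t b \<le> exp (- real n / a1) \<longleftrightarrow> enat l \<le> t"
proof (cases t)
  case (enat m)
  have "\<exists>q. b * real n / a1 \<le> real q" by (rule real_arch_simple)
  then have "b * real n / a1 \<le> real l" unfolding l by (rule LeastI_ex)
  moreover have "l \<le> q" if "b * real n / a1 \<le> real q" for q
    using that unfolding l by (rule Least_le)
  ultimately have "b * real n / a1 \<le> real m \<longleftrightarrow> l \<le> m" by force
  moreover have "real n / a1 \<le> real m / b \<longleftrightarrow> b * real n / a1 \<le> real m"
    using a b by (simp add: field_simps)
  ultimately show ?thesis using enat by (simp add: exp_neg_div_def)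
qed (simp add: exp_neg_div_def)

lemma subword_append: "m \<le> n \<Longrightarrow> init_word x n = init_word x m @ subword x m n"
  using upt_add_eq_append[of 0 m "n - m"] by (simp add: subword_def map_append [symmetric] del: map_append)

context factor_chain
begin

lemma ell_0 [simp]: "ell a 0 n = 0"
  by (simp add: ell_def)

lemma ell_bounds:
  assumes "i \<in> {1..k}"
  shows "wsum a i * real n / a 1 \<le> real (ell a i n)" "real (ell a i n) \<le> wsum a i * real n / a 1 + 1"
    "wsum a i * real n / a 1 \<le> real q \<Longrightarrow> ell a i n \<le> q"
proof -
  have e: "ell a i n = (LEAST q. wsum a i * real n / a 1 \<le> real q)" using assms by (simp add: ell_def)
  have "\<exists>q. wsum a i * real n / a 1 \<le> real q" by (rule real_arch_simple)
  then show "wsum a i * real n / a 1 \<le> real (ell a i n)" unfolding e by (rule LeastI_ex)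
  show le: "ell a i n \<le> q" if "wsum a i * real n / a 1 \<le> real q" for q
    unfolding e using that by (rule Least_le)
  have "0 \<le> wsum a i * real n / a 1" using wsum_pos[OF assms] a1_pos by simp
  then have "real (nat \<lceil>wsum a i * real n / a 1\<rceil>) = real_of_int \<lceil>wsum a i * real n / a 1\<rceil>"
    by simp
  moreover have "ell a i n \<le> nat \<lceil>wsum a i * real n / a 1\<rceil>" by (rule le) linarith
  ultimately show "real (ell a i n) \<le> wsum a i * real n / a 1 + 1" by linarith
qed

lemma ell_1: "ell a (Suc 0) n = n"
proof (rule antisym)
  have w: "wsum a (Suc 0) * real n / a 1 = real n" using a1_pos by (simp add: wsum_def)
  show "ell a (Suc 0) n \<le> n" using ell_bounds(3)[of "Suc 0" n n] w k_pos by simp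
  show "n \<le> ell a (Suc 0) n" using ell_bounds(1)[of "Suc 0" n] w k_pos by simp
qed

lemma ell_mono:
  assumes "i \<le> j" "j \<le> k"
  shows "ell a i n \<le> ell a j n"
proof (cases "i = 0")
  case False
  then have ij: "i \<in> {1..k}" "j \<in> {1..k}" using assms by auto
  have "wsum a i * real n / a 1 \<le> wsum a j * real n / a 1"
    using wsum_mono[OF assms] a1_pos by (intro divide_right_mono mult_right_mono) auto
  also have "\<dots> \<le> real (ell a j n)" by (rule ell_bounds(1)[OF ij(2)])
  finally show ?thesis by (rule ell_bounds(3)[OF ij(1)])
qed simp

lemma mem_wball_iff:
  "y \<in> wball k (A 1) p a x (exp (- real n / a 1)) \<longleftrightarrow> y \<in> seqs (A 1) \<and>
     (\<forall>i<k. \<forall>t<ell a (Suc i) n. tau p i (y t) = tau p i (x t))"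
proof -
  let ?d = "\<lambda>i. exp_neg_div (common_prefix (letterwise (tau p (i - 1)) x) (letterwise (tau p (i - 1)) y)) (wsum a i)"
  have "?d i \<le> exp (- real n / a 1) \<longleftrightarrow> (\<forall>t<ell a i n. tau p (i - 1) (y t) = tau p (i - 1) (x t))"
    if i: "i \<in> {1..k}" for i
  proof -
    have "ell a i n = (LEAST q. wsum a i * real n / a 1 \<le> real q)" using i by (simp add: ell_def)
    from exp_neg_div_le_iff[OF wsum_pos[OF i] a1_pos this] show ?thesis
      by (auto simp: enat_le_common_prefix letterwise_def)
  qed
  then have "wdist k p a x y \<le> exp (- real n / a 1) \<longleftrightarrow>
      (\<forall>i\<in>{1..k}. \<forall>t<ell a i n. tau p (i - 1) (y t) = tau p (i - 1) (x t))"
    unfolding wdist_def using k_pos by (subst Max_le_iff) auto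
  also have "\<dots> \<longleftrightarrow> (\<forall>i<k. \<forall>t<ell a (Suc i) n. tau p i (y t) = tau p i (x t))"
  proof -
    have "{1..k} = Suc ` {..<k}" by (simp add: image_Suc_lessThan)
    then show ?thesis by (simp, auto)
  qed
  finally show ?thesis by (simp add: wball_def)
qed

text \<open>With levels counted from 0, this is the image under \<tau>_i of the word called I_{i+1}
  in the theorem.\<close>

definition block :: "(nat \<Rightarrow> 'a) \<Rightarrow> nat \<Rightarrow> nat \<Rightarrow> 'a list" where
  "block x n i = map (tau p i) (subword x (ell a i n) (ell a (Suc i) n))"

primrec ball_words :: "(nat \<Rightarrow> 'a) \<Rightarrow> nat \<Rightarrow> nat \<Rightarrow> 'a list set" where
  "ball_words x n 0 = {[]}"
| "ball_words x n (Suc i) = (\<lambda>(I, K). I @ K) ` (ball_words x n i \<times> fiber (tau p i) (A 1) (block x n i))"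

lemma length_block: "length (block x n i) = ell a (Suc i) n - ell a i n"
  by (simp add: block_def subword_def)

lemma ball_words_props:
  assumes "i \<le> k"
  shows "finite (ball_words x n i)" "ball_words x n i \<subseteq> words (A 1) (ell a i n)"
  using assms
proof (induction i)
  case (Suc i)
  {
    case 1
    then show ?case using Suc by simp
  next
    case 2
    have "ell a i n \<le> ell a (Suc i) n" using 2 by (intro ell_mono) auto
    then have "length K + ell a i n = ell a (Suc i) n" if "K \<in> fiber (tau p i) (A 1) (block x n i)" for K
      using fiberD(2)[OF that] by (simp add: length_block)
    then show ?case
      using Suc.IH(2) 2 by (fastforce simp: in_words_iff dest: fiberD(1))
  }
qed (auto simp: in_words_iff)

lemma init_word_ball_words_iff:
  assumes y: "y \<in> seqs (A 1)" and "i \<le> k"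
  shows "init_word y (ell a i n) \<in> ball_words x n i \<longleftrightarrow>
    (\<forall>j<i. \<forall>t. ell a j n \<le> t \<and> t < ell a (Suc j) n \<longrightarrow> tau p j (y t) = tau p j (x t))"
  using assms(2)
proof (induction i)
  case (Suc i)
  let ?l = "ell a i n" and ?l' = "ell a (Suc i) n"
  have le: "?l \<le> ?l'" using Suc.prems by (intro ell_mono) auto
  let ?K = "subword y ?l ?l'"
  have s: "init_word y ?l' = init_word y ?l @ ?K" by (rule subword_append[OF le])
  have "init_word y ?l' \<in> ball_words x n (Suc i) \<longleftrightarrow>
      init_word y ?l \<in> ball_words x n i \<and> ?K \<in> fiber (tau p i) (A 1) (block x n i)"
  proof
    assume "init_word y ?l' \<in> ball_words x n (Suc i)"
    then obtain I K where IK: "init_word y ?l @ ?K = I @ K" "I \<in> ball_words x n i"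
        "K \<in> fiber (tau p i) (A 1) (block x n i)"
      by (auto simp: s)
    have "length I = ?l" using ball_words_props(2)[of i x n] IK(2) Suc.prems by (auto simp: in_words_iff)
    then have "init_word y ?l = I \<and> ?K = K" using IK(1) by (simp add: append_eq_append_conv)
    then show "init_word y ?l \<in> ball_words x n i \<and> ?K \<in> fiber (tau p i) (A 1) (block x n i)"
      using IK(2,3) by simp
  next
    assume "init_word y ?l \<in> ball_words x n i \<and> ?K \<in> fiber (tau p i) (A 1) (block x n i)"
    then show "init_word y ?l' \<in> ball_words x n (Suc i)" unfolding s by auto
  qed
  also have "?K \<in> fiber (tau p i) (A 1) (block x n i) \<longleftrightarrow>
      (\<forall>t. ?l \<le> t \<and> t < ?l' \<longrightarrow> tau p i (y t) = tau p i (x t))"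
    using y by (auto simp: fiber_def in_words_iff block_def subword_def seqs_iff)
  finally show ?case using Suc by (auto simp: less_Suc_eq)
qed simp

lemma wball_eq_UN:
  "wball k (A 1) p a x (exp (- real n / a 1)) = (\<Union>I\<in>ball_words x n k. cyl (A 1) I)"
proof (intro equalityI subsetI)
  \<comment> \<open>Level i demands agreement at all positions below \<open>ell a (Suc i) n\<close>.
    Such a position lies in the block of some level j \<le> i, and agreement on the finer level j
    implies it on level i.\<close>
  have eq: "(\<forall>i<k. \<forall>t<ell a (Suc i) n. tau p i (y t) = tau p i (x t)) \<longleftrightarrow>
      (\<forall>j<k. \<forall>t. ell a j n \<le> t \<and> t < ell a (Suc j) n \<longrightarrow> tau p j (y t) = tau p j (x t))" for y
  proof (intro iffI allI impI)
    fix i t assume *: "\<forall>j<k. \<forall>t. ell a j n \<le> t \<and> t < ell a (Suc j) n \<longrightarrow> tau p j (y t) = tau p j (x t)"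
      and i: "i < k" and t: "t < ell a (Suc i) n"
    have "\<exists>j\<le>i. ell a j n \<le> t \<and> t < ell a (Suc j) n"
      using t
    proof (induction i)
      case (Suc i)
      then show ?case by (metis le_SucI le_refl not_le_imp_less)
    qed auto
    then obtain j where j: "j \<le> i" "ell a j n \<le> t" "t < ell a (Suc j) n" by blast
    then have "tau p j (y t) = tau p j (x t)" using * i by auto
    then show "tau p i (y t) = tau p i (x t)" using j(1) by (rule tau_eq_mono)
  qed auto
  {
    fix y assume "y \<in> wball k (A 1) p a x (exp (- real n / a 1))"
    then have y: "y \<in> seqs (A 1)" "init_word y (ell a k n) \<in> ball_words x n k"
      unfolding mem_wball_iff eq using init_word_ball_words_iff[of y k n x] by auto
    moreover have "y \<in> cyl (A 1) (init_word y (ell a k n))" using y(1) by (simp add: cyl_iff)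
    ultimately show "y \<in> (\<Union>I\<in>ball_words x n k. cyl (A 1) I)" by blast
  next
    fix y assume "y \<in> (\<Union>I\<in>ball_words x n k. cyl (A 1) I)"
    then obtain I where I: "I \<in> ball_words x n k" "y \<in> cyl (A 1) I" by blast
    have "length I = ell a k n" using subsetD[OF ball_words_props(2) I(1)] by (simp add: in_words_iff)
    then have "y \<in> seqs (A 1)" "init_word y (ell a k n) = I" using I(2) by (auto simp: cyl_iff)
    then show "y \<in> wball k (A 1) p a x (exp (- real n / a 1))"
      unfolding mem_wball_iff eq using init_word_ball_words_iff[of y k n x] I(1) by auto
  }
qed

text \<open>The fibres are attached one at a time. For multiplicative \<open>w\<close> the sum over
  pairs would be a product; each concatenation errs by \<open>d\<close> at the length
  reached.\<close>

lemma ln_ball_words: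
  assumes am: "almost_mult (A 1) d w" and w: "w [] = 1" and x: "x \<in> seqs (A 1)" and "i \<le> k"
  shows "0 < (\<Sum>I\<in>ball_words x n i. w I) \<and>
    \<bar>ln (\<Sum>I\<in>ball_words x n i. w I) - (\<Sum>j<i. ln (push (tau p j) (A 1) w (block x n j)))\<bar>
      \<le> (\<Sum>j<i. d (ell a (Suc j) n))"
  using assms(4)
proof (induction i)
  case 0
  then show ?case using w by simp
next
  case (Suc i)
  let ?S = "ball_words x n i" and ?T = "fiber (tau p i) (A 1) (block x n i)"
  note IH = Suc.IH[OF Suc_leD[OF Suc.prems]]
  have le: "ell a i n \<le> ell a (Suc i) n" using Suc.prems by (intro ell_mono) auto
  have lenI: "length I = ell a i n" "set I \<subseteq> A 1" if "I \<in> ?S" for I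
    using subsetD[OF ball_words_props(2) that] Suc.prems by (auto simp: in_words_iff)
  have lenK: "length K = ell a (Suc i) n - ell a i n" "set K \<subseteq> A 1" if "K \<in> ?T" for K
    using fiberD[OF that] by (auto simp: length_block)
  have bl: "set (block x n i) \<subseteq> tau p i ` A 1"
    using x by (auto simp: block_def subword_def seqs_iff)
  have fin: "finite (?S \<times> ?T)" using ball_words_props(1)[of i x n] Suc.prems by simp
  have Sne: "?S \<noteq> {}" using IH by auto
  have ne: "?S \<times> ?T \<noteq> {}" using Sne fiber_nonempty[OF bl] by simp
  have "inj_on (\<lambda>(I, K). I @ K) (?S \<times> ?T)"
    using lenI(1) by (auto simp: inj_on_def append_eq_append_conv)
  then have sum: "(\<Sum>I\<in>ball_words x n (Suc i). w I) = (\<Sum>(I, K)\<in>?S \<times> ?T. w (I @ K))"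
    by (simp add: sum.reindex case_prod_unfold)
  have c: "0 < w I" "0 < w K" "0 < w (I @ K)" "\<bar>ln (w (I @ K)) - ln (w I * w K)\<bar> \<le> d (ell a (Suc i) n)"
    if "I \<in> ?S" "K \<in> ?T" for I K
  proof -
    show p: "0 < w I" "0 < w K" "0 < w (I @ K)"
      using almost_mult_pos[OF am] lenI(2)[OF that(1)] lenK(2)[OF that(2)] by auto
    have "length I + length K = ell a (Suc i) n" using lenI(1)[OF that(1)] lenK(1)[OF that(2)] le by simp
    then show "\<bar>ln (w (I @ K)) - ln (w I * w K)\<bar> \<le> d (ell a (Suc i) n)"
      using almost_multD[OF am lenI(2)[OF that(1)] lenK(2)[OF that(2)]] p
      by (simp add: ln_mult diff_diff_eq)
  qed
  have pos: "0 < (\<Sum>(I, K)\<in>?S \<times> ?T. w (I @ K))"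
    using c fin ne by (intro sum_pos) auto
  have "\<bar>ln (\<Sum>(I, K)\<in>?S \<times> ?T. w (I @ K)) - ln (\<Sum>(I, K)\<in>?S \<times> ?T. w I * w K)\<bar> \<le> d (ell a (Suc i) n)"
    by (rule ln_sum_close[OF fin ne]) (use c in auto)
  moreover have "(\<Sum>(I, K)\<in>?S \<times> ?T. w I * w K) = (\<Sum>I\<in>?S. w I) * push (tau p i) (A 1) w (block x n i)"
    by (simp add: push_def sum_product sum.cartesian_product)
  moreover have "0 < push (tau p i) (A 1) w (block x n i)"
    using almost_mult_pos[OF am] bl by (intro push_pos) auto
  moreover from this have "ln ((\<Sum>I\<in>?S. w I) * push (tau p i) (A 1) w (block x n i)) =
      ln (\<Sum>I\<in>?S. w I) + ln (push (tau p i) (A 1) w (block x n i))"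
    using IH by (intro ln_mult_pos) auto
  ultimately have "\<bar>ln (\<Sum>(I, K)\<in>?S \<times> ?T. w (I @ K)) -
      (ln (\<Sum>I\<in>?S. w I) + ln (push (tau p i) (A 1) w (block x n i)))\<bar> \<le> d (ell a (Suc i) n)"
    by simp
  then show ?case using IH pos unfolding sum by (simp add: abs_le_iff)
qed

text \<open>The weights on level i inherit almost multiplicativity, so a block is, in logarithms,
  the difference of two initial words.\<close>

lemma ln_block:
  assumes am: "almost_mult (A 1) d w" and x: "x \<in> seqs (A 1)" and i: "i < k"
  defines "v \<equiv> \<lambda>m. push (tau p i) (A 1) w (map (tau p i) (init_word x m))"
  shows "\<bar>ln (v (ell a (Suc i) n)) - ln (v (ell a i n)) - ln (push (tau p i) (A 1) w (block x n i))\<bar>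
    \<le> d (ell a (Suc i) n)"
proof -
  have le: "ell a i n \<le> ell a (Suc i) n" using i by (intro ell_mono) auto
  have am': "almost_mult (A (Suc i)) d (push (tau p i) (A 1) w)"
    using tau_image[OF i] by (intro almost_mult_push[OF am]) auto
  have s: "set (map (tau p i) J) \<subseteq> A (Suc i)" if "set J \<subseteq> A 1" for J
    using that tau_image[OF i] by auto
  have J: "set (init_word x (ell a i n)) \<subseteq> A 1" "set (subword x (ell a i n) (ell a (Suc i) n)) \<subseteq> A 1"
    using x by (auto simp: subword_def seqs_iff)
  from almost_multD[OF am' s[OF J(1)] s[OF J(2)]] show ?thesis
    unfolding v_def block_def subword_append[OF le] map_append
    using le by (simp add: subword_def diff_diff_eq)
qed

end

section \<open>Weighted weak Gibbs measures\<close>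

context factor_chain
begin

text \<open>One measure must serve the general and the bounded claim, so the two constructions are
  alternatives: invariant weights when the stronger hypotheses hold, block weights
  otherwise.\<close>

lemma exists_gibbs_weights:
  assumes as: "C_asa (A 1) \<phi>"
  obtains w where "consistent (A 1) w" "tempered (A 1) w"
    "\<And>\<epsilon>. 0 < \<epsilon> \<Longrightarrow> \<exists>C\<ge>0. near (A 1) (\<lambda>n. C + \<epsilon> * real n) w
        (word_prob (A 1) (gibbs_weight k A p a (sup_weight (A 1) \<phi>)))"
    "C_aa (A 1) \<phi> \<and> bounded_distortion (A 1) \<phi> \<Longrightarrow> \<exists>C. almost_mult (A 1) (\<lambda>_. C) w"
proof -
  have fin: "finite (A 1)" "A 1 \<noteq> {}" by simp_all
  let ?F = "gibbs_weight k A p a (sup_weight (A 1) \<phi>)"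
  have tF: "tempered (A 1) ?F" by (rule tempered_gibbs_weight[OF tempered_sup_weight[OF as fin]])
  note tP = tempered_word_prob[OF tF fin]
  show ?thesis
  proof (cases "C_aa (A 1) \<phi> \<and> bounded_distortion (A 1) \<phi>")
    case True
    then obtain C where C: "almost_mult (A 1) (\<lambda>_. C) (sup_weight (A 1) \<phi>)"
      using almost_mult_sup_weight[OF _ _ fin(2)] by blast
    define C1 where "C1 = gibbs_const * C"
    have am: "almost_mult (A 1) (\<lambda>_. C1) ?F" unfolding C1_def by (rule almost_mult_gibbs_weight[OF C])
    have C1: "0 \<le> C1" using almost_mult_nonneg[OF am fin(2)] .
    obtain u where u: "consistent (A 1) u" "near (A 1) (\<lambda>_. 4 * C1) u (word_prob (A 1) ?F)"
      by (rule invariant_gibbs_weights[OF am fin]) blast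
    have nr: "\<exists>C\<ge>0. near (A 1) (\<lambda>n. C + \<epsilon> * real n) u (word_prob (A 1) ?F)" if "0 < \<epsilon>" for \<epsilon>
      using C1 that by (intro exI[of _ "4 * C1"] conjI near_mono[OF u(2)]) auto
    have "almost_mult (A 1) (\<lambda>n. 2 * C1 + 3 * (4 * C1)) u"
      by (rule almost_mult_near[OF almost_mult_word_prob[OF am fin] u(2)]) simp
    then show ?thesis using that[OF u(1) tempered_near[OF tP nr] nr] by blast
  next
    case False
    obtain w where w: "consistent (A 1) w"
        "\<And>\<epsilon>. 0 < \<epsilon> \<Longrightarrow> \<exists>C\<ge>0. near (A 1) (\<lambda>n. C + \<epsilon> * real n) w (word_prob (A 1) ?F)"
      by (rule gibbs_weights[OF tF fin]) blast
    show ?thesis using that[OF w(1) tempered_near[OF tP w(2)] w(2)] False by blast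
  qed
qed

lemma weighted_weak_GibbsI:
  assumes as: "C_asa (A 1) \<phi>" and \<mu>: "\<mu> \<in> borel_prob (A 1)"
    and w: "\<And>I. set I \<subseteq> A 1 \<Longrightarrow> measure \<mu> (cyl (A 1) I) = w I"
    and nr: "\<And>\<epsilon>. 0 < \<epsilon> \<Longrightarrow> \<exists>C\<ge>0. near (A 1) (\<lambda>n. C + \<epsilon> * real n) w
        (word_prob (A 1) (gibbs_weight k A p a (sup_weight (A 1) \<phi>)))"
  shows "weighted_weak_Gibbs k A p a \<phi> \<mu>"
proof -
  have fin: "finite (A 1)" "A 1 \<noteq> {}" by simp_all
  let ?F = "gibbs_weight k A p a (sup_weight (A 1) \<phi>)"
  let ?Z = "word_sum (A 1) ?F"
  let ?P = "weighted_pressure k A p a \<phi>"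
  have tF: "tempered (A 1) ?F" by (rule tempered_gibbs_weight[OF tempered_sup_weight[OF as fin]])
  obtain C0 where am0: "almost_mult (A 1) (\<lambda>n. C0 + 1 * real n) ?F"
    using tempered_almost_mult[OF tF _ fin(2), of 1] by auto
  have Fpos: "\<forall>I. set I \<subseteq> A 1 \<longrightarrow> 0 < ?F I" using almost_mult_pos[OF am0] by blast
  have wpos: "0 < w I" if "set I \<subseteq> A 1" for I
    using nr[of 1] that by (auto simp: near_def)
  define r where "r n I = measure \<mu> (cyl (A 1) I) / (exp (- real n * ?P / wsum a k) * weighted_pot k A p a \<phi> I)"
    for n I
  have rpos: "0 < r n I" and lnr: "ln (r n I) = ln (w I) - ln (?F I) + real n * (?P / wsum a k)"
    if n: "1 \<le> n" and I: "I \<in> words (A 1) n" for n I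
  proof -
    have sI: "set I \<subseteq> A 1" using I by (simp add: in_words_iff)
    have "weighted_pot k A p a \<phi> I = ?F I"
      by (rule weighted_pot_eq[OF C_asaD(3)[OF as] C_asaD(2)[OF as] n I])
    then have r: "r n I = w I / (exp (- real n * ?P / wsum a k) * ?F I)" using w[OF sI] by (simp add: r_def)
    show "0 < r n I" unfolding r using wpos[OF sI] Fpos sI by auto
    show "ln (r n I) = ln (w I) - ln (?F I) + real n * (?P / wsum a k)"
      unfolding r using wpos[OF sI] Fpos[rule_format, OF sI]
      by (subst ln_divide_pos) (auto simp: ln_mult_pos)
  qed
  define e where "e n = Max ((\<lambda>I. \<bar>ln (r n I)\<bar>) ` words (A 1) n)" for n
  have eI: "\<bar>ln (r n I)\<bar> \<le> e n" if "I \<in> words (A 1) n" for n I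
    unfolding e_def using that by (intro Max_ge) auto
  have ebound: "\<exists>C. \<forall>n\<ge>1. \<bar>e n + 1\<bar> \<le> C + \<epsilon> * real n" if \<epsilon>: "0 < \<epsilon>" for \<epsilon>
  proof -
    \<comment> \<open>One half is for the distance of \<open>w\<close> from the normalised Gibbs
      weight, the other for the distance of ln Z_n from its linear growth.\<close>
    have \<epsilon>2: "0 < \<epsilon> / 2" using \<epsilon> by simp
    obtain C1 where C1: "near (A 1) (\<lambda>n. C1 + \<epsilon> / 2 * real n) w (word_prob (A 1) ?F)"
      using nr[OF \<epsilon>2] by blast
    obtain C2 where C2: "\<And>n. 1 \<le> n \<Longrightarrow> \<bar>ln (?Z n) - real n * (?P / wsum a k)\<bar> \<le> C2 + \<epsilon> / 2 * real n"
      by (rule variational_principle[OF as \<epsilon>2]) blast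
    have "\<bar>e n + 1\<bar> \<le> (C1 + C2 + 1) + \<epsilon> * real n" if n: "1 \<le> n" for n
    proof -
      have "\<bar>ln (r n I)\<bar> \<le> C1 + C2 + \<epsilon> * real n" if I: "I \<in> words (A 1) n" for I
      proof -
        have sI: "set I \<subseteq> A 1" "length I = n" using I by (auto simp: in_words_iff)
        have "\<bar>ln (w I) - (ln (?F I) - ln (?Z n))\<bar> \<le> C1 + \<epsilon> / 2 * real n"
          using nearD(3)[OF C1 sI(1)] ln_word_prob(2)[OF fin Fpos sI(1)] sI(2) by simp
        then show ?thesis using C2[OF n] lnr[OF n I] by (simp add: abs_le_iff)
      qed
      moreover have "words (A 1) n \<noteq> {}" by (rule words_nonempty[OF fin(2)])
      ultimately have "e n \<le> C1 + C2 + \<epsilon> * real n"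
        unfolding e_def by (subst Max_le_iff) auto
      moreover have "0 \<le> e n"
      proof -
        obtain I where "I \<in> words (A 1) n" using words_nonempty[OF fin(2)] by blast
        then show ?thesis using eI by (meson abs_ge_zero order_trans)
      qed
      ultimately show ?thesis by simp
    qed
    then show ?thesis by blast
  qed
  have "fully_supported (A 1) \<mu>"
    unfolding fully_supported_def
  proof (intro allI impI)
    interpret prob_space \<mu> by (rule borel_probD(1)[OF \<mu>])
    fix U assume U: "openin (shift_space (A 1)) U \<and> U \<noteq> {}"
    then obtain x where x: "x \<in> U" by blast
    obtain n where n: "cyl (A 1) (init_word x n) \<subseteq> U"
      by (rule openin_cyl_subset[OF conjunct1[OF U] x])
    have "x \<in> seqs (A 1)" using openin_subset[OF conjunct1[OF U]] x by blast
    from init_word_in_words[OF this, of n] have s: "set (init_word x n) \<subseteq> A 1" by (simp add: in_words_iff)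
    have Us: "U \<in> sets \<mu>"
      unfolding borel_probD(2)[OF \<mu>] shift_borel_def using U
      by (subst sets_measure_of) (auto dest: openin_subset)
    have "0 < w (init_word x n)" by (rule wpos[OF s])
    also have "\<dots> = prob (cyl (A 1) (init_word x n))" by (rule w[OF s, symmetric])
    also have "\<dots> \<le> prob U" by (rule finite_measure_mono[OF n Us])
    finally show "0 < prob U" .
  qed
  moreover have "\<exists>\<kappa>. (\<forall>n\<ge>1. 0 < \<kappa> n) \<and> (\<lambda>n. ln (\<kappa> n) / real n) \<longlonglongrightarrow> 0 \<and>
        (\<forall>n\<ge>1. \<forall>I\<in>words (A 1) n. r n I \<in> {inverse (\<kappa> n)<..<\<kappa> n})"
  \<comment> \<open>The added 1 makes both inequalities strict without affecting the limit.\<close>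
  proof (intro exI[of _ "\<lambda>n. exp (e n + 1)"] conjI allI impI ballI)
    show "(\<lambda>n. ln (exp (e n + 1)) / real n) \<longlonglongrightarrow> 0"
      using sublinear_tendsto[OF ebound] by simp
    fix n I assume n: "1 \<le> n" and I: "I \<in> words (A 1) n"
    have "r n I = exp (ln (r n I))" using rpos[OF n I] by simp
    moreover have "- (e n + 1) < ln (r n I)" "ln (r n I) < e n + 1" using eI[OF I] by linarith+
    ultimately have "exp (- (e n + 1)) < r n I" "r n I < exp (e n + 1)" by (metis exp_less_mono)+
    then show "r n I \<in> {inverse (exp (e n + 1))<..<exp (e n + 1)}"
      by (simp only: greaterThanLessThan_iff exp_minus [symmetric])
  qed simp
  ultimately show ?thesis
    using \<mu> unfolding weighted_weak_Gibbs_def r_def by blast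
qed

lemma psi_pot_eq:
  assumes \<mu>: "\<mu> \<in> borel_prob (A 1)" and w: "\<And>I. set I \<subseteq> A 1 \<Longrightarrow> measure \<mu> (cyl (A 1) I) = w I"
    and i: "i \<in> {1..k}" and J: "set J \<subseteq> A 1"
  shows "factor_word_measure A p \<mu> i (map (tau p (i - 1)) J)
     = push (tau p (i - 1)) (A 1) w (map (tau p (i - 1)) J)"
proof -
  have "set (map (tau p (i - 1)) J) \<subseteq> A i" using J tau_image'[OF i] by auto
  from factor_word_measure_eq[OF i \<mu> this] show ?thesis
    unfolding push_def using w by (auto intro!: sum.cong dest: fiberD(1))
qed

lemma C_asa_psi_pot:
  assumes \<mu>: "\<mu> \<in> borel_prob (A 1)" and w: "\<And>I. set I \<subseteq> A 1 \<Longrightarrow> measure \<mu> (cyl (A 1) I) = w I"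
    and tw: "tempered (A 1) w" and i: "i \<in> {1..k}"
  shows "C_asa (A 1) (psi_pot A p \<mu> i)"
proof (rule C_asa_cong)
  have fin: "finite (A 1)" "A 1 \<noteq> {}" by simp_all
  let ?t = "tau p (i - 1)"
  have "tempered (A i) (push ?t (A 1) w)" by (rule tempered_push[OF tw fin(1) tau_image'[OF i]])
  then have "tempered (A 1) (\<lambda>I. push ?t (A 1) w (map ?t I))"
    by (rule tempered_comp) (use tau_image'[OF i] in auto)
  then show "C_asa (A 1) (\<lambda>n x. push ?t (A 1) w (map ?t (init_word x n)))"
    by (rule C_asa_word[OF _ fin])
  fix n x assume "x \<in> seqs (A 1)"
  then have s: "set (init_word x n) \<subseteq> A 1" using init_word_in_words by (simp add: in_words_iff)
  show "psi_pot A p \<mu> i n x = push ?t (A 1) w (map ?t (init_word x n))"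
    unfolding psi_pot_def by (rule psi_pot_eq[OF \<mu> _ i s]) (rule w)
qed

text \<open>Each of the k blocks costs the error of \<open>w\<close> at a length of at most (A_k/a_1
  + 1) n, which gives \<open>E\<close>. It is paid once for factorising the ball into blocks and
  once more for writing blocks as differences of initial words.\<close>

lemma ball_estimate:
  assumes \<mu>: "\<mu> \<in> borel_prob (A 1)" and w: "\<And>I. set I \<subseteq> A 1 \<Longrightarrow> measure \<mu> (cyl (A 1) I) = w I"
    and cons: "consistent (A 1) w" and am: "almost_mult (A 1) (\<lambda>n. C + \<epsilon> * real n) w"
    and \<epsilon>: "0 \<le> \<epsilon>" and x: "x \<in> seqs (A 1)" and n: "1 \<le> n"
  defines "B \<equiv> measure \<mu> (wball k (A 1) p a x (exp (- real n / a 1)))"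
    and "E \<equiv> real k * (C + \<epsilon> * (wsum a k / a 1 + 1) * real n)"
    and "f \<equiv> \<lambda>i. factor_word_measure A p \<mu> i (map (tau p (i - 1)) (subword x (ell a (i - 1) n) (ell a i n)))"
  shows "0 < B" "0 < (\<Prod>i=1..k. f i)" "\<bar>ln B - ln (\<Prod>i=1..k. f i)\<bar> \<le> E"
    "\<bar>ln B - (log_psi A p \<mu> 1 n x +
        (\<Sum>i=2..k. log_psi A p \<mu> i (ell a i n) x - log_psi A p \<mu> i (ell a (i - 1) n) x))\<bar> \<le> 2 * E"
proof -
  let ?d = "\<lambda>n. C + \<epsilon> * real n"
  define g where "g j = push (tau p j) (A 1) w (block x n j)" for j
  define v where "v j m = ln (push (tau p j) (A 1) w (map (tau p j) (init_word x m)))" for j m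
  have w1: "w [] = 1" using cons by (simp add: consistent_def)
  have sub: "set (subword x m m') \<subseteq> A 1" for m m'
    using x by (auto simp: subword_def seqs_iff)
  have f: "f (Suc j) = g j" if "j < k" for j
    using psi_pot_eq[OF \<mu> w, of "Suc j", OF _ _ sub] that by (simp add: f_def g_def block_def)
  have lp: "log_psi A p \<mu> (Suc j) m x = v j m" if "j < k" for j m
    using psi_pot_eq[OF \<mu> w, of "Suc j", OF _ _ sub] that by (simp add: log_psi_def psi_pot_def v_def)
  have gpos: "0 < g j" if "j < k" for j
    unfolding g_def
  proof (rule push_pos)
    show "set (block x n j) \<subseteq> tau p j ` A 1" unfolding block_def set_map by (rule image_mono[OF sub])
  qed (use almost_mult_pos[OF am] in auto)
  have prod: "(\<Prod>i=1..k. f i) = (\<Prod>j<k. g j)"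
    using f by (simp add: prod.atLeast1_atMost_eq)
  show fpos: "0 < (\<Prod>i=1..k. f i)" unfolding prod using gpos by (intro prod_pos) auto
  have lnprod: "ln (\<Prod>i=1..k. f i) = (\<Sum>j<k. ln (g j))"
    unfolding prod using gpos by (intro ln_prod) (auto simp: less_imp_neq[symmetric])
  have B: "B = (\<Sum>I\<in>ball_words x n k. w I)"
  proof -
    have "B = (\<Sum>I\<in>ball_words x n k. measure \<mu> (cyl (A 1) I))"
      unfolding B_def wball_eq_UN
      by (rule measure_UN_cyl[OF \<mu> ball_words_props[OF order_refl]])
    also have "\<dots> = (\<Sum>I\<in>ball_words x n k. w I)"
      using subsetD[OF ball_words_props(2)[OF order_refl, of x n]]
      by (intro sum.cong refl w) (simp add: in_words_iff)
    finally show ?thesis .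
  qed
  have dl: "?d (ell a (Suc j) n) \<le> C + \<epsilon> * (wsum a k / a 1 + 1) * real n" if "j < k" for j
  proof -
    have "real (ell a (Suc j) n) \<le> wsum a (Suc j) * real n / a 1 + 1"
      using that by (intro ell_bounds(2)) auto
    also have "wsum a (Suc j) * real n / a 1 \<le> wsum a k * real n / a 1"
      using wsum_mono[of "Suc j" k] that a1_pos by (intro divide_right_mono mult_right_mono) auto
    finally have "real (ell a (Suc j) n) \<le> (wsum a k / a 1 + 1) * real n"
      using n by (simp add: distrib_right)
    then have "\<epsilon> * real (ell a (Suc j) n) \<le> \<epsilon> * ((wsum a k / a 1 + 1) * real n)"
      using \<epsilon> by (rule mult_left_mono)
    then show ?thesis by (simp add: mult.assoc)
  qed
  have dE: "(\<Sum>j<k. ?d (ell a (Suc j) n)) \<le> E"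
  proof -
    have "(\<Sum>j<k. ?d (ell a (Suc j) n)) \<le> (\<Sum>j<k. C + \<epsilon> * (wsum a k / a 1 + 1) * real n)"
      using dl by (intro sum_mono) auto
    then show ?thesis by (simp add: E_def)
  qed
  note lb = ln_ball_words[OF am w1 x order_refl, of n]
  show "0 < B" using lb unfolding B by blast
  have 1: "\<bar>ln B - (\<Sum>j<k. ln (g j))\<bar> \<le> E"
    using lb dE unfolding B g_def by linarith
  then show "\<bar>ln B - ln (\<Prod>i=1..k. f i)\<bar> \<le> E" unfolding lnprod .
  have "\<bar>(\<Sum>j<k. v j (ell a (Suc j) n) - v j (ell a j n)) - (\<Sum>j<k. ln (g j))\<bar>
      \<le> (\<Sum>j<k. \<bar>v j (ell a (Suc j) n) - v j (ell a j n) - ln (g j)\<bar>)"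
    unfolding sum_subtractf [symmetric] by (rule sum_abs)
  also have "\<dots> \<le> (\<Sum>j<k. ?d (ell a (Suc j) n))"
    unfolding v_def g_def by (intro sum_mono ln_block[OF am x]) auto
  also have "\<dots> \<le> E" by (rule dE)
  finally have 2: "\<bar>(\<Sum>j<k. v j (ell a (Suc j) n) - v j (ell a j n)) - (\<Sum>j<k. ln (g j))\<bar> \<le> E" .
  have "(\<Sum>j<k. v j (ell a (Suc j) n) - v j (ell a j n)) = log_psi A p \<mu> 1 n x +
        (\<Sum>i=2..k. log_psi A p \<mu> i (ell a i n) x - log_psi A p \<mu> i (ell a (i - 1) n) x)"
  proof -
    \<comment> \<open>The term for i = 1 starts at the empty word, whose weight is 1, and
      \<open>ell a 1 n\<close> is n; so only the value at n survives.\<close>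
    have "v 0 0 = 0" using w1 by (simp add: v_def push_def)
    have "(\<Sum>j<k. v j (ell a (Suc j) n) - v j (ell a j n)) =
        (\<Sum>i=1..k. log_psi A p \<mu> i (ell a i n) x - log_psi A p \<mu> i (ell a (i - 1) n) x)"
      using lp by (simp add: sum.atLeast1_atMost_eq)
    also have "\<dots> = (log_psi A p \<mu> 1 (ell a 1 n) x - log_psi A p \<mu> 1 (ell a 0 n) x) +
        (\<Sum>i=2..k. log_psi A p \<mu> i (ell a i n) x - log_psi A p \<mu> i (ell a (i - 1) n) x)"
      using k_pos by (subst sum.atLeast_Suc_atMost) (auto simp: numeral_2_eq_2)
    finally show ?thesis using lp[of 0 0] k_pos \<open>v 0 0 = 0\<close> by (simp add: ell_1)
  qed
  then show "\<bar>ln B - (log_psi A p \<mu> 1 n x +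
        (\<Sum>i=2..k. log_psi A p \<mu> i (ell a i n) x - log_psi A p \<mu> i (ell a (i - 1) n) x))\<bar> \<le> 2 * E"
    using 1 2 by linarith
qed

end

text \<open>Constant sequences reduce surjectivity on sequences to surjectivity on letters.\<close>

lemma one_block_factor_image:
  assumes "one_block_factor L L' q"
  shows "q ` L = L'"
proof
  show "q ` L \<subseteq> L'" using assms by (simp add: one_block_factor_def)
  show "L' \<subseteq> q ` L"
  proof
    fix b assume "b \<in> L'"
    then have "(\<lambda>_. b) \<in> letterwise q ` seqs L"
      using assms by (simp add: one_block_factor_def seqs_iff)
    then obtain x where "x \<in> seqs L" "(\<lambda>_. b) = letterwise q x" by blast
    then show "b \<in> q ` L" unfolding letterwise_def seqs_iff by (metis imageI)
  qed
qed

theorem theorem5p10: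
  fixes k :: nat
    and A :: "nat \<Rightarrow> 'a set"
    and p :: "nat \<Rightarrow> 'a \<Rightarrow> 'a"
    and a :: "nat \<Rightarrow> real"
    and \<phi> :: "nat \<Rightarrow> (nat \<Rightarrow> 'a) \<Rightarrow> real"
  assumes "2 \<le> k"
    and "\<And>i. i \<in> {1..k} \<Longrightarrow> finite (A i) \<and> A i \<noteq> {}"
    and "\<And>i. i \<in> {1..k-1} \<Longrightarrow> one_block_factor (A i) (A (Suc i)) (p i)"
    and "0 < a 1"
    and "\<And>i. i \<in> {2..k} \<Longrightarrow> 0 \<le> a i"
    and "C_asa (A 1) \<phi>"
  shows "\<exists>\<mu>. weighted_weak_Gibbs k A p a \<phi> \<mu> \<and>
    (\<forall>i\<in>{1..k}. C_asa (A 1) (psi_pot A p \<mu> i)) \<and>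
    (\<exists>c :: (nat \<Rightarrow> 'a) \<Rightarrow> nat \<Rightarrow> real.
       (\<forall>x\<in>seqs (A 1). \<forall>n\<ge>1.
          ln (measure \<mu> (wball k (A 1) p a x (exp (- real n / a 1)))) =
            log_psi A p \<mu> 1 n x +
            (\<Sum>i=2..k. log_psi A p \<mu> i (ell a i n) x - log_psi A p \<mu> i (ell a (i - 1) n) x) +
            c x n) \<and>
       (\<forall>x\<in>seqs (A 1). (\<lambda>n. c x n / real n) \<longlonglongrightarrow> 0) \<and>
       (C_aa (A 1) \<phi> \<and> bounded_distortion (A 1) \<phi> \<longrightarrow>
          (\<exists>C. \<forall>x\<in>seqs (A 1). \<forall>n\<ge>1. \<bar>c x n\<bar> \<le> C) \<and>
          (\<exists>C1>0. \<exists>C2>0. \<forall>x\<in>seqs (A 1). \<forall>n\<ge>1.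
             measure \<mu> (wball k (A 1) p a x (exp (- real n / a 1))) /
               (\<Prod>i=1..k. factor_word_measure A p \<mu> i
                            (map (tau p (i - 1)) (subword x (ell a (i - 1) n) (ell a i n))))
             \<in> {C1..C2})))"
proof -
  interpret factor_chain k A p a
  proof
    show "1 \<le> k" using assms(1) by simp
    show "finite (A i)" "A i \<noteq> {}" if "i \<in> {1..k}" for i using assms(2)[OF that] by auto
    show "p i ` A i = A (Suc i)" if "i \<in> {1..k-1}" for i
      by (rule one_block_factor_image[OF assms(3)[OF that]])
    show "0 < a 1" by (rule assms(4))
    show "0 \<le> a i" if "i \<in> {2..k}" for i by (rule assms(5)[OF that])
  qed
  have fin: "finite (A 1)" "A 1 \<noteq> {}" by simp_all
  obtain w where w: "consistent (A 1) w" "tempered (A 1) w"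
    and nr: "\<And>\<epsilon>. 0 < \<epsilon> \<Longrightarrow> \<exists>C\<ge>0. near (A 1) (\<lambda>n. C + \<epsilon> * real n) w
        (word_prob (A 1) (gibbs_weight k A p a (sup_weight (A 1) \<phi>)))"
    and aa: "C_aa (A 1) \<phi> \<and> bounded_distortion (A 1) \<phi> \<Longrightarrow> \<exists>C. almost_mult (A 1) (\<lambda>_. C) w"
    by (rule exists_gibbs_weights[OF assms(6)]) blast
  obtain \<mu> where \<mu>: "\<mu> \<in> borel_prob (A 1)" "\<And>I. set I \<subseteq> A 1 \<Longrightarrow> measure \<mu> (cyl (A 1) I) = w I"
    by (rule exists_cyl_measure[OF w(1) fin(1)]) blast
  let ?B = "\<lambda>x n. measure \<mu> (wball k (A 1) p a x (exp (- real n / a 1)))"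
  let ?S = "\<lambda>x n. log_psi A p \<mu> 1 n x +
      (\<Sum>i=2..k. log_psi A p \<mu> i (ell a i n) x - log_psi A p \<mu> i (ell a (i - 1) n) x)"
  let ?Q = "\<lambda>x n. \<Prod>i=1..k. factor_word_measure A p \<mu> i
      (map (tau p (i - 1)) (subword x (ell a (i - 1) n) (ell a i n)))"
  define c where "c x n = ln (?B x n) - ?S x n" for x n
  have gibbs: "weighted_weak_Gibbs k A p a \<phi> \<mu>"
    by (rule weighted_weak_GibbsI[OF assms(6) \<mu> nr])
  have psi: "\<forall>i\<in>{1..k}. C_asa (A 1) (psi_pot A p \<mu> i)"
    using C_asa_psi_pot[OF \<mu> w(2)] by blast
  have lim: "(\<lambda>n. c x n / real n) \<longlonglongrightarrow> 0" if x: "x \<in> seqs (A 1)" for x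
  proof (rule sublinear_tendsto)
    fix \<epsilon> :: real assume "0 < \<epsilon>"
    \<comment> \<open>The coefficient of the rate in the bound 2E, so that the rate \<epsilon> / K
      ends up as \<epsilon>.\<close>
    define K where "K = 2 * real k * (wsum a k / a 1 + 1)"
    have K: "0 < K" unfolding K_def using wsum_pos[of k] k_pos a1_pos
      by (intro mult_pos_pos add_nonneg_pos) (auto intro: divide_nonneg_pos less_imp_le)
    then have \<epsilon>K: "0 < \<epsilon> / K" using \<open>0 < \<epsilon>\<close> by simp
    obtain C where am: "almost_mult (A 1) (\<lambda>n. C + \<epsilon> / K * real n) w"
      using tempered_almost_mult[OF w(2) \<epsilon>K fin(2)] by blast
    have "\<bar>c x n\<bar> \<le> 2 * (real k * (C + \<epsilon> / K * (wsum a k / a 1 + 1) * real n))" if "1 \<le> n" for n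
      unfolding c_def by (rule ball_estimate(4)[OF \<mu> w(1) am less_imp_le[OF \<epsilon>K] x that])
    moreover have "2 * (real k * (C + \<epsilon> / K * (wsum a k / a 1 + 1) * real n)) = 2 * real k * C + \<epsilon> * real n" for n
    proof -
      have "2 * (real k * (C + e * t * real n)) = 2 * real k * C + e * (2 * real k * t) * real n" for e t
        by (simp add: algebra_simps)
      from this[of "\<epsilon> / K" "wsum a k / a 1 + 1"] 
      have "2 * (real k * (C + \<epsilon> / K * (wsum a k / a 1 + 1) * real n)) = 2 * real k * C + \<epsilon> / K * K * real n"
        by (simp only: K_def)
      then show ?thesis using K by simp
    qed
    ultimately show "\<exists>C. \<forall>n\<ge>1. \<bar>c x n\<bar> \<le> C + \<epsilon> * real n" by metis
  qed
  have bounded: "(\<exists>C. \<forall>x\<in>seqs (A 1). \<forall>n\<ge>1. \<bar>c x n\<bar> \<le> C) \<and>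
      (\<exists>C1>0. \<exists>C2>0. \<forall>x\<in>seqs (A 1). \<forall>n\<ge>1. ?B x n / ?Q x n \<in> {C1..C2})"
    if hyp: "C_aa (A 1) \<phi> \<and> bounded_distortion (A 1) \<phi>"
  proof -
    \<comment> \<open>Rate 0 turns the same ball estimate into bounds independent of x and
      n.\<close>
    obtain C where C: "almost_mult (A 1) (\<lambda>n. C + 0 * real n) w" using aa[OF hyp] by auto
    have "\<bar>c x n\<bar> \<le> 2 * (real k * C)" if "x \<in> seqs (A 1)" "1 \<le> n" for x n
      using ball_estimate(4)[OF \<mu> w(1) C order_refl that] by (simp add: c_def)
    moreover have "?B x n / ?Q x n \<in> {exp (- (real k * C))..exp (real k * C)}"
      if "x \<in> seqs (A 1)" "1 \<le> n" for x n
    proof -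
      note be = ball_estimate(1-3)[OF \<mu> w(1) C order_refl that]
      have "\<bar>ln (?B x n) - ln (?Q x n)\<bar> \<le> real k * C" using be(3) by simp
      from ln_close_bounds[OF be(1,2) this] show ?thesis
        using be(2) by (simp add: pos_le_divide_eq pos_divide_le_eq)
    qed
    ultimately show ?thesis by (meson exp_gt_zero)
  qed
  have "\<forall>x\<in>seqs (A 1). \<forall>n\<ge>1. ln (?B x n) = ?S x n + c x n" by (simp add: c_def)
  with gibbs psi lim bounded show ?thesis by blast
qed

end
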